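(* Let $n$ be a nonnegative integer. The class of $\mathbf{cd}$-indices of minor posets $\mathrm{M}(L,\mathrm{irr}(L))$ of generator-enriched lattices $(L,\mathrm{irr}(L))$ for which $L$ is join extremal of length $n$ is coefficientwise minimized by the $\mathbf{cd}$-index $\Psi(B_{n+1})$ of the rank $n+1$ Boolean algebra. That is, $\Psi(B_{n+1})$ belongs to this class, and $\Psi(B_{n+1})\le\Psi(\mathrm{M}(L,\mathrm{irr}(L)))$ coefficientwise for every join extremal lattice $L$ of length $n$.
   Context: A generator-enriched lattice is a pair $(L,G)$ where $L$ is a finite lattice and $G\subseteq L\setminus\{\widehat 0\}$ generates $L$ under joins (the empty join is $\widehat 0$). Elements of $G$ are called generators. For a set $H\subseteq L$ and $z\in L$ with $z<h$ for all $h\in H$, $\langle H|z\rangle=(\{z\vee\bigvee_{x\in X}x: X\subseteq H\},H)$, a generator-enriched lattice with minimum $z$ (joins computed in $L$). For $I\subseteq G$, the deletion is $(L,G)\setminus I=\langle G\setminus I\,|\,\widehat 0\rangle$ and the contraction is $(L,G)/I=\langle\{g\vee i_0: g\in G\}\setminus\{i_0\}\,|\,i_0\rangle$ where $i_0=\bigvee_{i\in I}i$. A minor of $(L,G)$ is any generator-enriched lattice obtained from $(L,G)$ by a (possibly empty) sequence of deletions and contractions. The minor poset $\mathrm{M}(L,G)$ consists of all minors of $(L,G)$ together with an adjoined minimum element $\emptyset$, ordered by $(K_1,H_1)\le(K_2,H_2)$ when $(K_1,H_1)$ is a minor of $(K_2,H_2)$. $\mathrm{irr}(L)$ is the set of join-irreducibles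 of $L$. The length of a finite lattice is the length (number of elements minus one) of its longest chain; it is at most $|\mathrm{irr}(L)|$, and $L$ is join extremal when its length equals $|\mathrm{irr}(L)|$. $B_m$ is the lattice of subsets of $\{1,\dots,m\}$. $\mathbf{cd}$-index: let $P$ be a graded poset of rank $n+1$ with $\widehat 0$ and $\widehat 1$, and let $\mathbf a,\mathbf b$ be noncommuting variables. To a chain $C=\{\widehat 0<x_1<\dots<x_k<\widehat 1\}$ assign the weight $w(C)=w_1\cdots w_n$ with $w_i=\mathbf b$ if $C$ contains an element of rank $i$ and $w_i=\mathbf a-\mathbf b$ otherwise. The $\mathbf{ab}$-index is $\Psi(P)=\sum_C w(C)$ over all such chains. If it can be written as a polynomial in $\mathbf c=\mathbf a+\mathbf b$ and $\mathbf d=\mathbf{ab}+\mathbf{ba}$, this noncommutative polynomial is the $\mathbf{cd}$-index of $P$, also denoted $\Psi(P)$. Every Eulerian poset has a $\mathbf{cd}$-index, and minor posets are Eulerian, of rank $|G|+1$. Inequalities compare coefficients of $\mathbf{cd}$-monomials. *)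

theory Defs
  imports "HOL-Algebra.Lattice" "HOL-Library.Poly_Mapping"
begin

section \<open>Finite lattices\<close>

(* The locale lattice admits the empty carrier, hence the nonemptiness condition. *)
definition finite_lattice :: "'a gorder \<Rightarrow> bool" where
  "finite_lattice L \<longleftrightarrow> lattice L \<and> finite (carrier L) \<and> carrier L \<noteq> {}"

definition order_chain :: "'a gorder \<Rightarrow> 'a set \<Rightarrow> bool" where
  "order_chain P C \<longleftrightarrow>
     C \<subseteq> carrier P \<and> (\<forall>x\<in>C. \<forall>y\<in>C. x \<sqsubseteq>\<^bsub>P\<^esub> y \<or> y \<sqsubseteq>\<^bsub>P\<^esub> x)"

definition poset_length :: "'a gorder \<Rightarrow> nat" where
  "poset_length P = Max {card C - 1 | C. order_chain P C \<and> C \<noteq> {}}"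

definition irr :: "'a gorder \<Rightarrow> 'a set" where
  "irr L = {j \<in> carrier L. j \<noteq> \<bottom>\<^bsub>L\<^esub> \<and>
     (\<forall>x\<in>carrier L. \<forall>y\<in>carrier L. x \<squnion>\<^bsub>L\<^esub> y = j \<longrightarrow> x = j \<or> y = j)}"

definition join_extremal :: "'a gorder \<Rightarrow> bool" where
  "join_extremal L \<longleftrightarrow> finite_lattice L \<and> poset_length L = card (irr L)"


section \<open>Generator-enriched lattices and their minors\<close>

definition generator_enriched :: "'a gorder \<Rightarrow> 'a set \<Rightarrow> bool" where
  "generator_enriched L G \<longleftrightarrow>
     finite_lattice L \<and> G \<subseteq> carrier L - {\<bottom>\<^bsub>L\<^esub>} \<and>
     (\<forall>x\<in>carrier L. \<exists>X\<subseteq>G. x = \<Squnion>\<^bsub>L\<^esub> X)"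

(* The lattice spanned by H over z carries the order of L restricted to its elements.
   Joins of nonempty subsets agree in both lattices, but the empty join of the new one is z,
   so iterating deletions and contractions refers to the bottom of the current minor. *)
definition span_over :: "'a gorder \<Rightarrow> 'a set \<Rightarrow> 'a \<Rightarrow> 'a gorder \<times> 'a set" where
  "span_over L H z = (L\<lparr>carrier := {z \<squnion>\<^bsub>L\<^esub> (\<Squnion>\<^bsub>L\<^esub> X) | X. X \<subseteq> H}\<rparr>, H)"

definition deletion :: "'a gorder \<Rightarrow> 'a set \<Rightarrow> 'a set \<Rightarrow> 'a gorder \<times> 'a set" where
  "deletion L G I = span_over L (G - I) \<bottom>\<^bsub>L\<^esub>"

definition contraction :: "'a gorder \<Rightarrow> 'a set \<Rightarrow> 'a set \<Rightarrow> 'a gorder \<times> 'a set" where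
  "contraction L G I =
     (let i\<^sub>0 = \<Squnion>\<^bsub>L\<^esub> I in span_over L ({g \<squnion>\<^bsub>L\<^esub> i\<^sub>0 | g. g \<in> G} - {i\<^sub>0}) i\<^sub>0)"

(* is_minor M N: M is a minor of N. *)
inductive is_minor :: "'a gorder \<times> 'a set \<Rightarrow> 'a gorder \<times> 'a set \<Rightarrow> bool" where
  minor_refl: "is_minor M M"
| minor_deletion: "is_minor (K, H) N \<Longrightarrow> I \<subseteq> H \<Longrightarrow> is_minor (deletion K H I) N"
| minor_contraction: "is_minor (K, H) N \<Longrightarrow> I \<subseteq> H \<Longrightarrow> is_minor (contraction K H I) N"

(* None is the adjoined minimum. *)
definition minor_poset :: "'a gorder \<Rightarrow> 'a set \<Rightarrow> ('a gorder \<times> 'a set) option gorder" where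
  "minor_poset L G =
     \<lparr>carrier = insert None (Some ` {M. is_minor M (L, G)}),
      eq = (=),
      le = (\<lambda>x y. case x of None \<Rightarrow> True
               | Some M \<Rightarrow> (case y of None \<Rightarrow> False | Some N \<Rightarrow> is_minor M N))\<rparr>"

definition boolean_algebra_poset :: "nat \<Rightarrow> nat set gorder" where
  "boolean_algebra_poset m = \<lparr>carrier = Pow {1..m}, eq = (=), le = (\<subseteq>)\<rparr>"


section \<open>The ab-index and the cd-index\<close>

(* Words form a monoid under concatenation, so ('v list \<Rightarrow>\<^sub>0 int) is the ring of
   noncommutative integer polynomials in the variables 'v. *)
instantiation list :: (type) monoid_add
begin
definition zero_list :: "'a list" where "zero_list = []"
definition plus_list :: "'a list \<Rightarrow> 'a list \<Rightarrow> 'a list" where "plus_list = (@)"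
instance by standard (simp_all add: zero_list_def plus_list_def)
end

datatype ab_var = Var_a | Var_b
datatype cd_var = Var_c | Var_d

type_synonym ab_poly = "ab_var list \<Rightarrow>\<^sub>0 int"
type_synonym cd_poly = "cd_var list \<Rightarrow>\<^sub>0 int"

definition poly_a :: ab_poly where "poly_a = Poly_Mapping.single [Var_a] 1"
definition poly_b :: ab_poly where "poly_b = Poly_Mapping.single [Var_b] 1"

fun cd_var_to_ab :: "cd_var \<Rightarrow> ab_poly" where
  "cd_var_to_ab Var_c = poly_a + poly_b"
| "cd_var_to_ab Var_d = poly_a * poly_b + poly_b * poly_a"

definition cd_to_ab :: "cd_poly \<Rightarrow> ab_poly" where
  "cd_to_ab p = (\<Sum>w\<in>Poly_Mapping.keys p.
     of_int (Poly_Mapping.lookup p w) * prod_list (map cd_var_to_ab w))"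

(* In a graded poset this is the rank function. *)
definition elem_rank :: "'a gorder \<Rightarrow> 'a \<Rightarrow> nat" where
  "elem_rank P x = poset_length (P\<lparr>carrier := {y \<in> carrier P. y \<sqsubseteq>\<^bsub>P\<^esub> x}\<rparr>)"

(* The rank of P is n + 1 = poset_length P, so [1..<poset_length P] lists 1, ..., n. *)
definition chain_weight :: "'a gorder \<Rightarrow> 'a set \<Rightarrow> ab_poly" where
  "chain_weight P C =
     prod_list (map (\<lambda>i. if \<exists>x\<in>C. elem_rank P x = i then poly_b else poly_a - poly_b)
       [1..<poset_length P])"

definition ab_index :: "'a gorder \<Rightarrow> ab_poly" where
  "ab_index P = (\<Sum>C\<in>{C. order_chain P C \<and> \<bottom>\<^bsub>P\<^esub> \<in> C \<and> \<top>\<^bsub>P\<^esub> \<in> C}. chain_weight P C)"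

(* c and d are algebraically independent, so a cd-index is unique if it exists. *)
definition cd_index :: "'a gorder \<Rightarrow> cd_poly" where
  "cd_index P = (THE p. cd_to_ab p = ab_index P)"

(* The order instance of poly_mapping is lexicographic, not coefficientwise. *)
definition coeff_le :: "cd_poly \<Rightarrow> cd_poly \<Rightarrow> bool" where
  "coeff_le p q \<longleftrightarrow> (\<forall>w. Poly_Mapping.lookup p w \<le> Poly_Mapping.lookup q w)"


section \<open>Join-irreducibles generate\<close>

lemma finite_lattice_bottom_least:
  assumes "finite_lattice L"
  shows "least L \<bottom>\<^bsub>L\<^esub> (carrier L)"
proof -
  interpret lattice L using assms by (simp add: finite_lattice_def)
  have "greatest L (\<Sqinter>\<^bsub>L\<^esub> (carrier L)) (Lower L (carrier L))"
    using assms by (intro finite_inf_greatest) (auto simp: finite_lattice_def)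
  hence "least L (\<Sqinter>\<^bsub>L\<^esub> (carrier L)) (carrier L)"
    by (auto simp: least_def greatest_def Lower_def)
  thus ?thesis unfolding bottom_def by (rule someI)
qed

lemma le_upper_bound_of_irr:
  assumes L: "finite_lattice L" and "x \<in> carrier L" and u: "u \<in> carrier L"
    and "\<And>j. j \<in> irr L \<Longrightarrow> j \<sqsubseteq>\<^bsub>L\<^esub> x \<Longrightarrow> j \<sqsubseteq>\<^bsub>L\<^esub> u"
  shows "x \<sqsubseteq>\<^bsub>L\<^esub> u"
  using assms(2,4)
proof (induction "card {y \<in> carrier L. y \<sqsubseteq>\<^bsub>L\<^esub> x}" arbitrary: x rule: less_induct)
  case less
  interpret lattice L using L by (simp add: finite_lattice_def)
  note x = less.prems(1)
  consider "x = \<bottom>\<^bsub>L\<^esub>" | "x \<in> irr L"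
    | y z where "y \<in> carrier L" "z \<in> carrier L" "y \<squnion>\<^bsub>L\<^esub> z = x" "y \<noteq> x" "z \<noteq> x"
    using x by (auto simp: irr_def)
  thus ?case
  proof cases
    case 1
    thus ?thesis using finite_lattice_bottom_least[OF L] u by (auto simp: least_def)
  next
    case 2
    thus ?thesis using less.prems x by auto
  next
    case 3
    have step: "v \<sqsubseteq>\<^bsub>L\<^esub> u" if v: "v \<in> carrier L" "v \<sqsubseteq>\<^bsub>L\<^esub> x" "v \<noteq> x" for v
    proof (rule less.hyps)
      have "x \<notin> {y \<in> carrier L. y \<sqsubseteq>\<^bsub>L\<^esub> v}" using v x le_antisym by blast
      moreover have "{y \<in> carrier L. y \<sqsubseteq>\<^bsub>L\<^esub> v} \<subseteq> {y \<in> carrier L. y \<sqsubseteq>\<^bsub>L\<^esub> x}"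
        using v x le_trans by blast
      ultimately have "{y \<in> carrier L. y \<sqsubseteq>\<^bsub>L\<^esub> v} \<subset> {y \<in> carrier L. y \<sqsubseteq>\<^bsub>L\<^esub> x}"
        using x by blast
      thus "card {y \<in> carrier L. y \<sqsubseteq>\<^bsub>L\<^esub> v} < card {y \<in> carrier L. y \<sqsubseteq>\<^bsub>L\<^esub> x}"
        using L by (intro psubset_card_mono) (auto simp: finite_lattice_def)
      show "j \<sqsubseteq>\<^bsub>L\<^esub> u" if "j \<in> irr L" "j \<sqsubseteq>\<^bsub>L\<^esub> v" for j
        using that v x less.prems(2) le_trans unfolding irr_def by blast
    qed (fact v)
    have "y \<sqsubseteq>\<^bsub>L\<^esub> x" "z \<sqsubseteq>\<^bsub>L\<^esub> x" using 3 join_left join_right by blast+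
    hence "y \<squnion>\<^bsub>L\<^esub> z \<sqsubseteq>\<^bsub>L\<^esub> u" using 3 step u by (intro join_le) auto
    thus ?thesis using 3 by simp
  qed
qed

lemma generator_enriched_irr:
  assumes L: "finite_lattice L"
  shows "generator_enriched L (irr L)"
  unfolding generator_enriched_def
proof (intro conjI ballI)
  interpret lattice L using L by (simp add: finite_lattice_def)
  show "irr L \<subseteq> carrier L - {\<bottom>\<^bsub>L\<^esub>}" by (auto simp: irr_def)
  fix x assume x: "x \<in> carrier L"
  let ?X = "{j \<in> irr L. j \<sqsubseteq>\<^bsub>L\<^esub> x}"
  have l: "least L x (Upper L ?X)"
    using x le_upper_bound_of_irr[OF L x] by (auto simp: least_def Upper_def irr_def)
  hence "least L (\<Squnion>\<^bsub>L\<^esub> ?X) (Upper L ?X)" unfolding sup_def by (rule someI)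
  hence "x = \<Squnion>\<^bsub>L\<^esub> ?X" using l least_unique by blast
  moreover have "?X \<subseteq> irr L" by auto
  ultimately show "\<exists>X\<subseteq>irr L. x = \<Squnion>\<^bsub>L\<^esub> X" by (intro exI[of _ ?X]) (rule conjI)
qed (fact L)

end

theory Submission
  imports Defs
    "HOL-Computational_Algebra.Fraction_Field"
    "HOL-Computational_Algebra.Polynomial"
    "HOL-Library.Z2"
    "HOL-Library.Function_Algebras"
begin

text \<open>
  Identifying \<open>x\<close> in \<open>L\<close> with the set of join-irreducibles below it turns \<open>L\<close> into an
  intersection-closed family of subsets of \<open>irr L\<close>, and the minor poset only depends on that family.
  For the family of all subsets it is the face poset of a cube; for a maximal flag, which exists
  in \<open>L\<close> exactly because \<open>L\<close> is join extremal, it is a Boolean algebra. One descends from the cube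
  to \<open>L\<close> and from \<open>L\<close> to the flag by removing maximal unwanted members one at a time. Such a member
  \<open>u\<close> has a unique cover \<open>v\<close>, and the induced map of minor posets collapses triples
  \<open>{x\<^sub>1, x\<^sub>2, q}\<close> with \<open>q\<close> the join of \<open>x\<^sub>1\<close> and \<open>x\<^sub>2\<close> (a zip). It lowers the cd-index by the sum of
  \<open>\<Psi>[0, \<phi> q] d \<Psi>[q, 1]\<close> over these triples, the first factor being taken in the smaller poset.
  Zips preserve the Eulerian property and the acyclicity of
  intervals, so every factor is nonnegative by Karu's theorem: over an infinite field
  of characteristic 2, the coefficients of the cd-index are dimensions of stalks of iterated
  Cohen-Macaulay sheaves, obtained as cokernels of generic alternating forms.
\<close>

section \<open>Noncommutative ab- and cd-polynomials\<close>

text \<open>Characteristic 2 removes all orientations: a boundary is a plain sum over covers, it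
  squares to zero because an Eulerian interval of length two has two middle elements, and for the
  same reason the maps glued together in the resolution compose to zero. The field has to be
  infinite because forms that are nondegenerate at one element each are merged into one by avoiding
  finitely many parameters. A stalk is a quotient of two subspaces of a fixed type, with restriction
  maps induced by inclusions; one step of the resolution passes from vectors to functions of
  elements into vectors, and the result is packed back so that the induction stays within one type.
  The obstacle in the descent is a drop of rank: if the top of the minor poset were the
  \<open>q\<close> of a zip, the two cd-indices would have different degrees. This cannot happen
  when distinct join-irreducibles have distinct closures in the smaller family. A maximal flag has
  this property, since each of its steps adds one join-irreducible, and every family that contains
  the flag inherits it.\<close>

lemma poly_expand: "p = (\<Sum>w\<in>Poly_Mapping.keys p. Poly_Mapping.single w (Poly_Mapping.lookup p w))"
proof (rule poly_mapping_eqI)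
  fix k
  have "(\<Sum>w\<in>Poly_Mapping.keys p. Poly_Mapping.lookup (Poly_Mapping.single w (Poly_Mapping.lookup p w)) k)
     = (\<Sum>w\<in>Poly_Mapping.keys p. if w = k then Poly_Mapping.lookup p k else 0)"
    by (rule sum.cong) (auto simp: lookup_single when_def)
  also have "\<dots> = Poly_Mapping.lookup p k" by (simp add: in_keys_iff)
  finally show "Poly_Mapping.lookup p k = Poly_Mapping.lookup (\<Sum>w\<in>Poly_Mapping.keys p. Poly_Mapping.single w (Poly_Mapping.lookup p w)) k"
    by (simp add: lookup_sum)
qed

lemma lookup_mult_word:
  "Poly_Mapping.lookup (p * Poly_Mapping.single u (1::int)) v = (\<Sum>w\<in>Poly_Mapping.keys p. if w @ u = v then Poly_Mapping.lookup p w else 0)"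
proof -
  have "p * Poly_Mapping.single u 1 = (\<Sum>w\<in>Poly_Mapping.keys p. Poly_Mapping.single (w @ u) (Poly_Mapping.lookup p w))"
    by (subst (1) poly_expand) (simp add: sum_distrib_right mult_single plus_list_def)
  then show ?thesis by (simp add: lookup_sum lookup_single when_def)
qed

lemma lookup_mult_letter [simp]:
  "Poly_Mapping.lookup (p * Poly_Mapping.single [x] 1) (w @ [y]) = (if x = y then Poly_Mapping.lookup p w else (0::int))"
  "Poly_Mapping.lookup (p * Poly_Mapping.single [x] 1) [] = (0::int)"
  by (auto simp: lookup_mult_word in_keys_iff)

definition pJ :: ab_poly where "pJ = poly_a - poly_b"
definition pc :: ab_poly where "pc = poly_a + poly_b"
definition pd :: ab_poly where "pd = poly_a * poly_b + poly_b * poly_a"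

fun sw :: "ab_var => ab_var" where "sw Var_a = Var_b" | "sw Var_b = Var_a"

lemma sw_sw [simp]: "sw (sw x) = x" by (cases x) auto
lemma inj_sw: "inj (map sw)" by (rule inj_on_inverseI[where g = "map sw"]) (simp add: comp_def)
lemma inj_snoc: "inj (\<lambda>w. w @ [x])" by (simp add: inj_def)

text \<open>The involution that exchanges the letters a and b; cd-polynomials are fixed by
  it.\<close>

definition bar :: "ab_poly => ab_poly" where "bar = Poly_Mapping.map_key (map sw)"
text \<open>Keeps the words that end in a and strips that letter, so it undoes right multiplication
  by a, by a - b and by c, and kills right multiples of b.\<close>

definition tr :: "ab_poly => ab_poly" where "tr = Poly_Mapping.map_key (\<lambda>w. w @ [Var_a])"

lemma lookup_bar: "Poly_Mapping.lookup (bar p) w = Poly_Mapping.lookup p (map sw w)"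
  by (simp add: bar_def map_key.rep_eq[OF inj_sw])

lemma lookup_tr: "Poly_Mapping.lookup (tr p) w = Poly_Mapping.lookup p (w @ [Var_a])"
  by (simp add: tr_def map_key.rep_eq[OF inj_snoc])

lemma bar_add: "bar (p + q) = bar p + bar q" and bar_diff: "bar (p - q) = bar p - bar q"
  and bar_0 [simp]: "bar 0 = 0" and bar_1 [simp]: "bar 1 = 1" and bar_uminus: "bar (- p) = - bar p"
  by (rule poly_mapping_eqI, simp add: lookup_bar lookup_add lookup_minus lookup_one zero_list_def)+

lemma tr_add: "tr (p + q) = tr p + tr q" and tr_diff: "tr (p - q) = tr p - tr q" and tr_0 [simp]: "tr 0 = 0"
  by (rule poly_mapping_eqI, simp add: lookup_tr lookup_add lookup_minus)+

lemma bar_sum: "bar (\<Sum>i\<in>I. p i) = (\<Sum>i\<in>I. bar (p i))"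
  by (induction I rule: infinite_finite_induct) (auto simp: bar_add)

lemma tr_sum: "tr (\<Sum>i\<in>I. p i) = (\<Sum>i\<in>I. tr (p i))"
  by (induction I rule: infinite_finite_induct) (auto simp: tr_add)

lemma bar_letter: "bar (p * Poly_Mapping.single [x] 1) = bar p * Poly_Mapping.single [sw x] 1"
proof (rule poly_mapping_eqI)
  fix w show "Poly_Mapping.lookup (bar (p * Poly_Mapping.single [x] 1)) w = Poly_Mapping.lookup (bar p * Poly_Mapping.single [sw x] 1) w"
    by (cases w rule: rev_cases) (auto simp: lookup_bar)
qed

lemma bar_a: "bar (p * poly_a) = bar p * poly_b" and bar_b: "bar (p * poly_b) = bar p * poly_a"
  by (simp_all add: poly_a_def poly_b_def bar_letter)

lemma tr_a: "tr (p * poly_a) = p" and tr_b: "tr (p * poly_b) = 0"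
  by (rule poly_mapping_eqI, simp add: poly_a_def poly_b_def lookup_tr)+

abbreviation ep :: "ab_poly => int" where "ep p \<equiv> Poly_Mapping.lookup p []"

lemma ep_a [simp]: "ep (p * poly_a) = 0" and ep_b [simp]: "ep (p * poly_b) = 0"
  by (simp_all add: poly_a_def poly_b_def)

lemma bar_J: "bar (p * pJ) = - (bar p * pJ)"
  by (simp add: pJ_def algebra_simps bar_diff bar_a bar_b)
lemma bar_c: "bar (p * pc) = bar p * pc"
  by (simp add: pc_def algebra_simps bar_add bar_a bar_b)
lemma bar_d: "bar (p * pd) = bar p * pd"
  by (simp add: pd_def distrib_left mult.assoc[symmetric] bar_add bar_a bar_b add.commute)
lemma tr_J: "tr (p * pJ) = p" by (simp add: pJ_def algebra_simps tr_diff tr_a tr_b)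
lemma tr_c: "tr (p * pc) = p" by (simp add: pc_def algebra_simps tr_add tr_a tr_b)
lemma tr_d: "tr (p * pd) = p * poly_b"
  by (simp add: pd_def distrib_left mult.assoc[symmetric] tr_add tr_a tr_b)
lemma ep_J: "ep (p * pJ) = 0" by (simp add: pJ_def algebra_simps lookup_minus)
lemma ep_c: "ep (p * pc) = 0" by (simp add: pc_def algebra_simps lookup_add)
lemma ep_d: "ep (p * pd) = 0" by (simp add: pd_def distrib_left mult.assoc[symmetric] lookup_add)

text \<open>Under \<open>bar\<close> the words ending in b correspond to those ending in a, so an
  invariant polynomial is determined by its constant term and its words ending in a. This is the
  criterion by which \<open>hh_decomp\<close> is verified.\<close>

lemma bar_tr_0:
  assumes "bar e = e" "tr e = 0" "ep e = 0" shows "e = 0"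
proof (rule poly_mapping_eqI)
  fix w
  have a: "Poly_Mapping.lookup e (u @ [Var_a]) = 0" for u using assms(2) lookup_tr[of e u] by simp
  show "Poly_Mapping.lookup e w = Poly_Mapping.lookup 0 w"
  proof (cases w rule: rev_cases)
    case (snoc u x)
    show ?thesis
    proof (cases x)
      case Var_b
      then have "Poly_Mapping.lookup e w = Poly_Mapping.lookup e (map sw u @ [Var_a])"
        using lookup_bar[of e w] assms(1) snoc by simp
      then show ?thesis using a by simp
    qed (use snoc a in simp)
  qed (use assms in simp)
qed

lemma mult_J_0: "p * pJ = 0 ==> p = 0"
  using tr_J[of p] by simp

lemma bar_J_pow: "bar (p * pJ ^ n) = (-1) ^ n * (bar p * pJ ^ n)"
proof (induction n)
  case (Suc n)
  have "bar (p * pJ ^ Suc n) = bar (p * pJ ^ n * pJ)" by (simp add: power_Suc2 mult.assoc del: power_Suc)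
  also have "\<dots> = - ((-1) ^ n * (bar p * pJ ^ n) * pJ)" by (simp only: bar_J Suc)
  also have "\<dots> = (-1) ^ Suc n * (bar p * pJ ^ Suc n)" by (simp add: power_Suc2 mult.assoc del: power_Suc)
  finally show ?case .
qed simp

lemma bar_c_pow: "bar (p * pc ^ n) = bar p * pc ^ n"
proof (induction n)
  case (Suc n)
  have "bar (p * pc ^ Suc n) = bar (p * pc ^ n * pc)" by (simp only: power_Suc2 mult.assoc)
  also have "\<dots> = bar p * pc ^ n * pc" by (simp only: bar_c Suc)
  finally show ?case by (simp only: power_Suc2 mult.assoc)
qed simp

section \<open>The embedding of cd-polynomials into ab-polynomials\<close>

lemma cd_to_ab_superset:
  assumes "finite S" "Poly_Mapping.keys p \<subseteq> S"
  shows "cd_to_ab p = (\<Sum>w\<in>S. of_int (Poly_Mapping.lookup p w) * prod_list (map cd_var_to_ab w))"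
  unfolding cd_to_ab_def by (rule sum.mono_neutral_left) (use assms in \<open>auto simp: in_keys_iff\<close>)

lemma cd_to_ab_add: "cd_to_ab (p + q) = cd_to_ab p + cd_to_ab q"
proof -
  let ?S = "Poly_Mapping.keys p \<union> Poly_Mapping.keys q"
  have "Poly_Mapping.keys (p + q) \<subseteq> ?S" by (rule keys_add)
  then show ?thesis
    by (simp add: cd_to_ab_superset[of ?S] lookup_add sum.distrib[symmetric] distrib_right)
qed

lemma cd_to_ab_0 [simp]: "cd_to_ab 0 = 0" by (simp add: cd_to_ab_def)

lemma cd_to_ab_sum: "cd_to_ab (\<Sum>i\<in>I. p i) = (\<Sum>i\<in>I. cd_to_ab (p i))"
  by (induction I rule: infinite_finite_induct) (auto simp: cd_to_ab_add)

lemma cd_to_ab_diff: "cd_to_ab (p - q) = cd_to_ab p - cd_to_ab q"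
  using cd_to_ab_add[of "p - q" q] by (simp add: algebra_simps)

lemma cd_to_ab_single: "cd_to_ab (Poly_Mapping.single w x) = of_int x * prod_list (map cd_var_to_ab w)"
  by (subst cd_to_ab_superset[of "{w}"]) auto

lemma of_int_comm: "(of_int x :: ab_poly) * p = p * of_int x"
  by (rule mult_of_int_commute)

lemma cd_to_ab_mult: "cd_to_ab (p * q) = cd_to_ab p * cd_to_ab q"
proof -
  have s: "cd_to_ab (Poly_Mapping.single u x * Poly_Mapping.single v y)
      = cd_to_ab (Poly_Mapping.single u x) * cd_to_ab (Poly_Mapping.single v y)" for u v :: "cd_var list" and x y :: int
  proof -
    have "of_int x * of_int y * (prod_list (map cd_var_to_ab u) * prod_list (map cd_var_to_ab v))
      = of_int x * (of_int y * prod_list (map cd_var_to_ab u)) * prod_list (map cd_var_to_ab v)"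
      by (simp only: mult.assoc)
    also have "of_int y * prod_list (map cd_var_to_ab u) = prod_list (map cd_var_to_ab u) * of_int y"
      by (rule of_int_comm)
    finally show ?thesis by (simp add: mult_single plus_list_def cd_to_ab_single mult.assoc)
  qed
  have "p * q = (\<Sum>u\<in>Poly_Mapping.keys p. \<Sum>v\<in>Poly_Mapping.keys q.
      Poly_Mapping.single u (Poly_Mapping.lookup p u) * Poly_Mapping.single v (Poly_Mapping.lookup q v))"
    by (subst (1) poly_expand[of p], subst (1) poly_expand[of q]) (simp add: sum_product)
  then have "cd_to_ab (p * q) = cd_to_ab (\<Sum>u\<in>Poly_Mapping.keys p. Poly_Mapping.single u (Poly_Mapping.lookup p u))
      * cd_to_ab (\<Sum>v\<in>Poly_Mapping.keys q. Poly_Mapping.single v (Poly_Mapping.lookup q v))"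
    by (simp add: cd_to_ab_sum s sum_product)
  then show ?thesis using poly_expand[of p] poly_expand[of q] by simp
qed

lemma cd_to_ab_c: "cd_to_ab (Poly_Mapping.single (replicate n Var_c) x) = of_int x * pc ^ n"
  by (simp add: cd_to_ab_single pc_def power_def prod_list_replicate)

lemma cd_to_ab_dc: "cd_to_ab (Poly_Mapping.single (Var_d # replicate n Var_c) 1) = pd * pc ^ n"
  by (simp add: cd_to_ab_single pc_def pd_def prod_list_replicate)

lemma bar_cd: "bar (cd_to_ab p) = cd_to_ab p"
proof -
  have w: "bar (of_int x * prod_list (map cd_var_to_ab w)) = of_int x * prod_list (map cd_var_to_ab w)" for x w
  proof (induction w rule: rev_induct)
    case Nil
    have "bar (of_int x) = of_int x"
      by (rule poly_mapping_eqI) (simp add: lookup_bar lookup_of_int zero_list_def when_def)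
    then show ?case by simp
  next
    case (snoc y w)
    then show ?case
      by (cases y) (simp_all add: mult.assoc[symmetric] pc_def[symmetric] pd_def[symmetric] bar_c bar_d)
  qed
  show ?thesis unfolding cd_to_ab_def by (simp add: bar_sum w)
qed

text \<open>Induction on the length of words, splitting off the last letter: from \<alpha> c +
  \<beta> d = 0 one gets \<alpha> + \<beta> b = 0 by \<open>tr\<close>, then \<alpha> + \<beta> a =
  0 by \<open>bar\<close>, and the difference \<beta> (a - b) = 0 forces \<beta> = 0.\<close>

lemma cd_to_ab_inj_0: "cd_to_ab p = 0 ==> p = 0"
proof -
  have "(\<forall>w\<in>Poly_Mapping.keys p. length w < n) ==> cd_to_ab p = 0 ==> p = 0" for n
  proof (induction n arbitrary: p)
    case 0
    then show ?case by (auto simp: poly_mapping_eqI in_keys_iff intro!: poly_mapping_eqI)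
  next
    case (Suc n)
    define q where "q x = Poly_Mapping.map_key (\<lambda>w. w @ [x]) p" for x
    have lq: "Poly_Mapping.lookup (q x) w = Poly_Mapping.lookup p (w @ [x])" for x w
      by (simp add: q_def map_key.rep_eq[OF inj_snoc])
    have len: "\<forall>w\<in>Poly_Mapping.keys (q x). length w < n" for x
    proof
      fix w assume "w \<in> Poly_Mapping.keys (q x)"
      then have "w @ [x] \<in> Poly_Mapping.keys p" by (simp add: in_keys_iff lq)
      with Suc.prems(1) show "length w < n" by fastforce
    qed
    define p0 where "p0 = Poly_Mapping.lookup p []"
    have pe: "p = Poly_Mapping.single [] p0 + q Var_c * Poly_Mapping.single [Var_c] 1 + q Var_d * Poly_Mapping.single [Var_d] 1"
    proof (rule poly_mapping_eqI)
      fix w show "Poly_Mapping.lookup p w = Poly_Mapping.lookup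
         (Poly_Mapping.single [] p0 + q Var_c * Poly_Mapping.single [Var_c] 1 + q Var_d * Poly_Mapping.single [Var_d] 1) w"
      proof (cases w rule: rev_cases)
        case (snoc u x)
        then show ?thesis by (cases x) (simp_all add: lookup_add lq lookup_single)
      qed (simp add: lookup_add p0_def)
    qed
    define \<alpha> \<beta> where "\<alpha> = cd_to_ab (q Var_c)" and "\<beta> = cd_to_ab (q Var_d)"
    have "cd_to_ab p = cd_to_ab (Poly_Mapping.single [] p0 + q Var_c * Poly_Mapping.single [Var_c] 1 + q Var_d * Poly_Mapping.single [Var_d] 1)"
      using pe by simp
    then have e: "0 = of_int p0 + \<alpha> * pc + \<beta> * pd"
      using Suc.prems(2) by (simp add: cd_to_ab_add cd_to_ab_mult cd_to_ab_single \<alpha>_def \<beta>_def pc_def pd_def)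
    have "ep 0 = ep (of_int p0 + \<alpha> * pc + \<beta> * pd)" using e by simp
    then have p00: "p0 = 0" by (simp add: lookup_add ep_c ep_d lookup_of_int zero_list_def)
    have "tr (\<alpha> * pc + \<beta> * pd) = 0" using e p00 by simp
    then have 1: "\<alpha> + \<beta> * poly_b = 0" by (simp add: tr_add tr_c tr_d)
    then have "bar (\<alpha> + \<beta> * poly_b) = 0" by simp
    then have 2: "\<alpha> + \<beta> * poly_a = 0" by (simp add: bar_add bar_b bar_cd \<alpha>_def \<beta>_def)
    have "\<beta> * pJ = (\<alpha> + \<beta> * poly_a) - (\<alpha> + \<beta> * poly_b)" by (simp add: pJ_def algebra_simps)
    then have "\<beta> = 0" using 1 2 mult_J_0 by simp
    then have "\<alpha> = 0" using 1 by simp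
    have "q Var_c = 0" "q Var_d = 0" using Suc.IH[OF len] \<open>\<alpha> = 0\<close> \<open>\<beta> = 0\<close> by (simp_all add: \<alpha>_def \<beta>_def)
    then show ?case using pe p00 by simp
  qed
  from this[of "Suc (Max (length ` Poly_Mapping.keys p))"]
  show "cd_to_ab p = 0 ==> p = 0" by (simp add: less_Suc_eq_le)
qed

lemma cd_to_ab_inj: "cd_to_ab p = cd_to_ab q ==> p = q"
  using cd_to_ab_inj_0[of "p - q"] by (simp add: cd_to_ab_diff)

section \<open>Coefficientwise nonnegativity\<close>

definition nonneg_poly :: "('a \<Rightarrow>\<^sub>0 int) => bool" where
  "nonneg_poly p \<longleftrightarrow> (\<forall>w. 0 \<le> Poly_Mapping.lookup p w)"

lemma nonneg_add: "nonneg_poly p ==> nonneg_poly q ==> nonneg_poly (p + q)"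
  by (simp add: nonneg_poly_def lookup_add)

lemma nonneg_sum: "(\<And>i. i \<in> I ==> nonneg_poly (p i)) ==> nonneg_poly (\<Sum>i\<in>I. p i)"
  by (simp add: nonneg_poly_def lookup_sum sum_nonneg)

lemma nonneg_single: "0 \<le> x ==> nonneg_poly (Poly_Mapping.single w x)"
  by (simp add: nonneg_poly_def lookup_single when_def)

lemma nonneg_mult:
  fixes p q :: "'a::monoid_add \<Rightarrow>\<^sub>0 int"
  assumes "nonneg_poly p" "nonneg_poly q" shows "nonneg_poly (p * q)"
proof -
  have "p * q = (\<Sum>u\<in>Poly_Mapping.keys p. \<Sum>v\<in>Poly_Mapping.keys q.
      Poly_Mapping.single u (Poly_Mapping.lookup p u) * Poly_Mapping.single v (Poly_Mapping.lookup q v))"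
    by (subst (1) poly_expand[of p], subst (1) poly_expand[of q]) (simp add: sum_product)
  then show ?thesis using assms
    by (auto simp: mult_single nonneg_poly_def[of p] nonneg_poly_def[of q] intro!: nonneg_sum nonneg_single)
qed

section \<open>Linear algebra in characteristic two\<close>

text \<open>The field F_2(t) of rational functions over the field with two elements. Class instances
  attach to type constructors, so this particular case of \<open>fract\<close> gets a type of its
  own.\<close>

typedef fld = "UNIV :: bit poly fract set" morphisms rep_fld abs_fld by simp

setup_lifting type_definition_fld

instantiation fld :: field
begin
lift_definition zero_fld :: fld is 0 .
lift_definition one_fld :: fld is 1 .
lift_definition plus_fld :: "fld => fld => fld" is "(+)" .
lift_definition minus_fld :: "fld => fld => fld" is "(-)" .
lift_definition uminus_fld :: "fld => fld" is uminus .
lift_definition times_fld :: "fld => fld => fld" is "(*)" .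
lift_definition inverse_fld :: "fld => fld" is inverse .
lift_definition divide_fld :: "fld => fld => fld" is "(/)" .
instance
  by standard (transfer; simp add: algebra_simps divide_inverse)+
end

lemma fld_one_plus_one: "(1::fld) + 1 = 0"
proof -
  have b: "(b::bit) + b = 0" for b by (cases b) auto
  have p: "(p::bit poly) + p = 0" for p
    by (intro poly_eqI) (simp only: coeff_add b coeff_0)
  have "(1::bit poly fract) + 1 = Fraction_Field.Fract (1 + 1) 1"
    by (simp only: One_fract_def) simp
  also have "\<dots> = 0" by (simp only: p) (simp add: Zero_fract_def)
  finally show ?thesis by transfer
qed

lemma infinite_fld: "infinite (UNIV :: fld set)"
proof -
  have "inj (\<lambda>n. abs_fld (Fraction_Field.Fract (monom (1::bit) n) 1))"
    by (intro injI) (simp add: abs_fld_inject eq_fract monom_eq_iff')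
  then show ?thesis using infinite_UNIV_nat finite_imageD
    by (metis finite_subset subset_UNIV)
qed

text \<open>A class, so that functions into a vector space and functionals on it are again vector
  spaces by their type; subspaces are then plain sets.\<close>

class kvec = ab_group_add +
  fixes sc :: "fld => 'a => 'a" (infixr "\<cdot>" 75)
  assumes sc_right: "a \<cdot> (x + y) = a \<cdot> x + a \<cdot> y"
    and sc_left: "(a + b) \<cdot> x = a \<cdot> x + b \<cdot> x"
    and sc_sc: "a \<cdot> (b \<cdot> x) = (a * b) \<cdot> x"
    and sc_one: "1 \<cdot> x = x"

instantiation fld :: kvec
begin
definition sc_fld :: "fld => fld => fld" where "sc_fld = (*)"
instance by standard (simp_all add: sc_fld_def algebra_simps)
end

instantiation "fun" :: (type, kvec) kvec
begin
definition sc_fun :: "fld => ('a => 'b) => 'a => 'b" where "sc_fun c f = (\<lambda>x. c \<cdot> f x)"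
instance by standard (auto simp: sc_fun_def fun_eq_iff sc_right sc_left sc_sc sc_one)
end

interpretation kv: vector_space "sc :: fld => 'a => 'a::kvec"
  by standard (simp_all add: sc_right sc_left sc_sc sc_one)

text \<open>From here on addition also serves as subtraction: congruence of x and y modulo
  \<open>B\<close> reads \<open>x + y \<in> B\<close>.\<close>

lemma kv_add_self [simp]: "(x::'a::kvec) + x = 0"
  by (metis fld_one_plus_one kv.scale_zero_left sc_left sc_one)

lemma kv_uminus [simp]: "- (x::'a::kvec) = x"
  by (rule minus_unique) simp

lemma kv_minus_eq_plus: "(x::'a::kvec) - y = x + y"
  using diff_conv_add_uminus[of x y] by simp

abbreviation lin :: "('a::kvec => 'b::kvec) => bool" where
  "lin \<equiv> Vector_Spaces.linear sc sc"

interpretation kvp: vector_space_pair "sc :: fld => 'a => 'a::kvec" "sc :: fld => 'b => 'b::kvec"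
  by standard

declare plus_fun_apply [simp del] zero_fun_apply [simp del]

lemma sc_fun_apply: "(c \<cdot> f) x = c \<cdot> f x" by (simp add: sc_fun_def)

lemmas fun_apply = plus_fun_apply zero_fun_apply sc_fun_apply

lemma sum_fun_apply: "(\<Sum>i\<in>I. f i) x = (\<Sum>i\<in>I. f i x)"
  by (induction I rule: infinite_finite_induct) (auto simp: fun_apply)

lemma lin_iff: "lin f \<longleftrightarrow> (\<forall>x y. f (x + y) = f x + f y) \<and> (\<forall>c x. f (c \<cdot> x) = c \<cdot> f x)"
  unfolding Vector_Spaces.linear_iff by (auto intro: kv.vector_space_axioms)

section \<open>Dimensions of quotients of subspaces\<close>

definition imod :: "'a::kvec set => 'a set => bool" where
  "imod B T \<longleftrightarrow> finite T \<and> (\<forall>c. (\<Sum>t\<in>T. c t \<cdot> t) \<in> B \<longrightarrow> (\<forall>t\<in>T. c t = 0))"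

definition smod :: "'a::kvec set => 'a set => 'a set => bool" where
  "smod B T X \<longleftrightarrow> (\<forall>z\<in>X. \<exists>c. z + (\<Sum>t\<in>T. c t \<cdot> t) \<in> B)"

definition mbase :: "'a::kvec set => 'a set => 'a set => bool" where
  "mbase Z B S \<longleftrightarrow> S \<subseteq> Z \<and> imod B S \<and> smod B S Z"

text \<open>The quotient \<open>Z\<close>/\<open>B\<close> has dimension \<open>n\<close>, expressed
  by representatives instead of a quotient type. It is a relation because the quotient may have
  infinite dimension.\<close>

definition qd :: "'a::kvec set => 'a set => nat => bool" where
  "qd Z B n \<longleftrightarrow> (\<exists>S. mbase Z B S \<and> card S = n)"

lemma sum_if_eq:
  assumes "finite T" "t \<in> T" shows "(\<Sum>s\<in>T. (if s = t then a else b s) \<cdot> f s) = (a::fld) \<cdot> (f t :: 'a::kvec) + (\<Sum>s\<in>T - {t}. b s \<cdot> f s)"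
proof -
  have "(\<Sum>s\<in>T. (if s = t then a else b s) \<cdot> f s)
      = a \<cdot> f t + (\<Sum>s\<in>T - {t}. (if s = t then a else b s) \<cdot> f s)"
    using assms by (subst sum.remove[of T t]) auto
  also have "(\<Sum>s\<in>T - {t}. (if s = t then a else b s) \<cdot> f s) = (\<Sum>s\<in>T - {t}. b s \<cdot> f s)"
    by (rule sum.cong) auto
  finally show ?thesis .
qed

text \<open>The exchange lemma modulo \<open>B\<close>: the coefficient vectors of the elements of
  \<open>T\<close> with respect to \<open>S\<close> are linearly independent, and they lie in the
  span of as many unit vectors as \<open>S\<close> has elements.\<close>

lemma imod_card_le:
  assumes B: "kv.subspace B" and S: "finite S" and sp: "smod B S X" and T: "imod B T" "T \<subseteq> X"
  shows "card T \<le> card (S::'a::kvec set)"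
proof -
  have fT: "finite T" using T by (simp add: imod_def)
  have "\<forall>t. \<exists>c. t \<in> T \<longrightarrow> t + (\<Sum>s\<in>S. c s \<cdot> s) \<in> B"
    using sp T(2) by (auto simp: smod_def)
  then obtain c0 where c0: "\<And>t. t \<in> T ==> t + (\<Sum>s\<in>S. c0 t s \<cdot> s) \<in> B"
    by metis
  \<comment> \<open>Cut off outside \<open>S\<close>, so that the coefficient function lies in the
    span of the unit vectors \<open>e s\<close>.\<close>
  define c where "c t = (\<lambda>s. if s \<in> S then c0 t s else 0)" for t
  have c: "t + (\<Sum>s\<in>S. c t s \<cdot> s) \<in> B" if "t \<in> T" for t
    using c0[OF that] by (simp add: c_def cong: sum.cong)
  define e :: "'a => 'a => fld" where "e s = (\<lambda>s'. if s' = s then 1 else 0)" for s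
  have key: "(\<forall>t\<in>T. a t = 0)" if a0: "(\<Sum>t\<in>T. a t \<cdot> c t) = 0" for a
  proof -
    have z: "(\<Sum>t\<in>T. a t * c t s) = 0" for s
      using fun_cong[OF a0, of s] by (simp add: sum_fun_apply fun_apply sc_fld_def)
    have "(\<Sum>t\<in>T. a t \<cdot> (t + (\<Sum>s\<in>S. c t s \<cdot> s))) \<in> B"
      using c B by (intro kv.subspace_sum kv.subspace_scale) auto
    also have "(\<Sum>t\<in>T. a t \<cdot> (t + (\<Sum>s\<in>S. c t s \<cdot> s)))
        = (\<Sum>t\<in>T. a t \<cdot> t) + (\<Sum>t\<in>T. \<Sum>s\<in>S. (a t * c t s) \<cdot> s)"
      by (simp add: sc_right sum.distrib kv.scale_sum_right sc_sc)
    also have "(\<Sum>t\<in>T. \<Sum>s\<in>S. (a t * c t s) \<cdot> s) = (\<Sum>s\<in>S. (\<Sum>t\<in>T. a t * c t s) \<cdot> s)"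
      by (subst sum.swap) (simp add: kv.scale_sum_left)
    also have "\<dots> = 0" by (simp add: z)
    finally show ?thesis using T(1) by (simp add: imod_def)
  qed
  have inj: "inj_on c T"
  proof (rule inj_onI, rule ccontr)
    fix t t' assume tt: "t \<in> T" "t' \<in> T" "c t = c t'" "t \<noteq> t'"
    \<comment> \<open>Equal images give a relation with coefficient 1 at both elements, against
      \<open>key\<close>.\<close>
    have "(\<Sum>s\<in>T. (if s = t then 1 else if s = t' then 1 else 0) \<cdot> c s) = c t + c t'"
    proof -
      have "(\<Sum>s\<in>T. (if s = t then 1 else if s = t' then 1 else 0) \<cdot> c s)
         = 1 \<cdot> c t + (\<Sum>s\<in>T-{t}. (if s = t' then 1 else 0) \<cdot> c s)"
        by (rule sum_if_eq) (use fT tt in auto)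
      also have "(\<Sum>s\<in>T-{t}. (if s = t' then 1 else 0) \<cdot> c s) = 1 \<cdot> c t' + (\<Sum>s\<in>T-{t}-{t'}. 0 \<cdot> c s)"
        by (rule sum_if_eq) (use fT tt in auto)
      finally show ?thesis by (simp only: sc_one kv.scale_zero_left sum.neutral_const add_0_right)
    qed
    then have "(\<Sum>s\<in>T. (if s = t then 1 else if s = t' then 1 else 0) \<cdot> c s) = 0"
      using tt(3) by simp
    from key[OF this] tt(1) show False by auto
  qed
  have ind: "kv.independent (c ` T)"
  proof (rule kv.independent_if_scalars_zero)
    fix f x assume s: "(\<Sum>x\<in>c ` T. f x \<cdot> x) = 0" and x: "x \<in> c ` T"
    have "(\<Sum>t\<in>T. f (c t) \<cdot> c t) = 0" using s by (simp add: sum.reindex[OF inj])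
    from key[OF this] x show "f x = 0" by auto
  qed (use fT in auto)
  have "c ` T \<subseteq> kv.span (e ` S)"
  proof
    fix x assume "x \<in> c ` T"
    then obtain t where t: "t \<in> T" "x = c t" by auto
    have "c t = (\<Sum>s\<in>S. c t s \<cdot> e s)"
    proof
      fix s
      have "(\<Sum>s'\<in>S. c t s' \<cdot> e s') s = (\<Sum>s'\<in>S. if s' = s then c t s' else 0)"
        by (simp add: sum_fun_apply sc_fun_def sc_fld_def e_def if_distrib cong: if_cong sum.cong)
          (rule sum.cong, auto)
      also have "\<dots> = c t s" using S by (simp add: c_def)
      finally show "c t s = (\<Sum>s'\<in>S. c t s' \<cdot> e s') s" by simp
    qed
    then show "x \<in> kv.span (e ` S)" unfolding t(2)
      by (metis (no_types, lifting) kv.span_sum kv.span_scale kv.span_base imageI)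
  qed
  from kv.independent_span_bound[OF _ ind this] S
  have "card (c ` T) \<le> card (e ` S)" by auto
  also have "\<dots> \<le> card S" using S by (rule card_image_le)
  finally show ?thesis by (simp add: card_image[OF inj])
qed

lemma imod_empty [simp]: "imod B {}" by (simp add: imod_def)

lemma imod_insert:
  assumes B: "kv.subspace B" and T: "imod B T" and z: "\<nexists>c. z + (\<Sum>t\<in>T. c t \<cdot> t) \<in> B"
  shows "imod B (insert z T)" "z \<notin> T"
proof -
  have fT: "finite T" using T by (simp add: imod_def)
  show zT: "z \<notin> T"
  proof
    assume "z \<in> T"
    then have "(\<Sum>t\<in>T. (if t = z then 1 else 0) \<cdot> t) = 1 \<cdot> z + (\<Sum>t\<in>T-{z}. 0 \<cdot> t)"
      using fT by (intro sum_if_eq)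
    then have "z + (\<Sum>t\<in>T. (if t = z then 1 else 0) \<cdot> t) = 0" by (simp add: sc_one)
    with z B show False by (metis kv.subspace_0)
  qed
  show "imod B (insert z T)" unfolding imod_def
  proof (intro conjI allI impI)
    fix c assume "(\<Sum>t\<in>insert z T. c t \<cdot> t) \<in> B"
    then have s: "c z \<cdot> z + (\<Sum>t\<in>T. c t \<cdot> t) \<in> B" using fT zT by simp
    have cz: "c z = 0"
    proof (rule ccontr)
      assume c: "c z \<noteq> 0"
      have "inverse (c z) \<cdot> (c z \<cdot> z + (\<Sum>t\<in>T. c t \<cdot> t)) \<in> B"
        using s B by (rule_tac kv.subspace_scale)
      then have "z + (\<Sum>t\<in>T. (inverse (c z) * c t) \<cdot> t) \<in> B"
        using c by (simp add: sc_right sc_sc sc_one kv.scale_sum_right)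
      with z show False by meson
    qed
    with s T show "\<forall>t\<in>insert z T. c t = 0" by (auto simp: imod_def)
  qed (use fT in simp)
qed

text \<open>An independent subset of \<open>X\<close> of maximal size spans \<open>X\<close>; the
  bound \<open>N\<close> guarantees that a maximal size exists. As \<open>X\<close> is an arbitrary
  set, a basis can be chosen among prescribed vectors.\<close>

lemma ex_mod_basis:
  assumes B: "kv.subspace B" and bd: "\<And>T. T \<subseteq> X ==> imod B T ==> card T \<le> N"
  shows "\<exists>T\<subseteq>X. imod B T \<and> smod B T X"
proof -
  define P where "P n \<longleftrightarrow> (\<exists>T\<subseteq>X. imod B T \<and> card T = n)" for n
  have "P 0" unfolding P_def by (intro exI[of _ "{}"]) auto
  moreover have "\<forall>n. P n \<longrightarrow> n \<le> N" using bd by (auto simp: P_def)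
  ultimately obtain n where n: "P n" "\<And>m. P m ==> m \<le> n"
    by (metis Nat.ex_has_greatest_nat)
  then obtain T where T: "T \<subseteq> X" "imod B T" "card T = n" by (auto simp: P_def)
  have "smod B T X" unfolding smod_def
  proof (rule ballI, rule ccontr)
    fix z assume z: "z \<in> X" "\<nexists>c. z + (\<Sum>t\<in>T. c t \<cdot> t) \<in> B"
    from imod_insert[OF B T(2) z(2)] have "P (Suc n)"
      unfolding P_def using T z by (intro exI[of _ "insert z T"]) (auto simp: imod_def)
    from n(2)[OF this] show False by simp
  qed
  with T show ?thesis by blast
qed

lemma qd_unique:
  assumes "kv.subspace B" "qd Z B m" "qd Z B n" shows "m = n"
proof -
  obtain S T where "mbase Z B S" "card S = m" "mbase Z B T" "card T = n"
    using assms by (auto simp: qd_def)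
  then show ?thesis
    using imod_card_le[OF assms(1), of S Z T] imod_card_le[OF assms(1), of T Z S]
    by (auto simp: mbase_def imod_def)
qed

text \<open>A basis of \<open>A\<close> modulo \<open>B\<close> and one of \<open>B\<close> modulo
  \<open>C\<close> together form a basis of \<open>A\<close> modulo \<open>C\<close>.\<close>

lemma qd_trans:
  assumes sub: "kv.subspace B" "kv.subspace C" "C \<subseteq> B" "B \<subseteq> A"
    and "qd A B m" "qd B C n"
  shows "qd A C (m + n)"
proof -
  obtain S T where S: "mbase A B S" "card S = m" and T: "mbase B C T" "card T = n"
    using assms by (auto simp: qd_def)
  have fin: "finite S" "finite T" using S T by (auto simp: mbase_def imod_def)
  have TB: "T \<subseteq> B" using T by (auto simp: mbase_def)
  have disj: "S \<inter> T = {}"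
  proof (rule ccontr)
    assume "S \<inter> T \<noteq> {}"
    then obtain s where s: "s \<in> S" "s \<in> T" by blast
    have "(\<Sum>t\<in>S. (if t = s then 1 else 0) \<cdot> t) = 1 \<cdot> s + (\<Sum>t\<in>S-{s}. 0 \<cdot> t)"
      using fin s by (intro sum_if_eq)
    then have "(\<Sum>t\<in>S. (if t = s then 1 else 0) \<cdot> t) \<in> B" using s TB by (auto simp: sc_one)
    moreover have kS: "\<And>c. (\<Sum>t\<in>S. c t \<cdot> t) \<in> B ==> (\<forall>t\<in>S. c t = 0)"
      using S by (auto simp: mbase_def imod_def)
    ultimately have "\<forall>t\<in>S. (if t = s then 1 else 0::fld) = 0" by (rule_tac kS)
    with s(1) show False by auto
  qed
  have "imod C (S \<union> T)" unfolding imod_def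
  proof (intro conjI allI impI)
    fix c assume s: "(\<Sum>t\<in>S \<union> T. c t \<cdot> t) \<in> C"
    then have s': "(\<Sum>t\<in>S. c t \<cdot> t) + (\<Sum>t\<in>T. c t \<cdot> t) \<in> C"
      using fin disj by (simp add: sum.union_disjoint)
    have tB: "(\<Sum>t\<in>T. c t \<cdot> t) \<in> B"
      using TB sub by (intro kv.subspace_sum kv.subspace_scale) auto
    have "((\<Sum>t\<in>S. c t \<cdot> t) + (\<Sum>t\<in>T. c t \<cdot> t)) - (\<Sum>t\<in>T. c t \<cdot> t) \<in> B"
      using s' sub tB by (intro kv.subspace_diff) auto
    then have "(\<Sum>t\<in>S. c t \<cdot> t) \<in> B" by simp
    then have 0: "\<forall>t\<in>S. c t = 0" using S by (auto simp: mbase_def imod_def)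
    with s' have "(\<Sum>t\<in>T. c t \<cdot> t) \<in> C" by simp
    then have "\<forall>t\<in>T. c t = 0" using T by (auto simp: mbase_def imod_def)
    with 0 show "\<forall>t\<in>S \<union> T. c t = 0" by auto
  qed (use fin in auto)
  moreover have "smod C (S \<union> T) A" unfolding smod_def
  proof
    fix z assume z: "z \<in> A"
    then obtain c where c: "z + (\<Sum>t\<in>S. c t \<cdot> t) \<in> B" using S by (auto simp: mbase_def smod_def)
    then obtain d where d: "z + (\<Sum>t\<in>S. c t \<cdot> t) + (\<Sum>t\<in>T. d t \<cdot> t) \<in> C"
      using T unfolding mbase_def smod_def by blast
    define e where "e t = (if t \<in> S then c t else d t)" for t
    have "(\<Sum>t\<in>S \<union> T. e t \<cdot> t) = (\<Sum>t\<in>S. e t \<cdot> t) + (\<Sum>t\<in>T. e t \<cdot> t)"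
      using fin disj by (simp add: sum.union_disjoint)
    also have "(\<Sum>t\<in>S. e t \<cdot> t) = (\<Sum>t\<in>S. c t \<cdot> t)" by (simp add: e_def)
    also have "(\<Sum>t\<in>T. e t \<cdot> t) = (\<Sum>t\<in>T. d t \<cdot> t)"
      using disj by (intro sum.cong) (auto simp: e_def)
    finally have "z + (\<Sum>t\<in>S \<union> T. e t \<cdot> t) \<in> C" using d by (simp add: add.assoc)
    then show "\<exists>c. z + (\<Sum>t\<in>S \<union> T. c t \<cdot> t) \<in> C" by blast
  qed
  moreover have "S \<union> T \<subseteq> A" using S TB sub by (auto simp: mbase_def)
  moreover have "card (S \<union> T) = m + n" using S T fin disj by (simp add: card_Un_disjoint)
  ultimately show ?thesis unfolding qd_def mbase_def by blast
qed

lemma imod_mono: "imod B T ==> C \<subseteq> B ==> imod C T"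
  by (auto simp: imod_def)

lemma qd_quot_ex:
  assumes sub: "kv.subspace B" "kv.subspace C" "C \<subseteq> B" and a: "qd A C a"
  shows "\<exists>m. qd A B m"
proof -
  obtain S where S: "mbase A C S" "card S = a" using a by (auto simp: qd_def)
  have "\<exists>T\<subseteq>A. imod B T \<and> smod B T A"
  proof (rule ex_mod_basis[OF sub(1), of A a])
    fix T assume "T \<subseteq> A" "imod B T"
    then show "card T \<le> a" using imod_card_le[OF sub(2), of S A T] S imod_mono[OF _ sub(3)]
      by (auto simp: mbase_def imod_def)
  qed
  then show ?thesis by (auto simp: qd_def mbase_def)
qed

lemma qd_quot:
  assumes sub: "kv.subspace B" "kv.subspace C" "C \<subseteq> B" "B \<subseteq> A"
    and a: "qd A C a" and b: "qd B C b"
  shows "b \<le> a" "qd A B (a - b)"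
proof -
  obtain m where m: "qd A B m" using qd_quot_ex[OF sub(1-3) a] by blast
  from qd_unique[OF sub(2) a qd_trans[OF sub m b]] have "a = m + b" .
  with m show "b \<le> a" "qd A B (a - b)" by auto
qed

lemma qd_sub:
  assumes sub: "kv.subspace B" "kv.subspace C" "C \<subseteq> B" "B \<subseteq> A"
    and a: "qd A C a" and b: "qd A B b"
  shows "b \<le> a" "qd B C (a - b)"
proof -
  obtain S where S: "mbase A C S" "card S = a" using a by (auto simp: qd_def)
  have "\<exists>T\<subseteq>B. imod C T \<and> smod C T B"
  proof (rule ex_mod_basis[OF sub(2), of B a])
    fix T assume "T \<subseteq> B" "imod C T"
    then show "card T \<le> a" using imod_card_le[OF sub(2), of S A T] S sub(4)
      by (auto simp: mbase_def imod_def)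
  qed
  then obtain m where m: "qd B C m" by (auto simp: qd_def mbase_def)
  from qd_unique[OF sub(2) a qd_trans[OF sub b m]] have "a = b + m" .
  with m show "b \<le> a" "qd B C (a - b)" by auto
qed

section \<open>Linear maps between quotients\<close>

lemma lin_sum_scale: "lin \<theta> ==> \<theta> (\<Sum>s\<in>S. c s \<cdot> f s) = (\<Sum>s\<in>S. c s \<cdot> \<theta> (f s))"
  by (simp add: kvp.linear_sum kvp.linear_scale)

lemma lin_add: "lin \<theta> ==> \<theta> (x + y) = \<theta> x + \<theta> y"
  by (simp add: lin_iff)

lemma lin_scale: "lin \<theta> ==> \<theta> (c \<cdot> x) = c \<cdot> \<theta> x"
  by (simp add: lin_iff)

lemma lin_0: "lin \<theta> ==> \<theta> 0 = 0"
  by (metis lin_scale kv.scale_zero_left)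

lemma lin_sum: "lin \<theta> ==> \<theta> (\<Sum>s\<in>S. f s) = (\<Sum>s\<in>S. \<theta> (f s))"
  by (simp add: kvp.linear_sum)

text \<open>\<open>into\<close>, \<open>onto\<close>, \<open>refl\<close> and \<open>pres\<close>
  say that \<open>\<theta>\<close> induces an isomorphism of \<open>Z\<close>/\<open>B\<close> onto
  \<open>Z'\<close>/\<open>B'\<close>; the map itself may be neither injective nor onto.\<close>

lemma qd_iso:
  assumes \<theta>: "lin \<theta>" and B': "kv.subspace B'" and Z: "kv.subspace Z"
    and into: "\<And>z. z \<in> Z ==> \<theta> z \<in> Z'"
    and onto: "\<And>z'. z' \<in> Z' ==> \<exists>z\<in>Z. z' + \<theta> z \<in> B'"
    and refl: "\<And>z. z \<in> Z ==> \<theta> z \<in> B' ==> z \<in> B"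
    and pres: "\<And>z. z \<in> B ==> \<theta> z \<in> B'" and q: "qd Z B n"
  shows "qd Z' B' n"
proof -
  obtain S where S: "mbase Z B S" "card S = n" using q by (auto simp: qd_def)
  have fS: "finite S" "S \<subseteq> Z" using S by (auto simp: mbase_def imod_def)
  have key: "\<forall>t\<in>S. c t = 0" if "(\<Sum>t\<in>S. c t \<cdot> \<theta> t) \<in> B'" for c
  proof -
    have "\<theta> (\<Sum>t\<in>S. c t \<cdot> t) \<in> B'" using that by (simp add: lin_sum_scale[OF \<theta>])
    moreover have "(\<Sum>t\<in>S. c t \<cdot> t) \<in> Z" using fS Z by (intro kv.subspace_sum kv.subspace_scale) auto
    ultimately have "(\<Sum>t\<in>S. c t \<cdot> t) \<in> B" by (rule_tac refl)
    then show ?thesis using S by (auto simp: mbase_def imod_def)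
  qed
  have inj: "inj_on \<theta> S"
  proof (rule inj_onI, rule ccontr)
    fix t t' assume tt: "t \<in> S" "t' \<in> S" "\<theta> t = \<theta> t'" "t \<noteq> t'"
    have "(\<Sum>s\<in>S. (if s = t then 1 else if s = t' then 1 else 0) \<cdot> \<theta> s) = 1 \<cdot> \<theta> t + (\<Sum>s\<in>S-{t}. (if s = t' then 1 else 0) \<cdot> \<theta> s)"
      by (rule sum_if_eq) (use fS tt in auto)
    also have "(\<Sum>s\<in>S-{t}. (if s = t' then 1 else 0) \<cdot> \<theta> s) = 1 \<cdot> \<theta> t' + (\<Sum>s\<in>S-{t}-{t'}. 0 \<cdot> \<theta> s)"
      by (rule sum_if_eq) (use fS tt in auto)
    finally have "(\<Sum>s\<in>S. (if s = t then 1 else if s = t' then 1 else 0) \<cdot> \<theta> s) \<in> B'"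
      using tt(3) B' by (simp add: sc_one kv.subspace_0)
    from key[OF this] tt(1) show False by auto
  qed
  have "imod B' (\<theta> ` S)" unfolding imod_def
  proof (intro conjI allI impI)
    fix c assume "(\<Sum>t\<in>\<theta> ` S. c t \<cdot> t) \<in> B'"
    then have "(\<Sum>t\<in>S. c (\<theta> t) \<cdot> \<theta> t) \<in> B'" by (simp add: sum.reindex[OF inj])
    from key[OF this] show "\<forall>t\<in>\<theta> ` S. c t = 0" by auto
  qed (use fS in auto)
  moreover have "smod B' (\<theta> ` S) Z'" unfolding smod_def
  proof
    fix z' assume "z' \<in> Z'"
    from onto[OF this] obtain z where z: "z \<in> Z" "z' + \<theta> z \<in> B'" by blast
    obtain c where c: "z + (\<Sum>t\<in>S. c t \<cdot> t) \<in> B" using S z by (auto simp: mbase_def smod_def)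
    have "\<theta> (z + (\<Sum>t\<in>S. c t \<cdot> t)) \<in> B'" using pres c by blast
    then have "\<theta> z + (\<Sum>t\<in>S. c t \<cdot> \<theta> t) \<in> B'" by (simp add: lin_add[OF \<theta>] lin_sum_scale[OF \<theta>])
    with z(2) B' have "(z' + \<theta> z) + (\<theta> z + (\<Sum>t\<in>S. c t \<cdot> \<theta> t)) \<in> B'" by (rule_tac kv.subspace_add)
    also have "(z' + \<theta> z) + (\<theta> z + (\<Sum>t\<in>S. c t \<cdot> \<theta> t)) = z' + (\<theta> z + \<theta> z) + (\<Sum>t\<in>S. c t \<cdot> \<theta> t)"
      by (simp only: add.assoc)
    also have "\<dots> = z' + (\<Sum>t\<in>\<theta> ` S. c (inv_into S \<theta> t) \<cdot> t)"
      by (simp add: sum.reindex[OF inj] inv_into_f_f[OF inj])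
    finally show "\<exists>c. z' + (\<Sum>t\<in>\<theta> ` S. c t \<cdot> t) \<in> B'"
      by (intro exI[of _ "\<lambda>t. c (inv_into S \<theta> t)"])
  qed
  moreover have "\<theta> ` S \<subseteq> Z'" using into fS by auto
  ultimately show ?thesis using S(2) card_image[OF inj] unfolding qd_def mbase_def by blast
qed

text \<open>This is the exactness of dualization: it makes the transpose of an exact complex exact
  and supplies extensions of functionals. \<Gamma> is prescribed on a basis taken from
  \<open>W\<close> and from images under \<open>D\<close>; by the assumption \<open>van\<close> its
  values do not depend on the chosen preimages.\<close>

lemma lin_factor:
  fixes D :: "'a::kvec => 'b::kvec" and A :: "'a => fld"
  assumes D: "lin D" and A: "lin A" and U: "kv.subspace U" and W: "kv.subspace W"
    and van: "\<And>u. u \<in> U ==> D u \<in> W ==> A u = 0"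
  shows "\<exists>\<Gamma>. lin \<Gamma> \<and> (\<forall>w\<in>W. \<Gamma> w = 0) \<and> (\<forall>u\<in>U. \<Gamma> (D u) = A u)"
proof -
  obtain BW where BW: "BW \<subseteq> W" "kv.independent BW" "W \<subseteq> kv.span BW"
    by (rule kv.maximal_independent_subset[of W])
  have spW: "kv.span BW = W" using BW W by (simp add: kv.span_subspace)
  obtain BV where BV: "BW \<subseteq> BV" "BV \<subseteq> W \<union> D ` U" "kv.independent BV" "W \<union> D ` U \<subseteq> kv.span BV"
    by (rule kv.maximal_independent_subset_extend[of BW "W \<union> D ` U"]) (use BW in auto)
  have BVD: "b \<in> D ` U" if "b \<in> BV" "b \<notin> BW" for b
  proof (rule ccontr)
    assume "b \<notin> D ` U"
    then have "b \<in> kv.span BW" using that BV spW by auto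
    also have "\<dots> \<subseteq> kv.span (BV - {b})" using that BV by (intro kv.span_mono) auto
    finally show False using BV(3) that unfolding kv.dependent_def by blast
  qed
  define g where "g b = (if b \<in> BW then 0 else A (SOME u. u \<in> U \<and> D u = b))" for b
  obtain \<Gamma> where \<Gamma>: "lin \<Gamma>" "\<forall>b\<in>BV. \<Gamma> b = g b"
    using kvp.linear_independent_extend[OF BV(3), of g] by blast
  have \<Gamma>W: "\<Gamma> w = 0" if "w \<in> W" for w
  proof -
    have "\<Gamma> b = 0" if "b \<in> BW" for b using \<Gamma>(2) BV(1) that by (auto simp: g_def)
    moreover have "w \<in> kv.span BW" using that spW by simp
    ultimately show ?thesis by (metis \<Gamma>(1) kvp.linear_eq_0_on_span)
  qed
  \<comment> \<open>The vectors at which \<Gamma> takes the intended value, up to \<open>W\<close>: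
    a subspace that contains the basis, hence its whole span.\<close>
  define N where "N = {v. \<exists>u\<in>U. v + D u \<in> W \<and> \<Gamma> v = A u}"
  have "kv.subspace N"
  proof (rule kv.subspaceI)
    show "0 \<in> N" using U W unfolding N_def
      by (auto intro!: bexI[of _ 0] simp: lin_0[OF \<Gamma>(1)] lin_0[OF D] lin_0[OF A] kv.subspace_0)
    fix x y assume "x \<in> N" "y \<in> N"
    then obtain u u' where u: "u \<in> U" "x + D u \<in> W" "\<Gamma> x = A u" "u' \<in> U" "y + D u' \<in> W" "\<Gamma> y = A u'"
      unfolding N_def by blast
    have "(x + D u) + (y + D u') \<in> W" by (rule kv.subspace_add[OF W]) (use u in auto)
    then have "x + y + D (u + u') \<in> W" by (simp add: lin_add[OF D] ac_simps)
    moreover have "\<Gamma> (x + y) = A (u + u')" using u by (simp add: lin_add[OF \<Gamma>(1)] lin_add[OF A])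
    moreover have "u + u' \<in> U" by (rule kv.subspace_add[OF U]) (use u in auto)
    ultimately show "x + y \<in> N" unfolding N_def by blast
  next
    fix c x assume "x \<in> N"
    then obtain u where u: "u \<in> U" "x + D u \<in> W" "\<Gamma> x = A u" unfolding N_def by blast
    have "c \<cdot> (x + D u) \<in> W" by (rule kv.subspace_scale[OF W]) (use u in auto)
    then have "c \<cdot> x + D (c \<cdot> u) \<in> W" by (simp add: lin_scale[OF D] sc_right)
    moreover have "\<Gamma> (c \<cdot> x) = A (c \<cdot> u)" using u by (simp add: lin_scale[OF \<Gamma>(1)] lin_scale[OF A])
    moreover have "c \<cdot> u \<in> U" using u U by (intro kv.subspace_scale)
    ultimately show "c \<cdot> x \<in> N" unfolding N_def by blast
  qed
  moreover have "BV \<subseteq> N"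
  proof
    fix b assume b: "b \<in> BV"
    show "b \<in> N"
    proof (cases "b \<in> BW")
      case True
      then have "b + D 0 \<in> W" "\<Gamma> b = A 0" using BW \<Gamma>W by (auto simp: lin_0[OF D] lin_0[OF A])
      then show ?thesis unfolding N_def using U kv.subspace_0 by blast
    next
      case False
      define u where "u = (SOME u. u \<in> U \<and> D u = b)"
      have u: "u \<in> U \<and> D u = b" unfolding u_def by (rule someI_ex) (use BVD[OF b False] in auto)
      have "\<Gamma> b = A u" using \<Gamma>(2) b False by (simp add: g_def u_def)
      moreover have "b + D u \<in> W" using u W by (simp add: kv.subspace_0)
      ultimately show ?thesis using u unfolding N_def by blast
    qed
  qed
  ultimately have spN: "kv.span BV \<subseteq> N" by (simp add: kv.span_minimal)
  have "\<Gamma> (D u) = A u" if u: "u \<in> U" for u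
  proof -
    have "D u \<in> N" using spN BV(4) u by auto
    then obtain u' where u': "u' \<in> U" "D u + D u' \<in> W" "\<Gamma> (D u) = A u'" unfolding N_def by blast
    \<comment> \<open>The preimage \<open>u'\<close> supplied by \<open>N\<close> may differ from
      \<open>u\<close>, but only by a vector that \<open>D\<close> sends into
      \<open>W\<close>.\<close>
    have "A (u + u') = 0" using u u' U by (intro van kv.subspace_add) (auto simp: lin_add[OF D])
    then have "A u + A u' = 0" by (simp add: lin_add[OF A])
    then have "A u' = A u" by (metis kv_uminus add_eq_0_iff)
    with u' show ?thesis by simp
  qed
  with \<Gamma>W \<Gamma>(1) show ?thesis by blast
qed

section \<open>Annihilators and forms on dual spaces\<close>

definition ann :: "'a::kvec set => ('a => fld) set" where
  "ann B = {\<alpha>. lin \<alpha> \<and> (\<forall>b\<in>B. \<alpha> b = 0)}"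

lemma lin_zero: "lin (\<lambda>x. 0)"
  by (simp add: lin_iff)

lemma lin_comb_add: "lin f ==> lin g ==> lin (f + g)"
  by (simp add: lin_iff sc_right ac_simps fun_apply)


lemma lin_comb_sc: "lin f ==> lin (c \<cdot> f)"
  by (auto simp: fun_apply lin_iff sc_right sc_sc mult.commute)

lemma subspace_ann: "kv.subspace (ann B)"
  by (rule kv.subspaceI)
    (auto simp: fun_apply ann_def lin_comb_add lin_comb_sc lin_zero zero_fun_def[symmetric] lin_zero[unfolded zero_fun_def[symmetric]])

lemma ann_mono: "B \<subseteq> Z ==> ann Z \<subseteq> ann B" by (auto simp: ann_def)

text \<open>\<open>ann B\<close>/\<open>ann Z\<close> is the dual of
  \<open>Z\<close>/\<open>B\<close>. The dual basis arises by extending each coordinate functional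
  by zero on \<open>B\<close>, for which \<open>lin_factor\<close> is used with the identity as
  \<open>D\<close>.\<close>

lemma qd_ann:
  assumes B: "kv.subspace B" and Z: "kv.subspace Z" and BZ: "B \<subseteq> Z" and q: "qd Z B n"
  shows "qd (ann B) (ann Z) n"
proof -
  obtain S where S: "mbase Z B S" "card S = n" using q by (auto simp: qd_def)
  have fS: "finite S" "S \<subseteq> Z" and key: "\<And>c. (\<Sum>t\<in>S. c t \<cdot> t) \<in> B ==> (\<forall>t\<in>S. c t = 0)"
    using S by (auto simp: mbase_def imod_def)
  have ind: "kv.independent S"
  proof (rule kv.independent_if_scalars_zero)
    fix f x assume "(\<Sum>x\<in>S. f x \<cdot> x) = 0" "x \<in> S"
    then show "f x = 0" using key[of f] kv.subspace_0[OF B] by auto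
  qed (use fS in auto)
  have ex: "\<exists>\<epsilon>. \<epsilon> \<in> ann B \<and> (\<forall>t\<in>S. \<epsilon> t = (if t = s then 1 else 0))" if s: "s \<in> S" for s
  proof -
    obtain A where A: "lin A" "\<forall>t\<in>S. A t = (if t = s then 1 else 0 :: fld)"
      using kvp.linear_independent_extend[OF ind, of "\<lambda>t. if t = s then 1 else 0"] by blast
    have "\<exists>\<Gamma>. lin \<Gamma> \<and> (\<forall>w\<in>B. \<Gamma> w = 0) \<and> (\<forall>u\<in>kv.span S. \<Gamma> (id u) = A u)"
    proof (rule lin_factor[OF _ A(1) _ B])
      show "lin (id :: 'a => 'a)" by (simp add: lin_iff)
      fix u assume "u \<in> kv.span S" "id u \<in> B"
      then obtain c where "u = (\<Sum>t\<in>S. c t \<cdot> t)" using kv.span_finite[OF fS(1)] by auto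
      with key \<open>id u \<in> B\<close> show "A u = 0" using key[of c] by (simp add: lin_sum_scale[OF A(1)] lin_0[OF A(1)])
    qed simp
    then show ?thesis using A(2) unfolding ann_def by (auto simp: kv.span_base)
  qed
  then obtain \<epsilon> where \<epsilon>: "\<And>s. s \<in> S ==> \<epsilon> s \<in> ann B"
    "\<And>s t. s \<in> S ==> t \<in> S ==> \<epsilon> s t = (if t = s then 1 else 0)"
    by metis
  have inj: "inj_on \<epsilon> S" by (rule inj_onI) (metis \<epsilon>(2) zero_neq_one)
  have ev: "(\<Sum>s\<in>S. c s \<cdot> \<epsilon> s) t = c t" if "t \<in> S" for c t
  proof -
    have "(\<Sum>s\<in>S. c s \<cdot> \<epsilon> s) t = (\<Sum>s\<in>S. if s = t then c s else 0)"
      using that by (auto simp: sum_fun_apply fun_apply \<epsilon>(2) sc_fld_def intro!: sum.cong)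
    then show ?thesis using fS that by simp
  qed
  have "imod (ann Z) (\<epsilon> ` S)" unfolding imod_def
  proof (intro conjI allI impI)
    fix c assume "(\<Sum>t\<in>\<epsilon> ` S. c t \<cdot> t) \<in> ann Z"
    then have *: "(\<Sum>t\<in>S. c (\<epsilon> t) \<cdot> \<epsilon> t) \<in> ann Z" by (simp add: sum.reindex[OF inj])
    show "\<forall>t\<in>\<epsilon> ` S. c t = 0"
    proof clarify
      fix t assume t: "t \<in> S"
      with fS(2) * have "(\<Sum>t\<in>S. c (\<epsilon> t) \<cdot> \<epsilon> t) t = 0" unfolding ann_def by blast
      with ev[OF t, of "\<lambda>s. c (\<epsilon> s)"] show "c (\<epsilon> t) = 0" by simp
    qed
  qed (use fS in auto)
  moreover have "smod (ann Z) (\<epsilon> ` S) (ann B)" unfolding smod_def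
  proof
    fix \<alpha> assume \<alpha>: "\<alpha> \<in> ann B"
    define \<beta> where "\<beta> = \<alpha> + (\<Sum>s\<in>S. \<alpha> s \<cdot> \<epsilon> s)"
    have \<beta>B: "\<beta> \<in> ann B" unfolding \<beta>_def using \<alpha> \<epsilon>(1)
      by (intro kv.subspace_add kv.subspace_sum kv.subspace_scale subspace_ann) auto
    have lin\<beta>: "lin \<beta>" using \<beta>B by (simp add: ann_def)
    have \<beta>S: "\<beta> t = 0" if "t \<in> S" for t using ev[OF that, of \<alpha>] by (simp add: \<beta>_def fun_apply)
    have "\<beta> z = 0" if z: "z \<in> Z" for z
    proof -
      obtain c where c: "z + (\<Sum>t\<in>S. c t \<cdot> t) \<in> B" using S z by (auto simp: mbase_def smod_def)
      have "\<beta> (z + (\<Sum>t\<in>S. c t \<cdot> t)) = 0" using \<beta>B c unfolding ann_def by blast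
      moreover have "\<beta> (\<Sum>t\<in>S. c t \<cdot> t) = 0"
        using \<beta>S by (simp add: lin_sum_scale[OF lin\<beta>])
      ultimately show ?thesis by (simp add: lin_add[OF lin\<beta>])
    qed
    then have "\<beta> \<in> ann Z" using \<beta>B by (simp add: ann_def)
    moreover have "\<beta> = \<alpha> + (\<Sum>t\<in>\<epsilon> ` S. \<alpha> (inv_into S \<epsilon> t) \<cdot> t)"
      unfolding \<beta>_def by (simp add: sum.reindex[OF inj] inv_into_f_f[OF inj])
    ultimately show "\<exists>c. \<alpha> + (\<Sum>t\<in>\<epsilon> ` S. c t \<cdot> t) \<in> ann Z"
      by (intro exI[of _ "\<lambda>t. \<alpha> (inv_into S \<epsilon> t)"]) simp
  qed
  moreover have "\<epsilon> ` S \<subseteq> ann B" using \<epsilon> by auto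
  ultimately show ?thesis using S(2) card_image[OF inj] unfolding qd_def mbase_def by blast
qed


text \<open>A bilinear form on the dual of \<open>Z\<close>, written as a linear map from
  functionals to vectors. It descends to a map from \<open>ann B\<close>/\<open>ann Z\<close> to
  \<open>Z\<close>/\<open>B\<close>, and \<open>nondeg\<close> is the injectivity of that
  map.\<close>

definition form :: "'a::kvec set => (('a => fld) => 'a) => bool" where
  "form Z \<phi> \<longleftrightarrow> lin \<phi> \<and> (\<forall>\<alpha>. \<phi> \<alpha> \<in> Z) \<and> (\<forall>\<alpha>\<in>ann Z. \<phi> \<alpha> = 0)"

definition nondeg :: "'a::kvec set => 'a set => (('a => fld) => 'a) => bool" where
  "nondeg Z B \<phi> \<longleftrightarrow> (\<forall>\<alpha>\<in>ann B. \<phi> \<alpha> \<in> B \<longrightarrow> \<alpha> \<in> ann Z)"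

lemma form_add: "kv.subspace Z ==> form Z \<phi> ==> form Z \<psi> ==> form Z (\<phi> + \<psi>)"
  unfolding form_def by (auto simp: fun_apply lin_iff sc_right ac_simps intro: kv.subspace_add)

lemma form_sc: "kv.subspace Z ==> form Z \<phi> ==> form Z (c \<cdot> \<phi>)"
  unfolding form_def by (auto simp: fun_apply lin_iff sc_right sc_sc mult.commute intro: kv.subspace_scale)

lemma form_zero: "kv.subspace Z ==> form Z 0"
  unfolding form_def by (auto simp: fun_apply lin_iff kv.subspace_0)

lemma form_sum: "kv.subspace Z ==> (\<And>i. i \<in> I ==> form Z (\<phi> i)) ==> form Z (\<Sum>i\<in>I. \<phi> i)"
  by (induction I rule: infinite_finite_induct) (auto intro: form_add form_zero)

lemma form_mono:
  assumes "form W \<phi>" "W \<subseteq> Z" shows "form Z \<phi>"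
  using assms ann_mono[OF assms(2)] unfolding form_def by blast

text \<open>If the pencil \<open>\<phi> + t \<psi>\<close> degenerates at \<open>t \<noteq> 0\<close>, a kernel vector is an eigenvector of
  \<open>\<phi>\<^sup>-\<^sup>1 \<psi>\<close>, and eigenvectors for distinct eigenvalues are independent.\<close>

lemma finite_degenerate:
  fixes \<phi> \<psi> :: "('a::kvec => fld) => 'a"
  assumes B: "kv.subspace B" and Z: "kv.subspace Z" and BZ: "B \<subseteq> Z" and q: "qd Z B n"
    and \<phi>: "form Z \<phi>" "nondeg Z B \<phi>" and \<psi>: "form Z \<psi>"
  shows "finite {t. \<not> nondeg Z B (\<phi> + t \<cdot> \<psi>)}"
proof (rule ccontr)
  let ?bad = "{t. \<not> nondeg Z B (\<phi> + t \<cdot> \<psi>)}"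
  assume inf: "infinite ?bad"
  obtain S where S: "mbase (ann B) (ann Z) S" "card S = n"
    using qd_ann[OF B Z BZ q] by (auto simp: qd_def)
  obtain T where T: "T \<subseteq> ?bad" "finite T" "card T = Suc n"
    using infinite_arbitrarily_large[OF inf] by blast
  have "\<forall>t. \<exists>\<alpha>. t \<in> T \<longrightarrow> \<alpha> \<in> ann B \<and> \<phi> \<alpha> + t \<cdot> \<psi> \<alpha> \<in> B \<and> \<alpha> \<notin> ann Z"
    using T(1) by (auto simp: nondeg_def fun_apply)
  then obtain a where a: "\<And>t. t \<in> T ==> a t \<in> ann B" "\<And>t. t \<in> T ==> \<phi> (a t) + t \<cdot> \<psi> (a t) \<in> B"
    "\<And>t. t \<in> T ==> a t \<notin> ann Z"
    by metis
  have l\<phi>: "lin \<phi>" and l\<psi>: "lin \<psi>" using \<phi> \<psi> by (auto simp: form_def)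
  have T0: "t \<noteq> 0" if "t \<in> T" for t
  proof
    assume "t = 0"
    with a(2)[OF that] have "\<phi> (a t) \<in> B" by simp
    with a(1,3)[OF that] \<phi>(2) show False by (auto simp: nondeg_def)
  qed
  \<comment> \<open>\<open>\<psi>\<close> kills the given combination, so \<open>\<phi>\<close> maps
    the one with coefficients divided by the parameters into \<open>B\<close>, and nondegeneracy of
    \<open>\<phi>\<close> applies.\<close>
  have step: "(\<Sum>t\<in>U. (c t * inverse t) \<cdot> a t) \<in> ann Z"
    if U: "U \<subseteq> T" and c: "(\<Sum>t\<in>U. c t \<cdot> a t) \<in> ann Z" for U c
  proof -
    have fU: "finite U" using U T(2) finite_subset by blast
    have "\<psi> (\<Sum>t\<in>U. c t \<cdot> a t) = 0" using c \<psi> by (auto simp: form_def)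
    then have 0: "(\<Sum>t\<in>U. c t \<cdot> \<psi> (a t)) = 0" by (simp add: lin_sum_scale[OF l\<psi>])
    have "(\<Sum>t\<in>U. (c t * inverse t) \<cdot> (\<phi> (a t) + t \<cdot> \<psi> (a t))) \<in> B"
      using a(2) U by (intro kv.subspace_sum[OF B] kv.subspace_scale[OF B]) auto
    also have "(\<Sum>t\<in>U. (c t * inverse t) \<cdot> (\<phi> (a t) + t \<cdot> \<psi> (a t)))
       = (\<Sum>t\<in>U. (c t * inverse t) \<cdot> \<phi> (a t)) + (\<Sum>t\<in>U. c t \<cdot> \<psi> (a t))"
      unfolding sc_right sum.distrib sc_sc
      by (intro arg_cong2[of _ _ _ _ "(+)"] refl sum.cong) (use T0 U in auto)
    finally have "\<phi> (\<Sum>t\<in>U. (c t * inverse t) \<cdot> a t) \<in> B"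
      using 0 by (simp add: lin_sum_scale[OF l\<phi>])
    moreover have "(\<Sum>t\<in>U. (c t * inverse t) \<cdot> a t) \<in> ann B"
      using a(1) U by (intro kv.subspace_sum kv.subspace_scale subspace_ann) auto
    ultimately show ?thesis using \<phi>(2) by (auto simp: nondeg_def)
  qed
  have indep: "\<forall>t\<in>U. c t = 0" if U: "U \<subseteq> T" and c: "(\<Sum>t\<in>U. c t \<cdot> a t) \<in> ann Z" for U c
    using finite_subset[OF U T(2)] U c
  proof (induction U arbitrary: c rule: finite_induct)
    case (insert s U)
    \<comment> \<open>Adding \<open>s\<close> times the relation from \<open>step\<close> cancels
      the term of \<open>a s\<close> and multiplies the other coefficients by nonzero
      factors.\<close>
    have "(\<Sum>t\<in>insert s U. c t \<cdot> a t) + s \<cdot> (\<Sum>t\<in>insert s U. (c t * inverse t) \<cdot> a t) \<in> ann Z"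
      using insert.prems step[OF insert.prems]
      by (intro kv.subspace_add kv.subspace_scale subspace_ann)
    also have "(\<Sum>t\<in>insert s U. c t \<cdot> a t) + s \<cdot> (\<Sum>t\<in>insert s U. (c t * inverse t) \<cdot> a t)
      = (\<Sum>t\<in>insert s U. (c t + s * (c t * inverse t)) \<cdot> a t)"
      by (simp only: kv.scale_sum_right sc_sc sc_left sum.distrib)
    also have "\<dots> = (c s + s * (c s * inverse s)) \<cdot> a s + (\<Sum>t\<in>U. (c t + s * (c t * inverse t)) \<cdot> a t)"
      using insert.hyps by simp
    also have "c s + s * (c s * inverse s) = 0"
      using T0[of s] insert.prems kv_add_self[of "c s"] by (simp add: field_simps)
    finally have "(\<Sum>t\<in>U. (c t + s * (c t * inverse t)) \<cdot> a t) \<in> ann Z" by (simp only: kv.scale_zero_left add_0_left)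
    from insert.IH[OF _ this] insert.prems have z: "\<forall>t\<in>U. c t + s * (c t * inverse t) = 0" by simp
    have cU: "c t = 0" if t: "t \<in> U" for t
    proof (rule ccontr)
      assume "c t \<noteq> 0"
      have tT: "t \<in> T" "t \<noteq> s" using t insert by auto
      have "c t * (t + s) = t * (c t + s * (c t * inverse t))"
        using T0[OF tT(1)] by (simp add: field_simps)
      also have "\<dots> = 0" using z t by simp
      finally have "t + s = 0" using \<open>c t \<noteq> 0\<close> by simp
      then show False using tT(2) kv_minus_eq_plus[of t s] by simp
    qed
    then have "c s \<cdot> a s \<in> ann Z" using insert by simp
    then have "inverse (c s) \<cdot> (c s \<cdot> a s) \<in> ann Z" by (rule kv.subspace_scale[OF subspace_ann])
    then have "c s = 0" using a(3)[of s] insert.prems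
      by (cases "c s = 0") (auto simp: sc_sc sc_one)
    with cU show ?case by simp
  qed simp
  have inj: "inj_on a T"
  proof (rule inj_onI, rule ccontr)
    fix t t' assume tt: "t \<in> T" "t' \<in> T" "a t = a t'" "t \<noteq> t'"
    have "(\<Sum>s\<in>{t,t'}. 1 \<cdot> a s) \<in> ann Z" using tt kv.subspace_0[OF subspace_ann, of Z] by (simp add: sc_one)
    from indep[OF _ this] tt show False by auto
  qed
  have "imod (ann Z) (a ` T)" unfolding imod_def
  proof (intro conjI allI impI)
    fix c assume "(\<Sum>t\<in>a ` T. c t \<cdot> t) \<in> ann Z"
    then have "(\<Sum>t\<in>T. c (a t) \<cdot> a t) \<in> ann Z" by (simp add: sum.reindex[OF inj])
    from indep[OF _ this] show "\<forall>t\<in>a ` T. c t = 0" by auto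
  qed (use T in auto)
  moreover have "a ` T \<subseteq> ann B" using a by auto
  ultimately have "card (a ` T) \<le> card S"
    using imod_card_le[OF subspace_ann, of S Z "ann B"] S by (auto simp: mbase_def imod_def)
  then show False using S T card_image[OF inj] by simp
qed

lemma nondeg_sc:
  assumes "kv.subspace B" "c \<noteq> 0" "nondeg Z B \<phi>" shows "nondeg Z B (c \<cdot> \<phi>)"
  unfolding nondeg_def
proof (intro ballI impI)
  fix \<alpha> assume a: "\<alpha> \<in> ann B" "(c \<cdot> \<phi>) \<alpha> \<in> B"
  then have "inverse c \<cdot> (c \<cdot> \<phi> \<alpha>) \<in> B" by (rule_tac kv.subspace_scale[OF assms(1)]) (simp add: fun_apply)
  then have "\<phi> \<alpha> \<in> B" using assms(2) by (simp add: sc_sc sc_one)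
  with assms(3) a(1) show "\<alpha> \<in> ann Z" by (auto simp: nondeg_def)
qed

section \<open>Graded posets, Eulerian and acyclic intervals\<close>

definition cov :: "('p => 'p => bool) => ('p => nat) => 'p set => 'p => 'p set" where
  "cov lq rk S c = {w \<in> S. lq c w \<and> rk w = Suc (rk c)}"

text \<open>The boundary lowers the rank by one. Values at covers can be added directly, because
  restriction maps are inclusions and signs are absent.\<close>

definition bd :: "('p => 'p => bool) => ('p => nat) => 'p set => ('p => 'e) => 'p => 'e::comm_monoid_add" where
  "bd lq rk S f c = (\<Sum>w\<in>cov lq rk S c. f w)"

text \<open>Exactness at rank \<open>i\<close> of the complex with stalks
  \<open>Z w\<close>/\<open>B w\<close>, in terms of representatives. At the lowest rank of
  \<open>S\<close> the cycle condition is void, so every chain there has to be a boundary.\<close>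

definition exa :: "('p => 'p => bool) => ('p => nat) => 'p set => ('p => 'e::kvec set) => ('p => 'e set) => nat => bool" where
  "exa lq rk S Z B i \<longleftrightarrow> (\<forall>f. (\<forall>w\<in>S. rk w = i \<longrightarrow> f w \<in> Z w) \<longrightarrow>
      (\<forall>c\<in>S. Suc (rk c) = i \<longrightarrow> bd lq rk S f c \<in> B c) \<longrightarrow>
      (\<exists>g. (\<forall>w\<in>S. rk w = Suc i \<longrightarrow> g w \<in> Z w) \<and>
           (\<forall>c\<in>S. rk c = i \<longrightarrow> f c + bd lq rk S g c \<in> B c)))"

lemma exaD:
  assumes "exa lq rk S Z B i" "\<And>w. w \<in> S ==> rk w = i ==> f w \<in> Z w"
    "\<And>c. c \<in> S ==> Suc (rk c) = i ==> bd lq rk S f c \<in> B c"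
  obtains g where "\<And>w. w \<in> S ==> rk w = Suc i ==> g w \<in> Z w"
    "\<And>c. c \<in> S ==> rk c = i ==> f c + bd lq rk S g c \<in> B c"
proof -
  have "\<exists>g. (\<forall>w\<in>S. rk w = Suc i \<longrightarrow> g w \<in> Z w) \<and>
           (\<forall>c\<in>S. rk c = i \<longrightarrow> f c + bd lq rk S g c \<in> B c)"
    using assms(1)[unfolded exa_def, rule_format, of f] assms(2,3) by blast
  then show thesis using that by blast
qed

lemma exaI:
  assumes "\<And>f. (\<And>w. w \<in> S ==> rk w = i ==> f w \<in> Z w) ==>
      (\<And>c. c \<in> S ==> Suc (rk c) = i ==> bd lq rk S f c \<in> B c) ==>
      (\<exists>g. (\<forall>w\<in>S. rk w = Suc i \<longrightarrow> g w \<in> Z w) \<and>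
           (\<forall>c\<in>S. rk c = i \<longrightarrow> f c + bd lq rk S g c \<in> B c))"
  shows "exa lq rk S Z B i"
  unfolding exa_def using assms by blast

lemma bd_add: "bd lq rk S (\<lambda>w. f w + g w) c = bd lq rk S f c + bd lq rk S g c"
  by (simp add: bd_def sum.distrib)

definition ivl :: "'p set => ('p => 'p => bool) => 'p => 'p => 'p set" where
  "ivl X lq x z = {y \<in> X. lq x y \<and> lq y z}"

text \<open>Exactness at all ranks with constant coefficients; for a closed interval the two ends
  play the part of augmentations. Ranging over all pairs of subspaces covers every coefficient space
  that occurs later as a stalk.\<close>

definition acyc :: "'e::kvec itself => ('p => 'p => bool) => ('p => nat) => 'p set => bool" where
  "acyc t lq rk S \<longleftrightarrow> (\<forall>(Z::'e set) B i. kv.subspace Z \<longrightarrow> kv.subspace B \<longrightarrow> B \<subseteq> Z \<longrightarrow>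
      exa lq rk S (\<lambda>_. Z) (\<lambda>_. B) i)"

text \<open>The parity condition under which the boundary squares to zero.\<close>

definition dd0 :: "('p => 'p => bool) => ('p => nat) => 'p set => bool" where
  "dd0 lq rk S \<longleftrightarrow> finite S \<and> (\<forall>c\<in>S. \<forall>v\<in>S. rk v = Suc (Suc (rk c)) \<longrightarrow>
      even (card {w \<in> S. lq c w \<and> lq w v \<and> rk w = Suc (rk c)}))"

lemma kv_sum_const: "(\<Sum>w\<in>A. (v::'e::kvec)) = (if even (card A) then 0 else v)"
proof (induction A rule: infinite_finite_induct)
  case (insert x F)
  then show ?case by (auto)
qed auto

lemma bd_bd:
  assumes "dd0 lq rk S" "c \<in> S"
  shows "bd lq rk S (bd lq rk S f) c = (0::'e::kvec)"
proof -
  have fin: "finite S" using assms by (simp add: dd0_def)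
  let ?V = "{v \<in> S. rk v = Suc (Suc (rk c))}"
  have "bd lq rk S (bd lq rk S f) c = (\<Sum>w\<in>cov lq rk S c. \<Sum>v\<in>?V. if lq w v then f v else 0)"
    unfolding bd_def
  proof (rule sum.cong[OF refl])
    fix w assume w: "w \<in> cov lq rk S c"
    have "cov lq rk S w = {v \<in> ?V. lq w v}" using w by (auto simp: cov_def)
    then show "sum f (cov lq rk S w) = (\<Sum>v\<in>?V. if lq w v then f v else 0)"
      using fin sum.inter_filter[of ?V f "lq w"] by simp
  qed
  also have "\<dots> = (\<Sum>v\<in>?V. \<Sum>w\<in>cov lq rk S c. if lq w v then f v else 0)" by (rule sum.swap)
  also have "\<dots> = (\<Sum>v\<in>?V. 0)"
  proof (rule sum.cong[OF refl])
    fix v assume v: "v \<in> ?V"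
    have "(\<Sum>w\<in>cov lq rk S c. if lq w v then f v else 0) = (\<Sum>w\<in>{w\<in>cov lq rk S c. lq w v}. f v)"
      using fin by (subst sum.inter_filter) (auto simp: cov_def)
    also have "{w\<in>cov lq rk S c. lq w v} = {w \<in> S. lq c w \<and> lq w v \<and> rk w = Suc (rk c)}"
      by (auto simp: cov_def)
    also have "(\<Sum>w\<in>{w \<in> S. lq c w \<and> lq w v \<and> rk w = Suc (rk c)}. f v) = 0"
      using assms v by (simp add: kv_sum_const dd0_def)
    finally show "(\<Sum>w\<in>cov lq rk S c. if lq w v then f v else 0) = 0" .
  qed
  finally show ?thesis by simp
qed

text \<open>Lift the cycle along the stalkwise isomorphism induced by \<open>\<theta>\<close>, fill
  it there, and map the filling back.\<close>

lemma exa_transport: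
  assumes ex: "exa lq rk S A B i" and \<theta>: "lin \<theta>" and fin: "finite S"
    and A: "\<And>c. c \<in> S ==> rk c \<le> i ==> kv.subspace (A c)"
    and B': "\<And>c. c \<in> S ==> rk c \<le> Suc i ==> kv.subspace (B' c)"
    and Aanti: "\<And>c w. c \<in> S ==> w \<in> S ==> lq c w ==> rk w \<le> Suc i ==> A w \<subseteq> A c"
    and Banti: "\<And>c w. c \<in> S ==> w \<in> S ==> lq c w ==> rk w \<le> Suc i ==> B' w \<subseteq> B' c"
    and into: "\<And>c a. c \<in> S ==> rk c \<le> Suc i ==> a \<in> A c ==> \<theta> a \<in> A' c"
    and onto: "\<And>c a. c \<in> S ==> rk c \<le> Suc i ==> a \<in> A' c ==> \<exists>b\<in>A c. a + \<theta> b \<in> B' c"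
    and refl: "\<And>c a. c \<in> S ==> rk c \<le> Suc i ==> a \<in> A c ==> \<theta> a \<in> B' c ==> a \<in> B c"
    and pres: "\<And>c a. c \<in> S ==> rk c \<le> Suc i ==> a \<in> B c ==> \<theta> a \<in> B' c"
  shows "exa lq rk S A' B' i"
proof (rule exaI)
  fix f' assume f': "\<And>w. w \<in> S ==> rk w = i ==> f' w \<in> A' w"
    "\<And>c. c \<in> S ==> Suc (rk c) = i ==> bd lq rk S f' c \<in> B' c"
  have "\<forall>w. \<exists>b. w \<in> S \<and> rk w = i \<longrightarrow> b \<in> A w \<and> f' w + \<theta> b \<in> B' w"
    using onto f'(1) by (metis le_SucI order_refl)
  then obtain f where f: "\<And>w. w \<in> S ==> rk w = i ==> f w \<in> A w"
    "\<And>w. w \<in> S ==> rk w = i ==> f' w + \<theta> (f w) \<in> B' w"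
    by metis
  have cyc: "bd lq rk S f c \<in> B c" if c: "c \<in> S" "Suc (rk c) = i" for c
  proof (rule refl[OF c(1)])
    show "bd lq rk S f c \<in> A c" unfolding bd_def
      by (rule kv.subspace_sum[OF A]) (use c f(1) Aanti in \<open>auto simp: cov_def subset_iff\<close>)
    have "(\<Sum>w\<in>cov lq rk S c. f' w + \<theta> (f w)) \<in> B' c"
      by (rule kv.subspace_sum[OF B']) (use c f(2) Banti in \<open>auto simp: cov_def subset_iff\<close>)
    then have "bd lq rk S f' c + \<theta> (bd lq rk S f c) \<in> B' c"
      by (simp add: bd_def sum.distrib lin_iff kvp.linear_sum[OF \<theta>])
    from kv.subspace_add[OF B' this f'(2)[OF c]] c
    show "\<theta> (bd lq rk S f c) \<in> B' c" by (simp add: ac_simps) (simp add: add.assoc[symmetric])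
  qed (use c in simp)
  obtain g where g: "\<And>w. w \<in> S ==> rk w = Suc i ==> g w \<in> A w"
    "\<And>c. c \<in> S ==> rk c = i ==> f c + bd lq rk S g c \<in> B c"
    using exaD[OF ex f(1) cyc] by metis
  show "\<exists>g. (\<forall>w\<in>S. rk w = Suc i \<longrightarrow> g w \<in> A' w) \<and>
      (\<forall>c\<in>S. rk c = i \<longrightarrow> f' c + bd lq rk S g c \<in> B' c)"
  proof (intro exI[of _ "\<lambda>w. \<theta> (g w)"] conjI ballI impI)
    fix c assume c: "c \<in> S" "rk c = i"
    have "\<theta> (f c + bd lq rk S g c) \<in> B' c" using pres g(2) c by simp
    moreover have "\<theta> (f c + bd lq rk S g c) = \<theta> (f c) + bd lq rk S (\<lambda>w. \<theta> (g w)) c"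
      by (simp add: bd_def kvp.linear_add[OF \<theta>] kvp.linear_sum[OF \<theta>])
    ultimately have "(f' c + \<theta> (f c)) + (\<theta> (f c) + bd lq rk S (\<lambda>w. \<theta> (g w)) c) \<in> B' c"
      using f(2)[OF c] c by (rule_tac kv.subspace_add[OF B']) auto
    also have "(f' c + \<theta> (f c)) + (\<theta> (f c) + bd lq rk S (\<lambda>w. \<theta> (g w)) c)
       = f' c + (\<theta> (f c) + \<theta> (f c)) + bd lq rk S (\<lambda>w. \<theta> (g w)) c" by (simp only: add.assoc)
    finally show "f' c + bd lq rk S (\<lambda>w. \<theta> (g w)) c \<in> B' c" by simp
  qed (use into g in auto)
qed

text \<open>The long exact sequence of \<open>B\<close>/\<open>B0\<close>,
  \<open>Z\<close>/\<open>B0\<close> and \<open>Z\<close>/\<open>B\<close>: the boundary of a cycle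
  of \<open>Z\<close>/\<open>B\<close> is a cycle of \<open>B\<close>/\<open>B0\<close> one rank
  lower, and filling it there corrects the given cycle to one of
  \<open>Z\<close>/\<open>B0\<close>.\<close>

lemma exa_quot:
  assumes ex: "exa lq rk S Z B0 i" and exB: "\<And>i'. i = Suc i' ==> exa lq rk S B B0 i'"
    and dd: "dd0 lq rk S"
    and sB0: "\<And>c. c \<in> S ==> rk c \<le> i ==> kv.subspace (B0 c)"
    and sB: "\<And>c. c \<in> S ==> rk c \<le> i ==> kv.subspace (B c)"
    and sZ: "\<And>c. c \<in> S ==> rk c \<le> i ==> kv.subspace (Z c)"
    and B0B: "\<And>c. c \<in> S ==> rk c \<le> i ==> B0 c \<subseteq> B c"
    and BZ: "\<And>c. c \<in> S ==> rk c \<le> i ==> B c \<subseteq> Z c"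
  shows "exa lq rk S Z B i"
proof (rule exaI)
  fix f assume f: "\<And>w. w \<in> S ==> rk w = i ==> f w \<in> Z w"
    "\<And>c. c \<in> S ==> Suc (rk c) = i ==> bd lq rk S f c \<in> B c"
  have "\<exists>g. (\<forall>w\<in>S. rk w = i \<longrightarrow> g w \<in> B w) \<and> (\<forall>c\<in>S. Suc (rk c) = i \<longrightarrow> bd lq rk S f c + bd lq rk S g c \<in> B0 c)"
  proof (cases i)
    case 0
    then show ?thesis using sB by (intro exI[of _ "\<lambda>_. 0"]) (auto simp: kv.subspace_0)
  next
    case (Suc i')
    have *: "bd lq rk S f c \<in> B c" if "c \<in> S" "rk c = i'" for c using f(2) that Suc by simp
    have **: "bd lq rk S (bd lq rk S f) c \<in> B0 c" if "c \<in> S" "Suc (rk c) = i'" for c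
      using that Suc bd_bd[OF dd, of c f] sB0[of c] by (simp add: kv.subspace_0)
    obtain g where "\<And>w. w \<in> S ==> rk w = Suc i' ==> g w \<in> B w"
      "\<And>c. c \<in> S ==> rk c = i' ==> bd lq rk S f c + bd lq rk S g c \<in> B0 c"
      using exaD[OF exB[OF Suc] * **] by metis
    then show ?thesis using Suc by auto
  qed
  then obtain g where g: "\<And>w. w \<in> S ==> rk w = i ==> g w \<in> B w"
    "\<And>c. c \<in> S ==> Suc (rk c) = i ==> bd lq rk S f c + bd lq rk S g c \<in> B0 c" by blast
  have *: "f w + g w \<in> Z w" if "w \<in> S" "rk w = i" for w
    using that f(1) g(1) BZ[of w] by (rule_tac kv.subspace_add[OF sZ]) auto
  have **: "bd lq rk S (\<lambda>w. f w + g w) c \<in> B0 c" if "c \<in> S" "Suc (rk c) = i" for c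
    using g(2)[OF that] by (simp add: bd_add)
  obtain h where h: "\<And>w. w \<in> S ==> rk w = Suc i ==> h w \<in> Z w"
    "\<And>c. c \<in> S ==> rk c = i ==> (f c + g c) + bd lq rk S h c \<in> B0 c"
    using exaD[OF ex * **] by metis
  show "\<exists>g. (\<forall>w\<in>S. rk w = Suc i \<longrightarrow> g w \<in> Z w) \<and> (\<forall>c\<in>S. rk c = i \<longrightarrow> f c + bd lq rk S g c \<in> B c)"
  proof (intro exI[of _ h] conjI ballI impI)
    fix c assume c: "c \<in> S" "rk c = i"
    have "((f c + g c) + bd lq rk S h c) + g c \<in> B c"
      using h(2)[OF c] g(1)[OF c] B0B[of c] c by (rule_tac kv.subspace_add[OF sB]) auto
    also have "((f c + g c) + bd lq rk S h c) + g c = f c + (g c + g c) + bd lq rk S h c"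
      by (simp only: ac_simps)
    finally show "f c + bd lq rk S h c \<in> B c" by simp
  qed (use h in auto)
qed

text \<open>The companion for kernels: a filling \<open>q\<close> in \<open>Q\<close> need not lie
  in the kernel, but its image is a cycle of \<open>F\<close>, hence the boundary of some
  \<open>p\<close>; lifting \<open>p\<close>, which lives two ranks above \<open>i\<close>, and
  adding the boundary of the lift repairs \<open>q\<close>.\<close>

lemma exa_ker:
  assumes ex: "exa lq rk S Q B0 i" and exF: "exa lq rk S F BF (Suc i)" and \<theta>: "lin \<theta>"
    and dd: "dd0 lq rk S"
    and sQ: "\<And>c. c \<in> S ==> rk c \<le> Suc i ==> kv.subspace (Q c)"
    and sBF: "\<And>c. c \<in> S ==> rk c \<le> Suc (Suc i) ==> kv.subspace (BF c)"
    and Qanti: "\<And>c w. c \<in> S ==> w \<in> S ==> lq c w ==> rk w \<le> Suc (Suc i) ==> Q w \<subseteq> Q c"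
    and Banti: "\<And>c w. c \<in> S ==> w \<in> S ==> lq c w ==> rk w \<le> Suc (Suc i) ==> BF w \<subseteq> BF c"
    and into: "\<And>c a. c \<in> S ==> rk c \<le> Suc i ==> a \<in> Q c ==> \<theta> a \<in> F c"
    and pres: "\<And>c a. c \<in> S ==> rk c \<le> i ==> a \<in> B0 c ==> \<theta> a \<in> BF c"
    and surj: "\<And>c a. c \<in> S ==> rk c = Suc (Suc i) ==> a \<in> F c ==> \<exists>b\<in>Q c. a + \<theta> b \<in> BF c"
  shows "exa lq rk S (\<lambda>c. {q \<in> Q c. \<theta> q \<in> BF c}) B0 i"
proof (rule exaI)
  fix f assume f: "\<And>w. w \<in> S ==> rk w = i ==> f w \<in> {q \<in> Q w. \<theta> q \<in> BF w}"
    "\<And>c. c \<in> S ==> Suc (rk c) = i ==> bd lq rk S f c \<in> B0 c"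
  have *: "f w \<in> Q w" if "w \<in> S" "rk w = i" for w using f(1)[OF that] by simp
  obtain q where q: "\<And>w. w \<in> S ==> rk w = Suc i ==> q w \<in> Q w"
    "\<And>c. c \<in> S ==> rk c = i ==> f c + bd lq rk S q c \<in> B0 c"
    using exaD[OF ex * f(2)] by metis
  have th_bd: "\<theta> (bd lq rk S h c) = bd lq rk S (\<lambda>w. \<theta> (h w)) c" for h c
    by (simp add: bd_def kvp.linear_sum[OF \<theta>])
  have 1: "\<theta> (q w) \<in> F w" if "w \<in> S" "rk w = Suc i" for w using that q into by simp
  have 2: "bd lq rk S (\<lambda>w. \<theta> (q w)) c \<in> BF c" if c: "c \<in> S" "Suc (rk c) = Suc i" for c
  proof -
    have "\<theta> (f c + bd lq rk S q c) \<in> BF c" using c q(2) pres by simp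
    then have "(\<theta> (f c) + bd lq rk S (\<lambda>w. \<theta> (q w)) c) + \<theta> (f c) \<in> BF c"
      using f(1)[of c] c by (rule_tac kv.subspace_add[OF sBF]) (auto simp: kvp.linear_add[OF \<theta>] th_bd)
    also have "(\<theta> (f c) + bd lq rk S (\<lambda>w. \<theta> (q w)) c) + \<theta> (f c)
      = (\<theta> (f c) + \<theta> (f c)) + bd lq rk S (\<lambda>w. \<theta> (q w)) c" by (simp only: ac_simps)
    finally show ?thesis by simp
  qed
  obtain p where p: "\<And>w. w \<in> S ==> rk w = Suc (Suc i) ==> p w \<in> F w"
    "\<And>c. c \<in> S ==> rk c = Suc i ==> \<theta> (q c) + bd lq rk S p c \<in> BF c"
    using exaD[OF exF, of "\<lambda>w. \<theta> (q w)"] 1 2 by metis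
  have "\<forall>w. \<exists>b. w \<in> S \<and> rk w = Suc (Suc i) \<longrightarrow> b \<in> Q w \<and> p w + \<theta> b \<in> BF w"
    using surj p(1) by blast
  then obtain q' where q': "\<And>w. w \<in> S ==> rk w = Suc (Suc i) ==> q' w \<in> Q w"
    "\<And>w. w \<in> S ==> rk w = Suc (Suc i) ==> p w + \<theta> (q' w) \<in> BF w"
    by metis
  \<comment> \<open>The added boundary leaves the boundary of \<open>q\<close> unchanged.\<close>
  define g where "g w = q w + bd lq rk S q' w" for w
  show "\<exists>g. (\<forall>w\<in>S. rk w = Suc i \<longrightarrow> g w \<in> {q \<in> Q w. \<theta> q \<in> BF w}) \<and>
      (\<forall>c\<in>S. rk c = i \<longrightarrow> f c + bd lq rk S g c \<in> B0 c)"
  proof (intro exI[of _ g] conjI ballI impI)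
    fix w assume w: "w \<in> S" "rk w = Suc i"
    have "bd lq rk S q' w \<in> Q w" unfolding bd_def
      by (rule kv.subspace_sum[OF sQ]) (use w q'(1) Qanti in \<open>auto simp: cov_def subset_iff\<close>)
    then have gQ: "g w \<in> Q w" using q(1)[OF w] w unfolding g_def by (rule_tac kv.subspace_add[OF sQ]) auto
    have "(\<Sum>v\<in>cov lq rk S w. p v + \<theta> (q' v)) \<in> BF w"
      by (rule kv.subspace_sum[OF sBF]) (use w q'(2) Banti in \<open>auto simp: cov_def subset_iff\<close>)
    then have "bd lq rk S p w + bd lq rk S (\<lambda>v. \<theta> (q' v)) w \<in> BF w" by (simp add: bd_def sum.distrib)
    then have "(\<theta> (q w) + bd lq rk S p w) + (bd lq rk S p w + bd lq rk S (\<lambda>v. \<theta> (q' v)) w) \<in> BF w"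
      using p(2)[OF w] w by (rule_tac kv.subspace_add[OF sBF]) auto
    also have "(\<theta> (q w) + bd lq rk S p w) + (bd lq rk S p w + bd lq rk S (\<lambda>v. \<theta> (q' v)) w)
      = \<theta> (q w) + (bd lq rk S p w + bd lq rk S p w) + bd lq rk S (\<lambda>v. \<theta> (q' v)) w" by (simp only: add.assoc)
    also have "\<dots> = \<theta> (g w)" by (simp add: g_def kvp.linear_add[OF \<theta>] th_bd)
    finally show "g w \<in> {q \<in> Q w. \<theta> q \<in> BF w}" using gQ by simp
  next
    fix c assume c: "c \<in> S" "rk c = i"
    have "bd lq rk S g c = bd lq rk S q c + bd lq rk S (bd lq rk S q') c"
      unfolding bd_add[symmetric] g_def ..
    also have "\<dots> = bd lq rk S q c" using bd_bd[OF dd c(1)] by simp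
    finally show "f c + bd lq rk S g c \<in> B0 c" using q(2)[OF c] by simp
  qed
qed

section \<open>Finite posets with a strictly monotone rank function\<close>

locale rposet =
  fixes X :: "'p set" and lq :: "'p => 'p => bool" (infix "\<preceq>" 50) and rk :: "'p => nat"
  assumes fin: "finite X"
    and refl [simp]: "x \<in> X ==> x \<preceq> x"
    and antisym: "\<lbrakk>x \<in> X; y \<in> X; x \<preceq> y; y \<preceq> x\<rbrakk> \<Longrightarrow> x = y"
    and trans: "\<lbrakk>x \<in> X; y \<in> X; z \<in> X; x \<preceq> y; y \<preceq> z\<rbrakk> \<Longrightarrow> x \<preceq> z"
    and rk_less: "\<lbrakk>x \<in> X; y \<in> X; x \<preceq> y; x \<noteq> y\<rbrakk> \<Longrightarrow> rk x < rk y"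
begin

lemma rk_le: "\<lbrakk>x \<in> X; y \<in> X; x \<preceq> y\<rbrakk> \<Longrightarrow> rk x \<le> rk y"
  using rk_less by (cases "x = y") (auto intro: less_imp_le)

definition up :: "'p => 'p set" where "up x = {y \<in> X. x \<preceq> y}"

definition eulerian :: bool where
  "eulerian \<longleftrightarrow> (\<forall>x\<in>X. \<forall>z\<in>X. x \<preceq> z \<longrightarrow> x \<noteq> z \<longrightarrow> (\<Sum>y\<in>ivl X (\<preceq>) x z. (-1) ^ rk y) = (0::int))"

definition acyclic :: "'e::kvec itself => bool" where
  "acyclic t \<longleftrightarrow> (\<forall>x\<in>X. \<forall>z\<in>X. x \<preceq> z \<longrightarrow> x \<noteq> z \<longrightarrow> acyc t (\<preceq>) rk (ivl X (\<preceq>) x z))"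

text \<open>On an interval of length two the Eulerian sum is, up to sign, 2 minus the number of
  middle elements.\<close>

lemma thin:
  assumes eulerian "x \<in> X" "z \<in> X" "x \<preceq> z" "rk z = Suc (Suc (rk x))"
  shows "card {y \<in> X. x \<preceq> y \<and> y \<preceq> z \<and> rk y = Suc (rk x)} = 2"
proof -
  let ?M = "{y \<in> X. x \<preceq> y \<and> y \<preceq> z \<and> rk y = Suc (rk x)}"
  have xz: "x \<noteq> z" using assms(5) by auto
  have "y = x \<or> y = z \<or> y \<in> ?M" if "y \<in> ivl X (\<preceq>) x z" for y
    using that rk_less[of x y] rk_less[of y z] assms by (fastforce simp: ivl_def)
  then have eq: "ivl X (\<preceq>) x z = insert x (insert z ?M)"
    using assms by (auto simp: ivl_def)
  have "(\<Sum>y\<in>?M. (-1) ^ rk y) = (- ((-1) ^ rk x)) * int (card ?M)" by simp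
  moreover have "(\<Sum>y\<in>ivl X (\<preceq>) x z. (-1) ^ rk y) = (-1) ^ rk x + ((-1) ^ rk z + (\<Sum>y\<in>?M. (-1::int) ^ rk y))"
    unfolding eq using fin assms xz by (subst sum.insert; simp)+
  moreover have "(\<Sum>y\<in>ivl X (\<preceq>) x z. (-1) ^ rk y) = (0::int)"
    using assms(1)[unfolded eulerian_def] assms xz by auto
  ultimately have "(-1) ^ rk x * (2 - int (card ?M)) = 0" using assms(5) by (simp add: algebra_simps)
  then show ?thesis by simp
qed

lemma dd0_convex:
  assumes eul: eulerian and S: "S \<subseteq> X" and conv: "\<And>x y z. x \<in> S ==> z \<in> S ==> y \<in> X ==> x \<preceq> y ==> y \<preceq> z ==> y \<in> S"
  shows "dd0 (\<preceq>) rk S"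
  unfolding dd0_def
proof (intro conjI ballI impI)
  show "finite S" using fin S finite_subset by blast
  fix c v assume cv: "c \<in> S" "v \<in> S" "rk v = Suc (Suc (rk c))"
  have eq: "{w \<in> S. c \<preceq> w \<and> w \<preceq> v \<and> rk w = Suc (rk c)} = {w \<in> X. c \<preceq> w \<and> w \<preceq> v \<and> rk w = Suc (rk c)}"
    using S conv[OF cv(1,2)] by auto
  show "even (card {w \<in> S. c \<preceq> w \<and> w \<preceq> v \<and> rk w = Suc (rk c)})"
  proof (cases "c \<preceq> v")
    case True
    then show ?thesis unfolding eq using thin[OF eul] cv S by (simp add: subset_iff)
  next
    case False
    then have "{w \<in> X. c \<preceq> w \<and> w \<preceq> v \<and> rk w = Suc (rk c)} = {}" using trans cv S by blast
    then show ?thesis unfolding eq by (simp only: card.empty) simp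
  qed
qed

lemma dd0_up: "eulerian ==> x \<in> X ==> dd0 (\<preceq>) rk (up x)"
  by (rule dd0_convex) (auto simp: up_def intro: trans)

end

section \<open>Cohen-Macaulay sheaves and their resolutions\<close>

context rposet begin

text \<open>The direct sum of the \<open>A y\<close> over all y above \<open>x\<close> with rank in
  \<open>R\<close>, as functions supported there. Since all these sums live in one function type,
  the sum for a larger \<open>x\<close> is contained in the sum for a smaller one.\<close>

definition QS :: "('p => 'e::kvec set) => nat set => 'p => ('p => 'e) set" where
  "QS A R x = {\<zeta>. \<forall>y. \<zeta> y \<in> (if y \<in> X \<and> x \<preceq> y \<and> rk y \<in> R then A y else {0})}"

lemma QS_D1: "\<zeta> \<in> QS A R x ==> y \<in> X ==> x \<preceq> y ==> rk y \<in> R ==> \<zeta> y \<in> A y"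
  by (auto simp: QS_def dest: spec[of _ y])

lemma QS_D0: "\<zeta> \<in> QS A R x ==> \<not> (y \<in> X \<and> x \<preceq> y \<and> rk y \<in> R) ==> \<zeta> y = 0"
  unfolding QS_def by (metis (mono_tags, lifting) mem_Collect_eq singletonD)

lemma QS_I:
  assumes "\<And>y. y \<in> X ==> x \<preceq> y ==> rk y \<in> R ==> \<zeta> y \<in> A y"
    "\<And>y. \<not> (y \<in> X \<and> x \<preceq> y \<and> rk y \<in> R) ==> \<zeta> y = 0"
  shows "\<zeta> \<in> QS A R x"
  using assms unfolding QS_def by auto

lemma subspace_QS:
  assumes "\<And>y. y \<in> X ==> x \<preceq> y ==> rk y \<in> R ==> kv.subspace (A y)"
  shows "kv.subspace (QS A R x)"
proof (rule kv.subspaceI)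
  show "0 \<in> QS A R x" by (rule QS_I) (use assms kv.subspace_0 in \<open>auto simp: fun_apply\<close>)
next
  fix f g assume "f \<in> QS A R x" "g \<in> QS A R x"
  note fg = this
  show "f + g \<in> QS A R x"
  proof (rule QS_I)
    fix y assume y: "y \<in> X" "x \<preceq> y" "rk y \<in> R"
    show "(f + g) y \<in> A y" unfolding plus_fun_apply
      by (rule kv.subspace_add[OF assms[OF y] QS_D1[OF fg(1) y] QS_D1[OF fg(2) y]])
  qed (use QS_D0[OF fg(1)] QS_D0[OF fg(2)] in \<open>simp add: fun_apply\<close>)
next
  fix c f assume "f \<in> QS A R x"
  note f = this
  show "c \<cdot> f \<in> QS A R x"
  proof (rule QS_I)
    fix y assume y: "y \<in> X" "x \<preceq> y" "rk y \<in> R"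
    show "(c \<cdot> f) y \<in> A y" unfolding sc_fun_apply
      by (rule kv.subspace_scale[OF assms[OF y] QS_D1[OF f y]])
  qed (use QS_D0[OF f] in \<open>simp add: fun_apply\<close>)
qed

lemma QS_mono:
  assumes "\<And>y. y \<in> X ==> x \<preceq> y ==> rk y \<in> R ==> A y \<subseteq> A' y"
  shows "QS A R x \<subseteq> QS A' R x"
  using assms unfolding QS_def by (auto split: if_splits)

lemma QS_anti:
  assumes "x \<in> X" "x' \<in> X" "x \<preceq> x'" "\<And>y. y \<in> X ==> rk y \<in> R ==> 0 \<in> A y"
  shows "QS A R x' \<subseteq> QS A R x"
proof
  fix \<zeta> assume z: "\<zeta> \<in> QS A R x'"
  show "\<zeta> \<in> QS A R x"
  proof (rule QS_I)
    fix y assume y: "y \<in> X" "x \<preceq> y" "rk y \<in> R"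
    show "\<zeta> y \<in> A y" using QS_D1[OF z y(1) _ y(3)] QS_D0[OF z, of y] assms(4)[OF y(1,3)] by (cases "x' \<preceq> y") auto
  next
    fix y assume "\<not> (y \<in> X \<and> x \<preceq> y \<and> rk y \<in> R)"
    then show "\<zeta> y = 0" using QS_D0[OF z, of y] trans[OF assms(1,2) _ assms(3)] by blast
  qed
qed

definition sng :: "'p => 'e => 'p => 'e::kvec" where "sng y e = (\<lambda>y'. if y' = y then e else 0)"

lemma lin_sng: "lin (sng y)"
  by (auto simp: lin_iff sng_def fun_eq_iff fun_apply)

text \<open>One coordinate at a time is enlarged from \<open>A0\<close> to \<open>A\<close>;
  \<open>M U\<close> is the stage at which the coordinates in \<open>U\<close> have been
  enlarged.\<close>

lemma qd_QS:
  assumes sA: "\<And>y. y \<in> X ==> x \<preceq> y ==> rk y \<in> R ==> kv.subspace (A y) \<and> kv.subspace (A0 y) \<and> A0 y \<subseteq> A y \<and> qd (A y) (A0 y) (f y)"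
  shows "qd (QS A R x) (QS A0 R x) (\<Sum>y\<in>{y\<in>X. x \<preceq> y \<and> rk y \<in> R}. f y)"
proof -
  let ?Y = "{y\<in>X. x \<preceq> y \<and> rk y \<in> R}"
  define M where "M U y = (if y \<in> U then A y else A0 y)" for U y
  have sM: "kv.subspace (M U y)" if "y \<in> ?Y" for U y using sA that by (auto simp: M_def)
  have "finite U ==> U \<subseteq> ?Y ==> qd (QS (M U) R x) (QS A0 R x) (\<Sum>y\<in>U. f y)" for U
  proof (induction U rule: finite_induct)
    case empty
    have "M {} = A0" by (auto simp: M_def)
    moreover have "qd (QS A0 R x) (QS A0 R x) 0"
      unfolding qd_def by (intro exI[of _ "{}"]) (auto simp: mbase_def smod_def)
    ultimately show ?case by simp
  next
    case (insert u U)
    have "qd (QS (M (insert u U)) R x) (QS (M U) R x) (f u)"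
    proof (rule qd_iso[of "sng u" _ "A u" _ "A0 u"])
      show "lin (sng u)" by (rule lin_sng)
      show "kv.subspace (QS (M U) R x)" by (rule subspace_QS) (use sM in auto)
      show "kv.subspace (A u)" "qd (A u) (A0 u) (f u)" using sA insert by auto
      show "sng u z \<in> QS (M (insert u U)) R x" if "z \<in> A u" for z
      proof (rule QS_I)
        fix y assume y: "y \<in> X" "x \<preceq> y" "rk y \<in> R"
        show "sng u z y \<in> M (insert u U) y" 
          using that kv.subspace_0[OF sM, of y "insert u U"] y by (auto simp: sng_def M_def)
      qed (use insert.prems in \<open>auto simp: sng_def\<close>)
      show "\<exists>z\<in>A u. z' + sng u z \<in> QS (M U) R x" if z': "z' \<in> QS (M (insert u U)) R x" for z'
      proof (intro bexI[of _ "z' u"] QS_I)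
        show zu: "z' u \<in> A u" using QS_D1[OF z', of u] insert.prems by (auto simp: M_def)
        fix y assume y: "y \<in> X" "x \<preceq> y" "rk y \<in> R"
        then have "z' y \<in> M (insert u U) y" by (rule QS_D1[OF z'])
        then show "(z' + sng u (z' u)) y \<in> M U y"
          using y kv.subspace_0[OF sM, of y U] by (auto simp: fun_apply sng_def M_def split: if_splits)
      next
        fix y assume y: "\<not> (y \<in> X \<and> x \<preceq> y \<and> rk y \<in> R)"
        then have "y \<noteq> u" using insert.prems by auto
        then show "(z' + sng u (z' u)) y = 0" using QS_D0[OF z' y] by (simp add: fun_apply sng_def)
      qed
      show "z \<in> A0 u" if "z \<in> A u" "sng u z \<in> QS (M U) R x" for z
        using QS_D1[OF that(2), of u] insert by (auto simp: M_def sng_def)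
      show "sng u z \<in> QS (M U) R x" if "z \<in> A0 u" for z
      proof (rule QS_I)
        fix y assume y: "y \<in> X" "x \<preceq> y" "rk y \<in> R"
        show "sng u z y \<in> M U y" 
          using that kv.subspace_0[OF sM, of y U] y insert.hyps by (auto simp: sng_def M_def)
      qed (use insert.prems in \<open>auto simp: sng_def\<close>)
    qed
    note q1 = this
    have q2: "qd (QS (M U) R x) (QS A0 R x) (sum f U)" using insert by auto
    have "qd (QS (M (insert u U)) R x) (QS A0 R x) (f u + sum f U)"
    proof (rule qd_trans[OF _ _ _ _ q1 q2])
      show "kv.subspace (QS (M U) R x)" by (rule subspace_QS) (use sM in auto)
      show "kv.subspace (QS A0 R x)" by (rule subspace_QS) (use sA in auto)
      show "QS A0 R x \<subseteq> QS (M U) R x" by (rule QS_mono) (use sA in \<open>auto simp: M_def\<close>)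
      show "QS (M U) R x \<subseteq> QS (M (insert u U)) R x" by (rule QS_mono) (use sA in \<open>auto simp: M_def\<close>)
    qed
    then show ?case using insert by simp
  qed
  from this[of ?Y] fin have "qd (QS (M ?Y) R x) (QS A0 R x) (sum f ?Y)" by auto
  moreover have "QS (M ?Y) R x = QS A R x"
    unfolding QS_def M_def by (intro Collect_cong iff_allI) (auto split: if_splits)
  ultimately show ?thesis by simp
qed

lemma bd_up: "c \<in> up x ==> x \<in> X ==> cov (\<preceq>) rk (up x) c = {w \<in> X. c \<preceq> w \<and> rk w = Suc (rk c)}"
  by (auto simp: cov_def up_def intro: trans)

text \<open>The complex splits into coordinates: the part with values at y lives on the interval
  from \<open>x\<close> to y and has constant coefficients \<open>A y\<close>/\<open>A0 y\<close>.
  As \<open>rk x < j\<close>, this interval is nontrivial and hence acyclic.\<close>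

lemma exa_QS:
  fixes A A0 :: "'p => 'e::kvec set"
  assumes ac: "acyclic TYPE('e)" and x: "x \<in> X" "rk x < j"
    and sA: "\<And>y. y \<in> X ==> x \<preceq> y ==> rk y = j ==> kv.subspace (A y) \<and> kv.subspace (A0 y) \<and> A0 y \<subseteq> A y"
  shows "exa (\<preceq>) rk (up x) (QS A {j}) (QS A0 {j}) i"
proof (rule exaI)
  fix f assume f: "\<And>w. w \<in> up x ==> rk w = i ==> f w \<in> QS A {j} w"
    "\<And>c. c \<in> up x ==> Suc (rk c) = i ==> bd (\<preceq>) rk (up x) f c \<in> QS A0 {j} c"
  let ?Y = "{y\<in>X. x \<preceq> y \<and> rk y = j}"
  \<comment> \<open>A coordinate of the boundary over \<open>up x\<close> is a boundary over the
    interval, provided that the chain vanishes in this coordinate at elements not below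
    \<open>y\<close>.\<close>
  have bdev: "bd (\<preceq>) rk (ivl X (\<preceq>) x y) (\<lambda>w. h w y) c = bd (\<preceq>) rk (up x) h c y"
    if y: "y \<in> ?Y" and c: "c \<in> up x" "c \<preceq> y" and h: "\<And>w. w \<in> up x ==> rk w = Suc (rk c) ==> \<not> w \<preceq> y ==> h w y = 0"
    for h :: "'p => 'p => 'e" and y c
  proof -
    have "bd (\<preceq>) rk (up x) h c y = (\<Sum>w\<in>cov (\<preceq>) rk (up x) c. h w y)"
      by (simp add: bd_def sum_fun_apply)
    also have "\<dots> = (\<Sum>w\<in>cov (\<preceq>) rk (ivl X (\<preceq>) x y) c. h w y)"
      by (rule sum.mono_neutral_right) (use h fin y in \<open>auto simp: cov_def up_def ivl_def\<close>)
    finally show ?thesis by (simp add: bd_def)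
  qed
  have ex: "\<exists>g. (\<forall>w\<in>ivl X (\<preceq>) x y. rk w = Suc i \<longrightarrow> g w \<in> A y) \<and>
      (\<forall>c\<in>ivl X (\<preceq>) x y. rk c = i \<longrightarrow> f c y + bd (\<preceq>) rk (ivl X (\<preceq>) x y) g c \<in> A0 y)" if y: "y \<in> ?Y" for y
  proof -
    have "exa (\<preceq>) rk (ivl X (\<preceq>) x y) (\<lambda>_. A y) (\<lambda>_. A0 y) i"
    proof -
      have "x \<noteq> y" using y x by auto
      then show ?thesis using ac[unfolded acyclic_def] y x(1) sA[of y] unfolding acyc_def by auto
    qed
    then show ?thesis
    proof (rule exaD[where f = "\<lambda>w. f w y"])
      fix w assume w: "w \<in> ivl X (\<preceq>) x y" "rk w = i"
      then show "f w y \<in> A y" using QS_D1[OF f(1)[of w], of y] y by (auto simp: ivl_def up_def)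
    next
      fix c assume c: "c \<in> ivl X (\<preceq>) x y" "Suc (rk c) = i"
      have "bd (\<preceq>) rk (up x) f c y \<in> A0 y" using QS_D1[OF f(2)[of c], of y] c y by (auto simp: ivl_def up_def)
      moreover have "f w y = 0" if "w \<in> up x" "rk w = Suc (rk c)" "\<not> w \<preceq> y" for w
        using QS_D0[OF f(1)[of w], of y] that c by auto
      ultimately show "bd (\<preceq>) rk (ivl X (\<preceq>) x y) (\<lambda>w. f w y) c \<in> A0 y"
        using bdev[OF y, of c f] c by (auto simp: ivl_def up_def)
    qed blast
  qed
  define g where "g y = (SOME g. (\<forall>w\<in>ivl X (\<preceq>) x y. rk w = Suc i \<longrightarrow> g w \<in> A y) \<and>
      (\<forall>c\<in>ivl X (\<preceq>) x y. rk c = i \<longrightarrow> f c y + bd (\<preceq>) rk (ivl X (\<preceq>) x y) g c \<in> A0 y))" for y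
  have gg: "(\<forall>w\<in>ivl X (\<preceq>) x y. rk w = Suc i \<longrightarrow> g y w \<in> A y) \<and>
      (\<forall>c\<in>ivl X (\<preceq>) x y. rk c = i \<longrightarrow> f c y + bd (\<preceq>) rk (ivl X (\<preceq>) x y) (g y) c \<in> A0 y)"
    if "y \<in> ?Y" for y unfolding g_def by (rule someI_ex[OF ex[OF that]])
  have g: "\<And>y w. y \<in> ?Y ==> w \<in> ivl X (\<preceq>) x y ==> rk w = Suc i ==> g y w \<in> A y"
     "\<And>y c. y \<in> ?Y ==> c \<in> ivl X (\<preceq>) x y ==> rk c = i ==> f c y + bd (\<preceq>) rk (ivl X (\<preceq>) x y) (g y) c \<in> A0 y"
    using gg by blast+
  define G where "G w y = (if y \<in> ?Y \<and> w \<preceq> y then g y w else 0)" for w y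
  show "\<exists>g. (\<forall>w\<in>up x. rk w = Suc i \<longrightarrow> g w \<in> QS A {j} w) \<and>
      (\<forall>c\<in>up x. rk c = i \<longrightarrow> f c + bd (\<preceq>) rk (up x) g c \<in> QS A0 {j} c)"
  proof (intro exI[of _ G] conjI ballI impI)
    fix w assume w: "w \<in> up x" "rk w = Suc i"
    show "G w \<in> QS A {j} w"
    proof (rule QS_I)
      fix y assume y: "y \<in> X" "w \<preceq> y" "rk y \<in> {j}"
      then have yY: "y \<in> ?Y" using w trans[OF x(1)] by (auto simp: up_def)
      show "G w y \<in> A y" using g(1)[OF yY, of w] w y yY by (auto simp: G_def ivl_def up_def)
    next
      fix y assume "\<not> (y \<in> X \<and> w \<preceq> y \<and> rk y \<in> {j})"
      then show "G w y = 0" by (auto simp: G_def)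
    qed
  next
    fix c assume c: "c \<in> up x" "rk c = i"
    show "f c + bd (\<preceq>) rk (up x) G c \<in> QS A0 {j} c"
    proof (rule QS_I)
      fix y assume y: "y \<in> X" "c \<preceq> y" "rk y \<in> {j}"
      then have yY: "y \<in> ?Y" using c trans[OF x(1)] by (auto simp: up_def)
      have "bd (\<preceq>) rk (up x) G c y = bd (\<preceq>) rk (ivl X (\<preceq>) x y) (\<lambda>w. G w y) c"
        by (rule bdev[symmetric]) (use yY c y in \<open>auto simp: G_def\<close>)
      also have "\<dots> = bd (\<preceq>) rk (ivl X (\<preceq>) x y) (g y) c"
        unfolding bd_def by (rule sum.cong) (use yY in \<open>auto simp: G_def cov_def ivl_def\<close>)
      finally show "(f c + bd (\<preceq>) rk (up x) G c) y \<in> A0 y"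
        using g(2)[OF yY, of c] c y by (auto simp: fun_apply ivl_def up_def)
    next
      fix y assume y: "\<not> (y \<in> X \<and> c \<preceq> y \<and> rk y \<in> {j})"
      have "G w y = 0" if "w \<in> cov (\<preceq>) rk (up x) c" for w
        using that y c trans[of c w y] by (auto simp: G_def cov_def up_def)
      then have "bd (\<preceq>) rk (up x) G c y = 0" by (simp add: bd_def sum_fun_apply)
      moreover have "f c y = 0" using QS_D0[OF f(1)[OF c] y] .
      ultimately show "(f c + bd (\<preceq>) rk (up x) G c) y = 0" by (simp add: fun_apply)
    qed
  qed
qed

text \<open>A Cohen-Macaulay sheaf on the ranks up to \<open>m\<close>: the stalk at x is
  \<open>Z x\<close>/\<open>B x\<close> of dimension \<open>f x\<close>, restriction goes down the
  poset and is induced by inclusion, and over every \<open>up x\<close> the complex is exact at each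
  rank below \<open>m\<close>. At rank \<open>m\<close> itself homology is allowed.\<close>

definition CM :: "nat => ('p => 'e::kvec set) => ('p => 'e set) => ('p => nat) => bool" where
  "CM m Z B f \<longleftrightarrow>
    (\<forall>x\<in>X. rk x \<le> m \<longrightarrow> kv.subspace (Z x) \<and> kv.subspace (B x) \<and> B x \<subseteq> Z x \<and> qd (Z x) (B x) (f x)) \<and>
    (\<forall>x\<in>X. \<forall>y\<in>X. x \<preceq> y \<longrightarrow> rk y \<le> m \<longrightarrow> Z y \<subseteq> Z x \<and> B y \<subseteq> B x) \<and>
    (\<forall>x\<in>X. \<forall>i<m. exa (\<preceq>) rk (up x) Z B i)"

end

text \<open>One step of the resolution, from truncation at \<open>m\<close> to truncation at
  \<open>l\<close>. The forms live at rank \<open>l + 2\<close>, and those above an element of rank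
  \<open>l + 1\<close> add up to a nondegenerate form on the dual of its stalk. Acyclicity appears
  for vectors and for functionals because the complex and its transpose are both used.\<close>

locale cm_step = rposet +
  fixes Z B :: "'a => 'e::kvec set" and f :: "'a => nat" and m l :: nat
    and \<Phi> :: "'a => ('e => fld) => 'e"
  assumes eul: eulerian and ac1: "acyclic TYPE('e)" and ac2: "acyclic TYPE('e => fld)"
    and CM: "CM m Z B f" and lm: "Suc l < m"
    and form\<Phi>: "\<And>w. w \<in> X ==> rk w = Suc (Suc l) ==> form (Z w) (\<Phi> w)"
    and nondeg\<Phi>: "\<And>y. y \<in> X ==> rk y = Suc l ==>
      nondeg (Z y) (B y) (\<Sum>w\<in>{w\<in>X. y \<preceq> w \<and> rk w = Suc (rk y)}. \<Phi> w)"
begin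

abbreviation k where "k \<equiv> Suc l"

lemma sZ: "x \<in> X ==> rk x \<le> m ==> kv.subspace (Z x)"
  and sB: "x \<in> X ==> rk x \<le> m ==> kv.subspace (B x)"
  and BZ: "x \<in> X ==> rk x \<le> m ==> B x \<subseteq> Z x"
  and qdZ: "x \<in> X ==> rk x \<le> m ==> qd (Z x) (B x) (f x)"
  and Zanti: "x \<in> X ==> y \<in> X ==> x \<preceq> y ==> rk y \<le> m ==> Z y \<subseteq> Z x"
  and Banti: "x \<in> X ==> y \<in> X ==> x \<preceq> y ==> rk y \<le> m ==> B y \<subseteq> B x"
  and exZ: "x \<in> X ==> i < m ==> exa (\<preceq>) rk (up x) Z B i"
  using CM unfolding CM_def by blast+

definition aB :: "'a => ('e => fld) set" where "aB y = ann (B y)"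
definition aZ :: "'a => ('e => fld) set" where "aZ y = ann (Z y)"

lemma sub_aB: "kv.subspace (aB y)" and sub_aZ: "kv.subspace (aZ y)"
  by (simp_all add: aB_def aZ_def subspace_ann)

lemma aB_mono: "x \<in> X ==> y \<in> X ==> x \<preceq> y ==> rk y \<le> m ==> aB x \<subseteq> aB y"
  unfolding aB_def by (rule ann_mono[OF Banti])
lemma aZ_mono: "x \<in> X ==> y \<in> X ==> x \<preceq> y ==> rk y \<le> m ==> aZ x \<subseteq> aZ y"
  unfolding aZ_def by (rule ann_mono[OF Zanti])
lemma aZ_aB: "x \<in> X ==> rk x \<le> m ==> aZ x \<subseteq> aB x"
  unfolding aB_def aZ_def by (rule ann_mono[OF BZ])

text \<open>\<open>TZ j\<close>/\<open>T0 j\<close> is the sum of the dual stalks at rank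
  \<open>j\<close>. \<open>GZ j\<close> collects functionals one rank lower and is written so that
  it is zero for j = 0.\<close>

abbreviation TZ where "TZ j \<equiv> QS aB {j}"
abbreviation T0 where "T0 j \<equiv> QS aZ {j}"
abbreviation GZ where "GZ j \<equiv> QS aB {r. Suc r = j}"

text \<open>The transpose of \<open>bd\<close>, sending functionals upwards. The sum does not
  mention the base point x: for a family supported above x the other terms vanish.\<close>

definition Dl :: "nat => ('a => 'e => fld) => 'a => 'e => fld" where
  "Dl j \<alpha> = (\<lambda>y. if y \<in> X \<and> rk y = j then \<Sum>y'\<in>{y'\<in>X. y' \<preceq> y \<and> Suc (rk y') = j}. \<alpha> y' else 0)"

text \<open>\<open>TZ j\<close>/\<open>TB j\<close> is the cokernel of the transposed boundary into
  rank \<open>j\<close>.\<close>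

definition TB :: "nat => 'a => ('a => 'e => fld) set" where
  "TB j x = {\<alpha> \<in> TZ j x. \<exists>\<gamma>\<in>GZ j x. \<alpha> + Dl j \<gamma> \<in> T0 j x}"

lemma lin_Dl: "lin (Dl j)"
  unfolding lin_iff Dl_def by (auto simp: fun_eq_iff fun_apply sum_fun_apply sum.distrib kv.scale_sum_right)

lemma Dl_gen:
  assumes x: "x \<in> X" and j: "j \<le> m" and A: "\<And>y. kv.subspace (A y)"
    and mono: "\<And>y y'. y \<in> X ==> y' \<in> X ==> y' \<preceq> y ==> rk y \<le> m ==> A y' \<subseteq> A y"
    and g: "\<gamma> \<in> QS A {r. Suc r = j} x"
  shows "Dl j \<gamma> \<in> QS A {j} x"
proof (rule QS_I)
  fix y assume y: "y \<in> X" "x \<preceq> y" "rk y \<in> {j}"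
  have "\<gamma> y' \<in> A y" if y': "y' \<in> X" "y' \<preceq> y" "Suc (rk y') = j" for y'
  proof (cases "x \<preceq> y'")
    case True
    then have "\<gamma> y' \<in> A y'" using QS_D1[OF g y'(1)] y' by simp
    then show ?thesis using mono[OF y(1) y'(1,2)] y j by auto
  next
    case False
    then have "\<gamma> y' = 0" using QS_D0[OF g, of y'] by blast
    then show ?thesis using kv.subspace_0[OF A, of y] by simp
  qed
  then have "(\<Sum>y'\<in>{y'\<in>X. y' \<preceq> y \<and> Suc (rk y') = j}. \<gamma> y') \<in> A y"
    by (intro kv.subspace_sum[OF A]) auto
  then show "Dl j \<gamma> y \<in> A y" using y by (simp add: Dl_def)
next
  fix y assume y: "\<not> (y \<in> X \<and> x \<preceq> y \<and> rk y \<in> {j})"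
  show "Dl j \<gamma> y = 0"
  proof (cases "y \<in> X \<and> rk y = j")
    case True
    have "\<gamma> y' = 0" if y': "y' \<in> X" "y' \<preceq> y" for y'
      using QS_D0[OF g, of y'] y True trans[OF x y'(1) _ _ y'(2)] by blast
    then show ?thesis by (simp add: Dl_def)
  qed (auto simp: Dl_def)
qed

lemma Dl_TZ: "x \<in> X ==> j \<le> m ==> \<gamma> \<in> GZ j x ==> Dl j \<gamma> \<in> TZ j x"
  by (rule Dl_gen) (auto simp: sub_aB dest: subsetD[OF aB_mono])

lemma Dl_T0: "x \<in> X ==> j \<le> m ==> \<gamma> \<in> QS aZ {r. Suc r = j} x ==> Dl j \<gamma> \<in> T0 j x"
  by (rule Dl_gen) (auto simp: sub_aZ dest: subsetD[OF aZ_mono])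

lemma Dl_Dl: "Dl (Suc j) (Dl j \<gamma>) = 0"
proof
  fix y
  show "Dl (Suc j) (Dl j \<gamma>) y = 0 y"
  proof (cases "y \<in> X \<and> rk y = Suc j")
    case True
    let ?V = "{v\<in>X. Suc (rk v) = j}"
    have "Dl (Suc j) (Dl j \<gamma>) y = (\<Sum>w\<in>{w\<in>X. w \<preceq> y \<and> rk w = j}. \<Sum>v\<in>?V. if v \<preceq> w then \<gamma> v else 0)"
      using True fin by (auto simp: Dl_def sum.inter_filter[symmetric] intro!: sum.cong)
    also have "\<dots> = (\<Sum>v\<in>?V. \<Sum>w\<in>{w\<in>X. w \<preceq> y \<and> rk w = j}. if v \<preceq> w then \<gamma> v else 0)" by (rule sum.swap)
    also have "\<dots> = (\<Sum>v\<in>?V. 0)"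
    proof (rule sum.cong[OF HOL.refl])
      fix v assume v: "v \<in> ?V"
      have "(\<Sum>w\<in>{w\<in>X. w \<preceq> y \<and> rk w = j}. if v \<preceq> w then \<gamma> v else 0)
         = (\<Sum>w\<in>{w\<in>{w\<in>X. w \<preceq> y \<and> rk w = j}. v \<preceq> w}. \<gamma> v)"
        using fin by (subst sum.inter_filter) auto
      also have "{w\<in>{w\<in>X. w \<preceq> y \<and> rk w = j}. v \<preceq> w} = {w \<in> X. v \<preceq> w \<and> w \<preceq> y \<and> rk w = Suc (rk v)}"
        using v by auto
      also have "(\<Sum>w\<in>\<dots>. \<gamma> v) = 0"
      proof (cases "v \<preceq> y")
        case T: True
        then show ?thesis unfolding kv_sum_const using thin[OF eul, of v y] v True by simp
      next
        case False
        then have "{w \<in> X. v \<preceq> w \<and> w \<preceq> y \<and> rk w = Suc (rk v)} = {}" using trans v True by blast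
        then show ?thesis by (simp only: sum.empty)
      qed
      finally show "(\<Sum>w\<in>{w\<in>X. w \<preceq> y \<and> rk w = j}. if v \<preceq> w then \<gamma> v else 0) = 0" .
    qed
    finally show ?thesis by (simp add: fun_apply)
  qed (auto simp: Dl_def fun_apply)
qed

lemma sub_TZ: "kv.subspace (TZ j x)" and sub_T0: "kv.subspace (T0 j x)" and sub_GZ: "kv.subspace (GZ j x)"
  by (rule subspace_QS; simp add: sub_aB sub_aZ)+

lemma T0_TZ: "j \<le> m ==> T0 j x \<subseteq> TZ j x"
  by (rule QS_mono) (use aZ_aB in auto)

lemma sub_TB: "kv.subspace (TB j x)"
proof (rule kv.subspaceI)
  show "0 \<in> TB j x" unfolding TB_def
    using kv.subspace_0[OF sub_TZ] kv.subspace_0[OF sub_GZ] kv.subspace_0[OF sub_T0]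
    by (auto intro!: bexI[of _ 0] simp: lin_0[OF lin_Dl])
next
  fix a b assume "a \<in> TB j x" "b \<in> TB j x"
  then obtain c d where *: "a \<in> TZ j x" "b \<in> TZ j x" "c \<in> GZ j x" "d \<in> GZ j x"
    "a + Dl j c \<in> T0 j x" "b + Dl j d \<in> T0 j x" by (auto simp: TB_def)
  have "(a + Dl j c) + (b + Dl j d) \<in> T0 j x" by (rule kv.subspace_add[OF sub_T0 *(5,6)])
  then have "(a + b) + Dl j (c + d) \<in> T0 j x" by (simp add: lin_add[OF lin_Dl] ac_simps)
  then show "a + b \<in> TB j x" unfolding TB_def
    using kv.subspace_add[OF sub_TZ *(1,2)] kv.subspace_add[OF sub_GZ *(3,4)] by blast
next
  fix r a assume "a \<in> TB j x"
  then obtain c where *: "a \<in> TZ j x" "c \<in> GZ j x" "a + Dl j c \<in> T0 j x" by (auto simp: TB_def)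
  have "r \<cdot> (a + Dl j c) \<in> T0 j x" by (rule kv.subspace_scale[OF sub_T0 *(3)])
  then have "r \<cdot> a + Dl j (r \<cdot> c) \<in> T0 j x" by (simp add: lin_scale[OF lin_Dl] sc_right)
  then show "r \<cdot> a \<in> TB j x" unfolding TB_def
    using kv.subspace_scale[OF sub_TZ *(1)] kv.subspace_scale[OF sub_GZ *(2)] by blast
qed

lemma TB_TZ: "TB j x \<subseteq> TZ j x" by (auto simp: TB_def)

lemma T0_TB: "j \<le> m ==> T0 j x \<subseteq> TB j x"
  unfolding TB_def using T0_TZ kv.subspace_0[OF sub_GZ] by (auto intro!: bexI[of _ 0] simp: lin_0[OF lin_Dl])

lemma Dl_TB: "x \<in> X ==> j \<le> m ==> \<gamma> \<in> GZ j x ==> Dl j \<gamma> \<in> TB j x"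
  unfolding TB_def using Dl_TZ kv.subspace_0[OF sub_T0] by (auto intro!: bexI[of _ \<gamma>])

lemma GZ_Suc [simp]: "GZ (Suc j) x = TZ j x" by simp

lemma Dl_TB_T0: 
  assumes x: "x \<in> X" and j: "Suc j \<le> m" and a: "\<alpha> \<in> TB j x" shows "Dl (Suc j) \<alpha> \<in> T0 (Suc j) x"
proof -
  obtain c where c: "\<alpha> + Dl j c \<in> T0 j x" using a by (auto simp: TB_def)
  have "Dl (Suc j) (\<alpha> + Dl j c) \<in> T0 (Suc j) x" by (rule Dl_T0[OF x j]) (use c in simp)
  then show ?thesis by (simp add: lin_add[OF lin_Dl] Dl_Dl)
qed

text \<open>Exactness of the transposed complex: a functional vanishing on cycles factors through
  the boundary map.\<close>

lemma dual_exact: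
  assumes x: "x \<in> X" and j: "j < m" and a: "\<alpha> \<in> TZ j x" and D: "Dl (Suc j) \<alpha> \<in> T0 (Suc j) x"
  shows "\<alpha> \<in> TB j x"
proof -
  let ?Y = "{y\<in>X. x \<preceq> y \<and> rk y = j}"
  define A where "A g = (\<Sum>y\<in>?Y. \<alpha> y (g y))" for g :: "'a => 'e"
  define Dm where "Dm g = (\<lambda>c. if c \<in> X \<and> x \<preceq> c \<and> Suc (rk c) = j then \<Sum>y\<in>{y\<in>X. c \<preceq> y \<and> rk y = j}. g y else 0)"
    for g :: "'a => 'e"
  have la: "lin (\<alpha> y)" if "y \<in> ?Y" for y using QS_D1[OF a, of y] that by (auto simp: aB_def ann_def)
  have lA: "lin A" unfolding lin_iff A_def
  proof (intro conjI allI)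
    show "(\<Sum>y\<in>?Y. \<alpha> y ((g + h) y)) = (\<Sum>y\<in>?Y. \<alpha> y (g y)) + (\<Sum>y\<in>?Y. \<alpha> y (h y))" for g h
      unfolding sum.distrib[symmetric] plus_fun_apply by (rule sum.cong[OF HOL.refl], rule lin_add[OF la])
    show "(\<Sum>y\<in>?Y. \<alpha> y ((c \<cdot> g) y)) = c \<cdot> (\<Sum>y\<in>?Y. \<alpha> y (g y))" for c g
      unfolding kv.scale_sum_right sc_fun_apply by (rule sum.cong[OF HOL.refl], rule lin_scale[OF la])
  qed
  have lD: "lin Dm" unfolding lin_iff Dm_def
    by (auto simp: fun_eq_iff fun_apply sum.distrib kv.scale_sum_right)
  have sU: "kv.subspace (QS Z {j} x)" by (rule subspace_QS) (use sZ j in auto)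
  have sW: "kv.subspace (QS B {r. Suc r = j} x)" by (rule subspace_QS) (use sB j in auto)
  have "\<exists>\<Gamma>. lin \<Gamma> \<and> (\<forall>w\<in>QS B {r. Suc r = j} x. \<Gamma> w = 0) \<and> (\<forall>u\<in>QS Z {j} x. \<Gamma> (Dm u) = A u)"
  proof (rule lin_factor[OF lD lA sU sW])
    fix u assume u: "u \<in> QS Z {j} x" and Du: "Dm u \<in> QS B {r. Suc r = j} x"
    have uZ: "u w \<in> Z w" if "w \<in> up x" "rk w = j" for w using QS_D1[OF u, of w] that by (auto simp: up_def)
    have cyc: "bd (\<preceq>) rk (up x) u c \<in> B c" if "c \<in> up x" "Suc (rk c) = j" for c
    proof -
      have "cov (\<preceq>) rk (up x) c = {y\<in>X. c \<preceq> y \<and> rk y = j}" using bd_up[OF that(1) x] that by auto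
      then have "bd (\<preceq>) rk (up x) u c = Dm u c" using that by (simp add: Dm_def bd_def up_def)
      then show ?thesis using QS_D1[OF Du, of c] that by (auto simp: up_def)
    qed
    obtain g where g: "\<And>w. w \<in> up x ==> rk w = Suc j ==> g w \<in> Z w"
      "\<And>c. c \<in> up x ==> rk c = j ==> u c + bd (\<preceq>) rk (up x) g c \<in> B c"
      using exaD[OF exZ[OF x j] uZ cyc] by metis
    let ?W = "{w\<in>X. x \<preceq> w \<and> rk w = Suc j}"
    \<comment> \<open>Up to \<open>B\<close>, the cycle \<open>u\<close> is the boundary of
      \<open>g\<close>; moving the boundary to the other side turns \<open>A u\<close> into
      \<open>Dl (Suc j) \<alpha>\<close> applied to \<open>g\<close>, and this functional
      annihilates \<open>Z\<close>.\<close>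
    have "A u = (\<Sum>y\<in>?Y. \<alpha> y (bd (\<preceq>) rk (up x) g y))"
      unfolding A_def
    proof (rule sum.cong[OF HOL.refl])
      fix y assume y: "y \<in> ?Y"
      have "u y + bd (\<preceq>) rk (up x) g y \<in> B y" using g(2) y by (auto simp: up_def)
      then have "\<alpha> y (u y + bd (\<preceq>) rk (up x) g y) = 0"
        using QS_D1[OF a, of y] y by (auto simp: aB_def ann_def)
      then have "\<alpha> y (u y) + \<alpha> y (bd (\<preceq>) rk (up x) g y) = 0" by (simp add: lin_add[OF la[OF y]])
      then show "\<alpha> y (u y) = \<alpha> y (bd (\<preceq>) rk (up x) g y)" by (metis kv_uminus add_eq_0_iff)
    qed
    also have "\<dots> = (\<Sum>y\<in>?Y. \<Sum>w\<in>?W. if y \<preceq> w then \<alpha> y (g w) else 0)"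
    proof (rule sum.cong[OF HOL.refl])
      fix y assume y: "y \<in> ?Y"
      have "cov (\<preceq>) rk (up x) y = {w\<in>?W. y \<preceq> w}" using y by (auto simp: cov_def up_def)
      then have "\<alpha> y (bd (\<preceq>) rk (up x) g y) = (\<Sum>w\<in>{w\<in>?W. y \<preceq> w}. \<alpha> y (g w))"
        by (simp only: bd_def kvp.linear_sum[OF la[OF y]])
      also have "\<dots> = (\<Sum>w\<in>?W. if y \<preceq> w then \<alpha> y (g w) else 0)"
        by (rule sum.inter_filter) (use fin in simp)
      finally show "\<alpha> y (bd (\<preceq>) rk (up x) g y) = (\<Sum>w\<in>?W. if y \<preceq> w then \<alpha> y (g w) else 0)" .
    qed
    also have "\<dots> = (\<Sum>w\<in>?W. \<Sum>y\<in>?Y. if y \<preceq> w then \<alpha> y (g w) else 0)" by (rule sum.swap)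
    also have "\<dots> = (\<Sum>w\<in>?W. Dl (Suc j) \<alpha> w (g w))"
    proof (rule sum.cong[OF HOL.refl])
      fix w assume w: "w \<in> ?W"
      have a0: "\<alpha> y e = 0" if "y \<in> X" "\<not> x \<preceq> y" for y e
        using QS_D0[OF a, of y] that by (simp add: fun_apply)
      have "(\<Sum>y\<in>?Y. if y \<preceq> w then \<alpha> y (g w) else 0) = (\<Sum>y\<in>{y\<in>?Y. y \<preceq> w}. \<alpha> y (g w))"
        by (rule sum.inter_filter[symmetric]) (use fin in simp)
      also have "\<dots> = (\<Sum>y\<in>{y\<in>X. y \<preceq> w \<and> Suc (rk y) = Suc j}. \<alpha> y (g w))"
        by (rule sum.mono_neutral_left) (use fin a0 in auto)
      finally show "(\<Sum>y\<in>?Y. if y \<preceq> w then \<alpha> y (g w) else 0) = Dl (Suc j) \<alpha> w (g w)"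
        using w by (simp add: Dl_def sum_fun_apply)
    qed
    also have "\<dots> = 0"
    proof (rule sum.neutral, rule ballI)
      fix w assume w: "w \<in> ?W"
      have "Dl (Suc j) \<alpha> w \<in> ann (Z w)" using QS_D1[OF D, of w] w by (auto simp: aZ_def)
      moreover have "g w \<in> Z w" using g(1) w by (auto simp: up_def)
      ultimately show "Dl (Suc j) \<alpha> w (g w) = 0" by (auto simp: ann_def)
    qed
    finally show "A u = 0" .
  qed
  then obtain \<Gamma> where \<Gamma>: "lin \<Gamma>" "\<And>w. w\<in>QS B {r. Suc r = j} x ==> \<Gamma> w = 0" "\<And>u. u\<in>QS Z {j} x ==> \<Gamma> (Dm u) = A u"
    by blast
  \<comment> \<open>The components of \<Gamma>, read off on chains concentrated at one
    element.\<close>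
  define \<gamma> where "\<gamma> c = (if c \<in> X \<and> x \<preceq> c \<and> Suc (rk c) = j then (\<lambda>e. \<Gamma> (sng c e)) else 0)" for c
  have gG: "\<gamma> \<in> GZ j x"
  proof (rule QS_I)
    fix c assume c: "c \<in> X" "x \<preceq> c" "rk c \<in> {r. Suc r = j}"
    have "lin (\<lambda>e. \<Gamma> (sng c e))" unfolding lin_iff
      by (simp only: lin_add[OF lin_sng] lin_scale[OF lin_sng] lin_add[OF \<Gamma>(1)] lin_scale[OF \<Gamma>(1)]) simp
    moreover have "\<Gamma> (sng c e) = 0" if "e \<in> B c" for e
    proof (rule \<Gamma>(2), rule QS_I)
      fix y assume "y \<in> X" "x \<preceq> y" "rk y \<in> {r. Suc r = j}"
      then show "sng c e y \<in> B y" using that kv.subspace_0[OF sB, of y] j by (auto simp: sng_def)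
    qed (use c in \<open>auto simp: sng_def\<close>)
    ultimately show "\<gamma> c \<in> aB c" using c by (simp add: \<gamma>_def aB_def ann_def)
  qed (auto simp: \<gamma>_def)
  have "\<alpha> + Dl j \<gamma> \<in> T0 j x"
  proof (rule QS_I)
    fix y assume y: "y \<in> X" "x \<preceq> y" "rk y \<in> {j}"
    have inaB: "(\<alpha> + Dl j \<gamma>) y \<in> aB y"
      by (subst plus_fun_apply, rule kv.subspace_add[OF sub_aB QS_D1[OF a y] QS_D1[OF Dl_TZ[OF x _ gG] y]]) (use j in simp)
    have "\<alpha> y e = Dl j \<gamma> y e" if e: "e \<in> Z y" for e
    proof -
      have s: "sng y e \<in> QS Z {j} x"
      proof (rule QS_I)
        fix y' assume "y' \<in> X" "x \<preceq> y'" "rk y' \<in> {j}"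
        then show "sng y e y' \<in> Z y'" using e kv.subspace_0[OF sZ, of y'] j by (auto simp: sng_def)
      qed (use y in \<open>auto simp: sng_def\<close>)
      have "A (sng y e) = (\<Sum>y'\<in>?Y. if y' = y then \<alpha> y e else 0)"
        unfolding A_def by (rule sum.cong) (use la lin_0 in \<open>auto simp: sng_def\<close>)
      also have "\<dots> = \<alpha> y e" using y fin by simp
      finally have A: "A (sng y e) = \<alpha> y e" .
      have "Dm (sng y e) = (\<Sum>c\<in>{c\<in>X. x \<preceq> c \<and> c \<preceq> y \<and> Suc (rk c) = j}. sng c e)"
      proof
        fix c
        have "(\<Sum>c'\<in>{c\<in>X. x \<preceq> c \<and> c \<preceq> y \<and> Suc (rk c) = j}. sng c' e) c
          = (\<Sum>c'\<in>{c\<in>X. x \<preceq> c \<and> c \<preceq> y \<and> Suc (rk c) = j}. if c = c' then e else 0)"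
          by (simp add: sum_fun_apply sng_def)
        also have "\<dots> = (if c\<in>X \<and> x \<preceq> c \<and> c \<preceq> y \<and> Suc (rk c) = j then e else 0)"
          using fin by simp
        also have "\<dots> = Dm (sng y e) c" using y fin by (auto simp: Dm_def sng_def)
        finally show "Dm (sng y e) c = (\<Sum>c'\<in>{c\<in>X. x \<preceq> c \<and> c \<preceq> y \<and> Suc (rk c) = j}. sng c' e) c" ..
      qed
      then have "\<Gamma> (Dm (sng y e)) = (\<Sum>c\<in>{c\<in>X. x \<preceq> c \<and> c \<preceq> y \<and> Suc (rk c) = j}. \<gamma> c e)"
        by (simp add: kvp.linear_sum[OF \<Gamma>(1)] \<gamma>_def)
      also have "\<dots> = (\<Sum>c\<in>{c\<in>X. c \<preceq> y \<and> Suc (rk c) = j}. \<gamma> c e)"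
        by (rule sum.mono_neutral_left) (use fin in \<open>auto simp: \<gamma>_def fun_apply\<close>)
      also have "\<dots> = Dl j \<gamma> y e" using y by (simp add: Dl_def sum_fun_apply)
      finally show ?thesis using \<Gamma>(3)[OF s] A by simp
    qed
    then have "(\<alpha> + Dl j \<gamma>) y e = 0" if "e \<in> Z y" for e using that by (simp add: fun_apply)
    with inaB show "(\<alpha> + Dl j \<gamma>) y \<in> aZ y" by (auto simp: aB_def aZ_def ann_def)
  next
    fix y assume "\<not> (y \<in> X \<and> x \<preceq> y \<and> rk y \<in> {j})"
    then show "(\<alpha> + Dl j \<gamma>) y = 0"
      using QS_D0[OF a] QS_D0[OF Dl_TZ[OF x _ gG]] j by (simp add: fun_apply)
  qed
  with a gG show ?thesis by (auto simp: TB_def)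
qed

text \<open>\<open>up x\<close> has no elements of rank below \<open>rk x\<close>, so the zero chain
  is a filling.\<close>

lemma exa_trivial:
  assumes "x \<in> X" "i < rk x" "\<And>w. w \<in> up x ==> rk w = Suc i ==> 0 \<in> A w"
  shows "exa (\<preceq>) rk (up x) A A0 i"
  by (rule exaI, rule exI[of _ "\<lambda>_. 0"]) (use assms rk_le in \<open>fastforce simp: up_def\<close>)

lemma exa_TZ_T0: "x \<in> X ==> rk x < j ==> j \<le> m ==> exa (\<preceq>) rk (up x) (TZ j) (T0 j) i"
  by (rule exa_QS[OF ac2]) (auto simp: sub_aB sub_aZ dest: subsetD[OF aZ_aB])

lemma TZ_anti: "c \<in> X ==> w \<in> X ==> c \<preceq> w ==> TZ j w \<subseteq> TZ j c"
  by (rule QS_anti) (auto simp: kv.subspace_0[OF sub_aB])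

lemma T0_anti: "c \<in> X ==> w \<in> X ==> c \<preceq> w ==> T0 j w \<subseteq> T0 j c"
  by (rule QS_anti) (auto simp: kv.subspace_0[OF sub_aZ])

lemma upX: "c \<in> up x ==> c \<in> X" by (simp add: up_def)

text \<open>Induction on \<open>j\<close>: by \<open>dual_exact\<close> the transposed boundary
  identifies \<open>TZ j\<close>/\<open>TB j\<close> with
  \<open>TB (Suc j)\<close>/\<open>T0 (Suc j)\<close>, while
  \<open>TZ (Suc j)\<close>/\<open>T0 (Suc j)\<close> is exact by acyclicity of intervals;
  \<open>exa_quot\<close> combines the two.\<close>

lemma exa_TZ_TB:
  assumes x: "x \<in> X" and j: "rk x \<le> j" "j \<le> m" "i < j"
  shows "exa (\<preceq>) rk (up x) (TZ j) (TB j) i"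
  using j
proof (induction j arbitrary: i rule: dec_induct)
  case base
  then show ?case by (intro exa_trivial[OF x]) (auto simp: kv.subspace_0[OF sub_TZ])
next
  case (step j)
  show ?case
  proof (rule exa_quot[where ?B0.0 = "T0 (Suc j)"])
    show "exa (\<preceq>) rk (up x) (TZ (Suc j)) (T0 (Suc j)) i" using exa_TZ_T0[OF x] step by simp
    show "dd0 (\<preceq>) rk (up x)" by (rule dd0_up[OF eul x])
    show "exa (\<preceq>) rk (up x) (TB (Suc j)) (T0 (Suc j)) i'" if "i = Suc i'" for i'
    proof (rule exa_transport[where A = "TZ j" and B = "TB j" and \<theta> = "Dl (Suc j)"])
      show "exa (\<preceq>) rk (up x) (TZ j) (TB j) i'" using step that by auto
      show "lin (Dl (Suc j))" by (rule lin_Dl)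
      show "finite (up x)" using fin by (simp add: up_def)
      show "Dl (Suc j) a \<in> TB (Suc j) c" if "c \<in> up x" "a \<in> TZ j c" for c a
        using Dl_TB[OF upX[OF that(1)], of "Suc j" a] step that by simp
      show "\<exists>b\<in>TZ j c. a + Dl (Suc j) b \<in> T0 (Suc j) c" if "a \<in> TB (Suc j) c" for c a
        using that by (auto simp: TB_def)
      show "a \<in> TB j c" if "c \<in> up x" "a \<in> TZ j c" "Dl (Suc j) a \<in> T0 (Suc j) c" for c a
        using dual_exact[OF upX[OF that(1)] _ that(2,3)] step by simp
      show "Dl (Suc j) a \<in> T0 (Suc j) c" if "c \<in> up x" "a \<in> TB j c" for c a
        using Dl_TB_T0[OF upX[OF that(1)] _ that(2)] step by simp
    qed (use TZ_anti T0_anti in \<open>auto simp: sub_TZ sub_T0 up_def\<close>)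
  qed (use step T0_TB TB_TZ in \<open>auto simp: sub_TZ sub_T0 sub_TB\<close>)
qed

lemma qd_TZ_T0: "j \<le> m ==> qd (TZ j x) (T0 j x) (\<Sum>y\<in>{y\<in>X. x \<preceq> y \<and> rk y \<in> {j}}. f y)"
  by (rule qd_QS)
    (use qd_ann[OF sB sZ BZ qdZ] aZ_aB in \<open>auto simp: sub_aB sub_aZ aB_def[symmetric] aZ_def[symmetric]\<close>)

text \<open>The same identification read on dimensions; each step subtracts the previous dimension,
  whence the alternating signs.\<close>

lemma qd_TZ_TB:
  assumes x: "x \<in> X" and j: "rk x \<le> j" "j \<le> m"
  shows "\<exists>t. qd (TZ j x) (TB j x) t \<and> int t = (\<Sum>y\<in>{y\<in>X. x \<preceq> y \<and> rk y \<le> j}. (-1) ^ (j - rk y) * int (f y))"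
  using j
proof (induction j rule: dec_induct)
  case base
  have "TB (rk x) x = T0 (rk x) x"
  proof -
    have "\<gamma> = 0" if "\<gamma> \<in> GZ (rk x) x" for \<gamma>
    proof
      fix y
      have "\<not> (y \<in> X \<and> x \<preceq> y \<and> rk y \<in> {r. Suc r = rk x})" using rk_le[OF x, of y] by auto
      from QS_D0[OF that this] show "\<gamma> y = 0 y" by (simp add: fun_apply)
    qed
    note g0 = this
    show ?thesis
    proof
      show "TB (rk x) x \<subseteq> T0 (rk x) x"
      proof
        fix a assume "a \<in> TB (rk x) x"
        then obtain \<gamma> where g: "\<gamma> \<in> GZ (rk x) x" "a + Dl (rk x) \<gamma> \<in> T0 (rk x) x" by (auto simp: TB_def)
        from g(2) show "a \<in> T0 (rk x) x" unfolding g0[OF g(1)] lin_0[OF lin_Dl] by simp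
      qed
    qed (rule T0_TB[OF base])
  qed
  moreover have "{y\<in>X. x \<preceq> y \<and> rk y \<in> {rk x}} = {y\<in>X. x \<preceq> y \<and> rk y \<le> rk x}"
    by (auto intro: le_antisym rk_le[OF x])
  moreover have "(\<Sum>y\<in>{y\<in>X. x \<preceq> y \<and> rk y \<le> rk x}. (-1) ^ (rk x - rk y) * int (f y)) = int (\<Sum>y\<in>{y\<in>X. x \<preceq> y \<and> rk y \<le> rk x}. f y)"
    unfolding of_nat_sum by (rule sum.cong) (use rk_le[OF x] le_antisym in \<open>auto\<close>)
  ultimately show ?case using qd_TZ_T0[OF base, of x] by auto
next
  case (step j)
  then obtain t where t: "qd (TZ j x) (TB j x) t"
    "int t = (\<Sum>y\<in>{y\<in>X. x \<preceq> y \<and> rk y \<le> j}. (-1) ^ (j - rk y) * int (f y))" by auto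
  have q1: "qd (TB (Suc j) x) (T0 (Suc j) x) t"
  proof (rule qd_iso[OF lin_Dl[of "Suc j"] sub_T0 sub_TZ _ _ _ _ t(1)])
    show "Dl (Suc j) z \<in> TB (Suc j) x" if "z \<in> TZ j x" for z using Dl_TB[OF x, of "Suc j" z] step that by simp
    show "\<exists>z\<in>TZ j x. z' + Dl (Suc j) z \<in> T0 (Suc j) x" if "z' \<in> TB (Suc j) x" for z' using that by (auto simp: TB_def)
    show "z \<in> TB j x" if "z \<in> TZ j x" "Dl (Suc j) z \<in> T0 (Suc j) x" for z using dual_exact[OF x _ that] step by simp
    show "Dl (Suc j) z \<in> T0 (Suc j) x" if "z \<in> TB j x" for z using Dl_TB_T0[OF x _ that] step by simp
  qed
  let ?N = "\<Sum>y\<in>{y\<in>X. x \<preceq> y \<and> rk y \<in> {Suc j}}. f y"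
  have q2: "t \<le> ?N" "qd (TZ (Suc j) x) (TB (Suc j) x) (?N - t)"
    using qd_quot[OF sub_TB sub_T0 T0_TB TB_TZ qd_TZ_T0 q1] step by auto
  have eq: "{y\<in>X. x \<preceq> y \<and> rk y \<le> Suc j} = {y\<in>X. x \<preceq> y \<and> rk y \<in> {Suc j}} \<union> {y\<in>X. x \<preceq> y \<and> rk y \<le> j}" by auto
  have "(\<Sum>y\<in>{y\<in>X. x \<preceq> y \<and> rk y \<le> Suc j}. (-1) ^ (Suc j - rk y) * int (f y))
    = (\<Sum>y\<in>{y\<in>X. x \<preceq> y \<and> rk y \<in> {Suc j}}. (-1) ^ (Suc j - rk y) * int (f y))
    + (\<Sum>y\<in>{y\<in>X. x \<preceq> y \<and> rk y \<le> j}. (-1) ^ (Suc j - rk y) * int (f y))"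
    unfolding eq using fin by (subst sum.union_disjoint) auto
  also have "(\<Sum>y\<in>{y\<in>X. x \<preceq> y \<and> rk y \<in> {Suc j}}. (-1) ^ (Suc j - rk y) * int (f y)) = int ?N"
    by simp
  also have "(\<Sum>y\<in>{y\<in>X. x \<preceq> y \<and> rk y \<le> j}. (-1) ^ (Suc j - rk y) * int (f y)) = - int t"
    unfolding t(2) sum_negf[symmetric] by (rule sum.cong) (auto simp: Suc_diff_le)
  finally show ?case using q2 by (intro exI[of _ "?N - t"]) auto
qed

section \<open>Gluing the transposed complex to the original one\<close>

definition \<phi> :: "'a => ('e => fld) => 'e" where
  "\<phi> y = (\<Sum>w\<in>{w\<in>X. y \<preceq> w \<and> rk w = Suc (rk y)}. \<Phi> w)"

lemma form\<phi>: "y \<in> X ==> rk y = k ==> form (Z y) (\<phi> y)"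
  unfolding \<phi>_def
  by (rule form_sum[OF sZ]) (use lm in \<open>auto intro!: form_mono[OF form\<Phi> Zanti]\<close>)

text \<open>The gluing map: after the transposed boundary from rank \<open>l\<close> to rank
  \<open>k\<close>, the form \<open>\<phi> y\<close> turns functionals at y into vectors at
  y.\<close>

definition th :: "('a => 'e => fld) => 'a => 'e" where
  "th \<alpha> = (\<lambda>y. if y \<in> X \<and> rk y = k then \<phi> y (Dl k \<alpha> y) else 0)"

definition sg :: "('a => 'e) => 'e" where "sg \<zeta> = (\<Sum>y\<in>{y\<in>X. rk y = k}. \<zeta> y)"

abbreviation Q where "Q \<equiv> QS Z {k}"
abbreviation Q0 where "Q0 \<equiv> QS B {k}"
text \<open>The new stalk at x is \<open>nZ x\<close>/\<open>nB x\<close>: the middle homology of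
  the three-term complex formed by the dual stalks at rank \<open>l\<close>, the stalks at rank
  \<open>k\<close> and the stalk at x, with maps \<open>th\<close> and \<open>sg\<close>.\<close>

definition nZ :: "'a => ('a => 'e) set" where "nZ = (\<lambda>x. {\<zeta> \<in> Q x. sg \<zeta> \<in> B x})"
definition nB :: "'a => ('a => 'e) set" where "nB x = {\<zeta> \<in> Q x. \<exists>\<alpha>\<in>TZ l x. \<zeta> + th \<alpha> \<in> Q0 x}"

lemma lin_sg: "lin sg"
  by (auto simp: lin_iff sg_def fun_apply sum.distrib kv.scale_sum_right)

lemma lin_th: "lin th"
proof -
  have "lin (\<phi> y)" if "y \<in> X" "rk y = k" for y using form\<phi>[OF that] by (simp add: form_def)
  then show ?thesis unfolding lin_iff th_def
    by (auto simp: fun_eq_iff lin_add[OF lin_Dl] lin_scale[OF lin_Dl] fun_apply lin_iff)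
qed

lemma sub_Q: "kv.subspace (Q x)" and sub_Q0: "kv.subspace (Q0 x)"
  by (rule subspace_QS; use sZ sB lm in auto)+

lemma Q0_Q: "Q0 x \<subseteq> Q x" by (rule QS_mono) (use BZ lm in auto)

lemma Q_anti: "x \<in> X ==> y \<in> X ==> x \<preceq> y ==> Q y \<subseteq> Q x"
  by (rule QS_anti) (use kv.subspace_0[OF sZ] lm in auto)
lemma Q0_anti: "x \<in> X ==> y \<in> X ==> x \<preceq> y ==> Q0 y \<subseteq> Q0 x"
  by (rule QS_anti) (use kv.subspace_0[OF sB] lm in auto)

lemma th_Q:
  assumes x: "x \<in> X" and a: "\<alpha> \<in> TZ l x" shows "th \<alpha> \<in> Q x"
proof (rule QS_I)
  fix y assume "y \<in> X" "x \<preceq> y" "rk y \<in> {k}"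
  then show "th \<alpha> y \<in> Z y" using form\<phi>[of y] by (auto simp: th_def form_def)
next
  fix y assume y: "\<not> (y \<in> X \<and> x \<preceq> y \<and> rk y \<in> {k})"
  have "Dl k \<alpha> y = 0" by (rule QS_D0[OF Dl_TZ[OF x, of k \<alpha>] y]) (use lm a in auto)
  then show "th \<alpha> y = 0" using form\<phi>[of y] by (auto simp: th_def form_def lin_0)
qed

lemma sg_Q:
  assumes x: "x \<in> X" "rk x \<le> m" and z: "\<zeta> \<in> Q x" shows "sg \<zeta> \<in> Z x"
  unfolding sg_def
proof (rule kv.subspace_sum[OF sZ[OF x]])
  fix y assume y: "y \<in> {y\<in>X. rk y = k}"
  show "\<zeta> y \<in> Z x" using QS_D1[OF z, of y] QS_D0[OF z, of y] y Zanti[OF x(1), of y] lm kv.subspace_0[OF sZ[OF x]]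
    by (cases "x \<preceq> y") auto
qed

lemma sg_Q0:
  assumes x: "x \<in> X" "rk x \<le> m" and z: "\<zeta> \<in> Q0 x" shows "sg \<zeta> \<in> B x"
  unfolding sg_def
proof (rule kv.subspace_sum[OF sB[OF x]])
  fix y assume y: "y \<in> {y\<in>X. rk y = k}"
  show "\<zeta> y \<in> B x" using QS_D1[OF z, of y] QS_D0[OF z, of y] y Banti[OF x(1), of y] lm kv.subspace_0[OF sB[OF x]]
    by (cases "x \<preceq> y") auto
qed

text \<open>For v of rank \<open>l\<close> and w of rank \<open>Suc k\<close>, the term
  \<open>\<Phi> w (\<alpha> v)\<close> occurs once for each y between them: twice if v is below w,
  and never otherwise.\<close>

lemma sg_th: "sg (th \<alpha>) = 0"
proof -
  let ?Y = "{y\<in>X. rk y = k}" let ?V = "{v\<in>X. rk v = l}" let ?W = "{w\<in>X. rk w = Suc k}"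
  have fins: "finite ?Y" "finite ?V" "finite ?W" using fin by auto
  have l\<Phi>: "lin (\<Phi> w)" if "w \<in> ?W" for w using form\<Phi>[of w] that by (simp add: form_def)
  have "sg (th \<alpha>) = (\<Sum>y\<in>?Y. \<Sum>w\<in>?W. \<Sum>v\<in>?V. if v \<preceq> y \<and> y \<preceq> w then \<Phi> w (\<alpha> v) else 0)"
    unfolding sg_def
  proof (rule sum.cong[OF HOL.refl])
    fix y assume y: "y \<in> ?Y"
    have "th \<alpha> y = (\<Sum>w\<in>{w\<in>?W. y \<preceq> w}. \<Phi> w (\<Sum>v\<in>{v\<in>?V. v \<preceq> y}. \<alpha> v))"
    proof -
      have "{w \<in> X. y \<preceq> w \<and> rk w = Suc (rk y)} = {w\<in>?W. y \<preceq> w}" using y by auto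
      moreover have "{y' \<in> X. y' \<preceq> y \<and> Suc (rk y') = k} = {v\<in>?V. v \<preceq> y}" by auto
      ultimately show ?thesis using y by (simp add: th_def \<phi>_def Dl_def sum_fun_apply)
    qed
    also have "\<dots> = (\<Sum>w\<in>{w\<in>?W. y \<preceq> w}. \<Sum>v\<in>{v\<in>?V. v \<preceq> y}. \<Phi> w (\<alpha> v))"
      by (rule sum.cong[OF HOL.refl]) (use l\<Phi> kvp.linear_sum in auto)
    also have "\<dots> = (\<Sum>w\<in>{w\<in>?W. y \<preceq> w}. \<Sum>v\<in>?V. if v \<preceq> y then \<Phi> w (\<alpha> v) else 0)"
      using fins(2) by (intro sum.cong[OF HOL.refl] sum.inter_filter)
    also have "\<dots> = (\<Sum>w\<in>?W. if y \<preceq> w then \<Sum>v\<in>?V. if v \<preceq> y then \<Phi> w (\<alpha> v) else 0 else 0)"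
      using fins(3) by (intro sum.inter_filter)
    also have "\<dots> = (\<Sum>w\<in>?W. \<Sum>v\<in>?V. if v \<preceq> y \<and> y \<preceq> w then \<Phi> w (\<alpha> v) else 0)"
      by (intro sum.cong[OF HOL.refl]) (auto intro!: sum.cong)
    finally show "th \<alpha> y = (\<Sum>w\<in>?W. \<Sum>v\<in>?V. if v \<preceq> y \<and> y \<preceq> w then \<Phi> w (\<alpha> v) else 0)" .
  qed
  also have "\<dots> = (\<Sum>w\<in>?W. \<Sum>y\<in>?Y. \<Sum>v\<in>?V. if v \<preceq> y \<and> y \<preceq> w then \<Phi> w (\<alpha> v) else 0)" by (rule sum.swap)
  also have "\<dots> = (\<Sum>w\<in>?W. \<Sum>v\<in>?V. \<Sum>y\<in>?Y. if v \<preceq> y \<and> y \<preceq> w then \<Phi> w (\<alpha> v) else 0)"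
    by (rule sum.cong[OF HOL.refl], rule sum.swap)
  also have "\<dots> = (\<Sum>w\<in>?W. \<Sum>v\<in>?V. 0)"
  proof (intro sum.cong[OF HOL.refl])
    fix w v assume w: "w \<in> ?W" and v: "v \<in> ?V"
    have "(\<Sum>y\<in>?Y. if v \<preceq> y \<and> y \<preceq> w then \<Phi> w (\<alpha> v) else 0) = (\<Sum>y\<in>{y\<in>?Y. v \<preceq> y \<and> y \<preceq> w}. \<Phi> w (\<alpha> v))"
      using fins by (intro sum.inter_filter[symmetric])
    also have "{y\<in>?Y. v \<preceq> y \<and> y \<preceq> w} = {y \<in> X. v \<preceq> y \<and> y \<preceq> w \<and> rk y = Suc (rk v)}" using v by auto
    also have "(\<Sum>y\<in>\<dots>. \<Phi> w (\<alpha> v)) = 0"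
    proof (cases "v \<preceq> w")
      case True
      then show ?thesis using thin[OF eul, of v w] v w by (simp add: kv_sum_const)
    next
      case False
      then have "{y \<in> X. v \<preceq> y \<and> y \<preceq> w \<and> rk y = Suc (rk v)} = {}" using trans v w by blast
      then show ?thesis by (simp only: sum.empty)
    qed
    finally show "(\<Sum>y\<in>?Y. if v \<preceq> y \<and> y \<preceq> w then \<Phi> w (\<alpha> v) else 0) = 0" .
  qed
  finally show ?thesis by simp
qed

lemma nB_nZ:
  assumes x: "x \<in> X" "rk x \<le> m" shows "nB x \<subseteq> nZ x"
proof
  fix \<zeta> assume "\<zeta> \<in> nB x"
  then obtain \<alpha> where *: "\<zeta> \<in> Q x" "\<zeta> + th \<alpha> \<in> Q0 x" by (auto simp: nB_def)
  then have "sg (\<zeta> + th \<alpha>) \<in> B x" using sg_Q0[OF x] by simp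
  then have "sg \<zeta> \<in> B x" by (simp add: lin_add[OF lin_sg] sg_th)
  with * show "\<zeta> \<in> nZ x" by (simp add: nZ_def)
qed

text \<open>Nondegeneracy at each y of rank \<open>k\<close> shows that \<open>Dl k \<alpha>\<close>
  vanishes modulo \<open>aZ\<close>, and exactness of the transposed complex does the rest. So
  \<open>th\<close> embeds \<open>TZ l\<close>/\<open>TB l\<close> into
  \<open>Q\<close>/\<open>Q0\<close>.\<close>

lemma th_refl:
  assumes x: "x \<in> X" and a: "\<alpha> \<in> TZ l x" and t: "th \<alpha> \<in> Q0 x" shows "\<alpha> \<in> TB l x"
proof (rule dual_exact[OF x _ a])
  show "l < m" using lm by simp
  have D: "Dl k \<alpha> \<in> TZ k x" using Dl_TZ[OF x, of k \<alpha>] lm a by simp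
  show "Dl k \<alpha> \<in> T0 k x"
  proof (rule QS_I)
    fix y assume y: "y \<in> X" "x \<preceq> y" "rk y \<in> {k}"
    have "\<phi> y (Dl k \<alpha> y) \<in> B y" using QS_D1[OF t y] y by (simp add: th_def)
    moreover have "Dl k \<alpha> y \<in> ann (B y)" using QS_D1[OF D y] by (simp add: aB_def)
    ultimately show "Dl k \<alpha> y \<in> aZ y" using nondeg\<Phi>[of y] y unfolding nondeg_def \<phi>_def aZ_def by auto
  qed (rule QS_D0[OF D])
qed

lemma th_pres:
  assumes x: "x \<in> X" and a: "\<alpha> \<in> TB l x" shows "th \<alpha> \<in> Q0 x"
proof -
  have D: "Dl k \<alpha> \<in> T0 k x" using Dl_TB_T0[OF x _ a] lm by simp
  have "th \<alpha> y = 0" for y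
    using QS_D1[OF D, of y] QS_D0[OF D, of y] form\<phi>[of y]
    by (cases "x \<preceq> y") (auto simp: th_def form_def lin_0 aZ_def)
  then have "th \<alpha> = 0" by (auto simp: fun_apply)
  then show ?thesis using kv.subspace_0[OF sub_Q0] by simp
qed

lemma sub_nZ: "x \<in> X ==> rk x \<le> m ==> kv.subspace (nZ x)"
proof (rule kv.subspaceI)
  assume x: "x \<in> X" "rk x \<le> m"
  note [simp] = lin_0[OF lin_sg] lin_add[OF lin_sg] lin_scale[OF lin_sg]
  show "0 \<in> nZ x" using kv.subspace_0[OF sub_Q] kv.subspace_0[OF sB[OF x]] by (simp add: nZ_def)
  show "a + b \<in> nZ x" if "a \<in> nZ x" "b \<in> nZ x" for a b
    using that kv.subspace_add[OF sub_Q] kv.subspace_add[OF sB[OF x]] by (simp add: nZ_def)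
  show "c \<cdot> a \<in> nZ x" if "a \<in> nZ x" for a c
    using that kv.subspace_scale[OF sub_Q] kv.subspace_scale[OF sB[OF x]] by (simp add: nZ_def)
qed

lemma sub_nB: "kv.subspace (nB x)"
proof (rule kv.subspaceI)
  show "0 \<in> nB x" unfolding nB_def
    using kv.subspace_0[OF sub_TZ] kv.subspace_0[OF sub_Q] kv.subspace_0[OF sub_Q0]
    by (auto intro!: bexI[of _ 0] simp: lin_0[OF lin_th])
next
  fix a b assume "a \<in> nB x" "b \<in> nB x"
  then obtain c d where *: "a \<in> Q x" "b \<in> Q x" "c \<in> TZ l x" "d \<in> TZ l x"
    "a + th c \<in> Q0 x" "b + th d \<in> Q0 x" by (auto simp: nB_def)
  have "(a + th c) + (b + th d) \<in> Q0 x" by (rule kv.subspace_add[OF sub_Q0 *(5,6)])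
  then have "(a + b) + th (c + d) \<in> Q0 x" by (simp add: lin_add[OF lin_th] ac_simps)
  then show "a + b \<in> nB x" unfolding nB_def
    using kv.subspace_add[OF sub_Q *(1,2)] kv.subspace_add[OF sub_TZ *(3,4)] by blast
next
  fix r a assume "a \<in> nB x"
  then obtain c where *: "a \<in> Q x" "c \<in> TZ l x" "a + th c \<in> Q0 x" by (auto simp: nB_def)
  have "r \<cdot> (a + th c) \<in> Q0 x" by (rule kv.subspace_scale[OF sub_Q0 *(3)])
  then have "r \<cdot> a + th (r \<cdot> c) \<in> Q0 x" by (simp add: lin_scale[OF lin_th] sc_right)
  then show "r \<cdot> a \<in> nB x" unfolding nB_def
    using kv.subspace_scale[OF sub_Q *(1)] kv.subspace_scale[OF sub_TZ *(2)] by blast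
qed

lemma Q0_nB: "Q0 x \<subseteq> nB x"
  unfolding nB_def using Q0_Q kv.subspace_0[OF sub_TZ] by (auto intro!: bexI[of _ 0] simp: lin_0[OF lin_th])

text \<open>Exactness at rank \<open>rk c\<close> writes an element of the stalk at \<open>c\<close>
  as a sum of elements from the covers of \<open>c\<close>; repeating this reaches rank
  \<open>k\<close>.\<close>

lemma surj:
  assumes "c \<in> X" "rk c \<le> k" "a \<in> Z c"
  shows "\<exists>b\<in>Q c. a + sg b \<in> B c"
  using assms
proof (induction "k - rk c" arbitrary: c a)
  case 0
  then have k: "rk c = k" by simp
  have "sng c a \<in> Q c"
  proof (rule QS_I)
    fix y assume "y \<in> X" "c \<preceq> y" "rk y \<in> {k}"
    then show "sng c a y \<in> Z y" using rk_less[of c y] 0 k by (auto simp: sng_def)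
  qed (use 0 k in \<open>auto simp: sng_def\<close>)
  moreover have "sg (sng c a) = a" using 0 k fin by (simp add: sg_def sng_def)
  ultimately show ?case using kv.subspace_0[OF sB, of c] 0 lm by (auto intro!: bexI[of _ "sng c a"])
next
  case (Suc n)
  have rc: "rk c < k" using Suc by simp
  have ex: "exa (\<preceq>) rk (up c) Z B (rk c)" by (rule exZ) (use Suc rc lm in auto)
  \<comment> \<open>The chain concentrated at \<open>c\<close>; \<open>up c\<close> has no lower
    ranks, so it is a cycle.\<close>
  have 1: "(if w = c then a else 0) \<in> Z w" if "w \<in> up c" "rk w = rk c" for w
    using that rk_less[of c w] Suc.prems by (auto simp: up_def)
  have 2: "bd (\<preceq>) rk (up c) (\<lambda>w. if w = c then a else 0) w \<in> B w" if "w \<in> up c" "Suc (rk w) = rk c" for w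
    using that rk_le[of c w] Suc.prems by (auto simp: up_def)
  obtain g where g: "\<And>w. w \<in> up c ==> rk w = Suc (rk c) ==> g w \<in> Z w"
    "\<And>w. w \<in> up c ==> rk w = rk c ==> (if w = c then a else 0) + bd (\<preceq>) rk (up c) g w \<in> B w"
    using exaD[OF ex 1 2] by metis
  let ?W = "{w\<in>X. c \<preceq> w \<and> rk w = Suc (rk c)}"
  have "\<forall>w. \<exists>b. w \<in> ?W \<longrightarrow> b \<in> Q w \<and> g w + sg b \<in> B w"
  proof (intro allI)
    fix w show "\<exists>b. w \<in> ?W \<longrightarrow> b \<in> Q w \<and> g w + sg b \<in> B w"
    proof (cases "w \<in> ?W")
      case True
      then have "n = k - rk w" using Suc.hyps(2) by simp
      then show ?thesis using Suc.hyps(1)[of w "g w"] g(1)[of w] rc True by (auto simp: up_def)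
    next
      case False
      then show ?thesis by blast
    qed
  qed
  from choice[OF this] obtain b where bb: "\<forall>w. w \<in> ?W \<longrightarrow> b w \<in> Q w \<and> g w + sg (b w) \<in> B w" ..
  then have b: "\<And>w. w \<in> ?W ==> b w \<in> Q w" "\<And>w. w \<in> ?W ==> g w + sg (b w) \<in> B w" by simp_all
  have bQ: "(\<Sum>w\<in>?W. b w) \<in> Q c"
    by (rule kv.subspace_sum[OF sub_Q]) (use b(1) Q_anti Suc.prems in blast)
  have cc: "a + bd (\<preceq>) rk (up c) g c \<in> B c" using g(2)[of c] Suc.prems by (simp add: up_def)
  have eq: "bd (\<preceq>) rk (up c) g c = (\<Sum>w\<in>?W. g w)" using bd_up[of c c] Suc.prems by (simp add: bd_def up_def)
  have mk: "rk w \<le> m" if "w \<in> ?W" for w using that rc lm by auto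
  have "(\<Sum>w\<in>?W. g w + sg (b w)) \<in> B c"
  proof (rule kv.subspace_sum[OF sB])
    fix w assume w: "w \<in> ?W"
    then have "B w \<subseteq> B c" using Banti[of c w] Suc.prems mk[OF w] by simp
    then show "g w + sg (b w) \<in> B c" using b(2)[OF w] by blast
  qed (use Suc.prems rc lm in auto)
  then have "(\<Sum>w\<in>?W. g w) + sg (\<Sum>w\<in>?W. b w) \<in> B c" by (simp add: sum.distrib kvp.linear_sum[OF lin_sg])
  then have "(a + (\<Sum>w\<in>?W. g w)) + ((\<Sum>w\<in>?W. g w) + sg (\<Sum>w\<in>?W. b w)) \<in> B c"
    using cc eq Suc.prems lm by (rule_tac kv.subspace_add[OF sB]) auto
  also have "(a + (\<Sum>w\<in>?W. g w)) + ((\<Sum>w\<in>?W. g w) + sg (\<Sum>w\<in>?W. b w))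
     = a + ((\<Sum>w\<in>?W. g w) + (\<Sum>w\<in>?W. g w)) + sg (\<Sum>w\<in>?W. b w)" by (simp only: add.assoc)
  finally show ?case using bQ by auto
qed

text \<open>\<open>nZ\<close>/\<open>Q0\<close> is the kernel of \<open>sg\<close> onto the stalks
  of the given sheaf, so \<open>exa_ker\<close> applies. The bound \<open>i < l\<close> makes
  \<open>surj\<close> available at rank \<open>i + 2\<close>.\<close>

lemma exa_nZ_Q0:
  assumes x: "x \<in> X" and i: "rk x \<le> i" "i < l"
  shows "exa (\<preceq>) rk (up x) nZ Q0 i"
  unfolding nZ_def
proof (rule exa_ker[where F = Z and BF = B])
  show "exa (\<preceq>) rk (up x) Q Q0 i"
    by (rule exa_QS[OF ac1 x]) (use i lm sZ sB BZ in auto)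
  show "exa (\<preceq>) rk (up x) Z B (Suc i)" using exZ[OF x] i lm by simp
  show "lin sg" by (rule lin_sg)
  show "dd0 (\<preceq>) rk (up x)" by (rule dd0_up[OF eul x])
  show "kv.subspace (Q c)" for c by (rule sub_Q)
  show "kv.subspace (B c)" if "c \<in> up x" "rk c \<le> Suc (Suc i)" for c using that sB[of c] i lm by (simp add: up_def)
  show "Q w \<subseteq> Q c" if "c \<in> up x" "w \<in> up x" "c \<preceq> w" for c w using that Q_anti by (simp add: up_def)
  show "B w \<subseteq> B c" if "c \<in> up x" "w \<in> up x" "c \<preceq> w" "rk w \<le> Suc (Suc i)" for c w
    using that Banti[of c w] i lm by (simp add: up_def)
  show "sg a \<in> Z c" if "c \<in> up x" "rk c \<le> Suc i" "a \<in> Q c" for c a using that sg_Q[of c a] i lm by (simp add: up_def)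
  show "sg a \<in> B c" if "c \<in> up x" "rk c \<le> i" "a \<in> Q0 c" for c a using that sg_Q0[of c a] i lm by (simp add: up_def)
  show "\<exists>b\<in>Q c. a + sg b \<in> B c" if "c \<in> up x" "rk c = Suc (Suc i)" "a \<in> Z c" for c a
    using that surj[of c a] i by (simp add: up_def)
qed

text \<open>By \<open>th_refl\<close> and \<open>th_pres\<close>, \<open>th\<close> induces an
  isomorphism of \<open>TZ l\<close>/\<open>TB l\<close> onto
  \<open>nB\<close>/\<open>Q0\<close>.\<close>

lemma exa_nB_Q0:
  assumes x: "x \<in> X" and i: "rk x \<le> i" "i < l"
  shows "exa (\<preceq>) rk (up x) nB Q0 i"
proof (rule exa_transport[where A = "TZ l" and B = "TB l" and \<theta> = th])
  show "exa (\<preceq>) rk (up x) (TZ l) (TB l) i" using exa_TZ_TB[OF x] i lm by simp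
  show "lin th" by (rule lin_th)
  show "finite (up x)" using fin by (simp add: up_def)
  show "th a \<in> nB c" if "c \<in> up x" "a \<in> TZ l c" for c a
    unfolding nB_def using th_Q[OF upX[OF that(1)] that(2)] that kv.subspace_0[OF sub_Q0] by (auto intro!: bexI[of _ a])
  show "\<exists>b\<in>TZ l c. a + th b \<in> Q0 c" if "a \<in> nB c" for c a using that by (auto simp: nB_def)
  show "a \<in> TB l c" if "c \<in> up x" "a \<in> TZ l c" "th a \<in> Q0 c" for c a using th_refl[OF upX[OF that(1)] that(2,3)] .
  show "th a \<in> Q0 c" if "c \<in> up x" "a \<in> TB l c" for c a using th_pres[OF upX[OF that(1)] that(2)] .
qed (use TZ_anti Q0_anti in \<open>auto simp: sub_TZ sub_Q0 up_def\<close>)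

lemma exa_nZ_nB:
  assumes x: "x \<in> X" and i: "i < l"
  shows "exa (\<preceq>) rk (up x) nZ nB i"
proof (cases "rk x \<le> i")
  case False
  show ?thesis by (rule exa_trivial[OF x]) (use False i lm kv.subspace_0[OF sub_nZ] in \<open>auto simp: up_def\<close>)
next
  case True
  show ?thesis
  proof (rule exa_quot[OF exa_nZ_Q0[OF x True i]])
    show "exa (\<preceq>) rk (up x) nB Q0 i'" if "i = Suc i'" for i'
    proof (cases "rk x \<le> i'")
      case T: True
      then show ?thesis using exa_nB_Q0[OF x T] that i by simp
    next
      case False
      then show ?thesis by (intro exa_trivial[OF x]) (auto simp: kv.subspace_0[OF sub_nB])
    qed
    show "dd0 (\<preceq>) rk (up x)" by (rule dd0_up[OF eul x])
  qed (use i lm sub_nZ nB_nZ Q0_nB in \<open>auto simp: sub_Q0 sub_nB up_def\<close>)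
qed

text \<open>With N the dimension of \<open>Q\<close>/\<open>Q0\<close> and t that of
  \<open>nB\<close>/\<open>Q0\<close>, the homology has dimension N - f x - t, and the alternating
  sum equals N - t.\<close>

lemma qd_n:
  assumes x: "x \<in> X" "rk x \<le> l"
  shows "\<exists>n. qd (nZ x) (nB x) n \<and>
    int n = (\<Sum>y\<in>{y\<in>X. x \<preceq> y \<and> rk y \<le> k}. (-1) ^ (k - rk y) * int (f y)) - int (f x)"
proof -
  have xm: "rk x \<le> m" using x lm by simp
  let ?N = "\<Sum>y\<in>{y\<in>X. x \<preceq> y \<and> rk y \<in> {k}}. f y"
  have qQ: "qd (Q x) (Q0 x) ?N" by (rule qd_QS) (use sZ sB BZ qdZ lm in auto)
  have Q0nZ: "Q0 x \<subseteq> nZ x" using Q0_nB nB_nZ[OF x(1) xm] by blast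
  have nZQ: "nZ x \<subseteq> Q x" by (auto simp: nZ_def)
  obtain b where b: "qd (Q x) (nZ x) b" using qd_quot_ex[OF sub_nZ[OF x(1) xm] sub_Q0 Q0nZ qQ] by blast
  have "qd (Z x) (B x) b"
  proof (rule qd_iso[OF lin_sg sB[OF x(1) xm] sub_Q _ _ _ _ b])
    show "sg z \<in> Z x" if "z \<in> Q x" for z using sg_Q[OF x(1) xm that] .
    show "\<exists>z\<in>Q x. z' + sg z \<in> B x" if "z' \<in> Z x" for z' using surj[OF x(1) _ that] x by simp
  qed (auto simp: nZ_def)
  then have bf: "b = f x" using qd_unique[OF sB[OF x(1) xm]] qdZ[OF x(1) xm] by blast
  have q1: "b \<le> ?N" "qd (nZ x) (Q0 x) (?N - b)"
    using qd_sub[OF sub_nZ[OF x(1) xm] sub_Q0 Q0nZ nZQ qQ b] by auto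
  obtain t where t: "qd (TZ l x) (TB l x) t"
    "int t = (\<Sum>y\<in>{y\<in>X. x \<preceq> y \<and> rk y \<le> l}. (-1) ^ (l - rk y) * int (f y))"
    using qd_TZ_TB[OF x(1,2)] lm by auto
  have q2: "qd (nB x) (Q0 x) t"
  proof (rule qd_iso[OF lin_th sub_Q0 sub_TZ _ _ _ _ t(1)])
    show "th z \<in> nB x" if "z \<in> TZ l x" for z
      unfolding nB_def using th_Q[OF x(1) that] that kv.subspace_0[OF sub_Q0] by (auto intro!: bexI[of _ z])
    show "\<exists>z\<in>TZ l x. z' + th z \<in> Q0 x" if "z' \<in> nB x" for z' using that by (auto simp: nB_def)
    show "z \<in> TB l x" if "z \<in> TZ l x" "th z \<in> Q0 x" for z using th_refl[OF x(1) that] .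
    show "th z \<in> Q0 x" if "z \<in> TB l x" for z using th_pres[OF x(1) that] .
  qed
  have q3: "t \<le> ?N - b" "qd (nZ x) (nB x) (?N - b - t)"
    using qd_quot[OF sub_nB sub_Q0 Q0_nB nB_nZ[OF x(1) xm] q1(2) q2] by auto
  have eq: "{y\<in>X. x \<preceq> y \<and> rk y \<le> k} = {y\<in>X. x \<preceq> y \<and> rk y \<in> {k}} \<union> {y\<in>X. x \<preceq> y \<and> rk y \<le> l}" by auto
  have "(\<Sum>y\<in>{y\<in>X. x \<preceq> y \<and> rk y \<le> k}. (-1) ^ (k - rk y) * int (f y))
    = (\<Sum>y\<in>{y\<in>X. x \<preceq> y \<and> rk y \<in> {k}}. (-1) ^ (k - rk y) * int (f y))
    + (\<Sum>y\<in>{y\<in>X. x \<preceq> y \<and> rk y \<le> l}. (-1) ^ (k - rk y) * int (f y))"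
    unfolding eq using fin by (subst sum.union_disjoint) auto
  also have "(\<Sum>y\<in>{y\<in>X. x \<preceq> y \<and> rk y \<in> {k}}. (-1) ^ (k - rk y) * int (f y)) = int ?N" by simp
  also have "(\<Sum>y\<in>{y\<in>X. x \<preceq> y \<and> rk y \<le> l}. (-1) ^ (k - rk y) * int (f y)) = - int t"
    unfolding t(2) sum_negf[symmetric] by (rule sum.cong) (auto simp: Suc_diff_le)
  finally show ?thesis using q1 q3 bf by (intro exI[of _ "?N - b - t"]) auto
qed

lemma step_CM:
  "\<exists>f'. CM l nZ nB f' \<and> (\<forall>x\<in>X. rk x \<le> l \<longrightarrow>
    int (f' x) = (\<Sum>y\<in>{y\<in>X. x \<preceq> y \<and> rk y \<le> k}. (-1) ^ (k - rk y) * int (f y)) - int (f x))"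
proof -
  have "\<forall>x. \<exists>n. x \<in> X \<and> rk x \<le> l \<longrightarrow> qd (nZ x) (nB x) n \<and>
    int n = (\<Sum>y\<in>{y\<in>X. x \<preceq> y \<and> rk y \<le> k}. (-1) ^ (k - rk y) * int (f y)) - int (f x)"
    using qd_n by blast
  from choice[OF this] obtain f' where f: "\<forall>x. x \<in> X \<and> rk x \<le> l \<longrightarrow> qd (nZ x) (nB x) (f' x) \<and>
    int (f' x) = (\<Sum>y\<in>{y\<in>X. x \<preceq> y \<and> rk y \<le> k}. (-1) ^ (k - rk y) * int (f y)) - int (f x)" ..
  have nZanti: "nZ y \<subseteq> nZ x" if "x \<in> X" "y \<in> X" "x \<preceq> y" "rk y \<le> l" for x y
    using Q_anti[OF that(1-3)] Banti[OF that(1-3)] that(4) lm by (auto simp: nZ_def)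
  have nBanti: "nB y \<subseteq> nB x" if "x \<in> X" "y \<in> X" "x \<preceq> y" for x y
    using Q_anti[OF that] Q0_anti[OF that] TZ_anti[OF that] unfolding nB_def by blast
  have lm': "rk x \<le> m" if "rk x \<le> l" for x using that lm by simp
  have "CM l nZ nB f'" unfolding CM_def
  proof (intro conjI ballI impI)
    fix x assume x: "x \<in> X" "rk x \<le> l"
    show "kv.subspace (nZ x)" by (rule sub_nZ[OF x(1) lm'[OF x(2)]])
    show "kv.subspace (nB x)" by (rule sub_nB)
    show "nB x \<subseteq> nZ x" by (rule nB_nZ[OF x(1) lm'[OF x(2)]])
    show "qd (nZ x) (nB x) (f' x)" using f x by blast
  qed (use nZanti nBanti exa_nZ_nB in blast)+
  moreover have "\<forall>x\<in>X. rk x \<le> l \<longrightarrow>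
    int (f' x) = (\<Sum>y\<in>{y\<in>X. x \<preceq> y \<and> rk y \<le> k}. (-1) ^ (k - rk y) * int (f y)) - int (f x)"
    using f by blast
  ultimately show ?thesis by blast
qed

end

section \<open>The cd-index as a recursion over a poset\<close>

context rposet begin

text \<open>The sum of the weights of all chains from \<open>b\<close> to \<open>y\<close> in which
  \<open>y\<close> contributes a final letter b: z is the last element before \<open>y\<close>, and
  every rank strictly between contributes a - b. \<open>psi\<close> omits the final letter and is
  the ab-index of the interval. The conjunct \<open>y \<in> X\<close> empties the sum off the poset,
  so that the rank drops in every recursive call.\<close>

function pt :: "'p => 'p => ab_poly" where
  "pt b y = (if y = b then 1 else
     (\<Sum>z\<in>{z \<in> X. y \<in> X \<and> b \<preceq> z \<and> z \<preceq> y \<and> z \<noteq> y}. pt b z * pJ ^ (rk y - 1 - rk z)) * poly_b)"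
  by auto
termination
  by (relation "measure (\<lambda>(b, y). rk y)") (auto intro: rk_less)

declare pt.simps [simp del]

definition psi :: "'p => 'p => ab_poly" where
  "psi b y = (\<Sum>z\<in>{z \<in> X. b \<preceq> z \<and> z \<preceq> y \<and> z \<noteq> y}. pt b z * pJ ^ (rk y - 1 - rk z))"

lemma pt_self [simp]: "pt b b = 1" by (simp add: pt.simps)

lemma pt_psi: "y \<in> X ==> y \<noteq> b ==> pt b y = psi b y * poly_b"
  by (subst pt.simps) (simp add: psi_def)

text \<open>The ab-index of a sheaf with stalk dimensions \<open>f\<close>: chains may end at any y
  of rank at most \<open>m\<close>, are weighted by \<open>f y\<close> and are padded with a - b up
  to rank \<open>m\<close>.\<close>

definition hh :: "'p => nat => ('p => int) => ab_poly" where
  "hh b m f = (\<Sum>y\<in>{y\<in>X. b \<preceq> y \<and> rk y \<le> m}. of_int (f y) * (pt b y * pJ ^ (m - rk y)))"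

text \<open>The alternating sum of \<open>qd_TZ_TB\<close> as an operation on dimension functions:
  the dimensions of the dual sheaf.\<close>

definition dual :: "nat => ('p => int) => 'p => int" where
  "dual m f x = (\<Sum>y\<in>{y\<in>X. x \<preceq> y \<and> rk y \<le> m}. (-1) ^ (m - rk y) * f y)"

text \<open>The stalk dimensions that one step of the resolution produces; compare
  \<open>step_CM\<close>.\<close>

definition nk :: "nat => ('p => int) => 'p => int" where
  "nk m f x = dual m f x - f x"

text \<open>Write a as b + (a - b): the first summand lets the chain end in \<open>y\<close>, the
  second lengthens the last gap.\<close>

lemma psi_step:
  assumes "b \<in> X" "y \<in> X" "b \<preceq> y" "b \<noteq> y"
  shows "psi b y * poly_a = (\<Sum>v\<in>{v\<in>X. b \<preceq> v \<and> v \<preceq> y}. pt b v * pJ ^ (rk y - rk v))"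
proof -
  let ?V = "{v \<in> X. b \<preceq> v \<and> v \<preceq> y \<and> v \<noteq> y}"
  have eq: "{v\<in>X. b \<preceq> v \<and> v \<preceq> y} = insert y ?V" using assms by auto
  have "psi b y * poly_a = psi b y * poly_b + psi b y * pJ" by (simp add: pJ_def algebra_simps)
  also have "psi b y * pJ = (\<Sum>v\<in>?V. pt b v * pJ ^ (rk y - rk v))"
    unfolding psi_def sum_distrib_right
  proof (rule sum.cong[OF HOL.refl])
    fix v assume v: "v \<in> ?V"
    then have "rk v < rk y" using assms by (auto intro: rk_less)
    then have "rk y - rk v = Suc (rk y - 1 - rk v)" by simp
    then show "pt b v * pJ ^ (rk y - 1 - rk v) * pJ = pt b v * pJ ^ (rk y - rk v)"
      by (simp only: power_Suc2 mult.assoc)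
  qed
  finally show ?thesis unfolding eq using fin assms by (subst sum.insert) (auto simp: pt_psi)
qed

lemma bar_pt:
  assumes "b \<in> X" "y \<in> X" "b \<preceq> y" and psi: "b \<noteq> y ==> bar (psi b y) = psi b y"
  shows "bar (pt b y * pJ ^ e) = (-1) ^ e * (\<Sum>v\<in>{v\<in>X. b \<preceq> v \<and> v \<preceq> y}. pt b v * pJ ^ (rk y - rk v + e))"
proof -
  have "bar (pt b y) = (\<Sum>v\<in>{v\<in>X. b \<preceq> v \<and> v \<preceq> y}. pt b v * pJ ^ (rk y - rk v))"
  proof (cases "b = y")
    case True
    then have "{v\<in>X. b \<preceq> v \<and> v \<preceq> y} = {b}" using antisym assms by auto
    then show ?thesis using True by simp
  next
    case False
    then have "bar (pt b y) = psi b y * poly_a" using assms by (simp add: pt_psi bar_b psi)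
    then show ?thesis using psi_step False assms by simp
  qed
  then show ?thesis by (simp add: bar_J_pow sum_distrib_right mult.assoc power_add)
qed

lemma hh_cong:
  assumes "\<And>y. y \<in> X ==> b \<preceq> y ==> rk y \<le> m ==> f y = g y" shows "hh b m f = hh b m g"
  unfolding hh_def by (rule sum.cong) (use assms in auto)

lemma bar_of_int: "bar (of_int x * p) = of_int x * bar p"
proof (rule poly_mapping_eqI)
  have l: "Poly_Mapping.lookup (of_int x * p) w = x * Poly_Mapping.lookup p w" for p :: ab_poly and w
  proof (induction x)
    case (nonneg n)
    show ?case by (induction n) (auto simp: distrib_right lookup_add)
  next
    case (neg n)
    have "of_int (- int (Suc n)) * p = - (of_nat (Suc n) * p)" by (simp add: algebra_simps)
    moreover have "Poly_Mapping.lookup (of_nat m * p) w = int m * Poly_Mapping.lookup p w" for m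
      by (induction m) (auto simp: distrib_right lookup_add)
    ultimately show ?case by (simp del: of_nat_Suc)
  qed
  show "Poly_Mapping.lookup (bar (of_int x * p)) w = Poly_Mapping.lookup (of_int x * bar p) w" for w
    by (simp add: lookup_bar l)
qed

text \<open>\<open>bar\<close> turns the final b of a chain into a, which by \<open>psi_step\<close>
  becomes a sum over all ends v below y. Each a - b contributes a sign, and exchanging the sums over
  y and v produces \<open>dual\<close>.\<close>

lemma bar_hh:
  assumes b: "b \<in> X" and psi: "\<And>y. y \<in> X ==> b \<preceq> y ==> b \<noteq> y ==> rk y \<le> m ==> bar (psi b y) = psi b y"
  shows "bar (hh b m f) = hh b m (dual m f)"
proof -
  let ?Y = "{y\<in>X. b \<preceq> y \<and> rk y \<le> m}"
  have fY: "finite ?Y" using fin by simp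
  have "bar (hh b m f) = (\<Sum>y\<in>?Y. of_int (f y) * ((-1) ^ (m - rk y) * (\<Sum>v\<in>{v\<in>X. b \<preceq> v \<and> v \<preceq> y}. pt b v * pJ ^ (rk y - rk v + (m - rk y)))))"
    unfolding hh_def bar_sum bar_of_int
    by (rule sum.cong[OF HOL.refl]) (use b psi bar_pt in auto)
  also have "\<dots> = (\<Sum>y\<in>?Y. \<Sum>v\<in>?Y. if v \<preceq> y then of_int ((-1) ^ (m - rk y) * f y) * (pt b v * pJ ^ (m - rk v)) else 0)"
  proof (rule sum.cong[OF HOL.refl])
    fix y assume y: "y \<in> ?Y"
    have eq: "{v\<in>X. b \<preceq> v \<and> v \<preceq> y} = {v\<in>?Y. v \<preceq> y}" using y rk_le[of _ y] by fastforce
    have "of_int (f y) * ((-1) ^ (m - rk y) * (\<Sum>v\<in>{v\<in>X. b \<preceq> v \<and> v \<preceq> y}. pt b v * pJ ^ (rk y - rk v + (m - rk y))))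
      = (\<Sum>v\<in>{v\<in>?Y. v \<preceq> y}. of_int ((-1) ^ (m - rk y) * f y) * (pt b v * pJ ^ (m - rk v)))"
      unfolding eq sum_distrib_left
    proof (rule sum.cong[OF HOL.refl])
      fix v assume v: "v \<in> {v\<in>?Y. v \<preceq> y}"
      have "rk v \<le> rk y" using v y rk_le by simp
      then have e: "rk y - rk v + (m - rk y) = m - rk v" using y by simp
      have "(of_int ((-1) ^ (m - rk y) * f y) :: ab_poly) = of_int (f y) * (-1) ^ (m - rk y)"
        by (simp add: mult.commute[of "(-1) ^ (m - rk y)" "f y"])
      then show "of_int (f y) * ((-1) ^ (m - rk y) * (pt b v * pJ ^ (rk y - rk v + (m - rk y))))
        = of_int ((-1) ^ (m - rk y) * f y) * (pt b v * pJ ^ (m - rk v))"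
        unfolding e by (simp only: mult.assoc)
    qed
    then show "of_int (f y) * ((-1) ^ (m - rk y) * (\<Sum>v\<in>{v\<in>X. b \<preceq> v \<and> v \<preceq> y}. pt b v * pJ ^ (rk y - rk v + (m - rk y))))
      = (\<Sum>v\<in>?Y. if v \<preceq> y then of_int ((-1) ^ (m - rk y) * f y) * (pt b v * pJ ^ (m - rk v)) else 0)"
      using fY by (simp only: sum.inter_filter)
  qed
  also have "\<dots> = (\<Sum>v\<in>?Y. \<Sum>y\<in>?Y. if v \<preceq> y then of_int ((-1) ^ (m - rk y) * f y) * (pt b v * pJ ^ (m - rk v)) else 0)"
    by (rule sum.swap)
  also have "\<dots> = hh b m (dual m f)" unfolding hh_def
  proof (rule sum.cong[OF HOL.refl])
    fix v assume v: "v \<in> ?Y"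
    have eq: "{y\<in>X. v \<preceq> y \<and> rk y \<le> m} = {y\<in>?Y. v \<preceq> y}" using v trans[OF b] by auto
    show "(\<Sum>y\<in>?Y. if v \<preceq> y then of_int ((-1) ^ (m - rk y) * f y) * (pt b v * pJ ^ (m - rk v)) else 0)
      = of_int (dual m f v) * (pt b v * pJ ^ (m - rk v))"
      unfolding dual_def eq of_int_sum sum_distrib_right using fY by (simp only: sum.inter_filter)
  qed
  finally show ?thesis .
qed

text \<open>The stalk dimensions of the constant sheaf on the elements strictly below
  \<open>t\<close>.\<close>

definition below :: "'p => 'p => int" where "below t z = (if z \<preceq> t \<and> z \<noteq> t then 1 else 0)"

lemma psi_hh:
  assumes "t \<in> X" shows "psi b t = hh b (rk t - 1) (below t)"
proof -
  have "hh b (rk t - 1) (below t) = (\<Sum>y\<in>{y\<in>X. b \<preceq> y \<and> rk y \<le> rk t - 1}. if y \<preceq> t \<and> y \<noteq> t then pt b y * pJ ^ (rk t - 1 - rk y) else 0)"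
    unfolding hh_def by (rule sum.cong) (auto simp: below_def)
  also have "\<dots> = (\<Sum>y\<in>{y\<in>{y\<in>X. b \<preceq> y \<and> rk y \<le> rk t - 1}. y \<preceq> t \<and> y \<noteq> t}. pt b y * pJ ^ (rk t - 1 - rk y))"
    by (rule sum.inter_filter[symmetric]) (use fin in simp)
  also have "{y\<in>{y\<in>X. b \<preceq> y \<and> rk y \<le> rk t - 1}. y \<preceq> t \<and> y \<noteq> t} = {z \<in> X. b \<preceq> z \<and> z \<preceq> t \<and> z \<noteq> t}"
    using rk_less[of _ t] assms by force
  finally show ?thesis by (simp add: psi_def)
qed

lemma minus_one_sq: "(-1::int) ^ k * (-1) ^ k = 1"
  by (simp add: power_mult_distrib[symmetric])

lemma minus_one_diff: "a \<le> (m::nat) ==> (-1::int) ^ (m - a) = (-1) ^ m * (-1) ^ a"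
proof -
  assume "a \<le> m"
  then obtain d where m: "m = a + d" by (metis le_Suc_ex)
  have "(-1::int) ^ a * (-1) ^ a = 1" by (rule minus_one_sq)
  then show ?thesis unfolding m by (simp add: power_add mult.assoc mult.left_commute)
qed

lemma eul_sum: "eulerian ==> x \<in> X ==> z \<in> X ==> x \<preceq> z ==> x \<noteq> z ==> (\<Sum>y\<in>{y\<in>X. x \<preceq> y \<and> y \<preceq> z}. (-1) ^ rk y) = (0::int)"
  unfolding eulerian_def ivl_def by blast

text \<open>For \<open>x\<close> strictly below \<open>t\<close> this is the Eulerian relation of
  the interval from \<open>x\<close> to \<open>t\<close>, solved for the term of
  \<open>t\<close>.\<close>

lemma dual_below:
  assumes eul: eulerian and t: "t \<in> X" and x: "x \<in> X"
  shows "dual (rk t - 1) (below t) x = below t x"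
proof -
  let ?V = "{z\<in>X. x \<preceq> z \<and> z \<preceq> t \<and> z \<noteq> t}"
  have "dual (rk t - 1) (below t) x = (\<Sum>y\<in>{y\<in>X. x \<preceq> y \<and> rk y \<le> rk t - 1}. if y \<preceq> t \<and> y \<noteq> t then (-1) ^ (rk t - 1 - rk y) else 0)"
    unfolding dual_def by (rule sum.cong) (auto simp: below_def)
  also have "\<dots> = (\<Sum>y\<in>{y\<in>{y\<in>X. x \<preceq> y \<and> rk y \<le> rk t - 1}. y \<preceq> t \<and> y \<noteq> t}. (-1) ^ (rk t - 1 - rk y))"
    by (rule sum.inter_filter[symmetric]) (use fin in simp)
  also have "{y\<in>{y\<in>X. x \<preceq> y \<and> rk y \<le> rk t - 1}. y \<preceq> t \<and> y \<noteq> t} = ?V"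
    using rk_less[of _ t] t by force
  also have "(\<Sum>y\<in>?V. (-1) ^ (rk t - 1 - rk y)) = (\<Sum>y\<in>?V. (-1::int) ^ (rk t - 1) * (-1) ^ rk y)"
  proof (rule sum.cong[OF HOL.refl], rule minus_one_diff)
    fix y assume "y \<in> ?V"
    then show "rk y \<le> rk t - 1" using rk_less[of y t] t by auto
  qed
  finally have d: "dual (rk t - 1) (below t) x = (-1) ^ (rk t - 1) * (\<Sum>y\<in>?V. (-1) ^ rk y)"
    by (simp add: sum_distrib_left)
  show ?thesis
  proof (cases "x \<preceq> t \<and> x \<noteq> t")
    case True
    have eq: "{y\<in>X. x \<preceq> y \<and> y \<preceq> t} = insert t ?V" using t True by auto
    have "(\<Sum>y\<in>insert t ?V. (-1) ^ rk y) = (0::int)"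
      using eul_sum[OF eul x t] True unfolding eq by blast
    then have "0 = (-1::int) ^ rk t + (\<Sum>y\<in>?V. (-1) ^ rk y)" using fin by simp
    moreover have "rk t = Suc (rk t - 1)" using rk_less[OF x t] True by simp
    then have "(-1::int) ^ rk t = - ((-1) ^ (rk t - 1))" by (metis power_Suc mult_minus1)
    ultimately have s: "(\<Sum>y\<in>?V. (-1) ^ rk y) = (-1::int) ^ (rk t - 1)" by simp
    have "dual (rk t - 1) (below t) x = (-1) ^ (rk t - 1) * (-1) ^ (rk t - 1)"
      by (rule HOL.trans[OF d arg_cong[OF s, of "\<lambda>z. (-1) ^ (rk t - 1) * z"]])
    also have "\<dots> = 1" by (rule minus_one_sq)
    also have "1 = below t x" unfolding below_def by (rule if_P[OF True, symmetric])
    finally show ?thesis .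
  next
    case False
    have "z \<notin> ?V" for z
    proof
      assume z: "z \<in> ?V"
      then have "x \<preceq> t" using trans[OF x _ t, of z] by simp
      with False have "x = t" by simp
      with z antisym[OF x, of z] show False by simp
    qed
    then have "?V = {}" by blast
    then have "(\<Sum>y\<in>?V. (-1::int) ^ rk y) = 0" by (simp only: sum.empty)
    with d have "dual (rk t - 1) (below t) x = 0" by (simp only: mult_zero_right)
    moreover have "below t x = 0" unfolding below_def by (rule if_not_P[OF False])
    ultimately show ?thesis by simp
  qed
qed

text \<open>Induction on the rank of \<open>t\<close>: invariance at lower ranks gives
  \<open>bar_hh\<close>, and \<open>below t\<close> is self-dual.\<close>

lemma bar_psi:
  assumes eul: eulerian and b: "b \<in> X" and t: "t \<in> X" "b \<preceq> t" "b \<noteq> t"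
  shows "bar (psi b t) = psi b t"
  using t
proof (induction "rk t" arbitrary: t rule: less_induct)
  case less
  have "bar (psi b t) = hh b (rk t - 1) (dual (rk t - 1) (below t))"
    unfolding psi_hh[OF less.prems(1)]
  proof (rule bar_hh[OF b])
    fix y assume y: "y \<in> X" "b \<preceq> y" "b \<noteq> y" "rk y \<le> rk t - 1"
    have "rk b < rk t" using rk_less b less.prems by blast
    then show "bar (psi b y) = psi b y" using less.hyps[of y] y by simp
  qed
  also have "\<dots> = psi b t" unfolding psi_hh[OF less.prems(1)]
    by (rule hh_cong) (use dual_below[OF eul less.prems(1)] in auto)
  finally show ?case .
qed

text \<open>Moebius inversion: in an Eulerian poset the Moebius function is (-1) to the power of the
  rank difference.\<close>

lemma dual_dual:
  assumes eul: eulerian and x: "x \<in> X" "rk x \<le> m"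
  shows "dual m (dual m f) x = f x"
proof -
  let ?Y = "{y\<in>X. x \<preceq> y \<and> rk y \<le> m}"
  have fY: "finite ?Y" using fin by simp
  have "dual m (dual m f) x = (\<Sum>y\<in>?Y. \<Sum>w\<in>?Y. if y \<preceq> w then (-1) ^ (m - rk y) * ((-1) ^ (m - rk w) * f w) else 0)"
    unfolding dual_def
  proof (rule sum.cong[OF HOL.refl])
    fix y assume y: "y \<in> ?Y"
    have eq: "{w\<in>X. y \<preceq> w \<and> rk w \<le> m} = {w\<in>?Y. y \<preceq> w}" using y trans[OF x(1)] by auto
    show "(-1) ^ (m - rk y) * (\<Sum>w\<in>{w\<in>X. y \<preceq> w \<and> rk w \<le> m}. (-1) ^ (m - rk w) * f w)
       = (\<Sum>w\<in>?Y. if y \<preceq> w then (-1) ^ (m - rk y) * ((-1) ^ (m - rk w) * f w) else 0)"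
      unfolding eq sum_distrib_left using fY by (simp only: sum.inter_filter)
  qed
  also have "\<dots> = (\<Sum>w\<in>?Y. \<Sum>y\<in>?Y. if y \<preceq> w then (-1) ^ (m - rk y) * ((-1) ^ (m - rk w) * f w) else 0)"
    by (rule sum.swap)
  also have "\<dots> = (\<Sum>w\<in>?Y. if w = x then f x else 0)"
  proof (rule sum.cong[OF HOL.refl])
    fix w assume w: "w \<in> ?Y"
    have eq: "{y\<in>?Y. y \<preceq> w} = {y\<in>X. x \<preceq> y \<and> y \<preceq> w}" using w rk_le[of _ w] by fastforce
    have "(\<Sum>y\<in>?Y. if y \<preceq> w then (-1) ^ (m - rk y) * ((-1) ^ (m - rk w) * f w) else 0)
      = (\<Sum>y\<in>{y\<in>?Y. y \<preceq> w}. (-1) ^ (m - rk y) * ((-1) ^ (m - rk w) * f w))"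
      by (rule sum.inter_filter[symmetric, OF fY])
    also have "\<dots> = (\<Sum>y\<in>{y\<in>?Y. y \<preceq> w}. ((-1) ^ m * (-1) ^ rk y) * ((-1) ^ (m - rk w) * f w))"
      by (rule sum.cong[OF HOL.refl]) (simp add: minus_one_diff)
    also have "\<dots> = (-1) ^ m * ((-1) ^ (m - rk w) * f w) * (\<Sum>y\<in>{y\<in>X. x \<preceq> y \<and> y \<preceq> w}. (-1) ^ rk y)"
      unfolding eq sum_distrib_left by (rule sum.cong) (auto simp: mult_ac)
    also have "\<dots> = (if w = x then f x else 0)"
    proof (cases "w = x")
      case True
      have "{y\<in>X. x \<preceq> y \<and> y \<preceq> w} = {x}" using True x antisym by auto
      moreover have "(-1::int) ^ (m - rk x) = (-1) ^ m * (-1) ^ rk x" using x by (rule_tac minus_one_diff)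
      moreover note minus_one_sq
      ultimately show ?thesis using True by (simp add: mult_ac)
    next
      case False
      then show ?thesis using eul_sum[OF eul x(1), of w] w by auto
    qed
    finally show "(\<Sum>y\<in>?Y. if y \<preceq> w then (-1) ^ (m - rk y) * ((-1) ^ (m - rk w) * f w) else 0) = (if w = x then f x else 0)" .
  qed
  also have "\<dots> = f x" using x fY by simp
  finally show ?thesis .
qed

lemma dual_cong:
  assumes "\<And>y. y \<in> X ==> x \<preceq> y ==> rk y \<le> m ==> f y = g y" shows "dual m f x = dual m g x"
  unfolding dual_def by (rule sum.cong) (use assms in auto)

lemma dual_top: "x \<in> X ==> rk x = m ==> dual m f x = f x"
proof -
  assume x: "x \<in> X" "rk x = m"
  then have "{y\<in>X. x \<preceq> y \<and> rk y \<le> m} = {x}" using rk_less[of x] by force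
  then show ?thesis unfolding dual_def using x by simp
qed

lemma dual_Suc:
  assumes "x \<in> X" "rk x \<le> m" and g: "\<And>y. y \<in> X ==> rk y = Suc m ==> g y = 0"
  shows "dual (Suc m) g x = - dual m g x"
proof -
  have "dual (Suc m) g x = (\<Sum>y\<in>{y\<in>X. x \<preceq> y \<and> rk y \<le> m}. (-1) ^ (Suc m - rk y) * g y)"
    unfolding dual_def by (rule sum.mono_neutral_right) (use fin g in \<open>auto simp: le_Suc_eq\<close>)
  also have "\<dots> = - dual m g x" unfolding dual_def sum_negf[symmetric]
    by (rule sum.cong) (auto simp: Suc_diff_le)
  finally show ?thesis .
qed

lemma dual_diff: "dual m (\<lambda>x. f x - g x) x = dual m f x - dual m g x"
  by (simp add: dual_def algebra_simps sum_subtractf)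

text \<open>At rank \<open>Suc m\<close> the involution sends dual f - f to its negative. The
  function vanishes at rank \<open>Suc m\<close>, so passing to rank \<open>m\<close> changes the
  sign once more.\<close>

lemma nk_self_dual:
  assumes eul: eulerian and x: "x \<in> X" "rk x \<le> m"
  shows "dual m (nk (Suc m) f) x = nk (Suc m) f x"
proof -
  have "dual m (nk (Suc m) f) x = - dual (Suc m) (nk (Suc m) f) x"
    using dual_Suc[OF x, of "nk (Suc m) f"] by (simp add: nk_def dual_top)
  also have "dual (Suc m) (nk (Suc m) f) x = dual (Suc m) (dual (Suc m) f) x - dual (Suc m) f x"
    unfolding nk_def dual_diff ..
  also have "dual (Suc m) (dual (Suc m) f) x = f x" using dual_dual[OF eul] x by simp
  finally show ?thesis using nk_def[of "Suc m" f x] by linarith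
qed

lemma hh_Suc0:
  assumes g: "\<And>y. y \<in> X ==> rk y = Suc m ==> g y = 0"
  shows "hh b (Suc m) g = hh b m g * pJ"
proof -
  have "hh b (Suc m) g = (\<Sum>y\<in>{y\<in>X. b \<preceq> y \<and> rk y \<le> m}. of_int (g y) * (pt b y * pJ ^ (Suc m - rk y)))"
    unfolding hh_def by (rule sum.mono_neutral_right) (use fin g in \<open>auto simp: le_Suc_eq\<close>)
  also have "\<dots> = hh b m g * pJ" unfolding hh_def sum_distrib_right
    by (rule sum.cong) (auto simp: Suc_diff_le power_Suc2 mult.assoc simp del: power_Suc)
  finally show ?thesis .
qed

lemma tr_of_int: "tr (of_int x * (p * pJ)) = of_int x * p"
  by (metis mult.assoc tr_J)

lemma tr_of_int_b: "tr (of_int x * (p * poly_b)) = 0"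
  by (metis mult.assoc tr_b)

text \<open>For y of rank at most \<open>m\<close> the last factor a - b is stripped; for y of rank
  \<open>Suc m\<close> the words end in b and drop out.\<close>

lemma tr_hh:
  assumes b: "b \<in> X" "rk b \<le> m"
  shows "tr (hh b (Suc m) f) = hh b m f"
proof -
  have "tr (hh b (Suc m) f) = (\<Sum>y\<in>{y\<in>X. b \<preceq> y \<and> rk y \<le> Suc m}. if rk y \<le> m then of_int (f y) * (pt b y * pJ ^ (m - rk y)) else 0)"
    unfolding hh_def tr_sum
  proof (rule sum.cong[OF HOL.refl])
    fix y assume y: "y \<in> {y\<in>X. b \<preceq> y \<and> rk y \<le> Suc m}"
    show "tr (of_int (f y) * (pt b y * pJ ^ (Suc m - rk y))) = (if rk y \<le> m then of_int (f y) * (pt b y * pJ ^ (m - rk y)) else 0)"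
    proof (cases "rk y \<le> m")
      case True
      then have "pt b y * pJ ^ (Suc m - rk y) = (pt b y * pJ ^ (m - rk y)) * pJ"
        by (simp add: Suc_diff_le power_Suc2 mult.assoc del: power_Suc)
      then show ?thesis using True by (simp only: tr_of_int if_True)
    next
      case False
      then have "rk y = Suc m" "y \<noteq> b" using y b by auto
      then show ?thesis using y False by (simp add: pt_psi tr_of_int_b)
    qed
  qed
  also have "\<dots> = (\<Sum>y\<in>{y\<in>{y\<in>X. b \<preceq> y \<and> rk y \<le> Suc m}. rk y \<le> m}. of_int (f y) * (pt b y * pJ ^ (m - rk y)))"
    by (rule sum.inter_filter[symmetric]) (use fin in simp)
  also have "{y\<in>{y\<in>X. b \<preceq> y \<and> rk y \<le> Suc m}. rk y \<le> m} = {y\<in>X. b \<preceq> y \<and> rk y \<le> m}" by auto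
  finally show ?thesis by (simp add: hh_def)
qed

lemma ep_of_int: "ep (of_int x * (p * pJ)) = 0" "ep (of_int x * (p * poly_b)) = 0"
  by (metis mult.assoc ep_J, metis mult.assoc ep_b)

lemma ep_hh:
  assumes b: "b \<in> X" "rk b \<le> m"
  shows "ep (hh b (Suc m) f) = 0"
  unfolding hh_def lookup_sum
proof (rule sum.neutral, rule ballI)
  fix y assume y: "y \<in> {y\<in>X. b \<preceq> y \<and> rk y \<le> Suc m}"
  show "ep (of_int (f y) * (pt b y * pJ ^ (Suc m - rk y))) = 0"
  proof (cases "rk y \<le> m")
    case True
    then have "pt b y * pJ ^ (Suc m - rk y) = (pt b y * pJ ^ (m - rk y)) * pJ"
      by (simp add: Suc_diff_le power_Suc2 mult.assoc del: power_Suc)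
    then show ?thesis by (simp only: ep_of_int)
  next
    case False
    then have "rk y = Suc m" "y \<noteq> b" using y b by auto
    then show ?thesis using y False by (simp add: pt_psi ep_of_int)
  qed
qed

text \<open>The coefficient \<beta> in a decomposition of \<open>hh\<close> as \<alpha> + \<beta> b
  with both parts invariant: \<open>bar\<close> adds \<beta> (a - b), while on the side of functions
  it adds \<open>nk\<close>, which vanishes at rank \<open>k\<close>. Iterating \<open>tr\<close>
  then determines the part \<alpha>, which is \<open>al\<close>.\<close>

definition be :: "'p => nat => ('p => int) => ab_poly" where
  "be b k f = (if rk b < k then hh b (k - 1) (nk k f) else 0)"

definition al :: "'p => nat => ('p => int) => ab_poly" where
  "al b k f = (\<Sum>i\<in>{rk b<..<k}. be b i f * (pd * pc ^ (k - 1 - i))) + of_int (f b) * pc ^ (k - rk b)"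

lemma bar_be:
  assumes eul: eulerian and b: "b \<in> X" shows "bar (be b k f) = be b k f"
proof (cases "rk b < k")
  case True
  then obtain m where k: "k = Suc m" by (cases k) auto
  have "bar (hh b m (nk k f)) = hh b m (dual m (nk k f))"
    by (rule bar_hh[OF b]) (use bar_psi[OF eul b] in auto)
  also have "\<dots> = hh b m (nk k f)" by (rule hh_cong) (use nk_self_dual[OF eul] k in auto)
  finally show ?thesis using True k by (simp add: be_def)
qed (simp add: be_def)

text \<open>Induction on \<open>k\<close> through \<open>bar_tr_0\<close>: the difference
  \<open>?e\<close> of both sides is invariant, \<open>tr\<close> reduces it to the previous rank,
  and it has no constant term.\<close>

lemma hh_decomp:
  assumes eul: eulerian and b: "b \<in> X" and k: "rk b \<le> k"
  shows "hh b k f = al b k f + be b k f * poly_b"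
  using k
proof (induction k rule: dec_induct)
  case base
  have "{y\<in>X. b \<preceq> y \<and> rk y \<le> rk b} = {b}" using b rk_less[of b] by force
  then show ?case by (simp add: hh_def al_def be_def)
next
  case (step k)
  let ?e = "hh b (Suc k) f - al b (Suc k) f - be b (Suc k) f * poly_b"
  have ab: "al b (Suc k) f = (\<Sum>i\<in>{rk b<..<k}. be b i f * (pd * pc ^ (k - 1 - i)) * pc) + be b k f * pd + of_int (f b) * pc ^ (k - rk b) * pc"
  proof -
    have "(\<Sum>i\<in>{rk b<..<Suc k}. be b i f * (pd * pc ^ (Suc k - 1 - i)))
      = (\<Sum>i\<in>{rk b<..<k}. be b i f * (pd * pc ^ (k - 1 - i)) * pc) + be b k f * pd"
    proof (cases "rk b < k")
      case True
      then have "{rk b<..<Suc k} = insert k {rk b<..<k}" by auto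
      then have "(\<Sum>i\<in>{rk b<..<Suc k}. be b i f * (pd * pc ^ (Suc k - 1 - i)))
        = be b k f * pd + (\<Sum>i\<in>{rk b<..<k}. be b i f * (pd * pc ^ (k - i)))" by simp
      also have "(\<Sum>i\<in>{rk b<..<k}. be b i f * (pd * pc ^ (k - i))) = (\<Sum>i\<in>{rk b<..<k}. be b i f * (pd * pc ^ (k - 1 - i)) * pc)"
      proof (rule sum.cong[OF HOL.refl])
        fix i assume "i \<in> {rk b<..<k}"
        then have "k - i = Suc (k - 1 - i)" by auto
        then show "be b i f * (pd * pc ^ (k - i)) = be b i f * (pd * pc ^ (k - 1 - i)) * pc"
          by (simp only: power_Suc2 mult.assoc)
      qed
      finally show ?thesis by (simp add: add.commute)
    next
      case False
      then have "{rk b<..<Suc k} = {}" "{rk b<..<k} = {}" "be b k f = 0" by (auto simp: be_def)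
      then show ?thesis by simp
    qed
    moreover have "of_int (f b) * pc ^ (Suc k - rk b) = of_int (f b) * pc ^ (k - rk b) * pc"
      using step.hyps by (simp add: Suc_diff_le power_Suc2 mult.assoc del: power_Suc)
    ultimately show ?thesis by (simp add: al_def)
  qed
  have tral: "tr (al b (Suc k) f) = al b k f + be b k f * poly_b"
    unfolding ab by (simp add: tr_add tr_sum tr_c tr_d al_def)
  have "tr ?e = hh b k f - (al b k f + be b k f * poly_b)"
    using tr_hh[OF b step.hyps(1)] by (simp add: tr_diff tral tr_b)
  then have 1: "tr ?e = 0" using step.IH by simp
  have bal: "bar (al b (Suc k) f) = al b (Suc k) f"
  proof -
    have "bar (be b i f * (pd * pc ^ j)) = be b i f * (pd * pc ^ j)" for i j
      using bar_c_pow[of "be b i f * pd" j] bar_be[OF eul b] by (simp add: mult.assoc bar_d)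
    moreover have "bar (of_int (f b) * pc ^ j) = of_int (f b) * pc ^ j" for j
      using bar_c_pow[of "of_int (f b)" j] bar_of_int[of "f b" 1] by simp
    ultimately show ?thesis by (simp add: al_def bar_add bar_sum)
  qed
  have "bar (hh b (Suc k) f) = hh b (Suc k) (dual (Suc k) f)"
    by (rule bar_hh[OF b]) (use bar_psi[OF eul b] in auto)
  also have "\<dots> = hh b (Suc k) f + hh b (Suc k) (nk (Suc k) f)"
    unfolding hh_def sum.distrib[symmetric] nk_def by (rule sum.cong) (auto simp: algebra_simps)
  also have "hh b (Suc k) (nk (Suc k) f) = be b (Suc k) f * pJ"
    using step.hyps by (simp add: be_def hh_Suc0 nk_def dual_top)
  finally have bh: "bar (hh b (Suc k) f) = hh b (Suc k) f + be b (Suc k) f * pJ" .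
  have 2: "bar ?e = ?e"
    by (simp add: bar_diff bh bal bar_b bar_be[OF eul b]) (simp add: pJ_def algebra_simps)
  have 3: "ep ?e = 0"
    using ep_hh[OF b step.hyps(1), of f] unfolding ab
    by (simp add: lookup_minus lookup_add lookup_sum ep_c ep_d)
  from bar_tr_0[OF 2 1 3] show ?case by (simp add: algebra_simps)
qed

text \<open>\<open>al\<close> lifted to cd-polynomials and iterated: when a d is split off at rank
  i, the factor to its left belongs to the derived function \<open>nk i f\<close>, truncated at
  \<open>i - 1\<close>. All coefficients are values at \<open>b\<close> of iterated derived
  functions.\<close>

function Hcd :: "'p => nat => ('p => int) => cd_poly" where
  "Hcd b m f = (\<Sum>i\<in>{rk b<..<m}. Hcd b (i - 1) (nk i f) * Poly_Mapping.single (Var_d # replicate (m - 1 - i) Var_c) 1)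
     + Poly_Mapping.single (replicate (m - rk b) Var_c) (f b)"
  by auto
termination by (relation "measure (\<lambda>(b, m, f). m)") auto

declare Hcd.simps [simp del]

text \<open>For a self-dual function \<open>be\<close> vanishes and \<open>hh\<close> equals
  \<open>al\<close>; every inner function \<open>nk i f\<close> is again self-dual, at rank
  \<open>i - 1\<close>.\<close>

lemma Hcd_ab:
  assumes eul: eulerian and b: "b \<in> X" "rk b \<le> m"
    and f: "\<And>x. x \<in> X ==> rk x \<le> m ==> dual m f x = f x"
  shows "cd_to_ab (Hcd b m f) = hh b m f"
  using b(2) f
proof (induction m arbitrary: f rule: less_induct)
  case (less m)
  have "be b m f = 0"
  proof (cases "rk b < m")
    case True
    have "hh b (m - 1) (nk m f) = hh b (m - 1) (\<lambda>_. 0)"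
      by (rule hh_cong) (use less.prems True in \<open>auto simp: nk_def\<close>)
    then show ?thesis by (simp add: be_def hh_def)
  qed (simp add: be_def)
  then have "hh b m f = al b m f" using hh_decomp[OF eul b(1) less.prems(1)] by simp
  moreover have "cd_to_ab (Hcd b (i - 1) (nk i f)) = be b i f" if i: "i \<in> {rk b<..<m}" for i
  proof -
    obtain l where l: "i = Suc l" using i by (cases i) auto
    have "cd_to_ab (Hcd b l (nk i f)) = hh b l (nk i f)"
      by (rule less.IH) (use i l nk_self_dual[OF eul] in auto)
    then show ?thesis using i l by (simp add: be_def)
  qed
  ultimately show ?case
    by (subst Hcd.simps) (simp add: cd_to_ab_add cd_to_ab_sum cd_to_ab_mult cd_to_ab_dc cd_to_ab_c al_def)
qed

lemma Hcd_cong: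
  assumes "rk b \<le> m" "b \<in> X" "\<And>x. x \<in> X ==> rk x \<le> m ==> f x = g x"
  shows "Hcd b m f = Hcd b m g"
  using assms(1,3)
proof (induction m arbitrary: f g rule: less_induct)
  case (less m)
  have "Hcd b (i - 1) (nk i f) = Hcd b (i - 1) (nk i g)" if i: "i \<in> {rk b<..<m}" for i
  proof (rule less.IH)
    fix x assume "x \<in> X" "rk x \<le> i - 1"
    then show "nk i f x = nk i g x" unfolding nk_def using dual_cong[of x i f g] less.prems(2) i by auto
  qed (use i in auto)
  then have "(\<Sum>i\<in>{rk b<..<m}. Hcd b (i - 1) (nk i f) * Poly_Mapping.single (Var_d # replicate (m - 1 - i) Var_c) 1)
    = (\<Sum>i\<in>{rk b<..<m}. Hcd b (i - 1) (nk i g) * Poly_Mapping.single (Var_d # replicate (m - 1 - i) Var_c) 1)"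
    by (intro sum.cong) auto
  moreover have "f b = g b" using less.prems(2)[of b] less.prems(1) assms(2) by simp
  ultimately show ?case unfolding Hcd.simps[of b m f] Hcd.simps[of b m g] by simp
qed

end

section \<open>Nonnegativity of the cd-index\<close>

context rposet begin

text \<open>Nondegeneracy at one element is arranged by \<open>single\<close>. The elements are then
  treated one after the other, replacing \<Phi> by \<Phi> + t \<Psi> with t outside finitely many
  bad values.\<close>

lemma ex_forms:
  fixes Z B :: "'p => 'e::kvec set"
  assumes CM: "CM m Z B f" and lm: "Suc l < m" and Y: "Y \<subseteq> {y\<in>X. rk y = Suc l}"
  shows "\<exists>\<Phi>. (\<forall>w\<in>X. rk w = Suc (Suc l) \<longrightarrow> form (Z w) (\<Phi> w)) \<and>
     (\<forall>y\<in>Y. nondeg (Z y) (B y) (\<Sum>w\<in>{w\<in>X. y \<preceq> w \<and> rk w = Suc (rk y)}. \<Phi> w))"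
proof -
  have sZ: "x \<in> X ==> rk x \<le> m ==> kv.subspace (Z x)"
    and sB: "x \<in> X ==> rk x \<le> m ==> kv.subspace (B x)"
    and BZ: "x \<in> X ==> rk x \<le> m ==> B x \<subseteq> Z x"
    and qdZ: "x \<in> X ==> rk x \<le> m ==> qd (Z x) (B x) (f x)"
    and Zanti: "x \<in> X ==> y \<in> X ==> x \<preceq> y ==> rk y \<le> m ==> Z y \<subseteq> Z x"
    and exZ: "x \<in> X ==> i < m ==> exa (\<preceq>) rk (up x) Z B i" for x y i
    using CM unfolding CM_def by blast+
  let ?cv = "\<lambda>y. {w\<in>X. y \<preceq> w \<and> rk w = Suc (rk y)}"
  let ?fm = "\<lambda>\<Phi>. \<forall>w\<in>X. rk w = Suc (Suc l) \<longrightarrow> form (Z w) (\<Phi> w)"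
  let ?nd = "\<lambda>\<Phi> y. nondeg (Z y) (B y) (\<Sum>w\<in>?cv y. \<Phi> w)"
  have single: "\<exists>\<Psi>. ?fm \<Psi> \<and> ?nd \<Psi> y" if y: "y \<in> X" "rk y = Suc l" for y
  proof -
    let ?U = "\<Union>w\<in>?cv y. Z w"
    have ym: "rk y \<le> m" using y lm by simp
    have UZ: "?U \<subseteq> Z y" using Zanti[OF y(1)] y lm by fastforce
    obtain S where S: "mbase (Z y) (B y) S" using qdZ[OF y(1) ym] by (auto simp: qd_def)
    \<comment> \<open>A maximal independent set among the vectors from the covers of
      \<open>y\<close>; by exactness at \<open>rk y\<close> these vectors span \<open>Z y\<close>
      modulo \<open>B y\<close>.\<close>
    have "\<exists>T\<subseteq>?U. imod (B y) T \<and> smod (B y) T ?U"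
    proof (rule ex_mod_basis[OF sB[OF y(1) ym]])
      fix T assume "T \<subseteq> ?U" "imod (B y) T"
      then show "card T \<le> card S" using imod_card_le[OF sB[OF y(1) ym], of S "Z y" T] S UZ
        by (auto simp: mbase_def imod_def)
    qed
    then obtain T where T: "T \<subseteq> ?U" "imod (B y) T" "smod (B y) T ?U" by blast
    have fT: "finite T" using T by (simp add: imod_def)
    have "\<forall>s. \<exists>w. s \<in> T \<longrightarrow> w \<in> ?cv y \<and> s \<in> Z w" using T(1) by blast
    from choice[OF this] obtain ws where ws: "\<forall>s. s \<in> T \<longrightarrow> ws s \<in> ?cv y \<and> s \<in> Z (ws s)" ..
    \<comment> \<open>The form with identity matrix in this basis, distributed over the covers: each
      basis vector s is assigned to one cover \<open>ws s\<close> whose stalk contains it.\<close>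
    define \<Psi> where "\<Psi> w = (\<lambda>\<alpha>. \<Sum>s\<in>{s\<in>T. ws s = w}. \<alpha> s \<cdot> s)" for w and \<alpha> :: "'e => fld"
    have fm: "?fm \<Psi>"
    proof (intro ballI impI)
      fix w assume w: "w \<in> X" "rk w = Suc (Suc l)"
      have wm: "rk w \<le> m" using w lm by simp
      show "form (Z w) (\<Psi> w)" unfolding form_def
      proof (intro conjI allI ballI)
        show "lin (\<Psi> w)" unfolding lin_iff \<Psi>_def
          by (auto simp: fun_apply sc_left sum.distrib sc_fld_def sc_sc[symmetric] kv.scale_sum_right simp del: kv.scale_scale)
        show "\<Psi> w \<alpha> \<in> Z w" for \<alpha> unfolding \<Psi>_def
          by (rule kv.subspace_sum[OF sZ[OF w(1) wm]], rule kv.subspace_scale[OF sZ[OF w(1) wm]]) (use ws in auto)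
        show "\<Psi> w \<alpha> = 0" if "\<alpha> \<in> ann (Z w)" for \<alpha> unfolding \<Psi>_def
          by (rule sum.neutral) (use that ws in \<open>auto simp: ann_def\<close>)
      qed
    qed
    have sum: "(\<Sum>w\<in>?cv y. \<Psi> w) \<alpha> = (\<Sum>s\<in>T. \<alpha> s \<cdot> s)" for \<alpha>
    proof -
      have "(\<Sum>w\<in>?cv y. \<Psi> w) \<alpha> = (\<Sum>w\<in>?cv y. \<Sum>s\<in>{s\<in>T. ws s = w}. \<alpha> s \<cdot> s)"
        by (simp add: sum_fun_apply \<Psi>_def)
      also have "\<dots> = (\<Sum>s\<in>T. \<alpha> s \<cdot> s)"
        by (rule sum.group) (use fT fin ws in auto)
      finally show ?thesis .
    qed
    have "?nd \<Psi> y" unfolding nondeg_def sum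
    proof (intro ballI impI)
      fix \<alpha> assume a: "\<alpha> \<in> ann (B y)" "(\<Sum>s\<in>T. \<alpha> s \<cdot> s) \<in> B y"
      have a0: "\<forall>s\<in>T. \<alpha> s = 0" using a(2) T(2) by (auto simp: imod_def)
      have la: "lin \<alpha>" using a by (simp add: ann_def)
      have aU: "\<alpha> z = 0" if z: "z \<in> ?U" for z
      proof -
        obtain c where c: "z + (\<Sum>t\<in>T. c t \<cdot> t) \<in> B y" using T(3) z unfolding smod_def by blast
        have "\<alpha> (z + (\<Sum>t\<in>T. c t \<cdot> t)) = 0" using a(1) c unfolding ann_def by blast
        then show ?thesis using a0 by (simp add: lin_add[OF la] lin_sum_scale[OF la])
      qed
      have "\<alpha> z = 0" if z: "z \<in> Z y" for z
      proof -
        have ex: "exa (\<preceq>) rk (up y) Z B (rk y)" by (rule exZ) (use y lm in auto)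
        have 1: "(if w = y then z else 0) \<in> Z w" if "w \<in> up y" "rk w = rk y" for w
          using that rk_less[of y w] y z by (auto simp: up_def)
        have 2: "bd (\<preceq>) rk (up y) (\<lambda>w. if w = y then z else 0) w \<in> B w" if "w \<in> up y" "Suc (rk w) = rk y" for w
          using that rk_le[of y w] y by (auto simp: up_def)
        obtain g where g: "\<And>w. w \<in> up y ==> rk w = Suc (rk y) ==> g w \<in> Z w"
          "\<And>w. w \<in> up y ==> rk w = rk y ==> (if w = y then z else 0) + bd (\<preceq>) rk (up y) g w \<in> B w"
          using exaD[OF ex 1 2] by metis
        have yu: "y \<in> up y" using y by (simp add: up_def)
        have "z + bd (\<preceq>) rk (up y) g y \<in> B y" using g(2)[OF yu] by simp
        then have "\<alpha> (z + bd (\<preceq>) rk (up y) g y) = 0" using a(1) by (auto simp: ann_def)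
        moreover have "\<alpha> (bd (\<preceq>) rk (up y) g y) = 0"
          unfolding bd_def lin_sum[OF la] bd_up[OF yu y(1)]
          by (rule sum.neutral) (use g(1) aU in \<open>auto simp: up_def\<close>)
        ultimately show ?thesis by (simp add: lin_add[OF la])
      qed
      then show "\<alpha> \<in> ann (Z y)" using la by (simp add: ann_def)
    qed
    with fm show ?thesis by blast
  qed
  have "finite Y" using Y fin finite_subset by fastforce
  then show ?thesis using Y
  proof (induction Y rule: finite_induct)
    case empty
    show ?case by (intro exI[of _ "\<lambda>_. 0"]) (use lm in \<open>auto intro!: form_zero sZ\<close>)
  next
    case (insert u U)
    then obtain \<Phi> where \<Phi>: "?fm \<Phi>" "\<forall>y\<in>U. ?nd \<Phi> y" by auto
    obtain \<Psi> where \<Psi>: "?fm \<Psi>" "?nd \<Psi> u" using single[of u] insert by auto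
    let ?s = "\<lambda>\<Phi> y. \<Sum>w\<in>?cv y. \<Phi> w"
    have fs: "form (Z y) (?s \<Phi>' y)" if "?fm \<Phi>'" "y \<in> X" "rk y = Suc l" for \<Phi>' y
    proof (rule form_sum[OF sZ])
      fix w assume w: "w \<in> ?cv y"
      have "form (Z w) (\<Phi>' w)" using w that by simp
      moreover have "Z w \<subseteq> Z y" using Zanti[of y w] w that lm by simp
      ultimately show "form (Z y) (\<Phi>' w)" by (rule form_mono)
    qed (use that lm in auto)
    \<comment> \<open>At \<open>u\<close> it is \<Psi> that is nondegenerate, so there the pencil is
      normalized as \<Psi> plus \<open>inverse t\<close> times \<Phi>; hence the preimage under
      \<open>inverse\<close> and the exclusion of 0.\<close>
    define bad where "bad = (\<Union>y\<in>U. {t. \<not> nondeg (Z y) (B y) (?s \<Phi> y + t \<cdot> ?s \<Psi> y)}) \<union>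
      inverse -` {t. \<not> nondeg (Z u) (B u) (?s \<Psi> u + t \<cdot> ?s \<Phi> u)} \<union> {0}"
    have "finite bad" unfolding bad_def
    proof (intro finite_UnI finite_UN_I finite_vimageI insert.hyps)
      fix y assume "y \<in> U"
      then have y: "y \<in> X" "rk y = Suc l" "rk y \<le> m" using insert lm by auto
      show "finite {t. \<not> nondeg (Z y) (B y) (?s \<Phi> y + t \<cdot> ?s \<Psi> y)}"
        by (rule finite_degenerate[OF sB[OF y(1,3)] sZ[OF y(1,3)] BZ[OF y(1,3)] qdZ[OF y(1,3)] fs[OF \<Phi>(1) y(1,2)] _ fs[OF \<Psi>(1) y(1,2)]])
          (use \<Phi>(2) \<open>y \<in> U\<close> in blast)
    next
      have y: "u \<in> X" "rk u = Suc l" "rk u \<le> m" using insert lm by auto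
      show "finite {t. \<not> nondeg (Z u) (B u) (?s \<Psi> u + t \<cdot> ?s \<Phi> u)}"
        by (rule finite_degenerate[OF sB[OF y(1,3)] sZ[OF y(1,3)] BZ[OF y(1,3)] qdZ[OF y(1,3)] fs[OF \<Psi>(1) y(1,2)] \<Psi>(2) fs[OF \<Phi>(1) y(1,2)]])
      show "inj (inverse :: fld => fld)" by (auto intro: injI)
    qed auto
    then obtain t where t: "t \<notin> bad" using infinite_fld ex_new_if_finite by blast
    define \<Theta> where "\<Theta> w = \<Phi> w + t \<cdot> \<Psi> w" for w
    have s\<Theta>: "?s \<Theta> y = ?s \<Phi> y + t \<cdot> ?s \<Psi> y" for y
      by (simp add: \<Theta>_def sum.distrib kv.scale_sum_right)
    have "?fm \<Theta>" unfolding \<Theta>_def using \<Phi>(1) \<Psi>(1) lm by (auto intro!: form_add form_sc sZ)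
    moreover have "?nd \<Theta> y" if "y \<in> U" for y using t that unfolding s\<Theta> by (auto simp: bad_def)
    moreover have "?nd \<Theta> u"
    proof -
      have t0: "t \<noteq> 0" "nondeg (Z u) (B u) (?s \<Psi> u + inverse t \<cdot> ?s \<Phi> u)" using t by (auto simp: bad_def)
      have "?s \<Theta> u = t \<cdot> (?s \<Psi> u + inverse t \<cdot> ?s \<Phi> u)"
        unfolding s\<Theta> using t0(1) by (simp add: sc_right sc_sc sc_one add.commute)
      moreover have "kv.subspace (B u)" using sB[of u] insert lm by simp
      ultimately show ?thesis using nondeg_sc[OF _ t0] by simp
    qed
    ultimately show ?case by blast
  qed
qed

section \<open>Iterating the resolution inside one type\<close>

lemma CM_image:
  fixes Z B :: "'p => 'e::kvec set" and \<theta> :: "'e => 'e1::kvec"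
  assumes CM: "CM m Z B f" and \<theta>: "lin \<theta>" "inj \<theta>"
  shows "CM m (\<lambda>x. \<theta> ` Z x) (\<lambda>x. \<theta> ` B x) f"
proof -
  have sZ: "x \<in> X ==> rk x \<le> m ==> kv.subspace (Z x)"
    and sB: "x \<in> X ==> rk x \<le> m ==> kv.subspace (B x)"
    and BZ: "x \<in> X ==> rk x \<le> m ==> B x \<subseteq> Z x"
    and qdZ: "x \<in> X ==> rk x \<le> m ==> qd (Z x) (B x) (f x)"
    and Zanti: "x \<in> X ==> y \<in> X ==> x \<preceq> y ==> rk y \<le> m ==> Z y \<subseteq> Z x"
    and Banti: "x \<in> X ==> y \<in> X ==> x \<preceq> y ==> rk y \<le> m ==> B y \<subseteq> B x"
    and exZ: "x \<in> X ==> i < m ==> exa (\<preceq>) rk (up x) Z B i" for x y i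
    using CM unfolding CM_def by blast+
  have sub: "kv.subspace (\<theta> ` S)" if "kv.subspace S" for S
    using kvp.linear_subspace_image[OF \<theta>(1) that] .
  have im: "\<theta> a \<in> \<theta> ` S \<longleftrightarrow> a \<in> S" for a S using \<theta>(2) by (simp add: inj_image_mem_iff)
  show ?thesis unfolding CM_def
  proof (intro conjI ballI allI impI)
    fix x assume x: "x \<in> X" "rk x \<le> m"
    show "kv.subspace (\<theta> ` Z x)" "kv.subspace (\<theta> ` B x)" using sub sZ sB x by auto
    show "\<theta> ` B x \<subseteq> \<theta> ` Z x" using BZ x by blast
    show "qd (\<theta> ` Z x) (\<theta> ` B x) (f x)"
    proof (rule qd_iso[OF \<theta>(1) sub[OF sB[OF x]] sZ[OF x] _ _ _ _ qdZ[OF x]])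
      fix z' assume "z' \<in> \<theta> ` Z x"
      then obtain a where a: "a \<in> Z x" "z' = \<theta> a" by blast
      have "z' + \<theta> a \<in> \<theta> ` B x" using kv.subspace_0[OF sub[OF sB[OF x]]] a(2) by simp
      with a(1) show "\<exists>z\<in>Z x. z' + \<theta> z \<in> \<theta> ` B x" by blast
    qed (use im in auto)
  next
    fix x y assume x: "x \<in> X" "y \<in> X" "x \<preceq> y" "rk y \<le> m"
    show "\<theta> ` Z y \<subseteq> \<theta> ` Z x" using Zanti[OF x] by blast
    show "\<theta> ` B y \<subseteq> \<theta> ` B x" using Banti[OF x] by blast
  next
    fix x i assume x: "x \<in> X" and i: "i < m"
    show "exa (\<preceq>) rk (up x) (\<lambda>x. \<theta> ` Z x) (\<lambda>x. \<theta> ` B x) i"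
    proof (rule exa_transport[OF exZ[OF x i] \<theta>(1)])
      show "finite (up x)" using fin by (simp add: up_def)
      show "\<exists>b\<in>Z c. a + \<theta> b \<in> \<theta> ` B c" if "c \<in> up x" "rk c \<le> Suc i" "a \<in> \<theta> ` Z c" for c a
      proof -
        note h = that
        obtain b where b: "b \<in> Z c" "a = \<theta> b" using h(3) by blast
        have "a + \<theta> b \<in> \<theta> ` B c" using kv.subspace_0[OF sub[OF sB[of c]]] b(2) h i by (simp add: up_def)
        with b(1) show ?thesis by blast
      qed
      show "kv.subspace (Z c)" if "c \<in> up x" "rk c \<le> i" for c using that sZ[of c] i by (simp add: up_def)
      show "kv.subspace (\<theta> ` B c)" if "c \<in> up x" "rk c \<le> Suc i" for c
        using that sub[OF sB[of c]] i by (simp add: up_def)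
      show "Z w \<subseteq> Z c" if "c \<in> up x" "w \<in> up x" "c \<preceq> w" "rk w \<le> Suc i" for c w
        using that Zanti[of c w] i by (simp add: up_def)
      show "\<theta> ` B w \<subseteq> \<theta> ` B c" if "c \<in> up x" "w \<in> up x" "c \<preceq> w" "rk w \<le> Suc i" for c w
        using that Banti[of c w] i by (simp add: up_def image_mono)
    qed (simp_all add: im)
  qed
qed

text \<open>Repacks a function from elements to vectors as a vector by putting the element in front
  of the list; the value at the empty list is 0. Being injective, it moves the sheaf of each step
  back into the type of the previous one.\<close>

definition enc :: "('p => 'p list => fld) => 'p list => fld" where
  "enc \<zeta> l = (case l of [] => 0 | y # l' => \<zeta> y l')"

lemma lin_enc: "lin enc"
  by (auto simp: lin_iff fun_eq_iff fun_apply enc_def split: list.split)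

lemma inj_enc: "inj enc"
proof (rule injI, intro ext)
  fix a b and y :: 'p and l assume "enc a = enc b"
  from fun_cong[OF this, of "y # l"] show "a y l = b y l" by (simp add: enc_def)
qed

lemma CM_step:
  fixes Z B :: "'p => ('p list => fld) set"
  assumes eul: eulerian and ac: "acyclic TYPE('p list => fld)" "acyclic TYPE(('p list => fld) => fld)"
    and CM: "CM m Z B f" and lm: "Suc l < m"
  shows "\<exists>Z' B' f'. CM l Z' (B' :: 'p => ('p list => fld) set) f' \<and>
    (\<forall>x\<in>X. rk x \<le> l \<longrightarrow> int (f' x) = nk (Suc l) (\<lambda>x. int (f x)) x)"
proof -
  obtain \<Phi> where \<Phi>: "\<forall>w\<in>X. rk w = Suc (Suc l) \<longrightarrow> form (Z w) (\<Phi> w)"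
     "\<forall>y\<in>{y\<in>X. rk y = Suc l}. nondeg (Z y) (B y) (\<Sum>w\<in>{w\<in>X. y \<preceq> w \<and> rk w = Suc (rk y)}. \<Phi> w)"
    using ex_forms[OF CM lm subset_refl] by blast
  interpret cm_step X lq rk Z B f m l \<Phi>
    by unfold_locales (use eul ac CM lm \<Phi> in auto)
  from step_CM obtain f' where f': "CM l nZ nB f'" "\<forall>x\<in>X. rk x \<le> l \<longrightarrow>
    int (f' x) = (\<Sum>y\<in>{y\<in>X. x \<preceq> y \<and> rk y \<le> Suc l}. (-1) ^ (Suc l - rk y) * int (f y)) - int (f x)" by blast
  from CM_image[OF f'(1) lin_enc inj_enc] f'(2) show ?thesis
    unfolding nk_def dual_def by blast
qed

text \<open>By \<open>CM_step\<close> each inner function \<open>nk i f\<close> again consists of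
  stalk dimensions, so the values at \<open>b\<close> that make up the coefficients are
  nonnegative.\<close>

lemma Hcd_nonneg:
  fixes Z B :: "'p => ('p list => fld) set"
  assumes eul: eulerian and ac: "acyclic TYPE('p list => fld)" "acyclic TYPE(('p list => fld) => fld)"
    and b: "b \<in> X" "rk b \<le> m" and CM: "CM m Z B f"
  shows "nonneg_poly (Hcd b m (\<lambda>x. int (f x)))"
  using b(2) CM
proof (induction m arbitrary: Z B f rule: less_induct)
  case (less m)
  have "nonneg_poly (Hcd b (i - 1) (nk i (\<lambda>x. int (f x))))" if i: "i \<in> {rk b<..<m}" for i
  proof -
    obtain l where l: "i = Suc l" using i by (cases i) auto
    obtain Z' B' f' where *: "CM l Z' (B' :: 'p => ('p list => fld) set) f'"
      "\<forall>x\<in>X. rk x \<le> l \<longrightarrow> int (f' x) = nk (Suc l) (\<lambda>x. int (f x)) x"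
      using CM_step[OF eul ac less.prems(2), of l] i l by auto
    have "nonneg_poly (Hcd b l (\<lambda>x. int (f' x)))" by (rule less.IH[OF _ _ *(1)]) (use i l in auto)
    moreover have "Hcd b l (\<lambda>x. int (f' x)) = Hcd b l (nk i (\<lambda>x. int (f x)))"
      by (rule Hcd_cong) (use *(2) i l b in auto)
    ultimately show ?thesis using l by simp
  qed
  then show ?case by (subst Hcd.simps) (auto intro!: nonneg_add nonneg_sum nonneg_mult nonneg_single)
qed

text \<open>Karu's theorem for the interval from \<open>b\<close> to \<open>t\<close>. The starting
  sheaf is constant of dimension 1 strictly below \<open>t\<close> and zero elsewhere, truncated at
  \<open>rk t - 1\<close>.\<close>

theorem psi_nonneg:
  assumes eul: eulerian and ac: "acyclic TYPE('p list => fld)" "acyclic TYPE(('p list => fld) => fld)"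
    and b: "b \<in> X" and t: "t \<in> X" "b \<preceq> t" "b \<noteq> t"
  shows "\<exists>p. cd_to_ab p = psi b t \<and> nonneg_poly p"
proof -
  define m where "m = rk t - 1"
  have bt: "rk b < rk t" using rk_less b t by blast
  \<comment> \<open>The scalars, as the vectors supported at the empty list.\<close>
  define U where "U = range (\<lambda>c :: fld. (\<lambda>l :: 'p list. if l = [] then c else 0))"
  have sU: "kv.subspace U"
  proof (rule kv.subspaceI)
    show "0 \<in> U" unfolding U_def by (rule range_eqI[of _ _ 0]) (auto simp: fun_apply)
    fix x y assume "x \<in> U" "y \<in> U"
    then obtain c d where "x = (\<lambda>l. if l = [] then c else 0)" "y = (\<lambda>l. if l = [] then d else 0)" by (auto simp: U_def)
    then have "x + y = (\<lambda>l. if l = [] then c + d else 0)" by (auto simp: fun_apply)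
    then show "x + y \<in> U" by (auto simp: U_def)
  next
    fix c x assume "x \<in> U"
    then obtain d where "x = (\<lambda>l. if l = [] then d else 0)" by (auto simp: U_def)
    then have "c \<cdot> x = (\<lambda>l. if l = [] then c * d else 0)" by (auto simp: fun_apply sc_fld_def)
    then show "c \<cdot> x \<in> U" by (auto simp: U_def)
  qed
  have s0: "kv.subspace {0 :: 'p list => fld}" by (rule kv.subspaceI) auto
  define e where "e = (\<lambda>l :: 'p list. if l = [] then (1::fld) else 0)"
  have qU: "qd U {0} 1"
  proof -
    have "c = 0" if "c \<cdot> e = 0" for c
      using fun_cong[OF that, of "[]"] by (simp add: e_def fun_apply sc_fld_def)
    moreover have "\<exists>c. z + c \<cdot> e = 0" if "z \<in> U" for z
    proof -
      obtain d where d: "z = (\<lambda>l. if l = [] then d else 0)" using \<open>z \<in> U\<close> by (auto simp: U_def)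
      have "z + d \<cdot> e = 0" unfolding d by (auto simp: e_def fun_apply sc_fld_def fun_eq_iff)
      then show ?thesis by blast
    qed
    moreover have "e \<in> U" by (auto simp: U_def e_def)
    ultimately have "mbase U {0} {e}" unfolding mbase_def imod_def smod_def
      by (auto intro: exI[of _ "\<lambda>_. c" for c])
    then show ?thesis unfolding qd_def by (intro exI[of _ "{e}"]) simp
  qed
  have q0: "qd {0 :: 'p list => fld} {0} 0"
    unfolding qd_def by (intro exI[of _ "{}"]) (simp add: mbase_def smod_def)
  define Z where "Z x = (if x \<preceq> t \<and> x \<noteq> t then U else {0})" for x
  define f :: "'p => nat" where "f x = (if x \<preceq> t \<and> x \<noteq> t then 1 else 0)" for x
  have Z0: "0 \<in> Z x" for x using kv.subspace_0[OF sU] by (simp add: Z_def)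
  have "CM m Z (\<lambda>_. {0}) f" unfolding CM_def
  proof (intro conjI ballI allI impI)
    fix x assume "x \<in> X" "rk x \<le> m"
    show "kv.subspace (Z x)" "qd (Z x) {0} (f x)" "{0} \<subseteq> Z x" using sU s0 qU q0 Z0 by (auto simp: Z_def f_def)
  next
    fix x y assume x: "x \<in> X" "y \<in> X" "x \<preceq> y"
    show "Z y \<subseteq> Z x"
    proof (cases "y \<preceq> t \<and> y \<noteq> t")
      case True
      then have "x \<preceq> t \<and> x \<noteq> t" using trans[of x y t] antisym[of y t] x t by blast
      then show ?thesis using kv.subspace_0[OF sU] by (simp add: Z_def)
    qed (use kv.subspace_0[OF sU] in \<open>auto simp: Z_def\<close>)
  next
    fix x i assume x: "x \<in> X" and i: "i < m"
    show "exa (\<preceq>) rk (up x) Z (\<lambda>_. {0}) i"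
    proof (cases "x \<preceq> t \<and> x \<noteq> t")
      case False
      then have "Z y = {0}" if "y \<in> up x" for y
        using that trans[of x y t] antisym[of x t] antisym[of t y] x t False by (auto simp: Z_def up_def)
      then show ?thesis by (intro exaI exI[of _ "\<lambda>_. 0"]) (auto simp: bd_def)
    next
      case True
      \<comment> \<open>Acyclicity concerns the whole interval including \<open>t\<close>, but for
        \<open>i < m\<close> the ranks \<open>i\<close> and \<open>Suc i\<close> stay below the rank
        of \<open>t\<close>.\<close>
      have ex: "exa (\<preceq>) rk (ivl X (\<preceq>) x t) (\<lambda>_. U) (\<lambda>_. {0}) i"
        using ac(1) x t True sU s0 kv.subspace_0[OF sU] unfolding acyclic_def acyc_def by blast
      have bde: "bd (\<preceq>) rk (up x) h c = bd (\<preceq>) rk (ivl X (\<preceq>) x t) h c"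
        if "\<And>w. w \<in> up x ==> rk w = Suc (rk c) ==> \<not> w \<preceq> t ==> h w = 0" for h :: "'p => 'p list => fld" and c
        unfolding bd_def by (rule sum.mono_neutral_right) (use that fin in \<open>auto simp: cov_def up_def ivl_def\<close>)
      show ?thesis
      proof (rule exaI)
        fix g assume g: "\<And>w. w \<in> up x ==> rk w = i ==> g w \<in> Z w"
          "\<And>c. c \<in> up x ==> Suc (rk c) = i ==> bd (\<preceq>) rk (up x) g c \<in> {0}"
        have g0: "g w = 0" if "w \<in> up x" "rk w = i" "\<not> w \<preceq> t" for w using g(1)[of w] that by (simp add: Z_def)
        have 1: "g w \<in> U" if "w \<in> ivl X (\<preceq>) x t" "rk w = i" for w
          using g(1)[of w] that kv.subspace_0[OF sU] by (auto simp: up_def ivl_def Z_def split: if_splits)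
        have 2: "bd (\<preceq>) rk (ivl X (\<preceq>) x t) g c \<in> {0}" if "c \<in> ivl X (\<preceq>) x t" "Suc (rk c) = i" for c
          using g(2)[of c] bde[of c g] g0 that by (auto simp: up_def ivl_def)
        obtain h where h: "\<And>w. w \<in> ivl X (\<preceq>) x t ==> rk w = Suc i ==> h w \<in> U"
          "\<And>c. c \<in> ivl X (\<preceq>) x t ==> rk c = i ==> g c + bd (\<preceq>) rk (ivl X (\<preceq>) x t) h c \<in> {0}"
          using exaD[OF ex 1 2] by metis
        define h' where "h' w = (if w \<preceq> t then h w else 0)" for w
        show "\<exists>h. (\<forall>w\<in>up x. rk w = Suc i \<longrightarrow> h w \<in> Z w) \<and> (\<forall>c\<in>up x. rk c = i \<longrightarrow> g c + bd (\<preceq>) rk (up x) h c \<in> {0})"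
        proof (intro exI[of _ h'] conjI ballI impI)
          fix w assume w: "w \<in> up x" "rk w = Suc i"
          have "w \<noteq> t" using w i by (auto simp: m_def)
          then show "h' w \<in> Z w" using h(1)[of w] w by (auto simp: h'_def Z_def up_def ivl_def)
        next
          fix c assume c: "c \<in> up x" "rk c = i"
          have e1: "bd (\<preceq>) rk (up x) h' c = bd (\<preceq>) rk (ivl X (\<preceq>) x t) h' c"
            by (rule bde) (simp add: h'_def)
          have e2: "bd (\<preceq>) rk (ivl X (\<preceq>) x t) h' c = bd (\<preceq>) rk (ivl X (\<preceq>) x t) h c"
            unfolding bd_def by (rule sum.cong) (auto simp: h'_def cov_def ivl_def)
          show "g c + bd (\<preceq>) rk (up x) h' c \<in> {0}"
          proof (cases "c \<preceq> t")
            case T: True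
            then show ?thesis using h(2)[of c] c unfolding e1 e2 by (auto simp: up_def ivl_def)
          next
            case False
            have "h' w = 0" if "w \<in> cov (\<preceq>) rk (up x) c" for w
              using that False trans[of c w t] c t by (auto simp: h'_def cov_def up_def)
            then show ?thesis using g0[OF c False] by (simp add: bd_def)
          qed
        qed
      qed
    qed
  qed (use s0 in auto)
  moreover have "rk b \<le> m" using bt by (simp add: m_def)
  ultimately have nn: "nonneg_poly (Hcd b m (\<lambda>x. int (f x)))" using Hcd_nonneg[OF eul ac b] by blast
  have fb: "(\<lambda>x. int (f x)) = below t" by (auto simp: f_def below_def)
  have "cd_to_ab (Hcd b m (below t)) = psi b t"
    unfolding psi_hh[OF t(1)] m_def[symmetric]
    by (rule Hcd_ab[OF eul b]) (use bt dual_below[OF eul t(1)] in \<open>auto simp: m_def\<close>)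
  with nn show ?thesis unfolding fb by blast
qed

end

section \<open>Zipping maps\<close>

text \<open>Mayer-Vietoris: on the intersection the fillings over \<open>S1\<close> and
  \<open>S2\<close> differ by a cycle; filling it by \<open>h\<close> one rank higher and adding the
  boundary of \<open>h\<close> over \<open>S1\<close> makes them agree. Both parts are closed
  upwards in the union, so boundaries are computed within each part.\<close>

lemma acyc_union:
  fixes t :: "'e::kvec itself"
  assumes a1: "acyc t lq rk S1" and a2: "acyc t lq rk S2" and a12: "acyc t lq rk (S1 \<inter> S2)"
    and dd: "dd0 lq rk S1"
    and u1: "\<And>c w. c \<in> S1 ==> w \<in> S2 ==> lq c w ==> w \<in> S1"
    and u2: "\<And>c w. c \<in> S2 ==> w \<in> S1 ==> lq c w ==> w \<in> S2"
  shows "acyc t lq rk (S1 \<union> S2)"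
  unfolding acyc_def
proof (intro allI impI exaI)
  fix Z B :: "'e set" and i f
  assume sZ: "kv.subspace Z" and sB: "kv.subspace B" and BZ: "B \<subseteq> Z"
    and f: "\<And>w. w \<in> S1 \<union> S2 ==> rk w = i ==> f w \<in> Z"
      "\<And>c. c \<in> S1 \<union> S2 ==> Suc (rk c) = i ==> bd lq rk (S1 \<union> S2) f c \<in> B"
  have c1: "cov lq rk (S1 \<union> S2) c = cov lq rk S1 c" if "c \<in> S1" for c using that u1 by (auto simp: cov_def)
  have c2: "cov lq rk (S1 \<union> S2) c = cov lq rk S2 c" if "c \<in> S2" for c using that u2 by (auto simp: cov_def)
  have c12: "cov lq rk (S1 \<inter> S2) c = cov lq rk S1 c" "cov lq rk (S1 \<inter> S2) c = cov lq rk S2 c" if "c \<in> S1 \<inter> S2" for c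
    using that u1 u2 by (auto simp: cov_def)
  have e1: "exa lq rk S1 (\<lambda>_. Z) (\<lambda>_. B) i" and e2: "exa lq rk S2 (\<lambda>_. Z) (\<lambda>_. B) i"
    and e12: "exa lq rk (S1 \<inter> S2) (\<lambda>_. Z) (\<lambda>_. B) (Suc i)"
    using a1 a2 a12 sZ sB BZ by (auto simp: acyc_def)
  obtain g1 where g1: "\<And>w. w \<in> S1 ==> rk w = Suc i ==> g1 w \<in> Z"
    "\<And>c. c \<in> S1 ==> rk c = i ==> f c + bd lq rk S1 g1 c \<in> B"
  proof (rule exaD[OF e1, of f])
    fix c assume "c \<in> S1" "Suc (rk c) = i"
    then show "bd lq rk S1 f c \<in> B" using f(2)[of c] c1[of c] by (simp add: bd_def)
  qed (use f(1) in auto)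
  obtain g2 where g2: "\<And>w. w \<in> S2 ==> rk w = Suc i ==> g2 w \<in> Z"
    "\<And>c. c \<in> S2 ==> rk c = i ==> f c + bd lq rk S2 g2 c \<in> B"
  proof (rule exaD[OF e2, of f])
    fix c assume "c \<in> S2" "Suc (rk c) = i"
    then show "bd lq rk S2 f c \<in> B" using f(2)[of c] c2[of c] by (simp add: bd_def)
  qed (use f(1) in auto)
  obtain h where h: "\<And>w. w \<in> S1 \<inter> S2 ==> rk w = Suc (Suc i) ==> h w \<in> Z"
    "\<And>c. c \<in> S1 \<inter> S2 ==> rk c = Suc i ==> (g1 c + g2 c) + bd lq rk (S1 \<inter> S2) h c \<in> B"
  proof (rule exaD[OF e12, of "\<lambda>w. g1 w + g2 w"])
    fix w assume "w \<in> S1 \<inter> S2" "rk w = Suc i"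
    then show "g1 w + g2 w \<in> Z" using g1(1) g2(1) kv.subspace_add[OF sZ] by auto
  next
    fix c assume c: "c \<in> S1 \<inter> S2" "Suc (rk c) = Suc i"
    have "(f c + bd lq rk S1 g1 c) + (f c + bd lq rk S2 g2 c) \<in> B"
      by (rule kv.subspace_add[OF sB g1(2) g2(2)]) (use c in auto)
    also have "(f c + bd lq rk S1 g1 c) + (f c + bd lq rk S2 g2 c) = (f c + f c) + (bd lq rk S1 g1 c + bd lq rk S2 g2 c)"
      by (simp only: ac_simps)
    finally show "bd lq rk (S1 \<inter> S2) (\<lambda>w. g1 w + g2 w) c \<in> B"
      using c12[OF c(1)] by (simp add: bd_add) (simp add: bd_def)
  qed auto
  define h' where "h' w = (if w \<in> S1 \<inter> S2 then h w else 0)" for w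
  \<comment> \<open>The corrected filling on \<open>S1\<close> and the given one elsewhere; on the
    overlap they agree modulo \<open>B\<close>.\<close>
  define g where "g w = (if w \<in> S1 then g1 w + bd lq rk S1 h' w else g2 w)" for w
  have fin1: "finite S1" using dd by (simp add: dd0_def)
  show "\<exists>g. (\<forall>w\<in>S1 \<union> S2. rk w = Suc i \<longrightarrow> g w \<in> Z) \<and> (\<forall>c\<in>S1 \<union> S2. rk c = i \<longrightarrow> f c + bd lq rk (S1 \<union> S2) g c \<in> B)"
  proof (intro exI[of _ g] conjI ballI impI)
    fix w assume w: "w \<in> S1 \<union> S2" "rk w = Suc i"
    have "bd lq rk S1 h' w \<in> Z" unfolding bd_def
      by (rule kv.subspace_sum[OF sZ]) (use w h(1) kv.subspace_0[OF sZ] in \<open>auto simp: cov_def h'_def\<close>)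
    then show "g w \<in> Z" using w g1(1) g2(1) kv.subspace_add[OF sZ] by (auto simp: g_def)
  next
    fix c assume c: "c \<in> S1 \<union> S2" "rk c = i"
    show "f c + bd lq rk (S1 \<union> S2) g c \<in> B"
    proof (cases "c \<in> S1")
      case True
      have "bd lq rk (S1 \<union> S2) g c = bd lq rk S1 (\<lambda>w. g1 w + bd lq rk S1 h' w) c"
        unfolding bd_def[of _ _ _ g] bd_def[of _ _ _ "\<lambda>w. g1 w + bd lq rk S1 h' w"] c1[OF True]
        by (rule sum.cong) (auto simp: g_def cov_def)
      also have "\<dots> = bd lq rk S1 g1 c" using bd_bd[OF dd True, of h'] by (simp add: bd_add)
      finally show ?thesis using g1(2)[OF True c(2)] by simp
    next
      case False
      then have c2S: "c \<in> S2" using c by simp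
      have "(\<Sum>w\<in>cov lq rk S2 c. g w + g2 w) \<in> B"
      proof (rule kv.subspace_sum[OF sB])
        fix w assume w: "w \<in> cov lq rk S2 c"
        show "g w + g2 w \<in> B"
        proof (cases "w \<in> S1")
          case T: True
          then have w12: "w \<in> S1 \<inter> S2" using w by (auto simp: cov_def)
          have "bd lq rk S1 h' w = bd lq rk (S1 \<inter> S2) h w"
            unfolding bd_def c12(1)[OF w12, symmetric] by (rule sum.cong) (auto simp: h'_def cov_def)
          moreover have "(g1 w + g2 w) + bd lq rk (S1 \<inter> S2) h w \<in> B"
            by (rule h(2)[OF w12]) (use w c in \<open>auto simp: cov_def\<close>)
          ultimately show ?thesis using T by (simp add: g_def ac_simps)
        qed (simp add: g_def kv.subspace_0[OF sB])
      qed
      then have "bd lq rk (S1 \<union> S2) g c + bd lq rk S2 g2 c \<in> B"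
        using c2[OF c2S] by (simp add: bd_def sum.distrib)
      then have "(f c + bd lq rk S2 g2 c) + (bd lq rk (S1 \<union> S2) g c + bd lq rk S2 g2 c) \<in> B"
        by (rule kv.subspace_add[OF sB g2(2)[OF c2S c(2)]])
      also have "(f c + bd lq rk S2 g2 c) + (bd lq rk (S1 \<union> S2) g c + bd lq rk S2 g2 c)
        = f c + bd lq rk (S1 \<union> S2) g c + (bd lq rk S2 g2 c + bd lq rk S2 g2 c)" by (simp only: ac_simps)
      finally show ?thesis by simp
    qed
  qed
qed

text \<open>Fibers are single elements or triples \<open>{x1 q, x2 q, q}\<close> with
  \<open>q\<close> in \<open>R\<close>, where \<open>q\<close> lies one rank above the other two.
  \<open>R\<close> thus holds the elements that lose a rank, and \<open>lower\<close> lifts order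
  relations of the image to relations below a given lift.\<close>

locale zipmap = P: rposet X lq rk + P': rposet X' lq' rk'
  for X :: "'p set" and lq (infix "\<preceq>" 50) and rk and X' :: "'q set" and lq' (infix "\<preceq>''" 50) and rk' +
  fixes \<phi> :: "'p => 'q" and R :: "'p set" and x1 x2 :: "'p => 'p"
  assumes \<phi>X: "c \<in> X ==> \<phi> c \<in> X'"
    and onto: "c' \<in> X' ==> \<exists>c\<in>X. \<phi> c = c'"
    and mono: "\<lbrakk>a \<in> X; b \<in> X; a \<preceq> b\<rbrakk> \<Longrightarrow> \<phi> a \<preceq>' \<phi> b"
    and lower: "\<lbrakk>b \<in> X; a' \<in> X'; a' \<preceq>' \<phi> b\<rbrakk> \<Longrightarrow> \<exists>a\<in>X. a \<preceq> b \<and> \<phi> a = a'"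
    and RX: "q \<in> R ==> q \<in> X"
    and rk_nR: "\<lbrakk>c \<in> X; c \<notin> R\<rbrakk> \<Longrightarrow> rk' (\<phi> c) = rk c"
    and rk_R: "q \<in> R ==> rk q = Suc (rk' (\<phi> q))"
    and fib: "\<lbrakk>c \<in> X; d \<in> X; \<phi> c = \<phi> d; c \<noteq> d\<rbrakk> \<Longrightarrow> \<exists>q\<in>R. c \<in> {x1 q, x2 q, q} \<and> d \<in> {x1 q, x2 q, q}"
    and x1: "q \<in> R ==> x1 q \<in> X \<and> x1 q \<notin> R \<and> x1 q \<preceq> q \<and> \<phi> (x1 q) = \<phi> q"
    and x2: "q \<in> R ==> x2 q \<in> X \<and> x2 q \<notin> R \<and> x2 q \<preceq> q \<and> \<phi> (x2 q) = \<phi> q"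
    and x12: "q \<in> R ==> x1 q \<noteq> x2 q"
    and join: "\<lbrakk>q \<in> R; b \<in> X; x1 q \<preceq> b; x2 q \<preceq> b\<rbrakk> \<Longrightarrow> q \<preceq> b"
begin

lemma rk_x: "q \<in> R ==> rk (x1 q) = rk' (\<phi> q) \<and> rk (x2 q) = rk' (\<phi> q)"
  using x1 x2 rk_nR by metis

lemma fibR: "\<lbrakk>q \<in> R; c \<in> X; \<phi> c = \<phi> q\<rbrakk> \<Longrightarrow> c \<in> {x1 q, x2 q, q}"
proof (rule ccontr)
  assume a: "q \<in> R" "c \<in> X" "\<phi> c = \<phi> q" "c \<notin> {x1 q, x2 q, q}"
  then obtain q' where q': "q' \<in> R" "c \<in> {x1 q', x2 q', q'}" "q \<in> {x1 q', x2 q', q'}"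
    using fib[of c q] RX by auto
  then have "q = q'" using x1[of q'] x2[of q'] a(1) by auto
  with q' a show False by simp
qed

definition F :: "'q => 'p => 'p set" where "F a' b = {a \<in> X. \<phi> a = a' \<and> a \<preceq> b}"

text \<open>If \<open>q\<close> is not below \<open>b\<close>, then by \<open>join\<close> at most
  one of \<open>x1 q\<close> and \<open>x2 q\<close> is; so the part of a fiber below
  \<open>b\<close> is never a pair.\<close>

lemma F_cases:
  assumes b: "b \<in> X" and a': "a' \<in> X'" "a' \<preceq>' \<phi> b"
  obtains (single) a where "F a' b = {a}" "a \<in> X" "a \<notin> R" "\<phi> a = a'" "a \<preceq> b"
   | (triple) q where "q \<in> R" "F a' b = {x1 q, x2 q, q}" "\<phi> q = a'" "q \<preceq> b"
proof -
  obtain a where a: "a \<in> X" "a \<preceq> b" "\<phi> a = a'" using lower[OF b a'] by blast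
  show thesis
  proof (cases "\<exists>q\<in>R. \<phi> q = a'")
    case True
    then obtain q where q: "q \<in> R" "\<phi> q = a'" by blast
    have sub: "F a' b \<subseteq> {x1 q, x2 q, q}" using fibR[OF q(1)] q(2) by (auto simp: F_def)
    show thesis
    proof (cases "q \<preceq> b")
      case T: True
      have "x1 q \<preceq> b" "x2 q \<preceq> b" using P.trans[OF _ RX[OF q(1)] b _ T] x1[OF q(1)] x2[OF q(1)] by auto
      then have "F a' b = {x1 q, x2 q, q}" using sub T x1[OF q(1)] x2[OF q(1)] RX[OF q(1)] q(2) by (auto simp: F_def)
      with q T show thesis using triple by blast
    next
      case Fa: False
      then have "\<not> (x1 q \<preceq> b \<and> x2 q \<preceq> b)" using join[OF q(1) b] by blast
      moreover have "a \<in> {x1 q, x2 q}" using fibR[OF q(1) a(1)] a q Fa by auto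
      ultimately have "F a' b = {a}" using sub Fa a by (auto simp: F_def)
      moreover have "a \<notin> R" using \<open>a \<in> {x1 q, x2 q}\<close> x1[OF q(1)] x2[OF q(1)] by auto
      ultimately show thesis using single a by blast
    qed
  next
    case False
    have "d = a" if h: "d \<in> F a' b" for d
    proof (rule ccontr)
      assume "d \<noteq> a"
      then obtain q where q: "q \<in> R" "d \<in> {x1 q, x2 q, q}" using fib[of d a] a h by (auto simp: F_def)
      then have "\<phi> q = a'" using x1[OF q(1)] x2[OF q(1)] h by (auto simp: F_def)
      with q False show False by blast
    qed
    moreover have "a \<in> F a' b" using a by (simp add: F_def)
    ultimately have "F a' b = {a}" by blast
    moreover have "a \<notin> R" using False a by blast
    ultimately show thesis using single a by blast
  qed
qed

lemma rep: "c' \<in> X' ==> \<exists>c\<in>X. c \<notin> R \<and> \<phi> c = c'"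
proof -
  assume "c' \<in> X'"
  from onto[OF this] obtain c where c: "c \<in> X" "\<phi> c = c'" by blast
  then show ?thesis using x1[of c] by (cases "c \<in> R") auto
qed

text \<open>The preimage of an interval, cut off at a lift \<open>b\<close> of its upper end. By
  \<open>S_union\<close> and \<open>triple_S\<close> it is one interval of \<open>X\<close>, or the
  union of two that meet in a third.\<close>

definition S :: "'q => 'p => 'p set" where "S a' b = {c \<in> X. c \<preceq> b \<and> a' \<preceq>' \<phi> c}"

lemma S_union:
  assumes b: "b \<in> X" and a': "a' \<in> X'"
  shows "S a' b = (\<Union>a\<in>F a' b. ivl X (\<preceq>) a b)"
proof
  show "S a' b \<subseteq> (\<Union>a\<in>F a' b. ivl X (\<preceq>) a b)"
  proof
    fix c assume c: "c \<in> S a' b"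
    then obtain a where a: "a \<in> X" "a \<preceq> c" "\<phi> a = a'" using lower[of c a'] a' by (auto simp: S_def)
    then have "a \<preceq> b" using P.trans[of a c b] c b by (auto simp: S_def)
    then show "c \<in> (\<Union>a\<in>F a' b. ivl X (\<preceq>) a b)" using a c by (auto simp: F_def S_def ivl_def)
  qed
  show "(\<Union>a\<in>F a' b. ivl X (\<preceq>) a b) \<subseteq> S a' b" using mono by (auto simp: F_def S_def ivl_def)
qed

lemma S_sub: "S a' b \<subseteq> X" by (auto simp: S_def)
lemma S_fin: "finite (S a' b)" using P.fin S_sub finite_subset by blast

lemma S_dd: "P.eulerian ==> b \<in> X ==> a' \<in> X' ==> dd0 (\<preceq>) rk (S a' b)"
proof (rule P.dd0_convex[OF _ S_sub])
  fix x y z assume a: "a' \<in> X'" "b \<in> X" "x \<in> S a' b" "z \<in> S a' b" "y \<in> X" "x \<preceq> y" "y \<preceq> z"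
  have "y \<preceq> b" using P.trans[of y z b] a by (auto simp: S_def)
  moreover have "a' \<preceq>' \<phi> y" using P'.trans[of a' "\<phi> x" "\<phi> y"] mono[of x y] \<phi>X a by (auto simp: S_def)
  ultimately show "y \<in> S a' b" using a by (simp add: S_def)
qed

lemma triple_S:
  assumes b: "b \<in> X" and q: "q \<in> R"
  shows "ivl X (\<preceq>) (x1 q) b \<inter> ivl X (\<preceq>) (x2 q) b = ivl X (\<preceq>) q b"
    "ivl X (\<preceq>) q b \<subseteq> ivl X (\<preceq>) (x1 q) b" "ivl X (\<preceq>) q b \<subseteq> ivl X (\<preceq>) (x2 q) b"
proof -
  have "x1 q \<preceq> c" "x2 q \<preceq> c" if "c \<in> X" "q \<preceq> c" for c
    using P.trans[of _ q c] x1[OF q] x2[OF q] RX[OF q] that by auto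
  then show "ivl X (\<preceq>) (x1 q) b \<inter> ivl X (\<preceq>) (x2 q) b = ivl X (\<preceq>) q b"
    "ivl X (\<preceq>) q b \<subseteq> ivl X (\<preceq>) (x1 q) b" "ivl X (\<preceq>) q b \<subseteq> ivl X (\<preceq>) (x2 q) b"
    using join[OF q] by (auto simp: ivl_def)
qed

text \<open>The sum over \<open>S a' b\<close> vanishes by inclusion and exclusion, and a triple
  contributes 1 + 1 - 1 times the sign of its image.\<close>

lemma eulerian': 
  assumes eul: "P.eulerian" shows "P'.eulerian"
  unfolding P'.eulerian_def
proof (intro ballI impI)
  fix a' b' assume ab: "a' \<in> X'" "b' \<in> X'" "a' \<preceq>' b'" "a' \<noteq> b'"
  obtain b where b: "b \<in> X" "b \<notin> R" "\<phi> b = b'" using rep[OF ab(2)] by blast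
  have e0: "(\<Sum>c\<in>ivl X (\<preceq>) a b. (-1) ^ rk c) = (0::int)" if "a \<in> F a' b" for a
    using eul[unfolded P.eulerian_def] that b ab by (auto simp: F_def)
  have S0: "(\<Sum>c\<in>S a' b. (-1) ^ rk c) = (0::int)"
  proof (cases rule: F_cases[OF b(1) ab(1)])
    case (2 a)
    note s1 = this
    then show ?thesis using S_union[OF b(1) ab(1)] e0 by simp
  next
    case (3 q)
    note s2 = this
    have f: "finite (ivl X (\<preceq>) a b)" for a using P.fin by (simp add: ivl_def)
    have "S a' b = ivl X (\<preceq>) (x1 q) b \<union> ivl X (\<preceq>) (x2 q) b"
      unfolding S_union[OF b(1) ab(1)] s2(2) using triple_S[OF b(1) s2(1)] by auto
    moreover have "(\<Sum>c\<in>ivl X (\<preceq>) (x1 q) b \<union> ivl X (\<preceq>) (x2 q) b. (-1) ^ rk c) = (0::int)"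
      using sum.union_inter[OF f f, of "\<lambda>c. (-1::int) ^ rk c" "x1 q" "x2 q"] triple_S(1)[OF b(1) s2(1)] e0 s2(2) by simp
    ultimately show ?thesis by simp
  qed (use ab b in auto)
  have im: "\<phi> ` S a' b \<subseteq> ivl X' (\<preceq>') a' b'" using \<phi>X mono[OF _ b(1)] b(3) by (auto simp: S_def ivl_def)
  have "(\<Sum>c\<in>S a' b. (-1) ^ rk c) = (\<Sum>c'\<in>ivl X' (\<preceq>') a' b'. \<Sum>c\<in>{c\<in>S a' b. \<phi> c = c'}. (-1::int) ^ rk c)"
    by (rule sum.group[symmetric, OF S_fin _ im]) (use P'.fin in \<open>simp add: ivl_def\<close>)
  also have "\<dots> = (\<Sum>c'\<in>ivl X' (\<preceq>') a' b'. (-1) ^ rk' c')"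
  proof (rule sum.cong[OF HOL.refl])
    fix c' assume c': "c' \<in> ivl X' (\<preceq>') a' b'"
    have FS: "{c\<in>S a' b. \<phi> c = c'} = F c' b" using c' by (auto simp: S_def F_def ivl_def)
    show "(\<Sum>c\<in>{c\<in>S a' b. \<phi> c = c'}. (-1::int) ^ rk c) = (-1) ^ rk' c'"
    proof (cases rule: F_cases[OF b(1), of c'])
      case (3 a)
      then show ?thesis unfolding FS using rk_nR[of a] by auto
    next
      case (4 q)
      have "x1 q \<noteq> q" "x2 q \<noteq> q" using x1[OF 4(1)] x2[OF 4(1)] 4(1) by auto
      then show ?thesis unfolding FS 4(2) using rk_x[OF 4(1)] rk_R[OF 4(1)] x12[OF 4(1)] 4(3) by simp
    qed (use c' b in \<open>auto simp: ivl_def\<close>)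
  qed
  finally show "(\<Sum>c'\<in>ivl X' (\<preceq>') a' b'. (-1) ^ rk' c') = (0::int)" using S0 by simp
qed

lemma acyc_S:
  fixes t :: "'e::kvec itself"
  assumes eul: "P.eulerian" and ac: "P.acyclic t" and b: "b \<in> X" "b \<notin> R" and a': "a' \<in> X'" "a' \<preceq>' \<phi> b" "a' \<noteq> \<phi> b"
  shows "acyc t (\<preceq>) rk (S a' b)"
proof -
  have e0: "acyc t (\<preceq>) rk (ivl X (\<preceq>) a b)" if "a \<in> F a' b" for a
    using ac[unfolded P.acyclic_def] that b a' by (auto simp: F_def)
  show ?thesis
  proof (cases rule: F_cases[OF b(1) a'(1,2)])
    case (1 a)
    note s1 = this
    then show ?thesis using S_union[OF b(1) a'(1)] e0 by simp
  next
    case (2 q)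
    note s2 = this
    have "S a' b = ivl X (\<preceq>) (x1 q) b \<union> ivl X (\<preceq>) (x2 q) b"
      unfolding S_union[OF b(1) a'(1)] s2(2) using triple_S[OF b(1) s2(1)] by auto
    moreover have "acyc t (\<preceq>) rk (ivl X (\<preceq>) (x1 q) b \<union> ivl X (\<preceq>) (x2 q) b)"
    proof (rule acyc_union)
      show "acyc t (\<preceq>) rk (ivl X (\<preceq>) (x1 q) b \<inter> ivl X (\<preceq>) (x2 q) b)"
        unfolding triple_S(1)[OF b(1) s2(1)] by (rule e0) (simp add: s2)
      show "dd0 (\<preceq>) rk (ivl X (\<preceq>) (x1 q) b)"
      proof (rule P.dd0_convex[OF eul])
        fix x y z assume "x \<in> ivl X (\<preceq>) (x1 q) b" "z \<in> ivl X (\<preceq>) (x1 q) b" "y \<in> X" "x \<preceq> y" "y \<preceq> z"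
        then show "y \<in> ivl X (\<preceq>) (x1 q) b"
          using P.trans[of "x1 q" x y] P.trans[of y z b] x1[OF s2(1)] b(1) by (auto simp: ivl_def)
      qed (auto simp: ivl_def)
      show "w \<in> ivl X (\<preceq>) (x1 q) b" if "c \<in> ivl X (\<preceq>) (x1 q) b" "w \<in> ivl X (\<preceq>) (x2 q) b" "c \<preceq> w" for c w
        using that x1[OF s2(1)] P.trans[of "x1 q" c w] by (auto simp: ivl_def)
      show "w \<in> ivl X (\<preceq>) (x2 q) b" if "c \<in> ivl X (\<preceq>) (x2 q) b" "w \<in> ivl X (\<preceq>) (x1 q) b" "c \<preceq> w" for c w
        using that x2[OF s2(1)] P.trans[of "x2 q" c w] by (auto simp: ivl_def)
    qed (use e0 s2 in auto)
    ultimately show ?thesis by simp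
  qed
qed

text \<open>A cycle on an interval of \<open>X'\<close> is lifted to the preimage \<open>?S\<close>,
  filled there, and the filling is pushed forward by summing over the fiber elements outside
  \<open>R\<close>. The elements of \<open>R\<close> carry the values that turn the lift into a
  cycle.\<close>

lemma acyclic':
  fixes t :: "'e::kvec itself"
  assumes eul: "P.eulerian" and ac: "P.acyclic t" shows "P'.acyclic t"
  unfolding P'.acyclic_def
proof (intro ballI impI)
  fix a' b' assume ab: "a' \<in> X'" "b' \<in> X'" "a' \<preceq>' b'" "a' \<noteq> b'"
  obtain b where b: "b \<in> X" "b \<notin> R" "\<phi> b = b'" using rep[OF ab(2)] by blast
  let ?S = "S a' b" and ?S' = "ivl X' (\<preceq>') a' b'"
  let ?N = "?S - R"
  note acS = acyc_S[OF eul ac b(1,2) ab(1)]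
  have dd: "dd0 (\<preceq>) rk ?S" by (rule S_dd[OF eul b(1) ab(1)])
  have finN: "finite ?N" using S_fin by simp
  have finS': "finite ?S'" using P'.fin by (simp add: ivl_def)
  have \<phi>S: "\<phi> c \<in> ?S'" if "c \<in> ?S" for c using that \<phi>X mono[OF _ b(1)] b(3) by (auto simp: S_def ivl_def)
  \<comment> \<open>\<open>U c\<close> holds the covers of \<open>c\<close> outside
    \<open>R\<close>, \<open>U' c'\<close> the lifts outside \<open>R\<close> of the covers of
    \<open>c'\<close>; \<open>K1\<close> and \<open>K2\<close> compare the two.\<close>
  define U where "U c = {v \<in> ?N. c \<preceq> v \<and> rk v = Suc (rk c)}" for c
  define U' where "U' c' = {v \<in> ?N. c' \<preceq>' \<phi> v \<and> rk v = Suc (rk' c')}" for c'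
  have finU: "finite (U c)" "finite (U' c')" for c c'
    unfolding U_def U'_def by (rule finite_subset[OF _ finN]; auto)+
  have FS: "F c' b = {c \<in> ?S. \<phi> c = c'}" if "c' \<in> ?S'" for c' using that by (auto simp: F_def S_def ivl_def)
  have inX: "c' \<in> X' \<and> c' \<preceq>' \<phi> b" if "c' \<in> ?S'" for c' using that b(3) by (auto simp: ivl_def)
  have SX: "c \<in> X" if "c \<in> ?S" for c using that by (simp add: S_def)
  have down: "d \<in> ?S" if "c \<in> ?S" "d \<in> X" "d \<preceq> c" "\<phi> d \<in> ?S'" for c d
    using that P.trans[of d c b] b by (auto simp: S_def ivl_def)
  have U'_lift: "\<exists>d\<in>F c' b. d \<preceq> v" if c': "c' \<in> ?S'" and v: "v \<in> U' c'" for c' v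
  proof -
    obtain d where d: "d \<in> X" "d \<preceq> v" "\<phi> d = c'"
      using lower[of v c'] v c' by (auto simp: U'_def S_def ivl_def)
    then have "d \<in> ?S" using down[of v d] v c' by (auto simp: U'_def)
    then show ?thesis using d FS[OF c'] by auto
  qed
  have U_U': "U c \<subseteq> U' (\<phi> c)" if c: "c \<in> ?N" for c
  proof
    fix v assume v: "v \<in> U c"
    then show "v \<in> U' (\<phi> c)"
      using c mono[of c v] SX[of c] SX[of v] rk_nR[of c] by (auto simp: U_def U'_def)
  qed
  have K1: "U' c' = U c" if c': "c' \<in> ?S'" and F: "F c' b = {c}" "c \<notin> R" for c c'
  proof -
    have c: "c \<in> ?S" "\<phi> c = c'" using FS[OF c'] F by auto
    have "v \<in> U c" if v: "v \<in> U' c'" for v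
      using U'_lift[OF c' v] v F c rk_nR[of c] SX by (auto simp: U_def U'_def)
    then show ?thesis using U_U'[of c] c F by auto
  qed
  have K2: "U' c' = U (x1 q) \<union> U (x2 q)" "U (x1 q) \<inter> U (x2 q) = {}" if c': "c' \<in> ?S'" and q: "q \<in> R" "F c' b = {x1 q, x2 q, q}" "\<phi> q = c'" for q c'
  proof -
    have c: "x1 q \<in> ?S" "x2 q \<in> ?S" "q \<in> ?S" using FS[OF c'] q by auto
    note rkx = rk_x[OF q(1)] 
    have "v \<in> U (x1 q) \<union> U (x2 q)" if v: "v \<in> U' c'" for v
    proof -
      obtain d where d: "d \<in> {x1 q, x2 q, q}" "d \<preceq> v" using U'_lift[OF c' v] q by auto
      have "x1 q \<preceq> v \<or> x2 q \<preceq> v"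
        using d P.trans[of "x1 q" q v] x1[OF q(1)] RX[OF q(1)] v SX by (auto simp: U'_def)
      then show ?thesis using v rkx q by (auto simp: U_def U'_def)
    qed
    moreover have "U (x1 q) \<subseteq> U' c'" "U (x2 q) \<subseteq> U' c'"
      using U_U'[of "x1 q"] U_U'[of "x2 q"] c x1[OF q(1)] x2[OF q(1)] q(3) by auto
    ultimately show "U' c' = U (x1 q) \<union> U (x2 q)" by blast
    \<comment> \<open>A common cover of \<open>x1 q\<close> and \<open>x2 q\<close> lies above their
      join \<open>q\<close> and has the same rank, so it is \<open>q\<close>, which \<open>U\<close>
      excludes.\<close>
    have False if v: "v \<in> U (x1 q)" "v \<in> U (x2 q)" for v
    proof -
      have vX: "v \<in> X" "v \<notin> R" using v SX by (auto simp: U_def)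
      have "q \<preceq> v" using join[OF q(1) vX(1)] v by (auto simp: U_def)
      moreover have "rk v = rk q" using v rkx rk_R[OF q(1)] by (auto simp: U_def)
      ultimately have "q = v" using P.rk_less[OF RX[OF q(1)] vX(1)] by auto
      then show False using vX q by simp
    qed
    then show "U (x1 q) \<inter> U (x2 q) = {}" by blast
  qed
  \<comment> \<open>The images of \<open>c\<close> and \<open>q\<close> are comparable and have
    equal rank, so they coincide.\<close>
  have covR: "c \<in> {x1 q, x2 q}" if c: "c \<in> ?N" "q \<in> R" "c \<preceq> q" "rk q = Suc (rk c)" for c q
  proof -
    have cX: "c \<in> X" "c \<notin> R" using c SX by auto
    have "\<phi> c \<preceq>' \<phi> q" using mono[OF cX(1) RX[OF c(2)] c(3)] .
    moreover have "rk' (\<phi> c) = rk' (\<phi> q)" using rk_nR[OF cX] rk_R[OF c(2)] c(4) by simp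
    ultimately have "\<phi> c = \<phi> q" using P'.rk_less[OF \<phi>X[OF cX(1)] \<phi>X[OF RX[OF c(2)]]] by auto
    then show ?thesis using fibR[OF c(2) cX(1)] cX c by auto
  qed
  have cov1: "bd (\<preceq>) rk ?S h c = (\<Sum>v\<in>U c. h v)" if c: "c \<in> ?N" and F: "F (\<phi> c) b = {c}" for h :: "'p => 'e" and c
  proof -
    have "cov (\<preceq>) rk ?S c = U c"
    proof
      show "cov (\<preceq>) rk ?S c \<subseteq> U c"
      proof
        fix q assume q: "q \<in> cov (\<preceq>) rk ?S c"
        have "q \<notin> R"
        proof
          assume qR: "q \<in> R"
          then have "c \<in> {x1 q, x2 q}" using covR[OF c qR] q by (auto simp: cov_def)
          then have "\<phi> c = \<phi> q" using x1[OF qR] x2[OF qR] by auto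
          moreover have "q \<in> ?S" using q by (simp add: cov_def)
          ultimately have "q \<in> F (\<phi> c) b" by (auto simp: F_def S_def)
          then show False using F c qR by auto
        qed
        then show "q \<in> U c" using q by (auto simp: cov_def U_def)
      qed
    qed (auto simp: cov_def U_def)
    then show ?thesis by (simp add: bd_def)
  qed
  have cov2: "bd (\<preceq>) rk ?S h c = h q + (\<Sum>v\<in>U c. h v)"
    if q: "q \<in> R" "q \<in> ?S" and c: "c \<in> {x1 q, x2 q}" for h :: "'p => 'e" and c q
  proof -
    have cX: "c \<in> X" "c \<notin> R" "c \<preceq> q" "\<phi> c = \<phi> q" using c x1[OF q(1)] x2[OF q(1)] by auto
    have cN: "c \<in> ?N" using down[OF q(2) cX(1,3)] \<phi>S[OF q(2)] cX by simp
    have rkc: "rk q = Suc (rk c)" using c rk_x[OF q(1)] rk_R[OF q(1)] by auto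
    have "cov (\<preceq>) rk ?S c = insert q (U c)"
    proof
      show "cov (\<preceq>) rk ?S c \<subseteq> insert q (U c)"
      proof
        fix w assume w: "w \<in> cov (\<preceq>) rk ?S c"
        show "w \<in> insert q (U c)"
        proof (cases "w \<in> R")
          case True
          then have "c \<in> {x1 w, x2 w}" using covR[OF cN True] w by (auto simp: cov_def)
          then have "\<phi> w = \<phi> q" using x1[OF True] x2[OF True] cX by auto
          then have "w = q" using fibR[OF q(1) RX[OF True]] True x1[OF q(1)] x2[OF q(1)] by auto
          then show ?thesis by simp
        qed (use w in \<open>auto simp: cov_def U_def\<close>)
      qed
      show "insert q (U c) \<subseteq> cov (\<preceq>) rk ?S c" using q cX rkc by (auto simp: cov_def U_def)
    qed
    moreover have "q \<notin> U c" using q by (auto simp: U_def)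
    ultimately show ?thesis using finU by (simp add: bd_def)
  qed
  have grp: "(\<Sum>v\<in>U' c'. h v) = (\<Sum>w'\<in>cov (\<preceq>') rk' ?S' c'. \<Sum>v\<in>{v\<in>?N. \<phi> v = w'}. h v)" if "c' \<in> ?S'" for h :: "'p => 'e" and c'
  proof -
    have sub: "\<phi> ` U' c' \<subseteq> cov (\<preceq>') rk' ?S' c'" 
    proof
      fix w' assume "w' \<in> \<phi> ` U' c'"
      then obtain v where v: "v \<in> U' c'" "w' = \<phi> v" by blast
      then show "w' \<in> cov (\<preceq>') rk' ?S' c'"
        using \<phi>S[of v] rk_nR[of v] SX[of v] by (auto simp: U'_def cov_def)
    qed
    have "(\<Sum>v\<in>U' c'. h v) = (\<Sum>w'\<in>cov (\<preceq>') rk' ?S' c'. \<Sum>v\<in>{v\<in>U' c'. \<phi> v = w'}. h v)"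
      by (rule sum.group[symmetric, OF finU(2) _ sub]) (use finS' in \<open>simp add: cov_def\<close>)
    also have "\<dots> = (\<Sum>w'\<in>cov (\<preceq>') rk' ?S' c'. \<Sum>v\<in>{v\<in>?N. \<phi> v = w'}. h v)"
    proof (rule sum.cong[OF HOL.refl])
      fix w' assume "w' \<in> cov (\<preceq>') rk' ?S' c'"
      then have w': "c' \<preceq>' w'" "rk' w' = Suc (rk' c')" by (auto simp: cov_def)
      have "v \<in> U' c'" if "v \<in> ?N" "\<phi> v = w'" for v
        using that w' rk_nR[of v] SX[of v] by (auto simp: U'_def)
      then have "{v\<in>U' c'. \<phi> v = w'} = {v\<in>?N. \<phi> v = w'}" by (auto simp: U'_def)
      then show "(\<Sum>v\<in>{v\<in>U' c'. \<phi> v = w'}. h v) = (\<Sum>v\<in>{v\<in>?N. \<phi> v = w'}. h v)" by simp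
    qed
    finally show ?thesis .
  qed
  have "\<exists>c. c \<in> ?N \<and> \<phi> c = c'" if c': "c' \<in> ?S'" for c'
    
  proof (cases rule: F_cases[OF b(1), of c'])
    case (3 a)
    then show ?thesis using FS[OF c'] by auto
  next
    case (4 q)
    then show ?thesis using FS[OF c'] x1[OF 4(1)] by auto
  qed (use inX[OF c'] in auto)
  then have "\<forall>c'. \<exists>c. c' \<in> ?S' \<longrightarrow> c \<in> ?N \<and> \<phi> c = c'" by blast
  from choice[OF this] obtain rp where rp: "\<forall>c'. c' \<in> ?S' \<longrightarrow> rp c' \<in> ?N \<and> \<phi> (rp c') = c'" ..
  show "acyc t (\<preceq>') rk' ?S'" unfolding acyc_def
  proof (intro allI impI exaI)
    fix Z B :: "'e set" and i f'
    assume sZ: "kv.subspace Z" and sB: "kv.subspace B" and BZ: "B \<subseteq> Z"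
      and f': "\<And>w. w \<in> ?S' ==> rk' w = i ==> f' w \<in> Z"
        "\<And>c. c \<in> ?S' ==> Suc (rk' c) = i ==> bd (\<preceq>') rk' ?S' f' c \<in> B"
    \<comment> \<open>Each value is placed at one chosen lift outside \<open>R\<close>.\<close>
    define f0 where "f0 v = (if v = rp (\<phi> v) then f' (\<phi> v) else 0)" for v
    \<comment> \<open>On \<open>R\<close> the value makes the boundary at \<open>x2 v\<close>
      vanish. The boundary at \<open>x1 v\<close> is then the full boundary in the image, since
      \<open>U'\<close> is the disjoint union of the two sets of covers.\<close>
    define f where "f v = (if v \<in> R then \<Sum>w\<in>U (x2 v). f0 w else f0 v)" for v
    have f0s: "(\<Sum>v\<in>U' c'. f0 v) = bd (\<preceq>') rk' ?S' f' c'" if c': "c' \<in> ?S'" for c'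
      unfolding grp[OF c'] bd_def
    proof (rule sum.cong[OF HOL.refl])
      fix w' assume "w' \<in> cov (\<preceq>') rk' ?S' c'"
      then have w': "w' \<in> ?S'" by (simp add: cov_def)
      have "(\<Sum>v\<in>{v\<in>?N. \<phi> v = w'}. f0 v) = (\<Sum>v\<in>{v\<in>?N. \<phi> v = w'}. if v = rp w' then f' w' else 0)"
        by (rule sum.cong) (auto simp: f0_def)
      also have "\<dots> = f' w'"
      proof -
        have "finite {v\<in>?N. \<phi> v = w'}" by (rule finite_subset[OF _ finN]) auto
        moreover have "rp w' \<in> {v\<in>?N. \<phi> v = w'}" using rp w' by simp
        ultimately show ?thesis by (simp only: sum.delta if_True)
      qed
      finally show "(\<Sum>v\<in>{v\<in>?N. \<phi> v = w'}. f0 v) = f' w'" .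
    qed
    have fU: "(\<Sum>v\<in>U c. f v) = (\<Sum>v\<in>U c. f0 v)" for c
      by (rule sum.cong) (auto simp: f_def U_def)
    have f0Z: "f0 v \<in> Z" if "v \<in> ?N" "rk v = i" for v
      using that f'(1)[of "\<phi> v"] \<phi>S[of v] rk_nR[of v] SX[of v] kv.subspace_0[OF sZ] by (auto simp: f0_def)
    have fZ: "f v \<in> Z" if v: "v \<in> ?S" "rk v = i" for v
    proof (cases "v \<in> R")
      case True
      have "rk (x2 v) = rk' (\<phi> v)" "rk v = Suc (rk' (\<phi> v))" using rk_x[OF True] rk_R[OF True] by auto
      then show ?thesis using True v by (auto simp: f_def U_def intro!: kv.subspace_sum[OF sZ] f0Z)
    next
      case False
      then show ?thesis using f0Z v by (simp add: f_def)
    qed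
    have cyc1: "bd (\<preceq>) rk ?S f c \<in> B" if c: "c \<in> ?N" "Suc (rk c) = i" for c
    proof -
      have cS: "\<phi> c \<in> ?S'" using \<phi>S c by auto
      have cX: "c \<in> X" "c \<notin> R" using c SX by auto
      have b': "bd (\<preceq>') rk' ?S' f' (\<phi> c) \<in> B" by (rule f'(2)[OF cS]) (use c rk_nR[OF cX] in simp)
      show ?thesis
      proof (cases rule: F_cases[OF b(1), of "\<phi> c"])
        case (3 a)
        then have F: "F (\<phi> c) b = {c}" using FS[OF cS] c by auto
        show ?thesis using b' unfolding cov1[OF c(1) F] unfolding fU unfolding K1[OF cS F cX(2), symmetric] f0s[OF cS] .
      next
        case (4 q)
        have qS: "q \<in> ?S" using FS[OF cS] 4 by auto
        have cq: "c \<in> {x1 q, x2 q}" using fibR[OF 4(1) cX(1)] 4(1,3) cX by auto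
        have fq: "f q = (\<Sum>v\<in>U (x2 q). f0 v)" using 4 by (simp add: f_def)
        show ?thesis
        proof (cases "c = x2 q")
          case True
          then show ?thesis unfolding cov2[OF 4(1) qS cq] fU fq using kv.subspace_0[OF sB] by simp
        next
          case False
          then have "c = x1 q" using cq by simp
          then have "f q + (\<Sum>v\<in>U c. f0 v) = (\<Sum>v\<in>U' (\<phi> c). f0 v)"
            unfolding fq K2(1)[OF cS 4(1,2,3)]
            using K2(2)[OF cS 4(1,2,3)] finU by (subst sum.union_disjoint) (auto simp: add.commute)
          then show ?thesis unfolding cov2[OF 4(1) qS cq] fU using b' f0s[OF cS] by simp
        qed
      qed (use inX[OF cS] in auto)
    qed
    have cyc: "bd (\<preceq>) rk ?S f c \<in> B" if c: "c \<in> ?S" "Suc (rk c) = i" for c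
    proof (cases "c \<in> R")
      case True
      have x1S: "x1 c \<in> ?S" using down[OF c(1), of "x1 c"] x1[OF True] \<phi>S[OF c(1)] by simp
      \<comment> \<open>For \<open>c\<close> in \<open>R\<close> the cycle condition follows from
        the one outside \<open>R\<close>, because the boundary squares to zero at
        \<open>x1 c\<close>.\<close>
      have "0 = bd (\<preceq>) rk ?S (bd (\<preceq>) rk ?S f) (x1 c)" using bd_bd[OF dd x1S, of f] by simp
      also have "\<dots> = bd (\<preceq>) rk ?S f c + (\<Sum>v\<in>U (x1 c). bd (\<preceq>) rk ?S f v)"
        by (rule cov2[OF True c(1)]) simp
      finally have "bd (\<preceq>) rk ?S f c = (\<Sum>v\<in>U (x1 c). bd (\<preceq>) rk ?S f v)"
        by (metis kv_uminus add_eq_0_iff)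
      moreover have "(\<Sum>v\<in>U (x1 c). bd (\<preceq>) rk ?S f v) \<in> B"
        by (rule kv.subspace_sum[OF sB], rule cyc1) (use c rk_x[OF True] rk_R[OF True] in \<open>auto simp: U_def\<close>)
      ultimately show ?thesis by simp
    qed (use cyc1 c in auto)
    have ex: "exa (\<preceq>) rk ?S (\<lambda>_. Z) (\<lambda>_. B) i" using acS ab b sZ sB BZ by (auto simp: acyc_def)
    obtain g where g: "\<And>w. w \<in> ?S ==> rk w = Suc i ==> g w \<in> Z"
      "\<And>c. c \<in> ?S ==> rk c = i ==> f c + bd (\<preceq>) rk ?S g c \<in> B"
      using exaD[OF ex fZ cyc] by metis
    define g' where "g' w' = (\<Sum>v\<in>{v\<in>?N. \<phi> v = w'}. g v)" for w'
    have g's: "bd (\<preceq>') rk' ?S' g' c' = (\<Sum>v\<in>U' c'. g v)" if "c' \<in> ?S'" for c'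
      unfolding grp[OF that] bd_def g'_def ..
    show "\<exists>g. (\<forall>w\<in>?S'. rk' w = Suc i \<longrightarrow> g w \<in> Z) \<and> (\<forall>c\<in>?S'. rk' c = i \<longrightarrow> f' c + bd (\<preceq>') rk' ?S' g c \<in> B)"
    proof (intro exI[of _ g'] conjI ballI impI)
      fix w' assume "w' \<in> ?S'" "rk' w' = Suc i"
      note w' = this
      show "g' w' \<in> Z" unfolding g'_def
      proof (rule kv.subspace_sum[OF sZ])
        fix v assume "v \<in> {v \<in> ?N. \<phi> v = w'}"
        then show "g v \<in> Z" using g(1)[of v] rk_nR[of v] SX[of v] w' by auto
      qed
    next
      fix c' assume c': "c' \<in> ?S'" "rk' c' = i"
      show "f' c' + bd (\<preceq>') rk' ?S' g' c' \<in> B"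
      proof (cases rule: F_cases[OF b(1), of c'])
        case (3 c)
        have cN: "c \<in> ?N" using FS[OF c'(1)] 3 by auto
        have "rp c' \<in> F c' b" using rp c' FS[OF c'(1)] by auto
        then have "c = rp c'" using 3 by auto
        then have "f c = f' c'" using 3 by (auto simp: f_def f0_def)
        moreover have "f c + bd (\<preceq>) rk ?S g c \<in> B"
          by (rule g(2)) (use cN c' rk_nR[OF 3(2,3)] 3 in auto)
        moreover have "bd (\<preceq>) rk ?S g c = (\<Sum>v\<in>U' c'. g v)"
          using cov1[OF cN, of g] K1[OF c'(1) 3(1) 3(3)] 3 by simp
        ultimately show ?thesis using g's[OF c'(1)] by simp
      next
        case (4 q)
        have qS: "q \<in> ?S" "x1 q \<in> ?S" "x2 q \<in> ?S" using FS[OF c'(1)] 4 by auto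
        have rp12: "rp c' \<in> {x1 q, x2 q}" using rp c' fibR[OF 4(1), of "rp c'"] 4 SX by auto
        have px: "\<phi> (x1 q) = c'" "\<phi> (x2 q) = c'" "x1 q \<notin> R" "x2 q \<notin> R"
          using x1[OF 4(1)] x2[OF 4(1)] 4(3) by simp_all
        have fx: "f (x1 q) = (if x1 q = rp c' then f' c' else 0)" "f (x2 q) = (if x2 q = rp c' then f' c' else 0)"
          unfolding f_def f0_def px(1,2) using px(3,4) by simp_all
        have ff: "f (x1 q) + f (x2 q) = f' c'"
        proof (cases "x1 q = rp c'")
          case True
          then have "x2 q \<noteq> rp c'" using x12[OF 4(1)] by simp
          then show ?thesis unfolding fx using True by simp
        next
          case False
          then have "x2 q = rp c'" using rp12 by simp
          then show ?thesis unfolding fx using False by simp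
        qed
        \<comment> \<open>Adding the equations at \<open>x1 q\<close> and \<open>x2 q\<close>
          cancels the value of \<open>g\<close> at \<open>q\<close>.\<close>
        have "(f (x1 q) + bd (\<preceq>) rk ?S g (x1 q)) + (f (x2 q) + bd (\<preceq>) rk ?S g (x2 q)) \<in> B"
          by (rule kv.subspace_add[OF sB g(2) g(2)]) (use qS c' rk_x[OF 4(1)] 4(3) in auto)
        also have "(f (x1 q) + bd (\<preceq>) rk ?S g (x1 q)) + (f (x2 q) + bd (\<preceq>) rk ?S g (x2 q))
          = (f (x1 q) + f (x2 q)) + (g q + g q) + ((\<Sum>v\<in>U (x1 q). g v) + (\<Sum>v\<in>U (x2 q). g v))"
          using cov2[OF 4(1) qS(1), of "x1 q" g] cov2[OF 4(1) qS(1), of "x2 q" g] by (simp only: insertI1 insertI2 ac_simps)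
        also have "\<dots> = f' c' + bd (\<preceq>') rk' ?S' g' c'"
          unfolding g's[OF c'(1)] K2(1)[OF c'(1) 4(1,2,3)] ff
          using K2(2)[OF c'(1) 4(1,2,3)] finU by (simp add: sum.union_disjoint)
        finally show ?thesis .
      qed (use inX[OF c'(1)] in auto)
    qed
  qed
qed

end

section \<open>The ab-index under a zip map\<close>

context zipmap begin

text \<open>Once the zip terms are separated, the weight at z is \<gamma> b outside \<open>R\<close>
  and \<gamma> (c b - d) on \<open>R\<close>. The identity b J + b J + (c b - d) = b J, with J = a -
  b, makes a whole triple contribute like the single element of the image.\<close>

lemma fiber_sum:
  fixes \<gamma> :: "'q => ab_poly"
  defines "M \<equiv> \<lambda>z. if z \<in> R then \<gamma> (\<phi> z) * (pc * poly_b - pd) else \<gamma> (\<phi> z) * poly_b"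
  assumes b: "b \<in> X" and a': "a' \<in> X'" "a' \<preceq>' \<phi> b"
  shows "(\<Sum>z\<in>F a' b - {b}. M z * pJ ^ (rk b - 1 - rk z)) =
    (if a' = \<phi> b then (if b \<in> R then \<gamma> a' * (poly_b + poly_b) else 0)
     else \<gamma> a' * poly_b * pJ ^ (rk b - 1 - rk' a'))"
proof -
  have ident: "poly_b * pJ + poly_b * pJ + (pc * poly_b - pd) = poly_b * pJ"
    by (simp add: pJ_def pc_def pd_def algebra_simps)
  show ?thesis
  proof (cases rule: F_cases[OF b a'])
    case (1 a)
    have eq: "\<gamma> a' * poly_b * pJ ^ (rk b - 1 - rk' a') = M a * pJ ^ (rk b - 1 - rk a)"
      using 1 rk_nR[of a] by (auto simp: M_def)
    show ?thesis
    proof (cases "a' = \<phi> b")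
      case True
      then have "b \<in> F a' b" using b by (simp add: F_def)
      then have "b = a" using 1 by simp
      then show ?thesis using True 1 by simp
    next
      case False
      then have "F a' b - {b} = {a}" using 1 by auto
      then show ?thesis using False eq by simp
    qed
  next
    case (2 q)
    have ne: "x1 q \<noteq> q" "x2 q \<noteq> q" "x1 q \<noteq> x2 q" using x1[OF 2(1)] x2[OF 2(1)] x12[OF 2(1)] 2(1) by auto
    have Mx: "M (x1 q) = \<gamma> a' * poly_b" "M (x2 q) = \<gamma> a' * poly_b" "M q = \<gamma> a' * (pc * poly_b - pd)"
      using x1[OF 2(1)] x2[OF 2(1)] 2 by (auto simp: M_def)
    have rx: "rk (x1 q) = rk' a'" "rk (x2 q) = rk' a'" "rk q = Suc (rk' a')"
      using rk_x[OF 2(1)] rk_R[OF 2(1)] 2(3) by auto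
    show ?thesis
    proof (cases "b = q")
      case True
      then have "F a' b - {b} = {x1 q, x2 q}" using 2 ne by auto
      then show ?thesis using True 2 ne Mx rx by (simp add: distrib_left)
    next
      case False
      have lt: "rk q < rk b" using P.rk_less[OF RX[OF 2(1)] b 2(4)] False by auto
      have "\<phi> b \<noteq> a'"
      proof
        assume "\<phi> b = a'"
        then have "b \<in> {x1 q, x2 q, q}" using fibR[OF 2(1) b] 2(3) by simp
        then show False using False lt rx by auto
      qed
      moreover have "F a' b - {b} = {x1 q, x2 q, q}"
      proof -
        have "b \<noteq> x1 q" "b \<noteq> x2 q" using lt rx by auto
        then show ?thesis using 2(2) False by auto
      qed
      moreover have "rk b - 1 - rk' a' = Suc (rk b - 1 - rk q)" using lt rx by simp
      moreover have "\<gamma> a' * poly_b * (pJ * Q) + (\<gamma> a' * poly_b * (pJ * Q) + \<gamma> a' * (pc * poly_b - pd) * Q)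
         = \<gamma> a' * poly_b * (pJ * Q)" for Q
      proof -
        have "\<gamma> a' * poly_b * (pJ * Q) + (\<gamma> a' * poly_b * (pJ * Q) + \<gamma> a' * (pc * poly_b - pd) * Q)
          = \<gamma> a' * (poly_b * pJ + poly_b * pJ + (pc * poly_b - pd)) * Q"
          by (simp only: distrib_left distrib_right mult.assoc add.assoc)
        then show ?thesis unfolding ident by (simp only: mult.assoc)
      qed
      ultimately show ?thesis using ne rx by (simp add: Mx)
    qed
  qed
qed

definition zip_sum :: "'p => 'p => ab_poly" where
  "zip_sum bt b = (\<Sum>q\<in>{q\<in>R. q \<preceq> b \<and> q \<noteq> b}. P'.psi (\<phi> bt) (\<phi> q) * pd * P.psi q b)"

text \<open>The recursion of \<open>psi\<close> for the upper factor of each summand. The subtracted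
  sum consists of the terms z = q, which are absent because \<open>zip_sum\<close> at z involves
  only q strictly below z.\<close>

lemma zip_sum_rec:
  assumes b: "b \<in> X"
  shows "(\<Sum>z\<in>{z\<in>X. z \<preceq> b \<and> z \<noteq> b}. zip_sum bt z * poly_b * pJ ^ (rk b - 1 - rk z)) =
    zip_sum bt b - (\<Sum>q\<in>{q\<in>R. q \<preceq> b \<and> q \<noteq> b}. P'.psi (\<phi> bt) (\<phi> q) * pd * pJ ^ (rk b - 1 - rk q))"
proof -
  let ?Z = "{z\<in>X. z \<preceq> b \<and> z \<noteq> b}" and ?Q = "{q\<in>R. q \<preceq> b \<and> q \<noteq> b}"
  let ?g = "\<lambda>q. P'.psi (\<phi> bt) (\<phi> q) * pd" and ?J = "\<lambda>z. pJ ^ (rk b - 1 - rk z)"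
  have fR: "finite R" by (rule finite_subset[OF _ P.fin]) (use RX in blast)
  have fZ: "finite ?Z" and fQ: "finite ?Q" using P.fin fR by auto
  have "(\<Sum>z\<in>?Z. zip_sum bt z * poly_b * ?J z) =
    (\<Sum>z\<in>?Z. \<Sum>q\<in>?Q. if q \<preceq> z \<and> q \<noteq> z then ?g q * (P.psi q z * poly_b * ?J z) else 0)"
  proof (rule sum.cong[OF HOL.refl])
    fix z assume z: "z \<in> ?Z"
    have "q \<noteq> b" if "q \<preceq> z" "q \<in> R" for q

    proof
      assume "q = b"
      then show False using that z P.antisym[of z b] b by auto
    qed
    then have eq: "{q\<in>R. q \<preceq> z \<and> q \<noteq> z} = {q\<in>?Q. q \<preceq> z \<and> q \<noteq> z}"
    proof -
      have "q \<preceq> b" if "q \<in> R" "q \<preceq> z" for q using P.trans[OF RX[OF that(1)] _ b that(2)] z by auto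
      then show ?thesis using \<open>\<And>q. q \<preceq> z ==> q \<in> R ==> q \<noteq> b\<close> by auto
    qed
    have "zip_sum bt z * poly_b * ?J z = (\<Sum>q\<in>{q\<in>?Q. q \<preceq> z \<and> q \<noteq> z}. ?g q * (P.psi q z * poly_b * ?J z))"
      unfolding zip_sum_def eq sum_distrib_right by (rule sum.cong) (simp_all only: mult.assoc)
    also have "\<dots> = (\<Sum>q\<in>?Q. if q \<preceq> z \<and> q \<noteq> z then ?g q * (P.psi q z * poly_b * ?J z) else 0)"
      by (rule sum.inter_filter[OF fQ])
    finally show "zip_sum bt z * poly_b * ?J z = \<dots>" .
  qed
  also have "\<dots> = (\<Sum>q\<in>?Q. \<Sum>z\<in>?Z. if q \<preceq> z \<and> q \<noteq> z then ?g q * (P.psi q z * poly_b * ?J z) else 0)"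
    by (rule sum.swap)
  also have "\<dots> = (\<Sum>q\<in>?Q. ?g q * P.psi q b - ?g q * ?J q)"
  proof (rule sum.cong[OF HOL.refl])
    fix q assume q: "q \<in> ?Q"
    let ?Y = "{z\<in>?Z. q \<preceq> z \<and> q \<noteq> z}"
    have qX: "q \<in> X" using q RX by auto
    have eq: "{z \<in> X. q \<preceq> z \<and> z \<preceq> b \<and> z \<noteq> b} = insert q ?Y" using q qX by auto
    have "P.psi q b = ?J q + (\<Sum>z\<in>?Y. P.pt q z * ?J z)"
      unfolding P.psi_def eq using P.fin by (subst sum.insert) auto
    also have "(\<Sum>z\<in>?Y. P.pt q z * ?J z) = (\<Sum>z\<in>?Y. P.psi q z * poly_b * ?J z)"
      by (rule sum.cong) (auto simp: P.pt_psi)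
    finally have "?g q * (\<Sum>z\<in>?Y. P.psi q z * poly_b * ?J z) = ?g q * P.psi q b - ?g q * ?J q"
      by (simp add: distrib_left)
    then show "(\<Sum>z\<in>?Z. if q \<preceq> z \<and> q \<noteq> z then ?g q * (P.psi q z * poly_b * ?J z) else 0)
      = ?g q * P.psi q b - ?g q * ?J q"
      unfolding sum.inter_filter[OF fZ, symmetric] sum_distrib_left .
  qed
  finally show ?thesis by (simp only: sum_subtractf zip_sum_def)
qed

text \<open>Induction on the rank of \<open>b\<close>. For \<open>b\<close> in \<open>R\<close> the
  interval below \<open>b\<close> is one rank longer than its image, which the factor c makes up
  for.\<close>

lemma psi_zip:
  assumes bt: "bt \<in> X" "\<And>x. x \<in> X ==> bt \<preceq> x" and fb: "\<And>x. x \<in> X ==> \<phi> x = \<phi> bt ==> x = bt"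
    and b: "b \<in> X" "b \<noteq> bt"
  shows "P.psi bt b = P'.psi (\<phi> bt) (\<phi> b) * (if b \<in> R then pc else 1) + zip_sum bt b"
  using b
proof (induction "rk b" arbitrary: b rule: less_induct)
  case less
  define \<gamma> where "\<gamma> a' = P'.psi (\<phi> bt) a'" for a'
  define M where "M z = (if z \<in> R then \<gamma> (\<phi> z) * (pc * poly_b - pd) else \<gamma> (\<phi> z) * poly_b)" for z
  let ?J = "\<lambda>z. pJ ^ (rk b - 1 - rk z)"
  let ?Y = "{z\<in>X. z \<preceq> b \<and> z \<noteq> b \<and> z \<noteq> bt}"
  let ?Z = "{z\<in>X. z \<preceq> b \<and> z \<noteq> b}"
  have botR: "bt \<notin> R" using fb[of "x1 bt"] x1[of bt] by force
  have bt': "\<phi> bt \<preceq>' a'" if "a' \<in> X'" for a'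
    using onto[OF that] mono[OF bt(1)] bt(2) by blast
  have fY: "finite ?Y" and fZ: "finite ?Z" using P.fin by auto
  have zb: "zip_sum bt bt = 0"
  proof -
    have no: "\<not> (q \<preceq> bt \<and> q \<noteq> bt)" if "q \<in> R" for q using that RX[OF that] bt P.antisym[of q bt] by auto
    have "{q\<in>R. q \<preceq> bt \<and> q \<noteq> bt} = {}" using no by blast
    then show ?thesis by (simp only: zip_sum_def sum.empty)
  qed
  have Zeq: "?Z = insert bt ?Y" using bt less.prems by auto
  have "P.psi bt b = (\<Sum>z\<in>?Z. P.pt bt z * ?J z)"
    unfolding P.psi_def by (rule sum.cong) (use bt in auto)
  also have "\<dots> = ?J bt + (\<Sum>z\<in>?Y. P.pt bt z * ?J z)" unfolding Zeq using fY by (subst sum.insert) auto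
  \<comment> \<open>For z in \<open>R\<close>, \<gamma> c b is split into \<gamma> (c b - d) and
    \<gamma> d: the first enters \<open>fiber_sum\<close>, the second is the term missing in
    \<open>zip_sum_rec\<close>.\<close>
  also have "(\<Sum>z\<in>?Y. P.pt bt z * ?J z) = (\<Sum>z\<in>?Y. M z * ?J z + (zip_sum bt z * poly_b * ?J z + (if z \<in> R then \<gamma> (\<phi> z) * pd * ?J z else 0)))"
  proof (rule sum.cong[OF HOL.refl])
    fix z assume z: "z \<in> ?Y"
    have "P.pt bt z = P.psi bt z * poly_b" using z by (intro P.pt_psi) auto
    also have "P.psi bt z = \<gamma> (\<phi> z) * (if z \<in> R then pc else 1) + zip_sum bt z"
      unfolding \<gamma>_def using P.rk_less[of z b] z less.prems by (intro less.hyps) auto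
    finally show "P.pt bt z * ?J z = M z * ?J z + (zip_sum bt z * poly_b * ?J z + (if z \<in> R then \<gamma> (\<phi> z) * pd * ?J z else 0))"
      by (simp add: M_def algebra_simps)
  qed
  also have "\<dots> = (\<Sum>z\<in>?Y. M z * ?J z) + ((\<Sum>z\<in>?Y. zip_sum bt z * poly_b * ?J z) + (\<Sum>z\<in>?Y. if z \<in> R then \<gamma> (\<phi> z) * pd * ?J z else 0))"
    by (simp only: sum.distrib)
  also have "(\<Sum>z\<in>?Y. zip_sum bt z * poly_b * ?J z) = (\<Sum>z\<in>?Z. zip_sum bt z * poly_b * ?J z)"
    unfolding Zeq using fY zb by (subst sum.insert) auto
  also have "(\<Sum>z\<in>?Y. if z \<in> R then \<gamma> (\<phi> z) * pd * ?J z else 0) = (\<Sum>q\<in>{q\<in>R. q \<preceq> b \<and> q \<noteq> b}. \<gamma> (\<phi> q) * pd * ?J q)"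
  proof -
    have "{q\<in>R. q \<preceq> b \<and> q \<noteq> b} = {z\<in>?Y. z \<in> R}" using RX botR by auto
    then show ?thesis using fY by (simp only: sum.inter_filter)
  qed
  finally have main: "P.psi bt b = ?J bt + (\<Sum>z\<in>?Y. M z * ?J z) + zip_sum bt b"
    unfolding zip_sum_rec[OF less.prems(1)] \<gamma>_def by simp
  let ?Y' = "{a'\<in>X'. a' \<preceq>' \<phi> b \<and> a' \<noteq> \<phi> bt}"
  have \<phi>b: "\<phi> b \<in> X'" "\<phi> b \<noteq> \<phi> bt" using \<phi>X fb less.prems by auto
  have fY': "finite ?Y'" using P'.fin by simp
  have "\<phi> z \<in> ?Y'" if "z \<in> ?Y" for z using that \<phi>X[of z] mono[of z b] fb[of z] less.prems by auto
  then have im: "\<phi> ` ?Y \<subseteq> ?Y'" by (rule image_subsetI)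
  have "(\<Sum>z\<in>?Y. M z * ?J z) = (\<Sum>a'\<in>?Y'. \<Sum>z\<in>{z\<in>?Y. \<phi> z = a'}. M z * ?J z)"
    by (rule sum.group[symmetric, OF fY fY' im])
  also have "\<dots> = (\<Sum>a'\<in>?Y'. if a' = \<phi> b then (if b \<in> R then \<gamma> a' * (poly_b + poly_b) else 0)
     else \<gamma> a' * poly_b * pJ ^ (rk b - 1 - rk' a'))"
  proof (rule sum.cong[OF HOL.refl])
    fix a' assume a': "a' \<in> ?Y'"
    have "{z\<in>?Y. \<phi> z = a'} = F a' b - {b}" using a' by (auto simp: F_def)
    then show "(\<Sum>z\<in>{z\<in>?Y. \<phi> z = a'}. M z * ?J z) = (if a' = \<phi> b then (if b \<in> R then \<gamma> a' * (poly_b + poly_b) else 0)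
     else \<gamma> a' * poly_b * pJ ^ (rk b - 1 - rk' a'))"
      unfolding M_def using fiber_sum[OF less.prems(1), of a' \<gamma>] a' by simp
  qed
  also have "?Y' = insert (\<phi> b) {a'\<in>X'. a' \<preceq>' \<phi> b \<and> a' \<noteq> \<phi> b \<and> a' \<noteq> \<phi> bt}" using \<phi>b by auto
  also have "(\<Sum>a'\<in>\<dots>. if a' = \<phi> b then (if b \<in> R then \<gamma> a' * (poly_b + poly_b) else 0)
     else \<gamma> a' * poly_b * pJ ^ (rk b - 1 - rk' a')) = (if b \<in> R then \<gamma> (\<phi> b) * (poly_b + poly_b) else 0)
     + (\<Sum>a'\<in>{a'\<in>X'. a' \<preceq>' \<phi> b \<and> a' \<noteq> \<phi> b \<and> a' \<noteq> \<phi> bt}. \<gamma> a' * poly_b * pJ ^ (rk b - 1 - rk' a'))"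
  proof (subst sum.insert)
    show "finite {a'\<in>X'. a' \<preceq>' \<phi> b \<and> a' \<noteq> \<phi> b \<and> a' \<noteq> \<phi> bt}" using P'.fin by simp
  qed (auto intro!: sum.cong)
  finally have s: "(\<Sum>z\<in>?Y. M z * ?J z) = (if b \<in> R then \<gamma> (\<phi> b) * (poly_b + poly_b) else 0)
     + (\<Sum>a'\<in>{a'\<in>X'. a' \<preceq>' \<phi> b \<and> a' \<noteq> \<phi> b \<and> a' \<noteq> \<phi> bt}. \<gamma> a' * poly_b * pJ ^ (rk b - 1 - rk' a'))" .
  have rb: "rk' (\<phi> bt) = rk bt" by (rule rk_nR[OF bt(1) botR])
  have "rk' (\<phi> bt) < rk' (\<phi> b)" using P'.rk_less[OF \<phi>X[OF bt(1)] \<phi>b(1) bt'[OF \<phi>b(1)]] \<phi>b(2) by simp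
  note rlt = this
  have g: "\<gamma> (\<phi> b) = pJ ^ (rk' (\<phi> b) - 1 - rk bt) + (\<Sum>a'\<in>{a'\<in>X'. a' \<preceq>' \<phi> b \<and> a' \<noteq> \<phi> b \<and> a' \<noteq> \<phi> bt}. \<gamma> a' * poly_b * pJ ^ (rk' (\<phi> b) - 1 - rk' a'))"
  proof -
    let ?V = "{a'\<in>X'. a' \<preceq>' \<phi> b \<and> a' \<noteq> \<phi> b \<and> a' \<noteq> \<phi> bt}"
    have eq: "{z \<in> X'. \<phi> bt \<preceq>' z \<and> z \<preceq>' \<phi> b \<and> z \<noteq> \<phi> b} = insert (\<phi> bt) ?V"
      using bt' \<phi>b \<phi>X[OF bt(1)] by auto
    have "\<gamma> (\<phi> b) = pJ ^ (rk' (\<phi> b) - 1 - rk bt) + (\<Sum>a'\<in>?V. P'.pt (\<phi> bt) a' * pJ ^ (rk' (\<phi> b) - 1 - rk' a'))"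
      unfolding \<gamma>_def P'.psi_def eq using P'.fin by (subst sum.insert) (auto simp: rb)
    also have "(\<Sum>a'\<in>?V. P'.pt (\<phi> bt) a' * pJ ^ (rk' (\<phi> b) - 1 - rk' a')) = (\<Sum>a'\<in>?V. \<gamma> a' * poly_b * pJ ^ (rk' (\<phi> b) - 1 - rk' a'))"
      by (rule sum.cong) (auto simp: P'.pt_psi \<gamma>_def)
    finally show ?thesis .
  qed
  have "?J bt + (\<Sum>z\<in>?Y. M z * ?J z) = \<gamma> (\<phi> b) * (if b \<in> R then pc else 1)"
  proof (cases "b \<in> R")
    case False
    then show ?thesis unfolding s using g rk_nR[OF less.prems(1)] by simp
  next
    case True
    have r: "rk b = Suc (rk' (\<phi> b))" by (rule rk_R[OF True])
    have e1: "?J bt = pJ ^ (rk' (\<phi> b) - 1 - rk bt) * pJ"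
    proof -
      have "rk b - 1 - rk bt = Suc (rk' (\<phi> b) - 1 - rk bt)" using r rlt rb by simp
      then show ?thesis by (simp only: power_Suc2)
    qed
    have e2: "(\<Sum>a'\<in>{a'\<in>X'. a' \<preceq>' \<phi> b \<and> a' \<noteq> \<phi> b \<and> a' \<noteq> \<phi> bt}. \<gamma> a' * poly_b * pJ ^ (rk b - 1 - rk' a'))
      = (\<Sum>a'\<in>{a'\<in>X'. a' \<preceq>' \<phi> b \<and> a' \<noteq> \<phi> b \<and> a' \<noteq> \<phi> bt}. \<gamma> a' * poly_b * pJ ^ (rk' (\<phi> b) - 1 - rk' a')) * pJ"
      unfolding sum_distrib_right
    proof (rule sum.cong[OF HOL.refl])
      fix a' assume "a' \<in> {a'\<in>X'. a' \<preceq>' \<phi> b \<and> a' \<noteq> \<phi> b \<and> a' \<noteq> \<phi> bt}"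
      then have "rk' a' < rk' (\<phi> b)" using P'.rk_less[of a' "\<phi> b"] \<phi>b by auto
      then have "rk b - 1 - rk' a' = Suc (rk' (\<phi> b) - 1 - rk' a')" using r by simp
      then show "\<gamma> a' * poly_b * pJ ^ (rk b - 1 - rk' a') = \<gamma> a' * poly_b * pJ ^ (rk' (\<phi> b) - 1 - rk' a') * pJ"
        by (simp only: power_Suc2 mult.assoc)
    qed
    \<comment> \<open>The chains ending in \<open>x1 b\<close> and in \<open>x2 b\<close> give b
      each, the lengthened last gap gives a - b; together they give c.\<close>
    have "?J bt + (\<Sum>z\<in>?Y. M z * ?J z) = \<gamma> (\<phi> b) * (poly_b + poly_b) + \<gamma> (\<phi> b) * pJ"
      unfolding s e1 e2 using True by (subst (3) g) (simp add: distrib_right)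
    also have "\<dots> = \<gamma> (\<phi> b) * pc" by (simp add: pc_def pJ_def algebra_simps)
    finally show ?thesis using True by simp
  qed
  then show ?case unfolding main \<gamma>_def by simp
qed
end

section \<open>Minor posets of families of sets\<close>

text \<open>\<open>Some (z, H)\<close> encodes the minor with minimum z and generator set H, both
  described by members of the family; \<open>None\<close> is the adjoined minimum.\<close>

type_synonym 'a cell = "('a set \<times> 'a set set) option"

text \<open>The closure operator of an intersection-closed family; the join of members is the
  closure of their union.\<close>

definition cl :: "'a set set => 'a set => 'a set" where
  "cl F Y = \<Inter>{A \<in> F. Y \<subseteq> A}"

definition fam :: "'a set => 'a set set => bool" where
  "fam G F \<longleftrightarrow> finite G \<and> F \<subseteq> Pow G \<and> G \<in> F \<and> {} \<in> F \<and> (\<forall>A\<in>F. \<forall>B\<in>F. A \<inter> B \<in> F)"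

text \<open>The generators of the contraction to \<open>z\<close>; taking g outside \<open>z\<close>
  excludes \<open>z\<close> itself.\<close>

definition gn :: "'a set => 'a set set => 'a set => 'a set set" where
  "gn G F z = {cl F (insert g z) | g. g \<in> G - z}"

definition cells :: "'a set => 'a set set => 'a cell set" where
  "cells G F = insert None (Some ` {(z, H). z \<in> F \<and> H \<subseteq> gn G F z})"

text \<open>\<open>z'\<close> is the join of \<open>z\<close> with some elements of
  \<open>H\<close>. No subset has to be named: all h below \<open>z'\<close> may be used, and
  minimality says that they suffice.\<close>

definition sp :: "'a set set => 'a set => 'a set set => 'a set => bool" where
  "sp F z H z' \<longleftrightarrow> z \<subseteq> z' \<and> (\<forall>A\<in>F. z \<subseteq> A \<longrightarrow> (\<forall>h\<in>H. h \<subseteq> z' \<longrightarrow> h \<subseteq> A) \<longrightarrow> z' \<subseteq> A)"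

lemma sp_D: "sp F z H z' ==> A \<in> F ==> z \<subseteq> A ==> (\<And>h. h \<in> H ==> h \<subseteq> z' ==> h \<subseteq> A) ==> z' \<subseteq> A"
  by (simp add: sp_def)

text \<open>The minor order in closed form: one contraction, which moves the minimum to
  \<open>z'\<close> and joins every generator with \<open>z'\<close>, followed by one
  deletion.\<close>

fun mle :: "'a set set => 'a cell => 'a cell => bool" where
  "mle F None y = True"
| "mle F (Some _) None = False"
| "mle F (Some (z', H')) (Some (z, H)) \<longleftrightarrow> sp F z H z' \<and> (\<forall>h'\<in>H'. \<exists>h\<in>H. h' = cl F (h \<union> z'))"

fun mrk :: "'a cell => nat" where
  "mrk None = 0"
| "mrk (Some (z, H)) = Suc (card H)"

lemma cells_None [simp]: "None \<in> cells G F" by (simp add: cells_def)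
lemma cells_Some [simp]: "Some (z, H) \<in> cells G F \<longleftrightarrow> z \<in> F \<and> H \<subseteq> gn G F z" by (auto simp: cells_def)
lemma mle_None [simp]: "mle F x None \<longleftrightarrow> x = None" by (cases x) auto

lemma cells_cases [consumes 1, case_names None Some]:
  assumes "x \<in> cells G F"
  obtains "x = None" | z H where "x = Some (z, H)" "z \<in> F" "H \<subseteq> gn G F z"
  using assms by (auto simp: cells_def)

locale family =
  fixes G :: "'a set" and F
  assumes fam: "fam G F"
begin

lemma finG: "finite G" and FG: "A \<in> F ==> A \<subseteq> G" and GF: "G \<in> F" and empF: "{} \<in> F"
  and Int: "A \<in> F ==> B \<in> F ==> A \<inter> B \<in> F"
  using fam by (auto simp: fam_def)

lemma finF: "finite F" using finG FG by (intro finite_subset[of F "Pow G"]) auto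

lemma cl_in: "Y \<subseteq> G ==> cl F Y \<in> F"
proof -
  have "\<A> \<noteq> {} ==> \<A> \<subseteq> F ==> \<Inter>\<A> \<in> F" if "finite \<A>" for \<A>
    using that by (induction rule: finite_ne_induct) (auto intro: Int)
  then have *: "\<A> \<noteq> {} ==> \<A> \<subseteq> F ==> \<Inter>\<A> \<in> F" for \<A> using finF finite_subset by metis
  assume "Y \<subseteq> G"
  then show ?thesis unfolding cl_def by (intro *) (use GF in auto)
qed

lemma cl_ext: "Y \<subseteq> cl F Y" by (auto simp: cl_def)
lemma cl_least: "A \<in> F ==> Y \<subseteq> A ==> cl F Y \<subseteq> A" by (auto simp: cl_def)
lemma cl_sub: "A \<in> F ==> cl F Y \<subseteq> A \<longleftrightarrow> Y \<subseteq> A" using cl_ext cl_least by blast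
lemma cl_id: "A \<in> F ==> cl F A = A" using cl_ext cl_least by blast
lemma cl_eqI: "(\<And>A. A \<in> F ==> Y \<subseteq> A \<longleftrightarrow> Z \<subseteq> A) ==> cl F Y = cl F Z"
  by (simp add: cl_def) (metis (mono_tags, lifting))

lemma gn_D: "h \<in> gn G F z ==> z \<in> F ==> h \<in> F \<and> z \<subset> h"
proof -
  assume "h \<in> gn G F z" "z \<in> F"
  then obtain g where g: "g \<in> G" "g \<notin> z" "h = cl F (insert g z)" by (auto simp: gn_def)
  have "h \<in> F" unfolding g(3) by (rule cl_in) (use g FG[OF \<open>z \<in> F\<close>] in auto)
  moreover have "insert g z \<subseteq> h" unfolding g(3) by (rule cl_ext)
  ultimately show ?thesis using g by auto
qed

lemma gn_fin: "finite (gn G F z)" unfolding gn_def using finG by simp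

lemma H_fin: "H \<subseteq> gn G F z ==> finite H" using gn_fin finite_subset by blast

lemma gn_lift:
  assumes "h \<in> gn G F z" "z \<in> F" "z' \<in> F" "z \<subseteq> z'" "cl F (h \<union> z') \<noteq> z'"
  shows "cl F (h \<union> z') \<in> gn G F z'"
proof -
  obtain g where g: "g \<in> G" "h = cl F (insert g z)" using assms by (auto simp: gn_def)
  have "cl F (h \<union> z') = cl F (insert g z')"
    by (rule cl_eqI) (use assms in \<open>auto simp: g(2) cl_sub\<close>)
  moreover from this have "g \<notin> z'" using assms(5) cl_id[OF assms(3)] by (auto simp: insert_absorb)
  ultimately show ?thesis using g by (auto simp: gn_def)
qed

lemma fin_cells: "finite (cells G F)"
proof -
  have "cells G F \<subseteq> insert None (Some ` (Pow G \<times> Pow (Pow G)))"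
  proof
    fix x assume "x \<in> cells G F"
    then show "x \<in> insert None (Some ` (Pow G \<times> Pow (Pow G)))"
    proof (cases rule: cells_cases)
      case (Some z H)
      have "H \<subseteq> Pow G" using gn_D[OF _ Some(2)] FG Some(3) by blast
      moreover have "z \<in> Pow G" using FG[OF Some(2)] by simp
      ultimately show ?thesis unfolding Some(1) by (intro insertI2 imageI) simp
    qed simp
  qed
  then show ?thesis using finG by (auto intro: finite_subset)
qed

lemma mle_sub: "z \<in> F ==> H' \<subseteq> H ==> H \<subseteq> gn G F z ==> mle F (Some (z, H')) (Some (z, H))"
proof -
  assume a: "z \<in> F" "H' \<subseteq> H" "H \<subseteq> gn G F z"
  have "h = cl F (h \<union> z)" if "h \<in> H'" for h
  proof -
    have "h \<in> F" "h \<union> z = h" using gn_D[of h z] a that by auto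
    then show ?thesis by (simp add: cl_id)
  qed
  then show ?thesis using a by (auto simp: sp_def)
qed

text \<open>\<open>H'\<close> consists of joins with \<open>z'\<close> of generators h not below
  \<open>z'\<close>. If the minima differ, some h lies below \<open>z'\<close> and is lost; if they
  agree, \<open>H'\<close> is a proper subset of \<open>H\<close>.\<close>

lemma mrk_less:
  assumes "x \<in> cells G F" "y \<in> cells G F" "mle F x y" "x \<noteq> y"
  shows "mrk x < mrk y"
  using assms(1)
proof (cases rule: cells_cases)
  case None
  then show ?thesis using assms by (cases y) auto
next
  case (Some z' H')
  note x = Some
  show ?thesis using assms(2)
  proof (cases rule: cells_cases)
    case None
    then show ?thesis using assms x by simp
  next
    case (Some z H)
    note y = Some
    have sp: "sp F z H z'" and H': "\<And>h'. h' \<in> H' ==> \<exists>h\<in>H. h' = cl F (h \<union> z')" using assms(3) x y by auto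
    let ?S = "{h\<in>H. \<not> h \<subseteq> z'}"
    have fH: "finite H" using y H_fin by blast
    have sub: "H' \<subseteq> (\<lambda>h. cl F (h \<union> z')) ` ?S"
    proof
      fix h' assume h': "h' \<in> H'"
      then obtain h where h: "h \<in> H" "h' = cl F (h \<union> z')" using H' by blast
      have "\<not> h \<subseteq> z'"
      proof
        assume "h \<subseteq> z'"
        then have "h' = z'" using h cl_id[OF x(2)] by (simp add: Un_absorb1)
        then show False using gn_D[of h' z'] x h' by auto
      qed
      then show "h' \<in> (\<lambda>h. cl F (h \<union> z')) ` ?S" using h by auto
    qed
    have c1: "card H' \<le> card ?S" using surj_card_le[OF _ sub] fH by simp
    have "?S \<subseteq> H" by auto
    show ?thesis
    proof (cases "z' = z")
      case True
      have "H' \<subseteq> H"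
      proof
        fix h' assume "h' \<in> H'"
        then obtain h where h: "h \<in> H" "h' = cl F (h \<union> z')" using H' by blast
        have "h \<union> z' = h" "h \<in> F" using gn_D[of h z] h y True by auto
        then show "h' \<in> H" using h cl_id by simp
      qed
      moreover have "H' \<noteq> H" using assms(4) x y True by auto
      ultimately show ?thesis using x y psubset_card_mono[OF fH, of H'] by auto
    next
      case False
      have "\<not> (\<forall>h\<in>H. h \<subseteq> z' \<longrightarrow> h \<subseteq> z)" 
      proof
        assume "\<forall>h\<in>H. h \<subseteq> z' \<longrightarrow> h \<subseteq> z"
        then have "z' \<subseteq> z" using sp_D[OF sp y(2)] by simp
        moreover have "z \<subseteq> z'" using sp by (simp add: sp_def)
        ultimately show False using False by simp
      qed
      then have "?S \<noteq> H" by auto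
      then have "card ?S < card H" using psubset_card_mono[OF fH, of ?S] by blast
      then show ?thesis using c1 x y by simp
    qed
  qed
qed

lemma mle_trans:
  assumes "x \<in> cells G F" "y \<in> cells G F" "w \<in> cells G F" "mle F x y" "mle F y w"
  shows "mle F x w"
proof (cases "x = None \<or> y = None")
  case True
  then have "x = None" using assms(4) by auto
  then show ?thesis by simp
next
  case False
  then have "w \<noteq> None" using assms(5) by (cases w) auto
  with False obtain z2 H2 z1 H1 z H where e: "x = Some (z2, H2)" "y = Some (z1, H1)" "w = Some (z, H)"
    by (cases x; cases y; cases w) auto
  have zF: "z2 \<in> F" "z1 \<in> F" "z \<in> F" and HF: "H1 \<subseteq> gn G F z1" using assms e by auto
  have s1: "sp F z1 H1 z2" and s2: "sp F z H z1" using assms e by auto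
  have h1: "\<exists>h\<in>H. h1 = cl F (h \<union> z1)" if "h1 \<in> H1" for h1 using assms(5) e that by auto
  have h2: "\<exists>h\<in>H1. h2 = cl F (h \<union> z2)" if "h2 \<in> H2" for h2 using assms(4) e that by auto
  have "sp F z H z2" unfolding sp_def
  proof (intro conjI ballI impI)
    show "z \<subseteq> z2" using s1 s2 by (auto simp: sp_def)
    fix A assume A: "A \<in> F" "z \<subseteq> A" "\<forall>h\<in>H. h \<subseteq> z2 \<longrightarrow> h \<subseteq> A"
    have "z1 \<subseteq> z2" using s1 by (simp add: sp_def)
    have z1A: "z1 \<subseteq> A"
    proof (rule sp_D[OF s2 A(1,2)])
      fix h assume "h \<in> H" "h \<subseteq> z1"
      with \<open>z1 \<subseteq> z2\<close> show "h \<subseteq> A" using A(3) by auto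
    qed
    have "h \<subseteq> A" if h: "h \<in> H1" "h \<subseteq> z2" for h
    proof -
      obtain k where k: "k \<in> H" "h = cl F (k \<union> z1)" using h1[OF h(1)] by blast
      have "k \<subseteq> z2" using cl_ext[of "k \<union> z1"] k h by auto
      then have "k \<union> z1 \<subseteq> A" using A k z1A by auto
      then show ?thesis using cl_least[OF A(1)] k by auto
    qed
    then show "z2 \<subseteq> A" by (rule sp_D[OF s1 A(1) z1A])
  qed
  moreover have "\<exists>h\<in>H. h2 = cl F (h \<union> z2)" if "h2 \<in> H2" for h2
  proof -
    obtain k1 where k1: "k1 \<in> H1" "h2 = cl F (k1 \<union> z2)" using h2[OF \<open>h2 \<in> H2\<close>] by blast
    obtain k where k: "k \<in> H" "k1 = cl F (k \<union> z1)" using h1[OF k1(1)] by blast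
    have "z1 \<subseteq> z2" using s1 by (simp add: sp_def)
    then have "cl F (k1 \<union> z2) = cl F (k \<union> z2)"
      by (intro cl_eqI) (auto simp: k(2) cl_sub)
    then show ?thesis using k k1 by blast
  qed
  ultimately show ?thesis using e by simp
qed

sublocale M: rposet "cells G F" "mle F" mrk
proof
  show "mle F x x" if "x \<in> cells G F" for x using that
  proof (cases rule: cells_cases)
    case (Some z H)
    then show ?thesis using mle_sub by blast
  qed simp
  show "x = y" if "x \<in> cells G F" "y \<in> cells G F" "mle F x y" "mle F y x" for x y
    using mrk_less[of x y] mrk_less[of y x] that by fastforce
qed (use fin_cells mle_trans mrk_less in blast)+

definition tp :: "'a cell" where "tp = Some ({}, gn G F {})"

lemma tp_cells: "tp \<in> cells G F" by (simp add: tp_def empF)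

end

section \<open>Removing one member that has a unique cover\<close>

definition star :: "'a set => 'a set => 'a set => 'a set" where
  "star u v x = (if x = u then v else x)"

text \<open>\<open>u\<close> is renamed to \<open>v\<close> throughout, and a generator that thereby
  becomes equal to the minimum disappears.\<close>

definition dl :: "'a set => 'a set => 'a cell => 'a cell" where
  "dl u v = map_option (\<lambda>(z, H). (star u v z, star u v ` H - {star u v z}))"

lemma dl_simps [simp]: "dl u v None = None" "dl u v (Some (z, H)) = Some (star u v z, star u v ` H - {star u v z})"
  by (simp_all add: dl_def)

locale fam_step = family G F for G :: "'a set" and F +
  fixes u v
  assumes u: "u \<in> F" "u \<noteq> {}" and v: "v \<in> F" "u \<subset> v" and cover: "\<And>A. A \<in> F ==> u \<subset> A ==> v \<subseteq> A"
begin

abbreviation "F' \<equiv> F - {u}"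
abbreviation st ("_\<^sup>\<star>" [1000] 1000) where "st x \<equiv> star u v x"

lemma st_u [simp]: "st u = v" and st_v [simp]: "st v = v" and st_other: "x \<noteq> u ==> st x = x"
  using v by (auto simp: star_def)
lemma st_ext: "x \<subseteq> st x" using v by (auto simp: star_def)
lemma st_F: "x \<in> F ==> st x \<in> F'" using v by (auto simp: star_def)
lemma st_sub: "A \<in> F' ==> x \<in> F ==> st x \<subseteq> A \<longleftrightarrow> x \<subseteq> A"
  using cover[of A] v by (auto simp: star_def)
lemma st_mono: "x \<in> F ==> y \<in> F ==> x \<subseteq> y ==> st x \<subseteq> st y"
  using st_sub[OF st_F] st_ext by blast

text \<open>An intersection equal to \<open>u\<close> would come from two members strictly above
  \<open>u\<close>, and both contain \<open>v\<close>.\<close>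

lemma fam': "fam G F'"
proof -
  have "G \<noteq> u" using v FG[OF v(1)] by auto
  moreover have "A \<inter> B \<noteq> u" if "A \<in> F'" "B \<in> F'" for A B
  proof
    assume e: "A \<inter> B = u"
    then have "v \<subseteq> A" "v \<subseteq> B" using that cover[of A] cover[of B] by auto
    then show False using e v by auto
  qed
  ultimately show ?thesis using fam u by (auto simp: fam_def)
qed

sublocale N: family G F' by unfold_locales (rule fam')

lemma cl': "Y \<subseteq> G ==> cl F' Y = st (cl F Y)"
proof
  assume Y: "Y \<subseteq> G"
  show "cl F' Y \<subseteq> st (cl F Y)"
    by (rule N.cl_least) (use st_F[OF cl_in[OF Y]] st_ext[of "cl F Y"] cl_ext[of Y] in auto)
  have "cl F Y \<subseteq> cl F' Y" by (auto simp: cl_def)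
  then show "st (cl F Y) \<subseteq> cl F' Y" using st_sub[OF N.cl_in[OF Y] cl_in[OF Y]] by simp
qed

lemma gn_st:
  assumes "h \<in> gn G F z" "z \<in> F" "st h \<noteq> st z"
  shows "st h \<in> gn G F' (st z)"
proof -
  obtain g where g: "g \<in> G" "h = cl F (insert g z)" using assms by (auto simp: gn_def)
  have s: "insert g z \<subseteq> G" using g FG[OF assms(2)] by auto
  have "st h = cl F' (insert g z)" using cl'[OF s] g by simp
  also have "\<dots> = cl F' (insert g (st z))"
    by (rule N.cl_eqI) (use st_sub assms in auto)
  finally have e: "st h = cl F' (insert g (st z))" .
  have "g \<notin> st z"
  proof
    assume "g \<in> st z"
    then show False using e N.cl_id[OF st_F[OF assms(2)]] assms(3) by (simp add: insert_absorb)
  qed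
  then show ?thesis using e g by (auto simp: gn_def)
qed

lemma gn_lift_st:
  assumes "d \<in> gn G F' w" "w \<in> F'"
  shows "\<exists>h\<in>gn G F w. st h = d"
proof -
  obtain g where g: "g \<in> G - w" "d = cl F' (insert g w)" using assms by (auto simp: gn_def)
  then show ?thesis using cl'[of "insert g w"] FG[of w] assms by (auto simp: gn_def)
qed

lemma cl'_st: "h \<in> F ==> z \<in> F ==> cl F' (st h \<union> st z) = st (cl F (h \<union> z))"
proof -
  assume "h \<in> F" "z \<in> F"
  then have "cl F' (st h \<union> st z) = cl F' (h \<union> z)" by (intro N.cl_eqI) (auto simp: st_sub)
  then show ?thesis using cl' FG[OF \<open>h \<in> F\<close>] FG[OF \<open>z \<in> F\<close>] by simp
qed

lemma dl_cells:
  assumes "x \<in> cells G F" shows "dl u v x \<in> cells G F'"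
  using assms
proof (cases rule: cells_cases)
  case (Some z H)
  then show ?thesis using st_F[OF Some(2)] gn_st[OF _ Some(2)] by auto
qed simp

lemma dl_onto:
  assumes "x' \<in> cells G F'" shows "\<exists>x\<in>cells G F. dl u v x = x'"
  using assms
proof (cases rule: cells_cases)
  case (Some w D)
  have w: "w \<in> F" "st w = w" "w \<notin> D" using Some N.gn_D[of w w] st_other by auto
  let ?H = "{h\<in>gn G F w. st h \<in> D}"
  have "st ` ?H = D" using gn_lift_st[OF _ Some(2)] Some(3) by force
  then have "dl u v (Some (w, ?H)) = x'" using w Some by simp
  then show ?thesis using w by (intro bexI[of _ "Some (w, ?H)"]) auto
qed (auto intro!: bexI[of _ None])

lemma dl_mono:
  assumes "a \<in> cells G F" "b \<in> cells G F" "mle F a b"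
  shows "mle F' (dl u v a) (dl u v b)"
proof (cases "a = None")
  case False
  then have "b \<noteq> None" using assms(3) by (cases b) auto
  with False obtain z' H' z H where e: "a = Some (z', H')" "b = Some (z, H)"
    by (cases a; cases b) auto
  have zF: "z' \<in> F" "z \<in> F" and HF: "H' \<subseteq> gn G F z'" "H \<subseteq> gn G F z" using assms e by auto
  have sp: "sp F z H z'" and H': "\<And>h'. h' \<in> H' ==> \<exists>h\<in>H. h' = cl F (h \<union> z')" using assms e by auto
  have hF: "h \<in> F" if "h \<in> H" for h using gn_D[of h z] that HF zF by auto
  have zz: "st z \<subseteq> st z'" using sp zF st_mono by (simp add: sp_def)
  have "sp F' (st z) (st ` H - {st z}) (st z')" unfolding sp_def
  proof (intro conjI ballI impI)
    fix A assume A: "A \<in> F'" "st z \<subseteq> A" "\<forall>h\<in>st ` H - {st z}. h \<subseteq> st z' \<longrightarrow> h \<subseteq> A"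
    have "z \<subseteq> A" using A(2) st_ext by blast
    moreover have "h \<subseteq> A" if h: "h \<in> H" "h \<subseteq> z'" for h
    proof (cases "st h = st z")
      case True
      then show ?thesis using A(2) st_ext[of h] by auto
    next
      case False
      have "st h \<subseteq> st z'" using st_mono[OF hF zF(1)] h by simp
      then have "st h \<subseteq> A" using A(3) h False by auto
      then show ?thesis using st_ext[of h] by auto
    qed
    ultimately have "z' \<subseteq> A" using A(1) by (intro sp_D[OF sp]) auto
    then show "st z' \<subseteq> A" using st_sub A(1) zF by simp
  qed (fact zz)
  moreover have "\<exists>h\<in>st ` H - {st z}. k = cl F' (h \<union> st z')" if k: "k \<in> st ` H' - {st z'}" for k
  proof -
    obtain h' where h': "h' \<in> H'" "k = st h'" using k by auto
    obtain h where h: "h \<in> H" "h' = cl F (h \<union> z')" using H'[OF h'(1)] by blast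
    have e: "k = cl F' (st h \<union> st z')" using cl'_st[OF hF[OF h(1)] zF(1)] h h' by simp
    have "st h \<noteq> st z"
    proof
      assume "st h = st z"
      then have "st h \<union> st z' = st z'" using zz by auto
      then show False using e k N.cl_id[OF st_F[OF zF(1)]] by simp
    qed
    then show ?thesis using e h by auto
  qed
  ultimately show ?thesis unfolding e by simp
qed simp

text \<open>The lifted minimum is the closure of \<open>z\<close> together with every h in
  \<open>H\<close> whose renamed version lies below \<open>w'\<close>; its own renamed version is
  \<open>w'\<close>, and the generators are lifted as joins with it.\<close>

lemma dl_lower:
  assumes b: "b \<in> cells G F" and a': "a' \<in> cells G F'" "mle F' a' (dl u v b)"
  shows "\<exists>a\<in>cells G F. mle F a b \<and> dl u v a = a'"
proof (cases "a' = None")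
  case True
  then show ?thesis by (intro bexI[of _ None]) auto
next
  case False
  then have "b \<noteq> None" using a'(2) by (cases b) auto
  with False obtain w' D' z H where e: "a' = Some (w', D')" "b = Some (z, H)"
    by (cases a'; cases b) auto
  have zF: "w' \<in> F'" "z \<in> F" and HF: "D' \<subseteq> gn G F' w'" "H \<subseteq> gn G F z" using a' b e by auto
  have sp: "sp F' (st z) (st ` H - {st z}) w'"
    and D': "\<And>d. d \<in> D' ==> \<exists>h\<in>st ` H - {st z}. d = cl F' (h \<union> w')" using a' e by auto
  have hF: "h \<in> F" if "h \<in> H" for h using gn_D[of h z] that HF zF by auto
  let ?Y = "z \<union> \<Union>{h\<in>H. st h \<subseteq> w'}"
  define w where "w = cl F ?Y"
  have YG: "?Y \<subseteq> G" using FG[OF zF(2)] FG[OF hF] by auto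
  have wF: "w \<in> F" unfolding w_def by (rule cl_in[OF YG])
  have Yw: "?Y \<subseteq> w" unfolding w_def by (rule cl_ext)
  have zw': "st z \<subseteq> w'" using sp by (simp add: sp_def)
  have ww: "st w = w'"
  proof
    have "?Y \<subseteq> w'" using zw' st_ext[of z] st_ext by blast
    then have "w \<subseteq> w'" unfolding w_def by (intro cl_least) (use zF in auto)
    then show "st w \<subseteq> w'" using st_sub[OF zF(1) wF] by simp
    have "st z \<subseteq> st w" using st_mono[OF zF(2) wF] Yw by auto
    moreover have "k \<subseteq> st w" if k: "k \<in> st ` H - {st z}" "k \<subseteq> w'" for k
    proof -
      obtain h where h: "h \<in> H" "k = st h" using k by auto
      have "h \<subseteq> w" using Yw h k by auto
      then show ?thesis using st_mono[OF hF[OF h(1)] wF] h by simp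
    qed
    ultimately show "w' \<subseteq> st w" by (rule sp_D[OF sp st_F[OF wF]])
  qed
  define D where "D = {k. \<exists>h\<in>H. k = cl F (h \<union> w) \<and> st k \<in> D'}"
  have w'D: "w' \<notin> D'" using N.gn_D[of w' w'] HF zF by auto
  have Dg: "D \<subseteq> gn G F w"
  proof
    fix k assume "k \<in> D"
    then obtain h where h: "h \<in> H" "k = cl F (h \<union> w)" "st k \<in> D'" by (auto simp: D_def)
    have "k \<noteq> w" using h(3) w'D ww by auto
    then show "k \<in> gn G F w" unfolding h(2) by (intro gn_lift[of h z]) (use h HF zF wF Yw in auto)
  qed
  have "st ` D = D'"
  proof
    show "D' \<subseteq> st ` D"
    proof
      fix d assume d: "d \<in> D'"
      then obtain h where h: "h \<in> H" "d = cl F' (st h \<union> w')" using D' by blast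
      then have "d = st (cl F (h \<union> w))" using cl'_st[OF hF[OF h(1)] wF] ww by simp
      then show "d \<in> st ` D" using h d by (auto simp: D_def)
    qed
  qed (auto simp: D_def)
  then have "dl u v (Some (w, D)) = a'" using e ww w'D by simp
  moreover have "mle F (Some (w, D)) b"
  proof -
    have "sp F z H w" unfolding sp_def
    proof (intro conjI ballI impI)
      fix A assume A: "A \<in> F" "z \<subseteq> A" "\<forall>h\<in>H. h \<subseteq> w \<longrightarrow> h \<subseteq> A"
      have "?Y \<subseteq> A" using A Yw by blast
      then show "w \<subseteq> A" unfolding w_def by (rule cl_least[OF A(1)])
    qed (use Yw in auto)
    then show ?thesis using e by (auto simp: D_def)
  qed
  ultimately show ?thesis using wF Dg by (intro bexI[of _ "Some (w, D)"]) auto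
qed

text \<open>The cells in which \<open>u\<close> and \<open>v\<close> both occur with
  \<open>v\<close> as a generator, so that renaming merges them and the rank drops. The other two
  members of the triple avoid one of the two: \<open>r1\<close> deletes \<open>v\<close>, while
  \<open>r2\<close> deletes \<open>u\<close>, or contracts to \<open>v\<close> if \<open>u\<close>
  is the minimum.\<close>

definition Rz :: "'a cell set" where
  "Rz = {Some (z, H) | z H. z \<in> F \<and> H \<subseteq> gn G F z \<and> v \<in> H \<and> u \<in> insert z H}"

fun r1 :: "'a cell => 'a cell" where
  "r1 None = None" | "r1 (Some (z, H)) = Some (z, H - {v})"
fun r2 :: "'a cell => 'a cell" where
  "r2 None = None" | "r2 (Some (z, H)) = (if z = u then Some (v, H - {v}) else Some (z, H - {u}))"

lemma st_inj: "u \<notin> P \<or> v \<notin> P ==> inj_on st P"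
  by (auto simp: inj_on_def star_def split: if_splits)

lemma gn_not_v: "H \<subseteq> gn G F v ==> u \<notin> H"
  using gn_D[of u v] v by auto

lemma z_notin: "z \<in> F ==> H \<subseteq> gn G F z ==> z \<notin> H" using gn_D[of z z] by auto

lemma card_st: "finite H ==> card (st ` H - {st z}) = card (st ` insert z H) - 1"
proof -
  assume "finite H"
  have "st ` H - {st z} = st ` insert z H - {st z}" by auto
  then have "card (st ` H - {st z}) = card (st ` insert z H - {st z})" by (rule arg_cong)
  also have "\<dots> = card (st ` insert z H) - 1" by (rule card_Diff_singleton) simp
  finally show ?thesis .
qed

lemma gn_u: "H \<subseteq> gn G F u ==> H - {v} \<subseteq> gn G F v"
proof
  fix h assume a: "H \<subseteq> gn G F u" "h \<in> H - {v}"
  then have h: "h \<in> gn G F u" "h \<noteq> v" by auto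
  have "h \<in> F" "v \<subseteq> h" using gn_D[OF h(1) u(1)] cover by auto
  then have "cl F (h \<union> v) = h" using cl_id[of h] by (simp add: Un_absorb2)
  then show "h \<in> gn G F v" using gn_lift[OF h(1) u(1) v(1)] h v by auto
qed

lemma v_gn: "v \<in> gn G F u"
proof -
  obtain g where g: "g \<in> v" "g \<notin> u" using v by auto
  have i: "insert g u \<subseteq> v" using g v by auto
  have "cl F (insert g u) \<subseteq> v" using cl_least[OF v(1) i] .
  moreover have "insert g u \<subseteq> G" using i FG[OF v(1)] by auto
  then have "v \<subseteq> cl F (insert g u)" using cover[OF cl_in] cl_ext[of "insert g u"] g by blast
  ultimately show ?thesis using g FG[OF v(1)] by (auto simp: gn_def intro!: exI[of _ g])
qed

lemma insert_two:
  "P - {a, b} = B ==> a \<in> P \<or> b \<in> P ==> P = insert a B \<or> P = insert b B \<or> P = insert a (insert b B)"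
  by (cases "a \<in> P"; cases "b \<in> P") blast+

sublocale Z: zipmap "cells G F" "mle F" mrk "cells G F'" "mle F'" mrk "dl u v" Rz r1 r2
proof
  fix q assume q: "q \<in> Rz"
  then obtain z H where e: "q = Some (z, H)" "z \<in> F" "H \<subseteq> gn G F z" "v \<in> H" "u \<in> insert z H" by (auto simp: Rz_def)
  have zH: "z \<notin> H" using z_notin e by simp
  have fH: "finite H" using H_fin e by simp
  show "q \<in> cells G F" using e by simp
  show "mrk q = Suc (mrk (dl u v q))"
  proof -
    have uv: "u \<noteq> v" using v by auto
    have "st ` insert z H = st ` (insert z H - {v})"
    proof
      show "st ` insert z H \<subseteq> st ` (insert z H - {v})"
      proof
        fix x assume "x \<in> st ` insert z H"
        then obtain y where y: "y \<in> insert z H" "x = st y" by auto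
        have "st u \<in> st ` (insert z H - {v})" by (rule imageI) (use e(5) uv in auto)
        moreover have "st y \<in> st ` (insert z H - {v})" if "y \<noteq> v" by (rule imageI) (use y that in simp)
        ultimately show "x \<in> st ` (insert z H - {v})" unfolding y(2) by (cases "y = v") simp_all
      qed
    qed auto
    then have "card (st ` insert z H) = card (insert z H - {v})" using card_image[OF st_inj, of "insert z H - {v}"] by simp
    also have "\<dots> = card H" using fH zH e(4) by simp
    finally have "card (st ` H - {st z}) = card H - 1" by (simp only: card_st[OF fH])
    moreover have "card H > 0" using fH e(4) card_gt_0_iff by blast
    ultimately show ?thesis using e by simp
  qed
  have uu: "u \<in> H" if "z \<noteq> u" using e that by auto
  have Hv: "st ` H = insert v (st ` (H - {v}))"
    using image_insert[of st v "H - {v}"] e(4) by (simp add: insert_absorb)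
  have i1: "st ` (H - {v}) - {st z} = st ` H - {st z}"
  proof (cases "z = u")
    case False
    have "st u \<in> st ` (H - {v})" using uu[OF False] v by (intro imageI) auto
    then have "v \<in> st ` (H - {v})" by simp
    then show ?thesis by (simp add: Hv insert_absorb)
  qed (simp add: Hv)
  show "r1 q \<in> cells G F \<and> r1 q \<notin> Rz \<and> mle F (r1 q) q \<and> dl u v (r1 q) = dl u v q"
    using e i1 mle_sub[of z "H - {v}" H] by (auto simp: Rz_def)
  show "r2 q \<in> cells G F \<and> r2 q \<notin> Rz \<and> mle F (r2 q) q \<and> dl u v (r2 q) = dl u v q"
  proof (cases "z = u")
    case True
    have H: "H - {v} \<subseteq> gn G F v" using gn_u e True by simp
    have "\<exists>k\<in>H. h = cl F (k \<union> v)" if h: "h \<in> H - {v}" for h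
    proof (rule bexI[of _ h])
      have "h \<in> F" "h \<union> v = h" using gn_D[of h v] H h v by auto
      then show "h = cl F (h \<union> v)" by (simp add: cl_id)
    qed (use h in auto)
    moreover have "sp F u H v" using e v by (simp add: sp_def)
    ultimately have "mle F (Some (v, H - {v})) q" using e True by simp
    then show ?thesis using e True v H i1 by (auto simp: Rz_def)
  next
    case False
    have "st v \<in> st ` (H - {u})" using e v by (intro imageI) auto
    moreover have "st ` H = insert v (st ` (H - {u}))"
      using image_insert[of st u "H - {u}"] uu[OF False] by (simp add: insert_absorb)
    ultimately have "st ` (H - {u}) = st ` H" by (simp add: insert_absorb)
    then show ?thesis using e False mle_sub[of z "H - {u}" H] by (auto simp: Rz_def)
  qed
  show "r1 q \<noteq> r2 q" using e v by auto
  \<comment> \<open>Of the relation to \<open>q\<close>, everything except the generator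
    \<open>v\<close> is already given by \<open>r1 q\<close>.\<close>
  show "mle F q b" if b: "b \<in> cells G F" "mle F (r1 q) b" "mle F (r2 q) b" for b
  proof -
    obtain y K where y: "b = Some (y, K)" using b e by (cases b) auto
    have s: "sp F y K z" and H1: "\<And>h. h \<in> H - {v} ==> \<exists>k\<in>K. h = cl F (k \<union> z)" using b(2) e y by auto
    have "\<exists>k\<in>K. v = cl F (k \<union> z)"
    proof (cases "z = u")
      case True
      \<comment> \<open>\<open>v\<close> is spanned by \<open>K\<close> over \<open>y\<close>, and
        \<open>y\<close> is below \<open>u\<close>; so some k in \<open>K\<close> lies below
        \<open>v\<close> but not below \<open>u\<close>, and its join with \<open>u\<close> is the
        cover \<open>v\<close>.\<close>
      have s2: "sp F y K v" using b(3) e y True by auto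
      have "y \<subseteq> u" using s True by (simp add: sp_def)
      then have "\<not> (\<forall>k\<in>K. k \<subseteq> v \<longrightarrow> k \<subseteq> u)" using s2 u v unfolding sp_def by blast
      then obtain k where k: "k \<in> K" "k \<subseteq> v" "\<not> k \<subseteq> u" by blast
      have sub: "k \<union> u \<subseteq> v" using k v by auto
      have c1: "cl F (k \<union> u) \<subseteq> v" using cl_least[OF v(1) sub] .
      have "u \<subset> cl F (k \<union> u)" using cl_ext[of "k \<union> u"] k by auto
      moreover have "k \<union> u \<subseteq> G" using sub FG[OF v(1)] by (rule subset_trans)
      ultimately have "v \<subseteq> cl F (k \<union> u)" by (intro cover[OF cl_in])
      with c1 have "v = cl F (k \<union> u)" by (rule_tac subset_antisym)
      then show ?thesis using k True by blast
    next
      case False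
      have "v \<in> H - {u}" using e v by auto
      then show ?thesis using b(3) e y False by auto
    qed
    then show ?thesis using e y s H1 by auto
  qed
next
  show "mrk (dl u v c) = mrk c" if c: "c \<in> cells G F" "c \<notin> Rz" for c
    using c(1)
  proof (cases rule: cells_cases)
    case (Some z H)
    \<comment> \<open>Renaming is injective unless \<open>u\<close> and \<open>v\<close> both occur;
      a cell with minimum \<open>v\<close> cannot have the generator \<open>u\<close>.\<close>
    have "u \<notin> insert z H \<or> v \<notin> insert z H" using Some c(2) gn_not_v v by (auto simp: Rz_def)
    then have "card (st ` insert z H) = card (insert z H)" by (intro card_image st_inj)
    also have "\<dots> = Suc (card H)" using z_notin[OF Some(2,3)] H_fin[OF Some(3)] by simp
    finally show ?thesis using Some card_st[OF H_fin[OF Some(3)]] by (simp del: image_insert)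
  qed simp
  show "\<exists>q\<in>Rz. c \<in> {r1 q, r2 q, q} \<and> d \<in> {r1 q, r2 q, q}"
    if cd: "c \<in> cells G F" "d \<in> cells G F" "dl u v c = dl u v d" "c \<noteq> d" for c d
  proof -
    have "c \<noteq> None" "d \<noteq> None" using cd(3,4) by (cases c; cases d; auto)+
    then obtain z H y K where e: "c = Some (z, H)" "d = Some (y, K)" by (cases c; cases d) auto
    have zF: "z \<in> F" "y \<in> F" and HF: "H \<subseteq> gn G F z" "K \<subseteq> gn G F y" using cd e by auto
    have p: "st z = st y \<and> st ` H - {st z} = st ` K - {st y}"
      using cd(3) unfolding e dl_simps option.inject prod.inject .
    note zy = p[THEN conjunct1] and HK0 = p[THEN conjunct2]
    have HK: "st ` H - {st z} = st ` K - {st z}" using HK0 unfolding zy .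
    have zH: "z \<notin> H" "y \<notin> K" using z_notin zF HF by auto
    \<comment> \<open>Renaming does not touch these generators, so they can be read off from the
      common image.\<close>
    have B: "H - {u, v, z} = K - {u, v, z}"
    proof -
      have *: "P - {u, v, z} = (st ` P - {st z}) - {u, v, z}" if "st z = z \<or> st z = v" for P
        using that by (auto simp: star_def)
      have "st z = z \<or> st z = v" by (auto simp: star_def)
      then show ?thesis using *[of H] *[of K] HK by simp
    qed
    show ?thesis
    proof (cases "st z = v")
      case True
      have zz: "z \<in> {u, v}" "y \<in> {u, v}" using True zy by (auto simp: star_def split: if_splits)
      have nu: "u \<notin> H" "u \<notin> K" using zz zH gn_not_v HF by auto
      have BB: "H - {v} = K - {v}" using B zz nu by auto
      have nv: "z = v ==> v \<notin> H" "y = v ==> v \<notin> K" using zH by auto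
      \<comment> \<open>Both minima are \<open>u\<close> or \<open>v\<close>, so the triple is the
        one whose top has minimum \<open>u\<close>.\<close>
      define q where "q = Some (u, insert v (H - {v}))"
      have "z = u \<or> y = u"
      proof (rule ccontr)
        assume "\<not> ?thesis"
        then have "z = v" "y = v" using zz by auto
        then show False using e cd(4) BB nv by auto
      qed
      then have "H - {v} \<subseteq> gn G F u" using HF BB by auto
      then have "q \<in> Rz" using u v_gn by (auto simp: q_def Rz_def)
      moreover have "c \<in> {r1 q, r2 q, q}" using zz nv e by (auto simp: q_def)
      moreover have "d \<in> {r1 q, r2 q, q}" using zz nv e BB by (auto simp: q_def)
      ultimately show ?thesis by blast
    next
      case False
      then have zu: "z \<noteq> u" "z = y" using zy by (auto simp: star_def split: if_splits)
      have zv: "z \<noteq> v" using False by auto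
      have BB: "H - {u, v} = K - {u, v}" using B zH zu by auto
      have uv: "u \<noteq> v" using v by auto
      have mem: "u \<in> P \<or> v \<in> P \<longleftrightarrow> v \<in> st ` P - {st z}" for P
        using False by (auto simp: star_def)
      have m: "u \<in> H \<or> v \<in> H \<longleftrightarrow> u \<in> K \<or> v \<in> K" unfolding mem HK ..
      have HneK: "H \<noteq> K" using cd(4) e zu by auto
      have m1: "u \<in> H \<or> v \<in> H"
      proof (rule ccontr)
        assume "\<not> ?thesis"
        then have "H = K" using m BB by auto
        with HneK show False ..
      qed
      \<comment> \<open>The minima agree, and the generator sets differ only in which of
        \<open>u\<close> and \<open>v\<close> they contain.\<close>
      define q where "q = Some (z, insert u (insert v (H - {u, v})))"
      have "\<not> (u \<in> H \<and> u \<in> K \<and> v \<notin> H \<and> v \<notin> K)" "\<not> (v \<in> H \<and> v \<in> K \<and> u \<notin> H \<and> u \<notin> K)"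
        using HneK BB by blast+
      then have "u \<in> H \<union> K" "v \<in> H \<union> K" using m m1 by blast+
      then have "u \<in> gn G F z" "v \<in> gn G F z" using HF zu by auto
      then have "q \<in> Rz" using zF HF by (auto simp: q_def Rz_def)
      moreover have "r1 q = Some (z, insert u (H - {u, v}))" "r2 q = Some (z, insert v (H - {u, v}))"
        using uv zu by (auto simp: q_def)
      moreover have "c \<in> {Some (z, insert u (H - {u, v})), Some (z, insert v (H - {u, v})), q}"
        using insert_two[of H, OF HOL.refl m1] e by (auto simp: q_def)
      moreover have "d \<in> {Some (z, insert u (H - {u, v})), Some (z, insert v (H - {u, v})), q}"
        using insert_two[OF BB[symmetric]] m m1 e zu by (auto simp: q_def)
      ultimately show ?thesis by (intro bexI[of _ q]) simp_all
    qed
  qed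
qed (use dl_cells dl_onto dl_mono dl_lower in blast)+

end

section \<open>Descent from a family to a subfamily\<close>

context family begin

text \<open>The properties that zips preserve and that \<open>psi_nonneg\<close> asks for, with
  acyclicity for vectors and for functionals.\<close>

definition good :: bool where
  "good \<longleftrightarrow> M.eulerian \<and> M.acyclic TYPE('a cell list => fld) \<and> M.acyclic TYPE(('a cell list => fld) => fld)"

lemma good_psi:
  "good ==> x \<in> cells G F ==> y \<in> cells G F ==> mle F x y ==> x \<noteq> y ==> \<exists>p. cd_to_ab p = M.psi x y \<and> nonneg_poly p"
  unfolding good_def by (rule M.psi_nonneg) auto

end

definition Psi :: "'a set => 'a set set => ab_poly" where
  "Psi G F = rposet.psi (cells G F) (mle F) mrk None (Some ({}, gn G F {}))"

text \<open>The top cell then has as many generators as \<open>G\<close> has elements, so all simple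
  families on \<open>G\<close> have minor posets of the same rank.\<close>

definition simple :: "'a set => 'a set set => bool" where
  "simple G F \<longleftrightarrow> inj_on (\<lambda>g. cl F {g}) G"

context fam_step begin

lemma good': "good ==> N.good"
proof -
  assume g: good
  have e: M.eulerian using g by (simp only: good_def)
  show ?thesis unfolding N.good_def
    by (intro conjI Z.eulerian'[OF e] Z.acyclic'[OF e]) (use g in \<open>simp_all only: good_def\<close>)
qed

lemma dl_tp: "dl u v tp = N.tp"
proof -
  have s: "st {} = {}" using u by (simp add: star_def)
  have ne: "st h \<noteq> {}" if "h \<in> gn G F {}" for h using gn_D[OF that empF] st_ext[of h] by auto
  have "st ` gn G F {} = gn G F' {}"
  proof
    show "st ` gn G F {} \<subseteq> gn G F' {}" using gn_st[OF _ empF] ne s by auto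
    show "gn G F' {} \<subseteq> st ` gn G F {}" using gn_lift_st[OF _ N.empF] by auto
  qed
  moreover have "{} \<notin> gn G F' {}" using N.gn_D[OF _ N.empF] by blast
  ultimately show ?thesis by (simp add: tp_def N.tp_def s)
qed

text \<open>If the top were in \<open>Rz\<close>, then \<open>u\<close> and \<open>v\<close> would
  be closures of single elements g and h, and after removing \<open>u\<close> both closures would be
  \<open>v\<close>.\<close>

lemma tp_R: "simple G F' ==> tp \<notin> Rz"
proof
  assume s: "simple G F'" and "tp \<in> Rz"
  then have "v \<in> gn G F {}" "u \<in> gn G F {}" using u by (auto simp: tp_def Rz_def)
  then obtain g h where g: "g \<in> G" "u = cl F {g}" and h: "h \<in> G" "v = cl F {h}" by (auto simp: gn_def)
  have "cl F' {g} = v" using cl'[of "{g}"] g(1) by (simp add: g(2)[symmetric])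
  moreover have "cl F' {h} = v" using cl'[of "{h}"] h(1) by (simp add: h(2)[symmetric])
  ultimately have "g = h" using s g h by (auto simp: simple_def inj_on_def)
  then show False using g h v by auto
qed

text \<open>\<open>psi_zip\<close> at the top, which \<open>tp_R\<close> keeps outside
  \<open>Rz\<close>. The factors around d are nonnegative by \<open>good_psi\<close>, on the left
  for the smaller family and on the right for the larger one.\<close>

lemma Psi_step:
  assumes g: good and s: "simple G F'"
  shows "\<exists>p. nonneg_poly p \<and> cd_to_ab p = Psi G F - Psi G F'"
proof -
  have ps: "M.psi None tp = N.M.psi (dl u v None) (dl u v tp) * (if tp \<in> Rz then pc else 1) + Z.zip_sum None tp"
  proof (rule Z.psi_zip)
    show "x = None" if "dl u v x = dl u v None" for x using that by (cases x) auto
  qed (use tp_cells in \<open>auto simp: tp_def\<close>)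
  have P: "Psi G F = M.psi None tp" "Psi G F' = N.M.psi None N.tp" by (simp_all add: Psi_def tp_def N.tp_def)
  have "N.M.psi (dl u v None) (dl u v tp) = N.M.psi None N.tp" by (simp only: dl_tp dl_simps)
  then have d: "Psi G F - Psi G F' = Z.zip_sum None tp" unfolding P ps using tp_R[OF s] by simp
  let ?Q = "{q\<in>Rz. mle F q tp \<and> q \<noteq> tp}"
  have "\<exists>p. cd_to_ab p = N.M.psi (dl u v None) (dl u v q) * pd * M.psi q tp \<and> nonneg_poly p" if q: "q \<in> ?Q" for q
  proof -
    have qX: "q \<in> cells G F" using q Z.RX by auto
    have "q \<noteq> None" using q by (auto simp: Rz_def)
    then have "dl u v q \<noteq> None" by (cases q) auto
    then have "\<exists>p1. cd_to_ab p1 = N.M.psi None (dl u v q) \<and> nonneg_poly p1"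
      by (intro N.good_psi[OF good'[OF g]] dl_cells[OF qX]) (auto simp del: not_None_eq)
    then obtain p1 where p1: "cd_to_ab p1 = N.M.psi None (dl u v q)" "nonneg_poly p1" by blast
    obtain p2 where p2: "cd_to_ab p2 = M.psi q tp" "nonneg_poly p2"
      using good_psi[OF g qX tp_cells] q by auto
    have "cd_to_ab (p1 * Poly_Mapping.single [Var_d] 1 * p2) = N.M.psi (dl u v None) (dl u v q) * pd * M.psi q tp"
      using cd_to_ab_dc[of 0] by (simp add: cd_to_ab_mult p1 p2)
    moreover have "nonneg_poly (p1 * Poly_Mapping.single [Var_d] 1 * p2)"
      by (intro nonneg_mult p1 p2 nonneg_single) simp
    ultimately show ?thesis by blast
  qed
  then have "\<forall>q. \<exists>p. q \<in> ?Q \<longrightarrow> cd_to_ab p = N.M.psi (dl u v None) (dl u v q) * pd * M.psi q tp \<and> nonneg_poly p" by blast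
  from choice[OF this] obtain p where p: "\<forall>q. q \<in> ?Q \<longrightarrow> cd_to_ab (p q) = N.M.psi (dl u v None) (dl u v q) * pd * M.psi q tp \<and> nonneg_poly (p q)" ..
  have "nonneg_poly (\<Sum>q\<in>?Q. p q)" by (rule nonneg_sum) (use p in blast)
  moreover have "cd_to_ab (\<Sum>q\<in>?Q. p q) = Z.zip_sum None tp"
    unfolding cd_to_ab_sum Z.zip_sum_def by (rule sum.cong[OF HOL.refl]) (use p in blast)
  ultimately show ?thesis unfolding d by blast
qed

end

text \<open>The closure in \<open>C\<close> depends only on the closure in \<open>F\<close>, so
  elements with the same closure in \<open>F\<close> keep a common closure in
  \<open>C\<close>.\<close>

lemma simple_mono:
  assumes C: "fam G C" and F: "fam G F" and CF: "C \<subseteq> F" and s: "simple G C"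
  shows "simple G F"
proof -
  interpret C: family G C by unfold_locales (rule C)
  interpret F: family G F by unfold_locales (rule F)
  have "cl C {g} = cl C (cl F {g})" for g
    by (rule C.cl_eqI) (use CF F.cl_sub in blast)
  then show ?thesis using s unfolding simple_def inj_on_def by metis
qed

text \<open>Above a maximal \<open>u\<close> in \<open>F - C\<close> there are only members of
  \<open>C\<close>, so the closure of \<open>u\<close> in \<open>C\<close> is its unique cover. The
  family without \<open>u\<close> still contains \<open>C\<close> and is therefore simple.\<close>

theorem descend:
  assumes "fam G F" "fam G C" "C \<subseteq> F" "simple G C" "family.good G F"
  shows "family.good G C \<and> (\<exists>p. nonneg_poly p \<and> cd_to_ab p = Psi G F - Psi G C)"
  using assms(1,3,5)
proof (induction "card (F - C)" arbitrary: F rule: less_induct)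
  case less
  interpret F: family G F by unfold_locales (rule less.prems(1))
  interpret C: family G C by unfold_locales (rule assms(2))
  show ?case
  proof (cases "F = C")
    case True
    then show ?thesis using less.prems(3) by (auto simp: nonneg_poly_def intro!: exI[of _ 0])
  next
    case False
    have fd: "finite (F - C)" using F.finF by simp
    moreover have "F - C \<noteq> {}" using False less.prems(2) by auto
    ultimately obtain u where uu: "u \<in> F - C" "\<And>A. A \<in> F - C ==> u \<subseteq> A ==> u = A"
      using finite_has_maximal[of "F - C"] by blast
    define v where "v = cl C u"
    have uG: "u \<subseteq> G" using F.FG uu by auto
    have vv: "v \<in> C" "u \<subseteq> v" unfolding v_def using C.cl_in[OF uG] C.cl_ext by auto
    interpret fam_step G F u v
    proof
      show "u \<in> F" using uu by simp
      show "u \<noteq> {}" using uu(1) C.empF by blast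
      show "v \<in> F" using vv less.prems(2) by auto
      show "u \<subset> v" using vv uu(1) by blast
      show "v \<subseteq> A" if A: "A \<in> F" "u \<subset> A" for A
      proof -
        have "A \<in> C" using uu(2)[of A] A by auto
        then show ?thesis unfolding v_def using A by (intro C.cl_least) auto
      qed
    qed
    have CF': "C \<subseteq> F - {u}" using less.prems(2) uu by auto
    have s: "simple G (F - {u})" by (rule simple_mono[OF assms(2) fam' CF' assms(4)])
    have "F - {u} - C \<subset> F - C" using uu by auto
    then have "card (F - {u} - C) < card (F - C)" using fd psubset_card_mono by blast
    from less.hyps[OF this fam' CF' good'[OF less.prems(3)]]
    obtain p where p: "family.good G C" "nonneg_poly p" "cd_to_ab p = Psi G (F - {u}) - Psi G C" by blast
    obtain p' where p': "nonneg_poly p'" "cd_to_ab p' = Psi G F - Psi G (F - {u})"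
      using Psi_step[OF less.prems(3) s] by blast
    show ?thesis using p p' by (intro conjI exI[of _ "p + p'"]) (simp_all add: nonneg_add cd_to_ab_add)
  qed
qed

text \<open>A perfect matching in which \<open>e0 i\<close> is covered by its partner
  \<open>e1 i\<close> and by no other \<open>e1 j\<close>: moving values from \<open>e0 i\<close> to
  \<open>e1 i\<close> is a contracting homotopy, and signs cancel in pairs.\<close>

lemma toggle:
  assumes fin: "finite I" and inj: "inj_on e0 I" "inj_on e1 I" and S: "S = e0 ` I \<union> e1 ` I"
    and dis: "e0 ` I \<inter> e1 ` I = {}"
    and rk1: "\<And>i. i \<in> I ==> rk (e1 i) = Suc (rk (e0 i))"
    and le01: "\<And>i j. i \<in> I ==> j \<in> I ==> rk (e0 j) = rk (e0 i) ==> lq (e0 i) (e1 j) \<longleftrightarrow> i = j"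
    and le10: "\<And>i j. i \<in> I ==> j \<in> I ==> \<not> lq (e1 i) (e0 j)"
    and le11: "\<And>i j. i \<in> I ==> j \<in> I ==> lq (e1 i) (e1 j) \<longleftrightarrow> lq (e0 i) (e0 j)"
  shows toggle_acyc: "acyc (t :: 'e::kvec itself) lq rk S" and toggle_sum: "(\<Sum>y\<in>S. (-1) ^ rk y) = (0::int)"
proof -
  show "(\<Sum>y\<in>S. (-1) ^ rk y) = (0::int)"
    unfolding S using fin dis inj rk1
    by (subst sum.union_disjoint) (auto simp: sum.reindex sum_negf)
  define K where "K i = {j\<in>I. lq (e0 i) (e0 j) \<and> rk (e0 j) = Suc (rk (e0 i))}" for i
  have K: "K i \<subseteq> I" "finite (K i)" for i using fin by (auto simp: K_def)
  have c1: "cov lq rk S (e1 i) = e1 ` K i" if i: "i \<in> I" for i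
  proof
    show "cov lq rk S (e1 i) \<subseteq> e1 ` K i"
      using i le10[OF i] le11[OF i] rk1 by (auto simp: cov_def S K_def)
    show "e1 ` K i \<subseteq> cov lq rk S (e1 i)"
      using i le11[OF i] rk1 by (auto simp: cov_def S K_def)
  qed
  have c0: "cov lq rk S (e0 i) = insert (e1 i) (e0 ` K i)" if i: "i \<in> I" for i
  proof
    show "cov lq rk S (e0 i) \<subseteq> insert (e1 i) (e0 ` K i)"
      using i le01[OF i] rk1 by (auto simp: cov_def S K_def)
    show "insert (e1 i) (e0 ` K i) \<subseteq> cov lq rk S (e0 i)"
      using i le01[OF i i] rk1 by (auto simp: cov_def S K_def)
  qed
  have inK: "inj_on e0 (K i)" "inj_on e1 (K i)" for i using inj K inj_on_subset by blast+
  have b1: "bd lq rk S h (e1 i) = (\<Sum>j\<in>K i. h (e1 j))" if "i \<in> I" for h :: "'b => 'e" and i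
    using inK by (simp add: bd_def c1[OF that] sum.reindex)
  have b0: "bd lq rk S h (e0 i) = h (e1 i) + (\<Sum>j\<in>K i. h (e0 j))" if i: "i \<in> I" for h :: "'b => 'e" and i
  proof -
    have "e1 i \<notin> e0 ` K i" using dis K(1)[of i] i by blast
    then show ?thesis using inK K(2) by (simp add: bd_def c0[OF i] sum.reindex)
  qed
  show "acyc t lq rk S" unfolding acyc_def
  proof (intro allI impI exaI)
    fix Z B :: "'e set" and m f
    assume sZ: "kv.subspace Z" and sB: "kv.subspace B" and BZ: "B \<subseteq> Z"
      and f: "\<And>w. w \<in> S ==> rk w = m ==> f w \<in> Z"
        "\<And>c. c \<in> S ==> Suc (rk c) = m ==> bd lq rk S f c \<in> B"
    define g where "g x = (if x \<in> e1 ` I then f (e0 (inv_into I e1 x)) else 0)" for x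
    have g1: "g (e1 i) = f (e0 i)" if "i \<in> I" for i using that inj by (simp add: g_def)
    have g0: "g (e0 i) = 0" if "i \<in> I" for i using that dis by (auto simp: g_def)
    show "\<exists>g. (\<forall>w\<in>S. rk w = Suc m \<longrightarrow> g w \<in> Z) \<and> (\<forall>c\<in>S. rk c = m \<longrightarrow> f c + bd lq rk S g c \<in> B)"
    proof (intro exI[of _ g] conjI ballI impI)
      fix w assume w: "w \<in> S" "rk w = Suc m"
      show "g w \<in> Z"
      proof (cases "w \<in> e1 ` I")
        case True
        then obtain i where "i \<in> I" "w = e1 i" by auto
        then show ?thesis using g1 f(1)[of "e0 i"] rk1[of i] w by (auto simp: S)
      qed (simp add: g_def kv.subspace_0[OF sZ])
    next
      fix c assume c: "c \<in> S" "rk c = m"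
      then consider i where "i \<in> I" "c = e0 i" | i where "i \<in> I" "c = e1 i" by (auto simp: S)
      then show "f c + bd lq rk S g c \<in> B"
      proof cases
        case (1 i)
        have "(\<Sum>j\<in>K i. g (e0 j)) = 0" by (rule sum.neutral) (use g0 K(1) in blast)
        then show ?thesis using 1 by (simp add: b0 g1 kv.subspace_0[OF sB])
      next
        case (2 i)
        \<comment> \<open>The equation at \<open>e1 i\<close> is the cycle condition at its partner
          \<open>e0 i\<close>, one rank lower.\<close>
        have "(\<Sum>j\<in>K i. g (e1 j)) = (\<Sum>j\<in>K i. f (e0 j))" by (rule sum.cong[OF HOL.refl]) (use g1 K(1) in blast)
        moreover have "bd lq rk S f (e0 i) \<in> B" by (rule f(2)) (use 2 c rk1[of i] in \<open>auto simp: S\<close>)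
        ultimately show ?thesis using 2 by (simp add: b0 b1)
      qed
    qed
  qed
qed

text \<open>\<open>S2\<close> is closed downwards and carries a subcomplex, since boundaries go
  down, with quotient complex on \<open>S1\<close>. The chain is filled over \<open>S1\<close>
  first, and what remains lives on \<open>S2\<close>.\<close>

lemma acyc_up:
  fixes t :: "'e::kvec itself"
  assumes a1: "acyc t lq rk S1" and a2: "acyc t lq rk S2" and dd: "dd0 lq rk (S1 \<union> S2)" and dis: "S1 \<inter> S2 = {}"
    and up: "\<And>x y. x \<in> S1 ==> y \<in> S2 ==> \<not> lq x y"
  shows "acyc t lq rk (S1 \<union> S2)"
  unfolding acyc_def
proof (intro allI impI exaI)
  let ?S = "S1 \<union> S2"
  fix Z B :: "'e set" and i f
  assume sZ: "kv.subspace Z" and sB: "kv.subspace B" and BZ: "B \<subseteq> Z"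
    and f: "\<And>w. w \<in> ?S ==> rk w = i ==> f w \<in> Z"
      "\<And>c. c \<in> ?S ==> Suc (rk c) = i ==> bd lq rk ?S f c \<in> B"
  have finS: "finite ?S" using dd by (simp add: dd0_def)
  have c1: "cov lq rk ?S c = cov lq rk S1 c" if "c \<in> S1" for c using that up by (auto simp: cov_def)
  have b1: "bd lq rk ?S h c = bd lq rk S1 h c" if "c \<in> S1" for c and h :: "'a => 'e" using c1[OF that] by (simp add: bd_def)
  have bs: "bd lq rk ?S h c = bd lq rk S1 h c + bd lq rk S2 h c" for c and h :: "'a => 'e"
  proof -
    have "cov lq rk ?S c = cov lq rk S1 c \<union> cov lq rk S2 c" by (auto simp: cov_def)
    moreover have "finite (cov lq rk S1 c)" "finite (cov lq rk S2 c)" using finS by (auto simp: cov_def)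
    moreover have "cov lq rk S1 c \<inter> cov lq rk S2 c = {}" using dis by (auto simp: cov_def)
    ultimately show ?thesis by (simp add: bd_def sum.union_disjoint)
  qed
  have ext: "bd lq rk S h c = bd lq rk S h' c" if "\<And>w. w \<in> S ==> h w = h' w" for S c and h h' :: "'a => 'e"
    unfolding bd_def by (rule sum.cong) (use that in \<open>auto simp: cov_def\<close>)
  have e1: "exa lq rk S1 (\<lambda>_. Z) (\<lambda>_. B) i" and e2: "exa lq rk S2 (\<lambda>_. Z) (\<lambda>_. B) i"
    using a1 a2 sZ sB BZ by (auto simp: acyc_def)
  obtain g1 where g1: "\<And>w. w \<in> S1 ==> rk w = Suc i ==> g1 w \<in> Z"
    "\<And>c. c \<in> S1 ==> rk c = i ==> f c + bd lq rk S1 g1 c \<in> B"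
  proof (rule exaD[OF e1, of f])
    fix c assume "c \<in> S1" "Suc (rk c) = i"
    then show "bd lq rk S1 f c \<in> B" using f(2)[of c] b1[of c f] by simp
  qed (use f(1) in auto)
  define h1 where "h1 w = (if w \<in> S1 then g1 w else 0)" for w
  have h1Z: "h1 w \<in> Z" if "rk w = Suc i" for w using that g1(1) kv.subspace_0[OF sZ] by (auto simp: h1_def)
  \<comment> \<open>What remains after the partial filling; on \<open>S1\<close> it lies in
    \<open>B\<close>.\<close>
  define k where "k c = f c + bd lq rk ?S h1 c" for c
  have bh1: "bd lq rk ?S h1 c = bd lq rk S1 g1 c" if "c \<in> S1" for c
    unfolding b1[OF that] by (rule ext) (simp add: h1_def)
  have k1: "k c \<in> B" if "c \<in> S1" "rk c = i" for c using g1(2)[OF that] bh1[OF that(1)] by (simp add: k_def)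
  have bk: "bd lq rk ?S k c = bd lq rk ?S f c" if "c \<in> ?S" for c
    unfolding k_def using bd_bd[OF dd that, of h1] by (simp add: bd_add)
  have kZ: "k w \<in> Z" if "w \<in> S2" "rk w = i" for w
    unfolding k_def
  proof (rule kv.subspace_add[OF sZ f(1)])
    show "bd lq rk ?S h1 w \<in> Z" unfolding bd_def
      by (rule kv.subspace_sum[OF sZ]) (use h1Z that in \<open>auto simp: cov_def\<close>)
  qed (use that in auto)
  have kc: "bd lq rk S2 k c \<in> B" if c: "c \<in> S2" "Suc (rk c) = i" for c
  proof -
    have "bd lq rk S1 k c \<in> B" unfolding bd_def
      by (rule kv.subspace_sum[OF sB]) (use k1 c in \<open>auto simp: cov_def\<close>)
    moreover have "bd lq rk ?S k c \<in> B" using bk[of c] f(2)[of c] c by simp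
    ultimately have "bd lq rk S1 k c + bd lq rk ?S k c \<in> B" by (rule kv.subspace_add[OF sB])
    also have "bd lq rk S1 k c + bd lq rk ?S k c = bd lq rk S2 k c" by (simp add: bs add.assoc[symmetric])
    finally show ?thesis .
  qed
  obtain g2 where g2: "\<And>w. w \<in> S2 ==> rk w = Suc i ==> g2 w \<in> Z"
    "\<And>c. c \<in> S2 ==> rk c = i ==> k c + bd lq rk S2 g2 c \<in> B"
    using exaD[OF e2, of k] kZ kc by metis
  define g where "g w = (if w \<in> S1 then g1 w else g2 w)" for w
  show "\<exists>g. (\<forall>w\<in>?S. rk w = Suc i \<longrightarrow> g w \<in> Z) \<and> (\<forall>c\<in>?S. rk c = i \<longrightarrow> f c + bd lq rk ?S g c \<in> B)"
  proof (intro exI[of _ g] conjI ballI impI)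
    fix c assume c: "c \<in> ?S" "rk c = i"
    have S1g: "bd lq rk S1 g c = bd lq rk S1 g1 c" for c by (rule ext) (simp add: g_def)
    show "f c + bd lq rk ?S g c \<in> B"
    proof (cases "c \<in> S1")
      case True
      then show ?thesis using g1(2) c b1[OF True] S1g by simp
    next
      case False
      have "bd lq rk S2 g c = bd lq rk S2 g2 c" by (rule ext) (use dis in \<open>auto simp: g_def\<close>)
      moreover have "bd lq rk ?S h1 c = bd lq rk S1 g1 c"
      proof -
        have "bd lq rk S1 h1 c = bd lq rk S1 g1 c" by (rule ext) (simp add: h1_def)
        moreover have "bd lq rk S2 h1 c = 0" unfolding bd_def
          by (rule sum.neutral) (use dis in \<open>auto simp: cov_def h1_def\<close>)
        ultimately show ?thesis by (simp add: bs)
      qed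
      ultimately have "f c + bd lq rk ?S g c = k c + bd lq rk S2 g2 c"
        by (simp add: k_def bs[of g] S1g add.assoc)
      then show ?thesis using g2(2) c False by auto
    qed
  qed (use g1 g2 in \<open>auto simp: g_def\<close>)
qed

section \<open>The cube\<close>

locale cube =
  fixes G :: "'a set"
  assumes finG: "finite G"
begin

sublocale family G "Pow G"
  by unfold_locales (use finG in \<open>auto simp: fam_def\<close>)

text \<open>The face of the cube formed by the sets between \<open>z\<close> and
  \<open>z \<union> A\<close>; \<open>A\<close> is the set of its free directions.\<close>

definition c :: "'a set => 'a set => 'a cell" where
  "c z A = Some (z, (\<lambda>g. insert g z) ` A)"

definition val :: "'a set => 'a set => bool" where
  "val z A \<longleftrightarrow> z \<subseteq> G \<and> A \<subseteq> G \<and> z \<inter> A = {}"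

lemma valD: "val z A ==> z \<subseteq> G" "val z A ==> A \<subseteq> G" "val z A ==> z \<inter> A = {}" "val z A ==> finite A"
  using finG by (auto simp: val_def intro: finite_subset)

lemma gn_Pow: "z \<subseteq> G ==> gn G (Pow G) z = (\<lambda>g. insert g z) ` (G - z)"
proof -
  assume z: "z \<subseteq> G"
  have "gn G (Pow G) z = (\<lambda>g. cl (Pow G) (insert g z)) ` (G - z)" by (auto simp: gn_def)
  also have "\<dots> = (\<lambda>g. insert g z) ` (G - z)"
    by (rule image_cong[OF HOL.refl], rule cl_id) (use z in auto)
  finally show ?thesis .
qed

lemma c_cells: "val z A ==> c z A \<in> cells G (Pow G)"
  unfolding c_def cells_Some by (subst gn_Pow) (auto simp: val_def)

lemma cellsE:
  assumes "x \<in> cells G (Pow G)"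
  obtains "x = None" | z A where "val z A" "x = c z A"
  using assms
proof (cases rule: cells_cases)
  case (Some z H)
  then have z: "z \<subseteq> G" by simp
  then have "H \<subseteq> (\<lambda>g. insert g z) ` (G - z)" using Some(3) gn_Pow by simp
  then obtain A where "A \<subseteq> G - z" "H = (\<lambda>g. insert g z) ` A" by (rule subset_imageE)
  then have "val z A" "x = c z A" using z Some(1) by (auto simp: val_def c_def)
  then show thesis by (rule that(2))
qed (rule that(1))

lemma ins_inj: "inj_on (\<lambda>g. insert g z) (- z)"
  by (auto simp: inj_on_def)

lemma ins_inj_A: "val z A ==> inj_on (\<lambda>g. insert g z) A"
  by (rule inj_on_subset[OF ins_inj]) (use valD(3) in blast)

lemma c_inj: "val z A ==> val z' A' ==> c z A = c z' A' \<longleftrightarrow> z = z' \<and> A = A'"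
proof
  assume v: "val z A" "val z' A'" and e: "c z A = c z' A'"
  note e' = e[unfolded c_def option.inject prod.inject]
  note z = e'[THEN conjunct1]
  have im: "(\<lambda>g. insert g z) ` A = (\<lambda>g. insert g z) ` A'" using e'[THEN conjunct2] unfolding z .
  have sub: "A \<subseteq> - z" "A' \<subseteq> - z" using valD(3)[OF v(1)] valD(3)[OF v(2)] unfolding z by blast+
  have "A = A'" using im inj_on_image_eq_iff[OF ins_inj sub] by (rule_tac iffD1)
  then show "z = z' \<and> A = A'" using z by (rule_tac conjI)
qed simp

lemma mrk_c: "val z A ==> mrk (c z A) = Suc (card A)"
  by (simp add: c_def card_image[OF ins_inj_A])

lemma sp_Pow:
  assumes "val z A" "z' \<subseteq> G"
  shows "sp (Pow G) z ((\<lambda>g. insert g z) ` A) z' \<longleftrightarrow> z \<subseteq> z' \<and> z' \<subseteq> z \<union> A"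
proof
  assume s: "sp (Pow G) z ((\<lambda>g. insert g z) ` A) z'"
  have "z' \<subseteq> z \<union> (z' \<inter> A)"
    by (rule sp_D[OF s]) (use assms valD(1)[OF assms(1)] in auto)
  then show "z \<subseteq> z' \<and> z' \<subseteq> z \<union> A" using s by (auto simp: sp_def)
next
  assume h: "z \<subseteq> z' \<and> z' \<subseteq> z \<union> A"
  show "sp (Pow G) z ((\<lambda>g. insert g z) ` A) z'" unfolding sp_def
  proof (intro conjI ballI impI subsetI)
    fix B x assume B: "z \<subseteq> B" "\<forall>h\<in>(\<lambda>g. insert g z) ` A. h \<subseteq> z' \<longrightarrow> h \<subseteq> B" and x: "x \<in> z'"
    show "x \<in> B"
    proof (cases "x \<in> z")
      case False
      then have "x \<in> A" using h x by blast
      moreover have "insert x z \<subseteq> z'" using h x by blast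
      ultimately have "insert x z \<subseteq> B" using B(2) by blast
      then show ?thesis by simp
    qed (use B in blast)
  qed (use h in blast)
qed

text \<open>Inclusion of faces. Closure in \<open>Pow G\<close> is the identity, so each generator
  determines its direction.\<close>

lemma mle_c:
  assumes v: "val z A" "val z' A'"
  shows "mle (Pow G) (c z' A') (c z A) \<longleftrightarrow> z \<subseteq> z' \<and> z' \<subseteq> z \<union> A \<and> A' \<subseteq> A"
proof -
  have "(\<exists>h\<in>(\<lambda>g. insert g z) ` A. insert g z' = cl (Pow G) (h \<union> z')) \<longleftrightarrow> g \<in> A"
    if g: "g \<in> A'" and z: "z \<subseteq> z'" for g
  proof -
    have gz: "g \<notin> z'" using g valD(3)[OF v(2)] by blast
    have e: "cl (Pow G) (insert k z \<union> z') = insert k z'" if "k \<in> A" for k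
    proof -
      have "insert k z \<union> z' = insert k z'" using z by blast
      moreover have "insert k z' \<in> Pow G" using that valD(2)[OF v(1)] valD(1)[OF v(2)] by blast
      ultimately show ?thesis using cl_id by simp
    qed
    have "insert g z' = insert k z' \<longleftrightarrow> g = k" for k using gz by blast
    then show ?thesis using e by auto
  qed
  then show ?thesis using sp_Pow[OF v(1) valD(1)[OF v(2)]]
    by (auto simp: c_def)
qed

definition low :: "'a set => 'a set => 'a cell set" where
  "low z A = insert None {c w B | w B. z \<subseteq> w \<and> w \<subseteq> z \<union> A \<and> B \<subseteq> A - w}"

lemma low_val: "val z A ==> z \<subseteq> w ==> w \<subseteq> z \<union> A ==> B \<subseteq> A - w ==> val w B"
  by (auto simp: val_def)

lemma low_ivl:
  assumes v: "val z A" shows "ivl (cells G (Pow G)) (mle (Pow G)) None (c z A) = low z A"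
proof
  show "ivl (cells G (Pow G)) (mle (Pow G)) None (c z A) \<subseteq> low z A"
  proof
    fix x assume x: "x \<in> ivl (cells G (Pow G)) (mle (Pow G)) None (c z A)"
    then have "x \<in> cells G (Pow G)" by (simp add: ivl_def)
    then show "x \<in> low z A"
    proof (cases rule: cellsE)
      case (2 w B)
      then have "z \<subseteq> w \<and> w \<subseteq> z \<union> A \<and> B \<subseteq> A" using x mle_c[OF v 2(1)] by (simp add: ivl_def)
      moreover have "B \<subseteq> A - w" using calculation valD(3)[OF 2(1)] by blast
      ultimately show ?thesis unfolding low_def 2(2) by blast
    qed (simp add: low_def)
  qed
  show "low z A \<subseteq> ivl (cells G (Pow G)) (mle (Pow G)) None (c z A)"
  proof
    fix x assume "x \<in> low z A"
    then consider "x = None" | w B where "x = c w B" "z \<subseteq> w" "w \<subseteq> z \<union> A" "B \<subseteq> A - w" by (auto simp: low_def)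
    then show "x \<in> ivl (cells G (Pow G)) (mle (Pow G)) None (c z A)"
    proof cases
      case (2 w B)
      have vw: "val w B" by (rule low_val[OF v 2(2-4)])
      then show ?thesis using c_cells[OF vw] mle_c[OF v vw] 2 by (auto simp: ivl_def)
    qed (simp add: ivl_def)
  qed
qed

definition I1 where "I1 z A = {(w, B). z \<subseteq> w \<and> w \<subseteq> z \<union> A \<and> B \<subseteq> A - w}"
text \<open>For a new direction \<open>g\<close>: \<open>e0 g\<close> puts a face on the side that
  contains \<open>g\<close>, and \<open>e1 g\<close> stretches it in direction \<open>g\<close>, one
  dimension up.\<close>

definition e0 where "e0 g p = c (insert g (fst p)) (snd p)"
definition e1 where "e1 g p = c (fst p) (insert g (snd p))"

context
  fixes z A g assumes v: "val z (insert g A)" and g: "g \<notin> A"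
begin

lemma I1_val:
  assumes "p \<in> I1 z A"
  shows "val (insert g (fst p)) (snd p)" "val (fst p) (insert g (snd p))" "g \<notin> fst p" "g \<notin> snd p" "fst p \<inter> snd p = {}" "finite (snd p)"
proof -
  have p: "z \<subseteq> fst p" "fst p \<subseteq> z \<union> A" "snd p \<subseteq> A - fst p" using assms by (auto simp: I1_def)
  have gz: "g \<notin> z" "g \<in> G" using v by (auto simp: val_def)
  show n: "g \<notin> fst p" "g \<notin> snd p" "fst p \<inter> snd p = {}" using p g gz by auto
  show "val (insert g (fst p)) (snd p)" "val (fst p) (insert g (snd p))"
    using p n v gz unfolding val_def by blast+
  then show "finite (snd p)" using valD(4) by blast
qed

text \<open>A face has \<open>g\<close> in its base point, has it as a free direction, or avoids it.
  The first two kinds are matched with each other, the third forms the smaller cube.\<close>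

lemma low_insert: "low z (insert g A) = (e0 g ` I1 z A \<union> e1 g ` I1 z A) \<union> low z A"
proof
  show "low z (insert g A) \<subseteq> (e0 g ` I1 z A \<union> e1 g ` I1 z A) \<union> low z A"
  proof
    fix x assume "x \<in> low z (insert g A)"
    then consider "x = None" | w B where "x = c w B" "z \<subseteq> w" "w \<subseteq> z \<union> insert g A" "B \<subseteq> insert g A - w" by (auto simp: low_def)
    then show "x \<in> (e0 g ` I1 z A \<union> e1 g ` I1 z A) \<union> low z A"
    proof cases
      case (2 w B)
      have gz: "g \<notin> z" using v by (auto simp: val_def)
      consider "g \<in> w" | "g \<in> B" "g \<notin> w" | "g \<notin> w" "g \<notin> B" by blast
      then show ?thesis
      proof cases
        case 1
        have "x = e0 g (w - {g}, B)" using 1 2 by (simp add: e0_def insert_absorb)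
        moreover have "(w - {g}, B) \<in> I1 z A" using 1 2 gz by (auto simp: I1_def)
        ultimately show ?thesis by blast
      next
        case h: 2
        have "x = e1 g (w, B - {g})" using h 2 by (simp add: e1_def insert_absorb)
        moreover have "(w, B - {g}) \<in> I1 z A" using h 2 by (auto simp: I1_def)
        ultimately show ?thesis by blast
      next
        case h: 3
        have "w \<subseteq> z \<union> A" "B \<subseteq> A - w" using h 2 by auto
        then show ?thesis using 2 by (auto simp: low_def)
      qed
    qed (simp add: low_def)
  qed
  show "(e0 g ` I1 z A \<union> e1 g ` I1 z A) \<union> low z A \<subseteq> low z (insert g A)"
  proof
    fix x assume "x \<in> (e0 g ` I1 z A \<union> e1 g ` I1 z A) \<union> low z A"
    then consider p where "p \<in> I1 z A" "x = e0 g p" | p where "p \<in> I1 z A" "x = e1 g p" | "x \<in> low z A" by blast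
    then show "x \<in> low z (insert g A)"
    proof cases
      case (1 p)
      have "z \<subseteq> insert g (fst p)" "insert g (fst p) \<subseteq> z \<union> insert g A" "snd p \<subseteq> insert g A - insert g (fst p)"
        using 1(1) g by (auto simp: I1_def)
      then show ?thesis unfolding 1(2) e0_def low_def by blast
    next
      case (2 p)
      have "z \<subseteq> fst p" "fst p \<subseteq> z \<union> insert g A" "insert g (snd p) \<subseteq> insert g A - fst p"
        using 2(1) I1_val(3)[OF 2(1)] by (auto simp: I1_def)
      then show ?thesis unfolding 2(2) e1_def low_def by blast
    next
      case 3
      have "\<exists>w B. c w' B' = c w B \<and> z \<subseteq> w \<and> w \<subseteq> z \<union> insert g A \<and> B \<subseteq> insert g A - w"
        if "z \<subseteq> w'" "w' \<subseteq> z \<union> A" "B' \<subseteq> A - w'" for w' B'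
        by (intro exI[of _ w'] exI[of _ B']) (use that in auto)
      then show ?thesis using 3 by (auto simp: low_def)
    qed
  qed
qed

lemma fin_I1: "finite (I1 z A)"
proof (rule finite_subset)
  show "I1 z A \<subseteq> Pow G \<times> Pow G" using v by (auto simp: I1_def val_def)
qed (use finG in simp)

lemma low_cases:
  assumes "x \<in> low z A"
  obtains "x = None" | w B where "x = c w B" "val w B" "g \<notin> w" "g \<notin> B"
proof -
  have vA: "val z A" "g \<notin> z" using v by (auto simp: val_def)
  consider "x = None" | w B where "x = c w B" "z \<subseteq> w" "w \<subseteq> z \<union> A" "B \<subseteq> A - w" using assms by (auto simp: low_def)
  then show thesis
  proof cases
    case (2 w B)
    have "g \<notin> w" "g \<notin> B" using 2 vA g by auto
    then show thesis using that(2) 2(1) low_val[OF vA(1) 2(2-4)] by blast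
  qed (rule that(1))
qed

lemma up_low:
  assumes x: "x \<in> e0 g ` I1 z A \<union> e1 g ` I1 z A" and y: "y \<in> low z A"
  shows "\<not> mle (Pow G) x y"
  using y
proof (cases rule: low_cases)
  case 1
  then show ?thesis using x by (auto simp: e0_def e1_def c_def)
next
  case (2 w B)
  consider p where "p \<in> I1 z A" "x = e0 g p" | p where "p \<in> I1 z A" "x = e1 g p" using x by blast
  then show ?thesis
  proof cases
    case (1 p)
    then show ?thesis using mle_c[OF 2(2) I1_val(1)[OF 1(1)]] 2 by (auto simp: e0_def)
  next
    case h: (2 p)
    then show ?thesis using mle_c[OF 2(2) I1_val(2)[OF h(1)]] 2 by (auto simp: e1_def)
  qed
qed

lemma up_low_disj: "(e0 g ` I1 z A \<union> e1 g ` I1 z A) \<inter> low z A = {}"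
proof -
  have "mle (Pow G) x x" if "x \<in> low z A" for x
    using that by (cases rule: low_cases) (auto intro: M.refl c_cells)
  then show ?thesis using up_low by blast
qed

lemma e_toggle:
  shows "acyc (t :: 'e::kvec itself) (mle (Pow G)) mrk (e0 g ` I1 z A \<union> e1 g ` I1 z A)"
    and "(\<Sum>y\<in>e0 g ` I1 z A \<union> e1 g ` I1 z A. (-1) ^ mrk y) = (0::int)"
proof -
  note V = I1_val
  have i0: "inj_on (e0 g) (I1 z A)"
  proof (rule inj_onI)
    fix p q assume pq: "p \<in> I1 z A" "q \<in> I1 z A" "e0 g p = e0 g q"
    then have "insert g (fst p) = insert g (fst q)" "snd p = snd q"
      using c_inj[OF V(1)[OF pq(1)] V(1)[OF pq(2)]] by (auto simp: e0_def)
    then show "p = q" using V(3)[OF pq(1)] V(3)[OF pq(2)] by (metis insert_ident prod_eqI)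
  qed
  have i1: "inj_on (e1 g) (I1 z A)"
  proof (rule inj_onI)
    fix p q assume pq: "p \<in> I1 z A" "q \<in> I1 z A" "e1 g p = e1 g q"
    then have "insert g (snd p) = insert g (snd q)" "fst p = fst q"
      using c_inj[OF V(2)[OF pq(1)] V(2)[OF pq(2)]] by (auto simp: e1_def)
    then show "p = q" using V(4)[OF pq(1)] V(4)[OF pq(2)] by (metis insert_ident prod_eqI)
  qed
  have rk0: "mrk (e0 g p) = Suc (card (snd p))" if "p \<in> I1 z A" for p
    using mrk_c[OF V(1)[OF that]] by (simp add: e0_def)
  have rk1: "mrk (e1 g p) = Suc (Suc (card (snd p)))" if "p \<in> I1 z A" for p
    using mrk_c[OF V(2)[OF that]] V(4,6)[OF that] by (simp add: e1_def)
  have l10: "\<not> mle (Pow G) (e1 g p) (e0 g q)" if "p \<in> I1 z A" "q \<in> I1 z A" for p q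
    using mle_c[OF V(1)[OF that(2)] V(2)[OF that(1)]] V(4)[OF that(2)] by (simp add: e0_def e1_def)
  have l11: "mle (Pow G) (e1 g p) (e1 g q) \<longleftrightarrow> mle (Pow G) (e0 g p) (e0 g q)" if "p \<in> I1 z A" "q \<in> I1 z A" for p q
    using mle_c[OF V(2)[OF that(2)] V(2)[OF that(1)]] mle_c[OF V(1)[OF that(2)] V(1)[OF that(1)]]
      V(3,4)[OF that(1)] V(3,4)[OF that(2)]
    unfolding e0_def e1_def by blast
  have l01: "mle (Pow G) (e0 g p) (e1 g q) \<longleftrightarrow> p = q"
    if pq: "p \<in> I1 z A" "q \<in> I1 z A" "mrk (e0 g q) = mrk (e0 g p)" for p q
  proof -
    have m: "mle (Pow G) (e0 g p) (e1 g q) \<longleftrightarrow> fst q \<subseteq> insert g (fst p) \<and> insert g (fst p) \<subseteq> fst q \<union> insert g (snd q) \<and> snd p \<subseteq> insert g (snd q)"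
      using mle_c[OF V(2)[OF pq(2)] V(1)[OF pq(1)]] by (simp add: e0_def e1_def)
    show ?thesis
    proof
      assume "mle (Pow G) (e0 g p) (e1 g q)"
      note h = this[unfolded m]
      \<comment> \<open>Equal rank means equally many free directions, so this inclusion is an
        equality.\<close>
      have s: "snd p \<subseteq> snd q" using h V(4)[OF pq(1)] by blast
      have "card (snd p) = card (snd q)" using pq rk0 by simp
      then have sq: "snd p = snd q" using s V(6)[OF pq(2)] card_subset_eq by blast
      have "fst q \<subseteq> fst p" using h V(3)[OF pq(2)] by blast
      moreover have "fst p \<subseteq> fst q" using h V(3,5)[OF pq(1)] sq by blast
      ultimately show "p = q" using sq by (simp add: prod_eq_iff)
    qed (use m in auto)
  qed
  have l10': "e0 g ` I1 z A \<inter> e1 g ` I1 z A = {}"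
  proof -
    have "e0 g p \<noteq> e1 g q" if "p \<in> I1 z A" "q \<in> I1 z A" for p q
      using c_inj[OF V(1)[OF that(1)] V(2)[OF that(2)]] V(3)[OF that(2)] by (auto simp: e0_def e1_def)
    then show ?thesis by blast
  qed
  have r: "mrk (e1 g p) = Suc (mrk (e0 g p))" if "p \<in> I1 z A" for p using rk0[OF that] rk1[OF that] by simp
  note T = fin_I1 i0 i1 HOL.refl l10' r l01 l10 l11
  show "acyc t (mle (Pow G)) mrk (e0 g ` I1 z A \<union> e1 g ` I1 z A)" by (rule toggle_acyc[where rk = mrk and lq = "mle (Pow G)", OF T])
  show "(\<Sum>y\<in>e0 g ` I1 z A \<union> e1 g ` I1 z A. (-1) ^ mrk y) = (0::int)" by (rule toggle_sum[where rk = mrk and lq = "mle (Pow G)", OF T])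
qed

end

lemma low_empty: "low z {} = {None, c z {}}" by (auto simp: low_def)

lemma low_fin: "val z A ==> finite (low z A)"
  using low_ivl[of z A] finite_subset[OF _ fin_cells, of "low z A"] by (auto simp: ivl_def)

lemma low_sum: "finite A ==> val z A ==> (\<Sum>y\<in>low z A. (-1) ^ mrk y) = (0::int)"
proof (induction A rule: finite_induct)
  case empty
  have "None \<noteq> c z {}" by (simp add: c_def)
  then show ?case by (simp add: low_empty mrk_c[OF empty]) 
next
  case (insert g A)
  have vA: "val z A" using insert.prems by (auto simp: val_def)
  have "finite (e0 g ` I1 z A \<union> e1 g ` I1 z A)" using fin_I1[OF insert.prems insert.hyps(2)] by simp
  then show ?case unfolding low_insert[OF insert.prems insert.hyps(2)]
    using up_low_disj[OF insert.prems insert.hyps(2)] e_toggle(2)[OF insert.prems insert.hyps(2)] insert.IH[OF vA] low_fin[OF vA]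
    by (subst sum.union_disjoint) auto
qed

section \<open>Intervals above a nonempty face\<close>

context
  fixes z A z' A' assumes v: "val z A" "val z' A'" and l: "mle (Pow G) (c z' A') (c z A)" and ne: "c z' A' \<noteq> c z A"
begin

lemma lz: "z \<subseteq> z'" "z' \<subseteq> z \<union> A" "A' \<subseteq> A" using l mle_c[OF v] by auto

text \<open>A face between the two is determined by its free directions \<open>B\<close>, since its
  base point must be \<open>z' - B\<close>; so the interval is Boolean.\<close>

lemma bool_ivl: "ivl (cells G (Pow G)) (mle (Pow G)) (c z' A') (c z A) = (\<lambda>B. c (z' - B) B) ` {B. A' \<subseteq> B \<and> B \<subseteq> A}"
proof
  show "ivl (cells G (Pow G)) (mle (Pow G)) (c z' A') (c z A) \<subseteq> (\<lambda>B. c (z' - B) B) ` {B. A' \<subseteq> B \<and> B \<subseteq> A}"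
  proof
    fix x assume x: "x \<in> ivl (cells G (Pow G)) (mle (Pow G)) (c z' A') (c z A)"
    then have "x \<in> cells G (Pow G)" by (simp add: ivl_def)
    then show "x \<in> (\<lambda>B. c (z' - B) B) ` {B. A' \<subseteq> B \<and> B \<subseteq> A}"
    proof (cases rule: cellsE)
      case 1
      then show ?thesis using x by (simp add: ivl_def c_def)
    next
      case (2 w B)
      have "z \<subseteq> w" "B \<subseteq> A" "w \<subseteq> z'" "z' \<subseteq> w \<union> B" "A' \<subseteq> B"
        using x mle_c[OF v(1) 2(1)] mle_c[OF 2(1) v(2)] by (simp_all add: ivl_def 2(2))
      moreover from this have "w = z' - B" using valD(3)[OF 2(1)] by blast
      ultimately show ?thesis using 2(2) by blast
    qed
  qed
  show "(\<lambda>B. c (z' - B) B) ` {B. A' \<subseteq> B \<and> B \<subseteq> A} \<subseteq> ivl (cells G (Pow G)) (mle (Pow G)) (c z' A') (c z A)"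
  proof
    fix x assume "x \<in> (\<lambda>B. c (z' - B) B) ` {B. A' \<subseteq> B \<and> B \<subseteq> A}"
    then obtain B where B: "x = c (z' - B) B" "A' \<subseteq> B" "B \<subseteq> A" by blast
    have vB: "val (z' - B) B" using v B by (auto simp: val_def)
    have "z \<subseteq> z' - B" using lz B valD(3)[OF v(1)] by blast
    moreover have "z' - B \<subseteq> z \<union> A" using lz by blast
    ultimately have "mle (Pow G) x (c z A)" using mle_c[OF v(1) vB] B by simp
    moreover have "mle (Pow G) (c z' A') x" using mle_c[OF vB v(2)] B by auto
    ultimately show "x \<in> ivl (cells G (Pow G)) (mle (Pow G)) (c z' A') (c z A)"
      using c_cells[OF vB] B by (simp add: ivl_def)
  qed
qed

text \<open>Matching along a direction \<open>g\<close> that is free in the upper face but not in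
  the lower one.\<close>

lemma bool_toggle:
  shows "acyc (t :: 'e::kvec itself) (mle (Pow G)) mrk (ivl (cells G (Pow G)) (mle (Pow G)) (c z' A') (c z A))"
    and "(\<Sum>y\<in>ivl (cells G (Pow G)) (mle (Pow G)) (c z' A') (c z A). (-1) ^ mrk y) = (0::int)"
proof -
  have "A' \<noteq> A"
  proof
    assume e: "A' = A"
    then have "z' = z" using lz valD(3)[OF v(2)] by blast
    then show False using ne e by simp
  qed
  then obtain g where g: "g \<in> A" "g \<notin> A'" using lz by blast
  define e where "e B = c (z' - B) B" for B
  define f where "f B = e (insert g B)" for B
  define I where "I = {B. A' \<subseteq> B \<and> B \<subseteq> A - {g}}"
  have vB: "val (z' - B) B" if "B \<subseteq> A" for B using v that by (auto simp: val_def)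
  have IA: "B \<subseteq> A" "insert g B \<subseteq> A" "g \<notin> B" if "B \<in> I" for B using that g by (auto simp: I_def)
  have S: "ivl (cells G (Pow G)) (mle (Pow G)) (c z' A') (c z A) = e ` I \<union> f ` I"
  proof -
    have "{B. A' \<subseteq> B \<and> B \<subseteq> A} = I \<union> insert g ` I"
    proof
      show "{B. A' \<subseteq> B \<and> B \<subseteq> A} \<subseteq> I \<union> insert g ` I"
      proof
        fix B assume B: "B \<in> {B. A' \<subseteq> B \<and> B \<subseteq> A}"
        show "B \<in> I \<union> insert g ` I"
        proof (cases "g \<in> B")
          case True
          have "B - {g} \<in> I" using B g by (auto simp: I_def)
          moreover have "B = insert g (B - {g})" using True by blast
          ultimately show ?thesis by blast
        qed (use B in \<open>auto simp: I_def\<close>)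
      qed
    qed (use g in \<open>auto simp: I_def\<close>)
    then show ?thesis unfolding bool_ivl e_def[symmetric] by (simp add: image_Un image_image f_def)
  qed
  have finA: "finite A" using valD(4)[OF v(1)] .
  have finI: "finite I" by (rule finite_subset[of _ "Pow A"]) (use finA in \<open>auto simp: I_def\<close>)
  have ie: "e B = e C \<longleftrightarrow> B = C" if "B \<subseteq> A" "C \<subseteq> A" for B C
    using c_inj[OF vB[OF that(1)] vB[OF that(2)]] by (auto simp: e_def)
  have re: "mrk (e B) = Suc (card B)" if "B \<subseteq> A" for B using mrk_c[OF vB[OF that]] by (simp add: e_def)
  have le: "mle (Pow G) (e B) (e C) \<longleftrightarrow> B \<subseteq> C" if "B \<subseteq> A" "C \<subseteq> A" for B C
    using mle_c[OF vB[OF that(2)] vB[OF that(1)]] unfolding e_def by blast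
  have i0: "inj_on e I" using ie IA by (auto simp: inj_on_def)
  have i1: "inj_on f I"
  proof (rule inj_onI)
    fix B C assume h: "B \<in> I" "C \<in> I" "f B = f C"
    then have "insert g B = insert g C" using ie[OF IA(2)[OF h(1)] IA(2)[OF h(2)]] by (simp add: f_def)
    then show "B = C" using IA(3)[OF h(1)] IA(3)[OF h(2)] by (simp add: insert_ident)
  qed
  have dis: "e ` I \<inter> f ` I = {}"
  proof -
    have "e B \<noteq> f C" if "B \<in> I" "C \<in> I" for B C
      using ie[OF IA(1)[OF that(1)] IA(2)[OF that(2)]] IA(3)[OF that(1)] by (auto simp: f_def)
    then show ?thesis by blast
  qed
  have r1: "mrk (f B) = Suc (mrk (e B))" if "B \<in> I" for B
    using re[OF IA(1)[OF that]] re[OF IA(2)[OF that]] IA(3)[OF that] finite_subset[OF IA(1)[OF that] finA] by (simp add: f_def)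
  have l01: "mle (Pow G) (e B) (f C) \<longleftrightarrow> B = C" if BC: "B \<in> I" "C \<in> I" "mrk (e C) = mrk (e B)" for B C
  proof -
    have "mle (Pow G) (e B) (f C) \<longleftrightarrow> B \<subseteq> C"
      using le[OF IA(1)[OF BC(1)] IA(2)[OF BC(2)]] IA(3)[OF BC(1)] by (auto simp: f_def)
    moreover have "card B = card C" using re[OF IA(1)[OF BC(1)]] re[OF IA(1)[OF BC(2)]] BC by simp
    ultimately show ?thesis using card_subset_eq[OF finite_subset[OF IA(1)[OF BC(2)] finA]] by blast
  qed
  have l10: "\<not> mle (Pow G) (f B) (e C)" if BC: "B \<in> I" "C \<in> I" for B C
    using le[OF IA(2)[OF BC(1)] IA(1)[OF BC(2)]] IA(3)[OF BC(2)] by (simp add: f_def)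
  have l11: "mle (Pow G) (f B) (f C) \<longleftrightarrow> mle (Pow G) (e B) (e C)" if BC: "B \<in> I" "C \<in> I" for B C
    using le[OF IA(2)[OF BC(1)] IA(2)[OF BC(2)]] le[OF IA(1)[OF BC(1)] IA(1)[OF BC(2)]] IA(3)[OF BC(1)] IA(3)[OF BC(2)]
    by (auto simp: f_def)
  note T = finI i0 i1 S dis r1 l01 l10 l11
  show "acyc t (mle (Pow G)) mrk (ivl (cells G (Pow G)) (mle (Pow G)) (c z' A') (c z A))" by (rule toggle_acyc[where rk = mrk and lq = "mle (Pow G)", OF T])
  show "(\<Sum>y\<in>ivl (cells G (Pow G)) (mle (Pow G)) (c z' A') (c z A). (-1) ^ mrk y) = (0::int)" by (rule toggle_sum[where rk = mrk and lq = "mle (Pow G)", OF T])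
qed

end

lemma mle_cases:
  assumes "x \<in> cells G (Pow G)" "y \<in> cells G (Pow G)" "mle (Pow G) x y" "x \<noteq> y"
  obtains z A where "val z A" "x = None" "y = c z A"
   | z A z' A' where "val z A" "val z' A'" "x = c z' A'" "y = c z A"
  using assms(2)
proof (cases rule: cellsE)
  case 1
  then show ?thesis using assms by simp
next
  case (2 z A)
  note y = 2
  show ?thesis using assms(1)
  proof (cases rule: cellsE)
    case 1
    then show ?thesis using y that(1) by blast
  next
    case (2 z' A')
    then show ?thesis using y that(2) by blast
  qed
qed

lemma cube_eulerian: "M.eulerian"
  unfolding M.eulerian_def
proof (intro ballI impI)
  fix x y assume h: "x \<in> cells G (Pow G)" "y \<in> cells G (Pow G)" "mle (Pow G) x y" "x \<noteq> y"
  then show "(\<Sum>y\<in>ivl (cells G (Pow G)) (mle (Pow G)) x y. (-1) ^ mrk y) = (0::int)"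
  proof (cases rule: mle_cases)
    case (1 z A)
    then show ?thesis using low_ivl low_sum valD(4) by simp
  next
    case (2 z A z' A')
    show ?thesis using bool_toggle(2)[OF 2(1,2)] h unfolding 2(3,4) by blast
  qed
qed

text \<open>Induction on the free directions: the faces that involve \<open>g\<close> are closed
  upwards and perfectly matched, and the rest is the smaller cube with the empty face.\<close>

lemma low_acyc: "finite A ==> val z A ==> acyc (t :: 'e::kvec itself) (mle (Pow G)) mrk (low z A)"
proof (induction A rule: finite_induct)
  case empty
  have ne: "None \<noteq> c z {}" by (simp add: c_def)
  have r: "mrk (c z {}) = Suc 0" using mrk_c[OF empty] by simp
  show ?case
    by (rule toggle_acyc[where I = "{()}" and ?e0.0 = "\<lambda>_. None" and ?e1.0 = "\<lambda>_. c z {}" and rk = mrk and lq = "mle (Pow G)"])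
      (use ne r M.refl[OF c_cells[OF empty]] in \<open>auto simp: low_empty\<close>)
next
  case (insert g A)
  have vA: "val z A" using insert.prems by (auto simp: val_def)
  note p = insert.prems insert.hyps(2)
  show ?case unfolding low_insert[OF p]
  proof (rule acyc_up)
    show "dd0 (mle (Pow G)) mrk ((e0 g ` I1 z A \<union> e1 g ` I1 z A) \<union> low z A)"
      unfolding low_insert[OF p, symmetric] low_ivl[OF insert.prems, symmetric]
    proof (rule M.dd0_convex[OF cube_eulerian])
      fix x y w assume h: "x \<in> ivl (cells G (Pow G)) (mle (Pow G)) None (c z (insert g A))"
        "w \<in> ivl (cells G (Pow G)) (mle (Pow G)) None (c z (insert g A))" "y \<in> cells G (Pow G)" "mle (Pow G) y w"
      show "y \<in> ivl (cells G (Pow G)) (mle (Pow G)) None (c z (insert g A))"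
        using M.trans[OF h(3) _ c_cells[OF insert.prems] h(4)] h by (simp add: ivl_def)
    qed (auto simp: ivl_def)
  qed (use e_toggle(1)[OF p] insert.IH[OF vA] up_low_disj[OF p] up_low[OF p] in auto)
qed

lemma cube_acyclic: "M.acyclic (t :: 'e::kvec itself)"
  unfolding M.acyclic_def
proof (intro ballI impI)
  fix x y assume h: "x \<in> cells G (Pow G)" "y \<in> cells G (Pow G)" "mle (Pow G) x y" "x \<noteq> y"
  then show "acyc t (mle (Pow G)) mrk (ivl (cells G (Pow G)) (mle (Pow G)) x y)"
  proof (cases rule: mle_cases)
    case (1 z A)
    then show ?thesis using low_ivl low_acyc valD(4) by simp
  next
    case (2 z A z' A')
    show ?thesis using bool_toggle(1)[OF 2(1,2)] h unfolding 2(3,4) by blast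
  qed
qed

lemma cube_good: good
  unfolding good_def by (intro conjI cube_eulerian cube_acyclic)

end

section \<open>The ab-index as a sum over chains\<close>

context rposet begin

definition chs :: "'p => 'p => 'p set set" where
  "chs b y = {D. D \<subseteq> X \<and> (\<forall>x\<in>D. \<forall>z\<in>D. x \<preceq> z \<or> z \<preceq> x) \<and> b \<in> D \<and> y \<in> D \<and> (\<forall>x\<in>D. x \<preceq> y)}"

text \<open>Letters for the ranks 1 to \<open>m - 1\<close>: with m = rk y the rank of the top is
  left out, with m = rk y + 1 it contributes the final b.\<close>

definition wt :: "'p set => nat => ab_poly" where
  "wt D m = prod_list (map (\<lambda>i. if \<exists>x\<in>D. rk x = i then poly_b else pJ) [1..<m])"

lemma chs_fin: "finite (chs b y)"
  by (rule finite_subset[of _ "Pow X"]) (use fin in \<open>auto simp: chs_def\<close>)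

lemma prod_list_J: "(\<And>i. i \<in> set xs ==> f i = pJ) ==> prod_list (map f xs) = pJ ^ length xs"
  by (induction xs) auto

lemma wt_insert:
  assumes D: "D \<in> chs b z" and z: "z \<in> X" "y \<in> X" "z \<preceq> y" "z \<noteq> y"
  shows "wt (insert y D) (rk y) = wt D (Suc (rk z)) * pJ ^ (rk y - 1 - rk z)"
proof -
  have lt: "rk z < rk y" using rk_less z by blast
  have dz: "rk x \<le> rk z" if "x \<in> D" for x using that D z(1) rk_le by (auto simp: chs_def)
  have split: "[1..<rk y] = [1..<Suc (rk z)] @ [Suc (rk z)..<rk y]"
    using upt_add_eq_append[of 1 "Suc (rk z)" "rk y - Suc (rk z)"] lt by simp
  have 1: "map (\<lambda>i. if \<exists>x\<in>insert y D. rk x = i then poly_b else pJ) [1..<Suc (rk z)]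
      = map (\<lambda>i. if \<exists>x\<in>D. rk x = i then poly_b else pJ) [1..<Suc (rk z)]"
    using lt by (intro map_cong[OF HOL.refl]) auto
  have 2: "prod_list (map (\<lambda>i. if \<exists>x\<in>insert y D. rk x = i then poly_b else pJ) [Suc (rk z)..<rk y])
      = pJ ^ length [Suc (rk z)..<rk y]"
    by (rule prod_list_J) (use dz in fastforce)
  show ?thesis unfolding wt_def split map_append prod_list.append 1 2 by simp
qed

text \<open>z is the largest element of the chain below \<open>y\<close>, found as the one of
  maximal rank.\<close>

lemma chs_rec:
  assumes b: "b \<in> X" and y: "y \<in> X" "y \<noteq> b"
  shows "chs b y = (\<Union>z\<in>{z\<in>X. b \<preceq> z \<and> z \<preceq> y \<and> z \<noteq> y}. insert y ` chs b z)"
proof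
  show "chs b y \<subseteq> (\<Union>z\<in>{z\<in>X. b \<preceq> z \<and> z \<preceq> y \<and> z \<noteq> y}. insert y ` chs b z)"
  proof
    fix D assume D: "D \<in> chs b y"
    have DX: "D \<subseteq> X" and tot: "\<And>x z. x \<in> D ==> z \<in> D ==> x \<preceq> z \<or> z \<preceq> x" and bD: "b \<in> D" and yD: "y \<in> D"
      and ly: "\<And>x. x \<in> D ==> x \<preceq> y" using D by (auto simp: chs_def)
    let ?E = "D - {y}"
    have fE: "finite ?E" using DX fin finite_subset by blast
    have bE: "b \<in> ?E" using bD y by auto
    obtain z where z: "z \<in> ?E" "rk z = Max (rk ` ?E)" using Max_in[of "rk ` ?E"] fE bE by fastforce
    have mx: "x \<preceq> z" if x: "x \<in> ?E" for x
    proof (cases "x = z")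
      case True
      then show ?thesis using DX z by auto
    next
      case False
      have "rk x \<le> rk z" unfolding z(2) using fE x by simp
      moreover have "z \<preceq> x ==> rk z < rk x" using rk_less[of z x] DX z x False by auto
      ultimately show ?thesis using tot[of x z] x z by force
    qed
    have "?E \<in> chs b z" unfolding chs_def using DX tot bE z(1) mx by auto
    moreover have "D = insert y ?E" using yD by auto
    moreover have "z \<in> X" "b \<preceq> z" "z \<preceq> y" "z \<noteq> y" using DX z mx[OF bE] ly by auto
    ultimately show "D \<in> (\<Union>z\<in>{z\<in>X. b \<preceq> z \<and> z \<preceq> y \<and> z \<noteq> y}. insert y ` chs b z)" by blast
  qed
  show "(\<Union>z\<in>{z\<in>X. b \<preceq> z \<and> z \<preceq> y \<and> z \<noteq> y}. insert y ` chs b z) \<subseteq> chs b y"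
  proof
    fix D assume "D \<in> (\<Union>z\<in>{z\<in>X. b \<preceq> z \<and> z \<preceq> y \<and> z \<noteq> y}. insert y ` chs b z)"
    then obtain z E where z: "z \<in> X" "b \<preceq> z" "z \<preceq> y" "z \<noteq> y" and E: "E \<in> chs b z" "D = insert y E" by blast
    have EX: "E \<subseteq> X" using E by (simp add: chs_def)
    have ly: "x \<preceq> y" if "x \<in> E" for x
    proof -
      have "x \<preceq> z" "x \<in> X" using E that EX by (auto simp: chs_def)
      then show ?thesis using trans[of x z y] z y by blast
    qed
    have yy: "y \<preceq> y" using y by simp
    show "D \<in> chs b y" unfolding chs_def E(2) using E(1) y ly yy EX by (auto simp: chs_def)
  qed
qed

lemma chs_top: "b \<in> X ==> D \<in> chs b z ==> z \<in> X ==> y \<in> X ==> z \<preceq> y ==> z \<noteq> y ==> y \<notin> D"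
  using antisym by (auto simp: chs_def)

text \<open>Splitting chain sums by the second largest element gives the recursions of
  \<open>psi\<close> and \<open>pt\<close>. With \<open>rk b = 0\<close> the letters start at rank
  1.\<close>

lemma pt_chs:
  assumes b: "b \<in> X" and r: "rk b = 0"
  shows "y \<in> X ==> b \<preceq> y ==> (y \<noteq> b \<longrightarrow> psi b y = (\<Sum>D\<in>chs b y. wt D (rk y))) \<and> pt b y = (\<Sum>D\<in>chs b y. wt D (Suc (rk y)))"
proof (induction "rk y" arbitrary: y rule: less_induct)
  case less
  show ?case
  proof (cases "y = b")
    case True
    have "D = {b}" if "D \<in> chs b b" for D
    proof -
      have "x = b" if "x \<in> D" for x
      proof (rule ccontr)
        assume "x \<noteq> b"
        then have "rk x < rk b" using rk_less[of x b] \<open>D \<in> chs b b\<close> that b by (auto simp: chs_def)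
        then show False using r by simp
      qed
      then show ?thesis using that by (auto simp: chs_def)
    qed
    moreover have "{b} \<in> chs b b" using b by (simp add: chs_def)
    ultimately have "chs b b = {{b}}" by blast
    then show ?thesis using True r by (simp add: wt_def)
  next
    case False
    let ?Z = "{z\<in>X. b \<preceq> z \<and> z \<preceq> y \<and> z \<noteq> y}"
    have fZ: "finite ?Z" using fin by simp
    have ch: "D \<in> chs b z ==> z \<in> ?Z ==> y \<notin> D" for D z using chs_top[OF b] less.prems by blast
    have inj: "inj_on (insert y) (chs b z)" if "z \<in> ?Z" for z
    proof (rule inj_onI)
      fix D E assume "D \<in> chs b z" "E \<in> chs b z" "insert y D = insert y E"
      then show "D = E" using ch[OF _ that, of D] ch[OF _ that, of E] by (simp add: insert_ident)
    qed
    have dis: "insert y ` chs b z \<inter> insert y ` chs b w = {}" if zw: "z \<in> ?Z" "w \<in> ?Z" "z \<noteq> w" for z w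
    proof (rule ccontr)
      assume "\<not> ?thesis"
      then obtain D E where DE: "D \<in> chs b z" "E \<in> chs b w" "insert y D = insert y E" by blast
      then have "D = E" using ch[OF DE(1) zw(1)] ch[OF DE(2) zw(2)] by (simp add: insert_ident)
      then have "z \<preceq> w" "w \<preceq> z" using DE(1,2) by (auto simp: chs_def)
      then show False using antisym[of z w] zw by auto
    qed
    have ps: "psi b y = (\<Sum>D\<in>chs b y. wt D (rk y))"
    proof -
      have "psi b y = (\<Sum>z\<in>?Z. (\<Sum>D\<in>chs b z. wt D (Suc (rk z))) * pJ ^ (rk y - 1 - rk z))"
        unfolding psi_def
      proof (rule sum.cong[OF HOL.refl])
        fix z assume z: "z \<in> ?Z"
        then have "rk z < rk y" using rk_less[of z y] less.prems by auto
        then show "pt b z * pJ ^ (rk y - 1 - rk z) = (\<Sum>D\<in>chs b z. wt D (Suc (rk z))) * pJ ^ (rk y - 1 - rk z)"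
          using less.hyps[of z] z by simp
      qed
      also have "\<dots> = (\<Sum>z\<in>?Z. \<Sum>D\<in>insert y ` chs b z. wt D (rk y))"
      proof (rule sum.cong[OF HOL.refl])
        fix z assume z: "z \<in> ?Z"
        have "(\<Sum>D\<in>insert y ` chs b z. wt D (rk y)) = (\<Sum>D\<in>chs b z. wt (insert y D) (rk y))"
          using sum.reindex[OF inj[OF z]] by simp
        also have "\<dots> = (\<Sum>D\<in>chs b z. wt D (Suc (rk z)) * pJ ^ (rk y - 1 - rk z))"
          by (rule sum.cong[OF HOL.refl], rule wt_insert) (use z less.prems in auto)
        finally show "(\<Sum>D\<in>chs b z. wt D (Suc (rk z))) * pJ ^ (rk y - 1 - rk z) = (\<Sum>D\<in>insert y ` chs b z. wt D (rk y))"
          by (simp add: sum_distrib_right)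
      qed
      also have "\<dots> = (\<Sum>D\<in>(\<Union>z\<in>?Z. insert y ` chs b z). wt D (rk y))"
        by (rule sum.UNION_disjoint[symmetric]) (use fZ chs_fin dis in auto)
      finally show ?thesis unfolding chs_rec[OF b less.prems(1) False] .
    qed
    moreover have "pt b y = (\<Sum>D\<in>chs b y. wt D (Suc (rk y)))"
    proof -
      have "wt D (Suc (rk y)) = wt D (rk y) * poly_b" if "D \<in> chs b y" for D
      proof -
        have "0 < rk y" using rk_less[OF b less.prems(1,2)] False by auto
        moreover have "\<exists>x\<in>D. rk x = rk y" using that by (auto simp: chs_def)
        ultimately show ?thesis by (simp add: wt_def)
      qed
      then show ?thesis using pt_psi[OF less.prems(1) False] ps by (simp add: sum_distrib_right)
    qed
    ultimately show ?thesis by blast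
  qed
qed

end

text \<open>Connects the abstract rank function with ranks defined as lengths of longest chains; for
  this every element other than \<open>b\<close> must have one exactly one rank below it.\<close>

locale graded_iso = rposet X lq rk for X :: "'p set" and lq (infix "\<preceq>" 50) and rk +
  fixes P :: "'c gorder" and \<iota> :: "'c => 'p" and b t :: 'p
  assumes bij: "bij_betw \<iota> (carrier P) X"
    and leq: "\<And>x y. x \<in> carrier P ==> y \<in> carrier P ==> x \<sqsubseteq>\<^bsub>P\<^esub> y \<longleftrightarrow> \<iota> x \<preceq> \<iota> y"
    and b: "b \<in> X" "rk b = 0" "\<And>x. x \<in> X ==> b \<preceq> x"
    and t: "t \<in> X" "\<And>x. x \<in> X ==> x \<preceq> t" "t \<noteq> b"
    and graded: "\<And>x. x \<in> X ==> x \<noteq> b ==> \<exists>y\<in>X. y \<preceq> x \<and> Suc (rk y) = rk x"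
begin

lemma \<iota>X: "x \<in> carrier P ==> \<iota> x \<in> X" and \<iota>inj: "x \<in> carrier P ==> y \<in> carrier P ==> \<iota> x = \<iota> y \<longleftrightarrow> x = y"
  and \<iota>onto: "p \<in> X ==> \<exists>x\<in>carrier P. \<iota> x = p"
  using bij by (auto simp: bij_betw_def inj_on_def)

lemma \<iota>bottom: "\<bottom>\<^bsub>P\<^esub> \<in> carrier P \<and> \<iota> \<bottom>\<^bsub>P\<^esub> = b"
proof -
  obtain x where x: "x \<in> carrier P" "\<iota> x = b" using \<iota>onto b by blast
  have "\<bottom>\<^bsub>P\<^esub> = x" unfolding bottom_def
  proof (rule some_equality)
    show "least P x (carrier P)" using x leq b \<iota>X by (auto simp: least_def)
    fix y assume "least P y (carrier P)"
    then have "y \<in> carrier P" "\<iota> y \<preceq> b" using x leq by (auto simp: least_def)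
    then show "y = x" using antisym[of "\<iota> y" b] b \<iota>X \<iota>inj x by metis
  qed
  with x show ?thesis by simp
qed

lemma \<iota>top: "\<top>\<^bsub>P\<^esub> \<in> carrier P \<and> \<iota> \<top>\<^bsub>P\<^esub> = t"
proof -
  obtain x where x: "x \<in> carrier P" "\<iota> x = t" using \<iota>onto t by blast
  have "\<top>\<^bsub>P\<^esub> = x" unfolding top_def
  proof (rule some_equality)
    show "greatest P x (carrier P)" using x leq t \<iota>X by (auto simp: greatest_def)
    fix y assume "greatest P y (carrier P)"
    then have "y \<in> carrier P" "t \<preceq> \<iota> y" using x leq by (auto simp: greatest_def)
    then show "y = x" using antisym[of "\<iota> y" t] t \<iota>X \<iota>inj x by metis
  qed
  with x show ?thesis by simp
qed

lemma ex_chain: "x \<in> X ==> \<exists>D\<in>chs b x. card D = Suc (rk x)"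
proof (induction "rk x" arbitrary: x rule: less_induct)
  case less
  show ?case
  proof (cases "x = b")
    case True
    then show ?thesis using b by (intro bexI[of _ "{b}"]) (auto simp: chs_def)
  next
    case False
    then obtain y where y: "y \<in> X" "y \<preceq> x" "Suc (rk y) = rk x" using graded less.prems by blast
    obtain D where D: "D \<in> chs b y" "card D = Suc (rk y)" using less.hyps[of y] y by auto
    have yx: "y \<noteq> x" using y by auto
    have "insert x D \<in> chs b x"
      using chs_rec[OF b(1) less.prems False] y yx b(3) D by blast
    moreover have "x \<notin> D" using chs_top[OF b(1) D(1) y(1) less.prems y(2) yx] .
    moreover have "finite D" using D(2) card_ge_0_finite by force
    ultimately show ?thesis using D y by (intro bexI[of _ "insert x D"]) auto
  qed
qed

text \<open>The elements of a chain have distinct ranks, which bounds its length, and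
  \<open>ex_chain\<close> attains the bound.\<close>

lemma rank_eq:
  assumes x: "x \<in> carrier P" shows "elem_rank P x = rk (\<iota> x)"
proof -
  let ?Q = "P\<lparr>carrier := {y \<in> carrier P. y \<sqsubseteq>\<^bsub>P\<^esub> x}\<rparr>"
  let ?M = "{card C - 1 | C. order_chain ?Q C \<and> C \<noteq> {}}"
  have bound: "card C - 1 \<le> rk (\<iota> x)" if C: "order_chain ?Q C" for C
  proof -
    have CP: "C \<subseteq> carrier P" "\<And>y. y \<in> C ==> \<iota> y \<preceq> \<iota> x" and tot0: "\<And>y z. y \<in> C ==> z \<in> C ==> y \<sqsubseteq>\<^bsub>P\<^esub> z \<or> z \<sqsubseteq>\<^bsub>P\<^esub> y"
      using C leq x by (auto simp: order_chain_def)
    have tot: "\<iota> y \<preceq> \<iota> z \<or> \<iota> z \<preceq> \<iota> y" if "y \<in> C" "z \<in> C" for y z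
      using tot0[OF that] leq CP(1) that by blast
    have "inj_on (\<lambda>y. rk (\<iota> y)) C"
    proof (rule inj_onI)
      fix y z assume h: "y \<in> C" "z \<in> C" "rk (\<iota> y) = rk (\<iota> z)"
      have X: "\<iota> y \<in> X" "\<iota> z \<in> X" using h CP \<iota>X by auto
      have "\<iota> y = \<iota> z" using tot[OF h(1,2)] rk_less[OF X] rk_less[OF X(2,1)] h(3) by force
      then show "y = z" using \<iota>inj h CP by blast
    qed
    moreover have "(\<lambda>y. rk (\<iota> y)) ` C \<subseteq> {..rk (\<iota> x)}"
      using rk_le[OF \<iota>X \<iota>X[OF x]] CP by auto
    ultimately have "card C \<le> card {..rk (\<iota> x)}" by (rule card_inj_on_le) simp
    then show ?thesis by simp
  qed
  obtain D where D: "D \<in> chs b (\<iota> x)" "card D = Suc (rk (\<iota> x))" using ex_chain[OF \<iota>X[OF x]] by blast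
  define C where "C = {y\<in>carrier P. \<iota> y \<in> D}"
  have im: "\<iota> ` C = D" using D(1) \<iota>onto by (force simp: C_def chs_def)
  have "inj_on \<iota> C" using bij by (auto simp: C_def bij_betw_def inj_on_def)
  then have cC: "card C = Suc (rk (\<iota> x))" using im D(2) card_image by metis
  have "order_chain ?Q C" using D(1) leq x by (auto simp: order_chain_def C_def chs_def)
  moreover have "C \<noteq> {}" using cC by auto
  ultimately have mem: "rk (\<iota> x) \<in> ?M" using cC by (intro CollectI exI[of _ C]) simp
  have "Max ?M = rk (\<iota> x)"
  proof (rule Max_eqI)
    show "finite ?M" by (rule finite_subset[of _ "{..rk (\<iota> x)}"]) (use bound in auto)
    show "y \<le> rk (\<iota> x)" if "y \<in> ?M" for y using that bound by auto
  qed (fact mem)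
  then show ?thesis by (simp add: elem_rank_def poset_length_def)
qed

lemma length_eq: "poset_length P = rk t"
proof -
  have "{y \<in> carrier P. y \<sqsubseteq>\<^bsub>P\<^esub> \<top>\<^bsub>P\<^esub>} = carrier P" using \<iota>top leq t \<iota>X by auto
  then show ?thesis using rank_eq[of "\<top>\<^bsub>P\<^esub>"] \<iota>top by (simp add: elem_rank_def)
qed

theorem ab_index_eq: "ab_index P = psi b t"
proof -
  let ?C = "{C. order_chain P C \<and> \<bottom>\<^bsub>P\<^esub> \<in> C \<and> \<top>\<^bsub>P\<^esub> \<in> C}"
  have CP: "C \<subseteq> carrier P" if "C \<in> ?C" for C using that by (auto simp: order_chain_def)
  have w: "chain_weight P C = wt (\<iota> ` C) (rk t)" if C: "C \<in> ?C" for C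
  proof -
    have e: "elem_rank P x = rk (\<iota> x)" if "x \<in> C" for x using rank_eq CP[OF C] that by blast
    have "(\<exists>x\<in>C. elem_rank P x = i) \<longleftrightarrow> (\<exists>x\<in>\<iota> ` C. rk x = i)" for i
      by (simp add: e cong: bex_cong)
    then show ?thesis unfolding chain_weight_def wt_def length_eq pJ_def by simp
  qed
  have "bij_betw ((`) \<iota>) ?C (chs b t)"
  proof (rule bij_betw_imageI)
    show "inj_on ((`) \<iota>) ?C"
    proof (rule inj_onI)
      fix C D assume "C \<in> ?C" "D \<in> ?C" "\<iota> ` C = \<iota> ` D"
      then show "C = D" using inj_on_image_eq_iff[of \<iota> "carrier P" C D] bij CP by (auto simp: bij_betw_def)
    qed
    show "(`) \<iota> ` ?C = chs b t"
    proof
      show "(`) \<iota> ` ?C \<subseteq> chs b t"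
      proof
        fix D assume "D \<in> (`) \<iota> ` ?C"
        then obtain C where C: "C \<in> ?C" "D = \<iota> ` C" by blast
        have "b \<in> D" "t \<in> D" using C \<iota>bottom \<iota>top by (auto intro: rev_image_eqI)
        moreover have "D \<subseteq> X" using C CP \<iota>X by auto
        moreover have "x \<preceq> z \<or> z \<preceq> x" if xz: "x \<in> D" "z \<in> D" for x z
        proof -
          obtain x' z' where x': "x' \<in> C" "z' \<in> C" "x = \<iota> x'" "z = \<iota> z'" using xz C(2) by blast
          have "x' \<sqsubseteq>\<^bsub>P\<^esub> z' \<or> z' \<sqsubseteq>\<^bsub>P\<^esub> x'" using C(1) x'(1,2) by (auto simp: order_chain_def)
          moreover have "x' \<in> carrier P" "z' \<in> carrier P" using CP[OF C(1)] x'(1,2) by auto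
          ultimately show ?thesis using leq[of x' z'] leq[of z' x'] unfolding x'(3,4) by simp
        qed
        ultimately show "D \<in> chs b t" using t(2) by (auto simp: chs_def)
      qed
      show "chs b t \<subseteq> (`) \<iota> ` ?C"
      proof
        fix D assume D: "D \<in> chs b t"
        define C where "C = {y\<in>carrier P. \<iota> y \<in> D}"
        have im: "\<iota> ` C = D" using D \<iota>onto by (force simp: C_def chs_def)
        have "C \<in> ?C" using D \<iota>bottom \<iota>top leq by (auto simp: C_def order_chain_def chs_def)
        then show "D \<in> (`) \<iota> ` ?C" using im by blast
      qed
    qed
  qed
  then have "(\<Sum>C\<in>?C. wt (\<iota> ` C) (rk t)) = (\<Sum>D\<in>chs b t. wt D (rk t))" by (rule sum.reindex_bij_betw)
  moreover have "ab_index P = (\<Sum>C\<in>?C. wt (\<iota> ` C) (rk t))"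
    unfolding ab_index_def by (rule sum.cong[OF HOL.refl w])
  ultimately show ?thesis using pt_chs[OF b(1,2) t(1) b(3)[OF t(1)]] t(3) by simp
qed

end

text \<open>The poset of cells is graded: deleting one generator lowers the rank by one, and a cell
  without generators lies one rank above \<open>None\<close>.\<close>

lemma (in family) cells_iso:
  assumes "bij_betw \<iota> (carrier P) (cells G F)"
    and "\<And>x y. x \<in> carrier P ==> y \<in> carrier P ==> x \<sqsubseteq>\<^bsub>P\<^esub> y \<longleftrightarrow> mle F (\<iota> x) (\<iota> y)"
    and tp: "\<And>x. x \<in> cells G F ==> mle F x tp"
  shows "ab_index P = Psi G F"
proof -
  interpret I: graded_iso "cells G F" "mle F" mrk P \<iota> None tp
  proof
    show "\<exists>y\<in>cells G F. mle F y x \<and> Suc (mrk y) = mrk x" if x: "x \<in> cells G F" "x \<noteq> None" for x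
      using x(1)
    proof (cases rule: cells_cases)
      case (Some z H)
      show ?thesis
      proof (cases "H = {}")
        case True
        then show ?thesis using Some by (intro bexI[of _ None]) auto
      next
        case False
        then obtain h where h: "h \<in> H" by blast
        have fH: "finite H" by (rule H_fin[OF Some(3)])
        have "Suc (card (H - {h})) = card H" using card_Suc_Diff1[OF fH h] .
        moreover have "mle F (Some (z, H - {h})) x" using mle_sub[OF Some(2) _ Some(3)] Some(1) by blast
        ultimately show ?thesis using Some by (intro bexI[of _ "Some (z, H - {h})"]) auto
      qed
    qed (use x in simp)
  qed (use assms tp_cells in \<open>auto simp: tp_def\<close>)
  show ?thesis using I.ab_index_eq by (simp add: Psi_def tp_def)
qed

section \<open>Maximal flags\<close>

locale flag =
  fixes G :: "'a set" and A :: "nat => 'a set" and n :: nat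
  assumes finG: "finite G" and A0: "A 0 = {}" and An: "A n = G"
    and strict: "\<And>i j. i < j ==> j \<le> n ==> A i \<subset> A j"
    and cardA: "\<And>i. i \<le> n ==> card (A i) = i"
begin

abbreviation "C \<equiv> A ` {..n}"

lemma sub: "i \<le> n ==> j \<le> n ==> A i \<subseteq> A j \<longleftrightarrow> i \<le> j"
  using strict[of i j] strict[of j i] by (cases i j rule: linorder_cases) auto

lemma inj: "i \<le> n ==> j \<le> n ==> A i = A j \<longleftrightarrow> i = j"
  using sub[of i j] sub[of j i] by auto

lemma Un: "i \<le> n ==> j \<le> n ==> A i \<union> A j = A (max i j)"
  using sub[of i j] sub[of j i] by (cases "i \<le> j") (auto simp: max_def)

lemma fam: "fam G C"
proof -
  have "A i \<inter> A j \<in> C" if "i \<le> n" "j \<le> n" for i j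
  proof (cases "i \<le> j")
    case True
    then have "A i \<inter> A j = A i" using sub[OF that] by auto
    then show ?thesis using that by auto
  next
    case False
    then have "A i \<inter> A j = A j" using sub[OF that(2,1)] by auto
    then show ?thesis using that by auto
  qed
  moreover have "A i \<subseteq> G" if "i \<le> n" for i using sub[OF that, of n] that An by simp
  moreover have "{} \<in> C" "G \<in> C" using imageI[of 0 "{..n}" A] imageI[of n "{..n}" A] A0 An by simp_all
  ultimately show ?thesis unfolding fam_def using finG by blast
qed

sublocale family G C by unfold_locales (rule fam)

lemma in_C: "i \<le> n ==> A i \<in> C" by simp

text \<open>An element that enters the flag at step j has, together with \<open>A i\<close> for i <
  j, the closure \<open>A j\<close>; so all later members are generators.\<close>

lemma gn_flag: "i \<le> n ==> gn G C (A i) = A ` {i<..n}"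
proof
  assume i: "i \<le> n"
  show "gn G C (A i) \<subseteq> A ` {i<..n}"
  proof
    fix h assume "h \<in> gn G C (A i)"
    then have h: "h \<in> C" "A i \<subset> h" using gn_D in_C[OF i] by blast+
    then obtain j where j: "j \<le> n" "h = A j" by auto
    then have "i < j" using h sub[OF j(1) i] by auto
    then show "h \<in> A ` {i<..n}" using j by auto
  qed
  show "A ` {i<..n} \<subseteq> gn G C (A i)"
  proof
    fix h assume "h \<in> A ` {i<..n}"
    then obtain j where j: "i < j" "j \<le> n" "h = A j" by auto
    obtain g where g: "g \<in> A j" "g \<notin> A (j - 1)" using strict[of "j - 1" j] j by auto
    have iG: "insert g (A i) \<subseteq> A j" using g strict[OF j(1,2)] by auto
    have AG: "A j \<subseteq> G" using FG in_C[OF j(2)] .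
    have "cl C (insert g (A i)) \<in> C" using iG AG by (intro cl_in) auto
    then obtain k where k: "k \<le> n" "cl C (insert g (A i)) = A k" by auto
    have Akj: "A k \<subseteq> A j" using cl_least[OF in_C[OF j(2)] iG] k by simp
    have "g \<in> A k" using cl_ext[of "insert g (A i)"] k by auto
    moreover have jn: "j - 1 \<le> n" using j(2) by simp
    ultimately have kj: "\<not> k \<le> j - 1" using sub[OF k(1) jn] g(2) by blast
    have "k = j" using sub[OF k(1) j(2)] Akj kj by auto
    moreover have "g \<in> G" "g \<notin> A i" using g AG sub[OF i jn] j by auto
    ultimately show "h \<in> gn G C (A i)" using k j by (auto simp: gn_def)
  qed
qed

text \<open>The closure of a single element is the member at which it enters, and each step adds
  only one element.\<close>

lemma simple_flag: "simple G C"
  unfolding simple_def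
proof (rule inj_onI)
  fix g h assume gh: "g \<in> G" "h \<in> G" "cl C {g} = cl C {h}"
  have "cl C {g} \<in> C" using gh by (intro cl_in) auto
  then obtain k where k: "k \<le> n" "cl C {g} = A k" "cl C {h} = A k" using gh(3) by auto
  have in_k: "x \<in> A k - A (k - 1) \<and> 0 < k" if x: "cl C {x} = A k" for x
  proof -
    have xk: "x \<in> A k" using cl_ext[of "{x}"] x by auto
    then have k0: "0 < k" using A0 by (cases k) auto
    have "x \<notin> A (k - 1)"
    proof
      assume "x \<in> A (k - 1)"
      then have "A k \<subseteq> A (k - 1)" using cl_least[of "A (k - 1)" "{x}"] x k(1) by auto
      moreover have k1: "k - 1 \<le> n" using k(1) by simp
      ultimately have "k \<le> k - 1" using sub[OF k(1) k1] by simp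
      then show False using k0 by simp
    qed
    then show ?thesis using xk k0 by simp
  qed
  note ik = in_k[OF k(2)] in_k[OF k(3)]
  have fk: "finite (A (k - 1))" "finite (A k)" using FG[of "A (k - 1)"] FG[of "A k"] k(1) finG finite_subset by auto
  have "A (k - 1) \<subseteq> A k" using sub[of "k - 1" k] k(1) by simp
  then have "card (A k - A (k - 1)) = 1" using card_Diff_subset[OF fk(1)] cardA k(1) ik by auto
  then obtain x where "A k - A (k - 1) = {x}" by (rule card_1_singletonE)
  then have "g \<in> {x}" "h \<in> {x}" using ik by blast+
  then show "g = h" by simp
qed

definition q :: "nat => nat set => 'a cell" where "q i S = Some (A i, A ` S)"

text \<open>A minor of a chain is a nonempty set of indices, the least being the minimum and the
  others the generators; the minor order is inclusion of these sets.\<close>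

lemma mle_q:
  assumes i: "i \<le> n" "S \<subseteq> {i<..n}" and i': "i' \<le> n" "S' \<subseteq> {i'<..n}"
  shows "mle C (q i' S') (q i S) \<longleftrightarrow> insert i' S' \<subseteq> insert i S"
proof
  assume l: "mle C (q i' S') (q i S)"
  have sp: "sp C (A i) (A ` S) (A i')" and S': "\<And>s'. s' \<in> S' ==> \<exists>s\<in>S. A s' = cl C (A s \<union> A i')"
    using l by (auto simp: q_def)
  have ii: "i \<le> i'" using sp sub[OF i(1) i'(1)] by (simp add: sp_def)
  have "i' \<in> insert i S"
  proof (rule ccontr)
    assume n: "i' \<notin> insert i S"
    have c: "i' - 1 \<le> n" using i' by simp
    \<comment> \<open>If \<open>i'\<close> is not among the indices, everything that could span
      \<open>A i'\<close> already lies in its predecessor.\<close>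
    have "A i' \<subseteq> A (i' - 1)"
    proof (rule sp_D[OF sp in_C[OF c]])
      show "A i \<subseteq> A (i' - 1)" using sub[OF i(1) c] ii n by auto
      fix h assume h: "h \<in> A ` S" "h \<subseteq> A i'"
      then obtain s where s: "s \<in> S" "h = A s" by auto
      have sn: "s \<le> n" using s i(2) by auto
      have "s \<noteq> i'" using s(1) n by auto
      then have "s \<le> i' - 1" using h(2) sub[OF sn i'(1)] s(2) by auto
      then show "h \<subseteq> A (i' - 1)" using sub[OF sn c] s(2) by simp
    qed
    then have "i' \<le> i' - 1" using sub[OF i'(1) c] by simp
    then show False using ii n by auto
  qed
  moreover have "s' \<in> S" if s': "s' \<in> S'" for s'
  proof -
    obtain s where s: "s \<in> S" "A s' = cl C (A s \<union> A i')" using S'[OF s'] by blast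
    have sn: "s \<le> n" "s' \<le> n" "i' < s'" using s i(2) s' i'(2) by auto
    have m: "max s i' \<le> n" using sn i' by simp
    have "A s' = A (max s i')" using s(2) Un[OF sn(1) i'(1)] cl_id[OF in_C[OF m]] by simp
    then have "s' = max s i'" using inj[OF sn(2) m] by simp
    then show ?thesis using s(1) sn(3) by (auto simp: max_def split: if_splits)
  qed
  ultimately show "insert i' S' \<subseteq> insert i S" by auto
next
  assume h: "insert i' S' \<subseteq> insert i S"
  have ii: "i \<le> i'" using h i(2) by auto
  have "sp C (A i) (A ` S) (A i')" unfolding sp_def
  proof (intro conjI ballI impI)
    show "A i \<subseteq> A i'" using sub[OF i(1) i'(1)] ii by simp
    fix B assume "B \<in> C" "A i \<subseteq> B" and B: "\<forall>h\<in>A ` S. h \<subseteq> A i' \<longrightarrow> h \<subseteq> B"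
    then show "A i' \<subseteq> B" using h by (cases "i' = i") auto
  qed
  moreover have "\<exists>s\<in>S. A s' = cl C (A s \<union> A i')" if s': "s' \<in> S'" for s'
  proof (rule bexI[of _ s'])
    have sn: "i' < s'" "s' \<le> n" using s' i'(2) by auto
    have "A s' \<union> A i' = A s'" using Un[OF sn(2) i'(1)] sn(1) by (simp add: max_def)
    then show "A s' = cl C (A s' \<union> A i')" using cl_id[OF in_C[OF sn(2)]] by simp
    show "s' \<in> S" using h s' sn ii by auto
  qed
  ultimately show "mle C (q i' S') (q i S)" by (auto simp: q_def)
qed

text \<open>Shifts \<open>{1..n + 1}\<close> down to the indices 0 to n and makes the least one the
  minimum; the empty set becomes the adjoined minimum.\<close>

definition io :: "nat set => 'a cell" where
  "io T = (if T = {} then None else q (Min T - 1) ((\<lambda>t. t - 1) ` (T - {Min T})))"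

lemma io_props:
  assumes T: "T \<subseteq> {1..n + 1}" "T \<noteq> {}"
  shows "Min T - 1 \<le> n" "(\<lambda>t. t - 1) ` (T - {Min T}) \<subseteq> {Min T - 1<..n}"
    "insert (Min T - 1) ((\<lambda>t. t - 1) ` (T - {Min T})) = (\<lambda>t. t - 1) ` T"
proof -
  have f: "finite T" using T(1) finite_subset by blast
  have m: "Min T \<in> T" using Min_in[OF f T(2)] .
  then have m1: "1 \<le> Min T" "Min T \<le> n + 1" using T by auto
  show "Min T - 1 \<le> n" using m1 by simp
  show "(\<lambda>t. t - 1) ` (T - {Min T}) \<subseteq> {Min T - 1<..n}"
  proof
    fix s assume "s \<in> (\<lambda>t. t - 1) ` (T - {Min T})"
    then obtain t where t: "t \<in> T" "t \<noteq> Min T" "s = t - 1" by auto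
    have "Min T \<le> t" using Min_le[OF f t(1)] .
    then show "s \<in> {Min T - 1<..n}" using t T(1) m1 by auto
  qed
  show "insert (Min T - 1) ((\<lambda>t. t - 1) ` (T - {Min T})) = (\<lambda>t. t - 1) ` T" using m by auto
qed

lemma io_le:
  assumes T: "T \<subseteq> {1..n + 1}" "T' \<subseteq> {1..n + 1}"
  shows "mle C (io T') (io T) \<longleftrightarrow> T' \<subseteq> T"
proof (cases "T' = {} \<or> T = {}")
  case True
  then show ?thesis by (auto simp: io_def q_def)
next
  case False
  then have ne: "T \<noteq> {}" "T' \<noteq> {}" by auto
  note p = io_props[OF T(1) ne(1)] and p' = io_props[OF T(2) ne(2)]
  have "(\<lambda>t. t - 1) ` T' \<subseteq> (\<lambda>t. t - 1) ` T \<longleftrightarrow> T' \<subseteq> T"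
  proof
    assume h: "(\<lambda>t. t - 1) ` T' \<subseteq> (\<lambda>t. t - 1) ` T"
    show "T' \<subseteq> T"
    proof
      fix t assume t: "t \<in> T'"
      then have "t - 1 \<in> (\<lambda>t. t - 1) ` T" using h by blast
      then obtain s where s: "s \<in> T" "t - 1 = s - 1" by blast
      have "1 \<le> t" "1 \<le> s" using t s T by auto
      then have "t = s" using s(2) by simp
      then show "t \<in> T" using s(1) by simp
    qed
  qed (rule image_mono)
  then show ?thesis using mle_q[OF p(1,2) p'(1,2)] ne unfolding p(3) p'(3) by (simp add: io_def)
qed

lemma io_cells: "T \<subseteq> {1..n + 1} ==> io T \<in> cells G C"
proof (cases "T = {}")
  case False
  assume T: "T \<subseteq> {1..n + 1}"
  note p = io_props[OF T False]
  have "A ` (\<lambda>t. t - 1) ` (T - {Min T}) \<subseteq> A ` {Min T - 1<..n}" by (rule image_mono[OF p(2)])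
  then show ?thesis unfolding io_def q_def using False p(1) gn_flag[OF p(1)] by simp
qed (simp add: io_def)

lemma io_onto: "x \<in> cells G C ==> \<exists>T\<subseteq>{1..n + 1}. io T = x"
proof -
  assume "x \<in> cells G C"
  then show ?thesis
  proof (cases rule: cells_cases)
    case None
    then show ?thesis by (intro exI[of _ "{}"]) (simp add: io_def)
  next
    case (Some z H)
    then obtain i where i: "i \<le> n" "z = A i" by auto
    have "H \<subseteq> A ` {i<..n}" using Some(3) gn_flag[OF i(1)] i by simp
    then obtain S where S: "S \<subseteq> {i<..n}" "H = A ` S" by (rule subset_imageE)
    let ?T = "Suc ` insert i S"
    have fS: "finite S" using S(1) finite_subset by blast
    have "Min ?T = Suc i" by (rule Min_eqI) (use fS S in auto)
    moreover have "?T - {Suc i} = Suc ` S" using S(1) by auto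
    ultimately have "io ?T = x" using Some(1) i S by (simp add: io_def q_def image_image)
    moreover have "?T \<subseteq> {1..n + 1}" using i S(1) by auto
    ultimately show ?thesis by blast
  qed
qed

theorem Psi_flag: "Psi G C = ab_index (boolean_algebra_poset (n + 1))"
proof (rule cells_iso[symmetric])
  have car: "carrier (boolean_algebra_poset (n + 1)) = Pow {1..n + 1}" by (simp add: boolean_algebra_poset_def)
  show "bij_betw io (carrier (boolean_algebra_poset (n + 1))) (cells G C)"
    unfolding car
  proof (rule bij_betw_imageI)
    show "inj_on io (Pow {1..n + 1})"
    proof (rule inj_onI)
      fix T T' assume h: "T \<in> Pow {1..n + 1}" "T' \<in> Pow {1..n + 1}" "io T = io T'"
      have "T \<subseteq> T'" using io_le[of T T] io_le[of T' T] h by auto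
      moreover have "T' \<subseteq> T" using io_le[of T' T'] io_le[of T T'] h by auto
      ultimately show "T = T'" by blast
    qed
    show "io ` Pow {1..n + 1} = cells G C" using io_cells io_onto by (auto simp: image_iff)
  qed
  show "x \<sqsubseteq>\<^bsub>boolean_algebra_poset (n + 1)\<^esub> y \<longleftrightarrow> mle C (io x) (io y)"
    if "x \<in> carrier (boolean_algebra_poset (n + 1))" "y \<in> carrier (boolean_algebra_poset (n + 1))" for x y
    using that io_le[of y x] by (simp add: boolean_algebra_poset_def)
  have tp: "tp = q 0 {0<..n}" using gn_flag[of 0] A0 by (simp add: tp_def q_def)
  show "mle C x tp" if x: "x \<in> cells G C" for x
    using x
  proof (cases rule: cells_cases)
    case (Some z H)
    then obtain i where i: "i \<le> n" "z = A i" by auto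
    have "H \<subseteq> A ` {i<..n}" using Some(3) gn_flag[OF i(1)] i by simp
    then obtain S where S: "S \<subseteq> {i<..n}" "H = A ` S" by (rule subset_imageE)
    have "x = q i S" using Some i S by (simp add: q_def)
    moreover have "insert i S \<subseteq> insert 0 {0<..n}" using i S by auto
    ultimately show ?thesis unfolding tp using mle_q[of 0 "{0<..n}" i S] i S by simp
  qed simp
qed

end

section \<open>Minors of a finite lattice\<close>

locale flat =
  fixes L :: "'a gorder" (structure)
  assumes fl: "finite_lattice L"
begin

sublocale lattice L using fl by (simp add: finite_lattice_def)

lemma finL: "finite (carrier L)" using fl by (simp add: finite_lattice_def)

lemma bot: "\<bottom> \<in> carrier L" "x \<in> carrier L ==> \<bottom> \<sqsubseteq> x"
  using finite_lattice_bottom_least[OF fl] by (auto simp: least_def)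

text \<open>Suprema relative to a subset of the lattice, so that joins formed inside a minor can be
  compared with joins in \<open>L\<close>.\<close>

lemma supK:
  assumes S: "S \<subseteq> carrier L" "Y \<subseteq> S" "s \<in> S" and s: "\<And>y. y \<in> S ==> s \<sqsubseteq> y \<longleftrightarrow> (\<forall>x\<in>Y. x \<sqsubseteq> y)"
  shows "\<Squnion>\<^bsub>L\<lparr>carrier := S\<rparr>\<^esub> Y = s"
proof -
  let ?K = "L\<lparr>carrier := S\<rparr>"
  have U: "Upper ?K Y = {u\<in>S. \<forall>x\<in>Y. x \<sqsubseteq> u}" using S(2) by (auto simp: Upper_def)
  have ss: "s \<sqsubseteq> s" using S le_refl by blast
  show ?thesis unfolding sup_def
  proof (rule some_equality)
    show "least ?K s (Upper ?K Y)" unfolding U least_def using s S(3) ss by auto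
    fix l assume "least ?K l (Upper ?K Y)"
    then have l: "l \<in> S" "\<forall>x\<in>Y. x \<sqsubseteq> l" "\<And>u. u \<in> S ==> \<forall>x\<in>Y. x \<sqsubseteq> u ==> l \<sqsubseteq> u"
      unfolding U least_def by auto
    have "l \<sqsubseteq> s" using l(3)[OF S(3)] s[OF S(3)] ss by blast
    moreover have "s \<sqsubseteq> l" using s[OF l(1)] l(2) by blast
    moreover have "l \<in> carrier L" "s \<in> carrier L" using l(1) S by auto
    ultimately show "l = s" using le_antisym by blast
  qed
qed

lemma join_iff:
  "x \<in> carrier L ==> y \<in> carrier L ==> u \<in> carrier L ==> x \<squnion> y \<sqsubseteq> u \<longleftrightarrow> x \<sqsubseteq> u \<and> y \<sqsubseteq> u"
proof
  assume c: "x \<in> carrier L" "y \<in> carrier L" "u \<in> carrier L"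
  have j: "x \<squnion> y \<in> carrier L" using c by simp
  assume h: "x \<squnion> y \<sqsubseteq> u"
  show "x \<sqsubseteq> u \<and> y \<sqsubseteq> u"
    using le_trans[OF join_left[OF c(1,2)] h c(1) j c(3)] le_trans[OF join_right[OF c(1,2)] h c(2) j c(3)] by simp
next
  assume c: "x \<in> carrier L" "y \<in> carrier L" "u \<in> carrier L" and h: "x \<sqsubseteq> u \<and> y \<sqsubseteq> u"
  then show "x \<squnion> y \<sqsubseteq> u" by (intro join_le) auto
qed

lemma lubL:
  assumes "A \<subseteq> carrier L"
  shows "\<Squnion> A \<in> carrier L \<and> (\<forall>y\<in>carrier L. \<Squnion> A \<sqsubseteq> y \<longleftrightarrow> (\<forall>a\<in>A. a \<sqsubseteq> y))"
proof -
  have "finite A" using assms finL finite_subset by blast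
  then have "\<exists>s\<in>carrier L. \<forall>y\<in>carrier L. s \<sqsubseteq> y \<longleftrightarrow> (\<forall>a\<in>A. a \<sqsubseteq> y)" using assms
  proof (induction A rule: finite_induct)
    case empty
    then show ?case using bot by (intro bexI[of _ "\<bottom>"]) auto
  next
    case (insert a A)
    then obtain s where s: "s \<in> carrier L" "\<forall>y\<in>carrier L. s \<sqsubseteq> y \<longleftrightarrow> (\<forall>a\<in>A. a \<sqsubseteq> y)" by blast
    have a: "a \<in> carrier L" using insert.prems by simp
    have "a \<squnion> s \<in> carrier L" using a s by simp
    then show ?case by (rule bexI[rotated]) (use join_iff[OF a s(1)] s(2) in simp)
  qed
  then obtain s where s: "s \<in> carrier L" "\<forall>y\<in>carrier L. s \<sqsubseteq> y \<longleftrightarrow> (\<forall>a\<in>A. a \<sqsubseteq> y)" by blast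
  have "\<Squnion>\<^bsub>L\<lparr>carrier := carrier L\<rparr>\<^esub> A = s" by (rule supK) (use assms s in auto)
  then show ?thesis using s by simp
qed

lemma sup_in: "A \<subseteq> carrier L ==> \<Squnion> A \<in> carrier L"
  and sup_iff: "A \<subseteq> carrier L ==> y \<in> carrier L ==> \<Squnion> A \<sqsubseteq> y \<longleftrightarrow> (\<forall>a\<in>A. a \<sqsubseteq> y)"
  using lubL by blast+

text \<open>Elements with the same upper bounds coincide; the identities between joins below are
  reduced to this.\<close>

lemma eqL:
  assumes "s \<in> carrier L" "t \<in> carrier L" "\<And>y. y \<in> carrier L ==> s \<sqsubseteq> y \<longleftrightarrow> t \<sqsubseteq> y"
  shows "s = t"
  using assms(3)[of s] assms(3)[of t] assms(1,2) le_refl[of s] le_refl[of t] le_antisym[of s t] by simp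

section \<open>The lattice as a family of sets of join-irreducibles\<close>

abbreviation G where "G \<equiv> irr L"

definition J :: "'a => 'a set" where "J x = {g \<in> irr L. g \<sqsubseteq> x}"

abbreviation F where "F \<equiv> J ` carrier L"

lemma GL: "g \<in> G ==> g \<in> carrier L \<and> g \<noteq> \<bottom>" by (auto simp: irr_def)

lemma J_le: "x \<in> carrier L ==> y \<in> carrier L ==> J x \<subseteq> J y \<longleftrightarrow> x \<sqsubseteq> y"
proof
  assume c: "x \<in> carrier L" "y \<in> carrier L" and "J x \<subseteq> J y"
  then show "x \<sqsubseteq> y" by (intro le_upper_bound_of_irr[OF fl c]) (auto simp: J_def)
next
  assume c: "x \<in> carrier L" "y \<in> carrier L" and h: "x \<sqsubseteq> y"
  show "J x \<subseteq> J y"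
  proof
    fix g assume "g \<in> J x"
    then have g: "g \<in> G" "g \<sqsubseteq> x" by (auto simp: J_def)
    then show "g \<in> J y" using le_trans[OF g(2) h] GL c by (auto simp: J_def)
  qed
qed

lemma J_inj: "x \<in> carrier L ==> y \<in> carrier L ==> J x = J y \<longleftrightarrow> x = y"
  using J_le[of x y] J_le[of y x] le_antisym[of x y] by auto

lemma J_bot: "J \<bottom> = {}"
proof -
  have "g = \<bottom>" if "g \<in> J \<bottom>" for g
    using that GL[of g] bot le_antisym[of g "\<bottom>"] by (auto simp: J_def)
  then show ?thesis using GL by (fastforce simp: J_def)
qed

lemma fam: "fam G F"
proof -
  have "\<Squnion> (carrier L) \<in> carrier L" "g \<sqsubseteq> \<Squnion> (carrier L)" if "g \<in> carrier L" for g
    using sup_in[of "carrier L"] sup_iff[of "carrier L" "\<Squnion> (carrier L)"] le_refl that by auto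
  then have "J (\<Squnion> (carrier L)) = G" using GL by (auto simp: J_def)
  moreover have "\<Squnion> (carrier L) \<in> carrier L" by (rule sup_in) simp
  ultimately have "G \<in> F" by (metis imageI)
  moreover have "{} \<in> F" using J_bot bot(1) by (metis imageI)
  moreover have "J x \<inter> J y \<in> F" if c: "x \<in> carrier L" "y \<in> carrier L" for x y
  proof -
    have m: "x \<sqinter> y \<in> carrier L" using c by simp
    have "J x \<inter> J y = J (x \<sqinter> y)"
    proof
      show "J (x \<sqinter> y) \<subseteq> J x \<inter> J y"
        using J_le[OF m c(1)] J_le[OF m c(2)] meet_left[OF c] meet_right[OF c] by simp
      show "J x \<inter> J y \<subseteq> J (x \<sqinter> y)"
      proof
        fix g assume "g \<in> J x \<inter> J y"
        then have g: "g \<in> G" "g \<sqsubseteq> x" "g \<sqsubseteq> y" by (auto simp: J_def)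
        then have "g \<sqsubseteq> x \<sqinter> y" using GL c by (intro meet_le) auto
        then show "g \<in> J (x \<sqinter> y)" using g by (simp add: J_def)
      qed
    qed
    then show ?thesis using m by simp
  qed
  moreover have "finite G" by (rule finite_subset[OF _ finL]) (use GL in blast)
  ultimately show ?thesis by (auto simp: fam_def J_def[of _])
qed

sublocale M: family G F by unfold_locales (rule fam)

lemma cl_J:
  assumes s: "s \<in> carrier L" and "\<And>y. y \<in> carrier L ==> s \<sqsubseteq> y \<longleftrightarrow> Y \<subseteq> J y"
  shows "cl F Y = J s"
proof -
  have "cl F Y = cl F (J s)" by (rule M.cl_eqI) (use assms J_le[OF s] in auto)
  then show ?thesis using M.cl_id s by simp
qed

lemma cl_join: "h \<in> carrier L ==> z \<in> carrier L ==> cl F (J h \<union> J z) = J (h \<squnion> z)"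
  by (rule cl_J) (simp_all add: join_iff J_le)

lemma cl_ins: "g \<in> G ==> z \<in> carrier L ==> cl F (insert g (J z)) = J (g \<squnion> z)"
proof (rule cl_J)
  assume g: "g \<in> G" "z \<in> carrier L"
  then show "g \<squnion> z \<in> carrier L" using GL by simp
  fix y assume y: "y \<in> carrier L"
  have "g \<in> J y \<longleftrightarrow> g \<sqsubseteq> y" using g by (simp add: J_def)
  then show "g \<squnion> z \<sqsubseteq> y \<longleftrightarrow> insert g (J z) \<subseteq> J y" using join_iff[of g z y] J_le[of z y] g GL y by simp
qed

text \<open>The pairs of minimum and generator set that describe minors; by the lemma
  \<open>minors\<close> they give exactly the minors of \<open>(L, irr L)\<close>.\<close>

definition vm :: "'a => 'a set => bool" where
  "vm z H \<longleftrightarrow> z \<in> carrier L \<and> H \<subseteq> carrier L \<and> J ` H \<subseteq> gn G F (J z)"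

definition cell :: "'a => 'a set => 'a cell" where "cell z H = Some (J z, J ` H)"

definition carr :: "'a => 'a set => 'a set" where "carr z H = {z \<squnion> (\<Squnion> X) | X. X \<subseteq> H}"

definition mk :: "'a => 'a set => 'a gorder \<times> 'a set" where "mk z H = (L\<lparr>carrier := carr z H\<rparr>, H)"

lemma vmD: "vm z H ==> z \<in> carrier L" "vm z H ==> H \<subseteq> carrier L" "vm z H ==> h \<in> H ==> z \<sqsubseteq> h \<and> h \<noteq> z"
proof -
  show "vm z H ==> z \<in> carrier L" "vm z H ==> H \<subseteq> carrier L" by (auto simp: vm_def)
  assume v: "vm z H" and h: "h \<in> H"
  then have "J h \<in> gn G F (J z)" "J z \<in> F" by (auto simp: vm_def)
  then have "J z \<subset> J h" using M.gn_D by blast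
  then show "z \<sqsubseteq> h \<and> h \<noteq> z" using J_le[of z h] v h by (auto simp: vm_def)
qed

lemma vm_sub: "vm z H ==> H' \<subseteq> H ==> vm z H'" by (auto simp: vm_def)

lemma cell_cells: "vm z H ==> cell z H \<in> cells G F" by (simp add: cell_def vm_def)

lemma zsup_in: "z \<in> carrier L ==> Y \<subseteq> carrier L ==> z \<squnion> (\<Squnion> Y) \<in> carrier L"
  using sup_in by simp

lemma zsup_iff: "z \<in> carrier L ==> Y \<subseteq> carrier L ==> y \<in> carrier L ==>
   z \<squnion> (\<Squnion> Y) \<sqsubseteq> y \<longleftrightarrow> z \<sqsubseteq> y \<and> (\<forall>x\<in>Y. x \<sqsubseteq> y)"
  using join_iff[OF _ sup_in] sup_iff by simp

section \<open>Joins, deletions and contractions inside a minor\<close>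

context
  fixes z H assumes v: "vm z H"
begin

lemma z_in: "z \<in> carrier L" and H_in: "H \<subseteq> carrier L" using vmD(1,2)[OF v] by auto

lemma carr_sub: "carr z H \<subseteq> carrier L"
  using zsup_in[OF z_in] H_in by (auto simp: carr_def)

lemma carr_ge: "x \<in> carr z H ==> z \<sqsubseteq> x"
proof -
  assume "x \<in> carr z H"
  then obtain X where X: "X \<subseteq> H" "x = z \<squnion> (\<Squnion> X)" by (auto simp: carr_def)
  have "X \<subseteq> carrier L" using X H_in by auto
  then show ?thesis unfolding X(2) using join_left[OF z_in sup_in] by blast
qed

lemma carr_sup:
  assumes Y: "Y \<subseteq> carr z H" shows "z \<squnion> (\<Squnion> Y) \<in> carr z H"
proof -
  \<comment> \<open>A join of elements of the carrier is the join over \<open>z\<close> of all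
    generators below one of them.\<close>
  let ?W = "{h\<in>H. \<exists>x\<in>Y. h \<sqsubseteq> x}"
  have YL: "Y \<subseteq> carrier L" and WL: "?W \<subseteq> carrier L" using Y carr_sub H_in by auto
  have "z \<squnion> (\<Squnion> Y) = z \<squnion> (\<Squnion> ?W)"
  proof (rule eqL)
    fix y assume y: "y \<in> carrier L"
    have "(\<forall>x\<in>Y. x \<sqsubseteq> y) \<longleftrightarrow> (\<forall>h\<in>?W. h \<sqsubseteq> y)" if zy: "z \<sqsubseteq> y"
    proof
      assume a: "\<forall>x\<in>Y. x \<sqsubseteq> y"
      show "\<forall>h\<in>?W. h \<sqsubseteq> y"
      proof
        fix h assume "h \<in> ?W"
        then obtain x where x: "x \<in> Y" "h \<sqsubseteq> x" "h \<in> H" by blast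
        show "h \<sqsubseteq> y" by (rule le_trans[OF x(2)]) (use a x YL H_in y in auto)
      qed
    next
      assume a: "\<forall>h\<in>?W. h \<sqsubseteq> y"
      show "\<forall>x\<in>Y. x \<sqsubseteq> y"
      proof
        fix x assume x: "x \<in> Y"
        then obtain X where X: "X \<subseteq> H" "x = z \<squnion> (\<Squnion> X)" using Y by (auto simp: carr_def)
        have XL: "X \<subseteq> carrier L" using X H_in by auto
        have xL: "x \<in> carrier L" using x YL by auto
        have "\<forall>h\<in>X. h \<sqsubseteq> x" using zsup_iff[OF z_in XL xL] le_refl[OF xL] X(2) by simp
        then have "\<forall>h\<in>X. h \<sqsubseteq> y" using a X(1) x by blast
        then show "x \<sqsubseteq> y" unfolding X(2) using zsup_iff[OF z_in XL y] zy by simp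
      qed
    qed
    then show "z \<squnion> (\<Squnion> Y) \<sqsubseteq> y \<longleftrightarrow> z \<squnion> (\<Squnion> ?W) \<sqsubseteq> y"
      unfolding zsup_iff[OF z_in YL y] zsup_iff[OF z_in WL y] by blast
  qed (use zsup_in[OF z_in] YL WL in auto)
  moreover have "?W \<subseteq> H" by auto
  ultimately show ?thesis unfolding carr_def by blast
qed

lemma z_carr: "z \<in> carr z H"
proof -
  have "z \<squnion> (\<Squnion> {}) = z"
    by (rule eqL) (use zsup_iff[OF z_in, of "{}"] zsup_in[OF z_in, of "{}"] z_in in auto)
  then show ?thesis using carr_sup[of "{}"] by simp
qed

lemma H_carr: "H \<subseteq> carr z H"
proof
  fix h assume h: "h \<in> H"
  have hL: "{h} \<subseteq> carrier L" using h H_in by auto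
  have "z \<squnion> (\<Squnion> {h}) = h"
  proof (rule eqL)
    fix y assume y: "y \<in> carrier L"
    have "h \<sqsubseteq> y ==> z \<sqsubseteq> y" using le_trans[of z h y] vmD(3)[OF v h] z_in hL y by simp
    then show "z \<squnion> (\<Squnion> {h}) \<sqsubseteq> y \<longleftrightarrow> h \<sqsubseteq> y" using zsup_iff[OF z_in hL y] by auto
  qed (use zsup_in[OF z_in hL] hL in auto)
  then have "h = z \<squnion> (\<Squnion> {h})" by simp
  moreover have "{h} \<subseteq> H" using h by simp
  ultimately show "h \<in> carr z H" unfolding carr_def by blast
qed

abbreviation "K \<equiv> L\<lparr>carrier := carr z H\<rparr>"

lemma K_bot: "\<bottom>\<^bsub>K\<^esub> = z"
  unfolding bottom_def
proof (rule some_equality)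
  show "least K z (carrier K)" using z_carr carr_ge by (auto simp: least_def)
  fix y assume "least K y (carrier K)"
  then have "y \<in> carr z H" "y \<sqsubseteq> z" using z_carr by (auto simp: least_def)
  then show "y = z" using le_antisym[of y z] carr_ge carr_sub z_in by auto
qed

text \<open>The extra \<open>z\<close> matters for the empty join, whose value in the minor is the
  minimum of the minor; nonempty joins are above \<open>z\<close> anyway.\<close>

lemma K_sup:
  assumes Y: "Y \<subseteq> carr z H" shows "\<Squnion>\<^bsub>K\<^esub> Y = z \<squnion> (\<Squnion> Y)"
proof (rule supK[OF carr_sub Y carr_sup[OF Y]])
  fix y assume y: "y \<in> carr z H"
  have YL: "Y \<subseteq> carrier L" "y \<in> carrier L" using Y y carr_sub by auto
  show "z \<squnion> (\<Squnion> Y) \<sqsubseteq> y \<longleftrightarrow> (\<forall>x\<in>Y. x \<sqsubseteq> y)"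
    using zsup_iff[OF z_in YL] carr_ge[OF y] by simp
qed

lemma K_join:
  assumes x: "x \<in> carr z H" "y \<in> carr z H" shows "x \<squnion>\<^bsub>K\<^esub> y = x \<squnion> y"
proof -
  have s: "{x, y} \<subseteq> carr z H" using x by simp
  have sL: "x \<in> carrier L" "y \<in> carrier L" using x carr_sub by auto
  then have sL2: "{x, y} \<subseteq> carrier L" by simp
  have "z \<squnion> (\<Squnion> {x, y}) = x \<squnion> y"
  proof (rule eqL)
    fix u assume u: "u \<in> carrier L"
    have "x \<sqsubseteq> u ==> z \<sqsubseteq> u" using le_trans[OF carr_ge[OF x(1)], of u] z_in sL u by simp
    then show "z \<squnion> (\<Squnion> {x, y}) \<sqsubseteq> u \<longleftrightarrow> x \<squnion> y \<sqsubseteq> u"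
      using zsup_iff[OF z_in sL2 u] join_iff[OF sL u] by auto
  qed (use zsup_in[OF z_in sL2] sL in auto)
  then show ?thesis unfolding join_def[of K] K_sup[OF s] .
qed

text \<open>Constructions inside a minor reduce to constructions in \<open>L\<close>: joins taken in
  \<open>K\<close> carry an extra \<open>z\<close>, which is absorbed because \<open>w\<close> is
  above \<open>z\<close>.\<close>

lemma K_span:
  assumes w: "w \<in> carr z H" and H': "H' \<subseteq> carr z H"
  shows "span_over K H' w = mk w H'"
proof -
  have "w \<squnion>\<^bsub>K\<^esub> (\<Squnion>\<^bsub>K\<^esub> X) = w \<squnion> (\<Squnion> X)" if X: "X \<subseteq> H'" for X
  proof -
    have Xc: "X \<subseteq> carr z H" using X H' by simp
    have XL: "X \<subseteq> carrier L" "w \<in> carrier L" using Xc w carr_sub by auto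
    note zs = zsup_in[OF z_in XL(1)]
    have "w \<squnion> (z \<squnion> (\<Squnion> X)) = w \<squnion> (\<Squnion> X)"
    proof (rule eqL)
      fix u assume u: "u \<in> carrier L"
      have "w \<sqsubseteq> u ==> z \<sqsubseteq> u" using le_trans[OF carr_ge[OF w], of u] z_in XL u by simp
      then show "w \<squnion> (z \<squnion> (\<Squnion> X)) \<sqsubseteq> u \<longleftrightarrow> w \<squnion> (\<Squnion> X) \<sqsubseteq> u"
        unfolding join_iff[OF XL(2) zs u] zsup_iff[OF z_in XL(1) u] zsup_iff[OF XL(2,1) u] by blast
    qed (use zs zsup_in[OF XL(2,1)] XL in auto)
    then show ?thesis unfolding K_sup[OF Xc] K_join[OF w carr_sup[OF Xc]] .
  qed
  then have i: "(\<lambda>X. w \<squnion>\<^bsub>K\<^esub> (\<Squnion>\<^bsub>K\<^esub> X)) ` Pow H' = (\<lambda>X. w \<squnion> (\<Squnion> X)) ` Pow H'"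
    by (intro image_cong[OF HOL.refl]) simp
  have "{f X | X. X \<subseteq> H'} = f ` Pow H'" for f :: "'a set => 'a" by auto
  then have "{w \<squnion>\<^bsub>K\<^esub> (\<Squnion>\<^bsub>K\<^esub> X) | X. X \<subseteq> H'} = carr w H'" unfolding carr_def[of w H'] using i by simp
  then show ?thesis unfolding span_over_def mk_def by simp
qed

lemma K_del: "deletion K H I = mk z (H - I)"
  unfolding deletion_def K_bot by (rule K_span[OF z_carr]) (use H_carr in blast)

definition cH :: "'a => 'a set" where "cH w = {g \<squnion> w | g. g \<in> H} - {w}"

lemma K_con:
  assumes I: "I \<subseteq> H"
  shows "contraction K H I = mk (z \<squnion> (\<Squnion> I)) (cH (z \<squnion> (\<Squnion> I)))"
proof -
  let ?w = "z \<squnion> (\<Squnion> I)"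
  have Ic: "I \<subseteq> carr z H" using I H_carr by blast
  have w: "?w \<in> carr z H" by (rule carr_sup[OF Ic])
  have "g \<squnion>\<^bsub>K\<^esub> ?w = g \<squnion> ?w" if "g \<in> H" for g using K_join[OF _ w] that H_carr by blast
  then have i: "(\<lambda>g. g \<squnion>\<^bsub>K\<^esub> ?w) ` H = (\<lambda>g. g \<squnion> ?w) ` H" by (intro image_cong[OF HOL.refl]) simp
  have "{f g | g. g \<in> H} = f ` H" for f :: "'a => 'a" by auto
  then have e: "{g \<squnion>\<^bsub>K\<^esub> ?w | g. g \<in> H} = {g \<squnion> ?w | g. g \<in> H}" using i by simp
  have "g \<squnion> ?w \<in> carr z H" if g: "g \<in> H" for g
  proof -
    have s: "{g, ?w} \<subseteq> carr z H" using g H_carr w by auto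
    have "\<Squnion>\<^bsub>K\<^esub> {g, ?w} = g \<squnion> ?w" using K_join[of g ?w] s by (simp add: join_def[of K])
    then show ?thesis using carr_sup[OF s] K_sup[OF s] by simp
  qed
  then have "cH ?w \<subseteq> carr z H" by (auto simp: cH_def)
  then show ?thesis unfolding contraction_def Let_def K_sup[OF Ic] e cH_def[symmetric] by (rule K_span[OF w])
qed

lemma vm_con:
  assumes w: "w \<in> carrier L" "z \<sqsubseteq> w" shows "vm w (cH w)"
proof -
  have "g \<squnion> w \<in> carrier L \<and> J (g \<squnion> w) \<in> gn G F (J w)" if g: "g \<in> H" "g \<squnion> w \<noteq> w" for g
  proof
    have gL: "g \<in> carrier L" using g H_in by auto
    show j: "g \<squnion> w \<in> carrier L" using gL w by simp
    have e: "cl F (J g \<union> J w) = J (g \<squnion> w)" by (rule cl_join[OF gL w(1)])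
    have "cl F (J g \<union> J w) \<in> gn G F (J w)"
    proof (rule M.gn_lift)
      show "J g \<in> gn G F (J z)" using v g by (auto simp: vm_def)
      show "J z \<subseteq> J w" using J_le[OF z_in w(1)] w by simp
      show "cl F (J g \<union> J w) \<noteq> J w" unfolding e using J_inj[OF j w(1)] g by simp
    qed (use z_in w in auto)
    then show "J (g \<squnion> w) \<in> gn G F (J w)" unfolding e .
  qed
  then show ?thesis using w by (auto simp: vm_def cH_def)
qed

end

text \<open>Induction along the sequence of operations. A deletion shrinks the generator set, and a
  contraction by \<open>I\<close> moves the minimum to the join of z with \<open>I\<close>, which is
  the shape described by \<open>sp\<close>.\<close>

lemma minor_mle:
  assumes "is_minor M N" "N = mk z0 H0" "vm z0 H0"
  shows "\<exists>z H. M = mk z H \<and> vm z H \<and> mle F (cell z H) (cell z0 H0)"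
  using assms
proof (induction rule: is_minor.induct)
  case (minor_refl M)
  then show ?case using M.M.refl[OF cell_cells] by blast
next
  case (minor_deletion K' H' N I)
  then obtain z H where e: "(K', H') = mk z H" "vm z H" "mle F (cell z H) (cell z0 H0)" by blast
  have KH: "K' = L\<lparr>carrier := carr z H\<rparr>" "H' = H" using e(1) by (simp_all add: mk_def)
  have v: "vm z (H - I)" by (rule vm_sub[OF e(2)]) auto
  have "mle F (cell z (H - I)) (cell z H)"
    unfolding cell_def by (rule M.mle_sub) (use e(2) in \<open>auto simp: vm_def\<close>)
  then have "mle F (cell z (H - I)) (cell z0 H0)"
    using M.M.trans[OF cell_cells[OF v] cell_cells[OF e(2)] cell_cells[OF minor_deletion.prems(2)]] e(3) by blast
  then show ?case unfolding KH K_del[OF e(2)] using v by blast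
next
  case (minor_contraction K' H' N I)
  then obtain z H where e: "(K', H') = mk z H" "vm z H" "mle F (cell z H) (cell z0 H0)" by blast
  have KH: "K' = L\<lparr>carrier := carr z H\<rparr>" "H' = H" using e(1) by (simp_all add: mk_def)
  have I: "I \<subseteq> H" using minor_contraction.hyps KH by simp
  let ?w = "z \<squnion> (\<Squnion> I)"
  note zL = vmD(1)[OF e(2)] and HL = vmD(2)[OF e(2)]
  have IL: "I \<subseteq> carrier L" using I HL by simp
  have wL: "?w \<in> carrier L" by (rule zsup_in[OF zL IL])
  have zw: "z \<sqsubseteq> ?w" and iw: "\<forall>i\<in>I. i \<sqsubseteq> ?w" using zsup_iff[OF zL IL wL] le_refl[OF wL] by auto
  have v: "vm ?w (cH H ?w)" by (rule vm_con[OF e(2) wL zw])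
  have "sp F (J z) (J ` H) (J ?w)" unfolding sp_def
  proof (intro conjI ballI impI)
    show "J z \<subseteq> J ?w" using J_le[OF zL wL] zw by simp
    fix A assume A: "A \<in> F" "J z \<subseteq> A" "\<forall>h\<in>J ` H. h \<subseteq> J ?w \<longrightarrow> h \<subseteq> A"
    then obtain y where y: "y \<in> carrier L" "A = J y" by blast
    have "z \<sqsubseteq> y" using A(2) J_le[OF zL y(1)] y(2) by simp
    moreover have "i \<sqsubseteq> y" if i: "i \<in> I" for i
    proof -
      have iL: "i \<in> carrier L" using i IL by auto
      have "J i \<subseteq> J ?w" using J_le[OF iL wL] iw i by simp
      then have "J i \<subseteq> J y" using A(3) i I y(2) by blast
      then show ?thesis using J_le[OF iL y(1)] by simp
    qed
    ultimately have "?w \<sqsubseteq> y" using zsup_iff[OF zL IL y(1)] by simp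
    then show "J ?w \<subseteq> A" unfolding y(2) using J_le[OF wL y(1)] by simp
  qed
  moreover have "\<exists>h\<in>J ` H. k = cl F (h \<union> J ?w)" if k: "k \<in> J ` cH H ?w" for k
  proof -
    obtain g where g: "g \<in> H" "k = J (g \<squnion> ?w)" using k by (auto simp: cH_def[OF e(2)])
    have "cl F (J g \<union> J ?w) = k" using cl_join[OF _ wL, of g] g HL by auto
    then show ?thesis using g(1) by blast
  qed
  ultimately have "mle F (cell ?w (cH H ?w)) (cell z H)" by (simp add: cell_def)
  then have "mle F (cell ?w (cH H ?w)) (cell z0 H0)"
    using M.M.trans[OF cell_cells[OF v] cell_cells[OF e(2)] cell_cells[OF minor_contraction.prems(2)]] e(3) by blast
  then show ?case unfolding KH K_con[OF e(2) I] using v by blast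
qed

text \<open>Contract all generators below \<open>z'\<close>, whose join with \<open>z\<close> is
  \<open>z'\<close> by \<open>sp\<close>, and then delete the generators outside
  \<open>H'\<close>.\<close>

lemma mle_minor:
  assumes v: "vm z H" and v': "vm z' H'" and l: "mle F (cell z' H') (cell z H)"
  shows "is_minor (mk z' H') (mk z H)"
proof -
  note zL = vmD(1)[OF v] and HL = vmD(2)[OF v] and z'L = vmD(1)[OF v'] and H'L = vmD(2)[OF v']
  have sp: "sp F (J z) (J ` H) (J z')" and lH: "\<And>h'. h' \<in> H' ==> \<exists>h\<in>H. J h' = cl F (J h \<union> J z')"
    using l by (auto simp: cell_def)
  let ?S = "{h\<in>H. h \<sqsubseteq> z'}"
  let ?w = "z \<squnion> (\<Squnion> ?S)"
  have SL: "?S \<subseteq> carrier L" using HL by auto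
  have wL: "?w \<in> carrier L" by (rule zsup_in[OF zL SL])
  have zz': "z \<sqsubseteq> z'" using sp J_le[OF zL z'L] by (simp add: sp_def)
  have w1: "?w \<sqsubseteq> z'" using zsup_iff[OF zL SL z'L] zz' by simp
  have zw: "z \<sqsubseteq> ?w" and sw: "\<forall>i\<in>?S. i \<sqsubseteq> ?w" using zsup_iff[OF zL SL wL] le_refl[OF wL] by auto
  have "J z' \<subseteq> J ?w"
  proof (rule sp_D[OF sp])
    show "J ?w \<in> F" using wL by simp
    show "J z \<subseteq> J ?w" using J_le[OF zL wL] zw by simp
    fix h assume h: "h \<in> J ` H" "h \<subseteq> J z'"
    then obtain k where k: "k \<in> H" "h = J k" by blast
    have kL: "k \<in> carrier L" using k HL by auto
    have "k \<sqsubseteq> z'" using h(2) k(2) J_le[OF kL z'L] by simp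
    then have "k \<sqsubseteq> ?w" using sw k(1) by blast
    then show "h \<subseteq> J ?w" using J_le[OF kL wL] k(2) by simp
  qed
  then have "z' \<sqsubseteq> ?w" using J_le[OF z'L wL] by simp
  then have wz: "?w = z'" using le_antisym[OF w1 _ wL z'L] by simp
  have S: "?S \<subseteq> H" by auto
  have "is_minor (L\<lparr>carrier := carr z H\<rparr>, H) (mk z H)" unfolding mk_def by (rule minor_refl)
  from minor_contraction[OF this S] have m: "is_minor (mk z' (cH H z')) (mk z H)"
    unfolding K_con[OF v S] wz .
  have vc: "vm z' (cH H z')" by (rule vm_con[OF v z'L zz'])
  have sub: "H' \<subseteq> cH H z'"
  proof
    fix h' assume h': "h' \<in> H'"
    then obtain h where h: "h \<in> H" "J h' = cl F (J h \<union> J z')" using lH by blast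
    have hL: "h \<in> carrier L" "h' \<in> carrier L" using h HL h' H'L by auto
    have "J h' = J (h \<squnion> z')" using h cl_join[OF hL(1) z'L] by simp
    then have "h' = h \<squnion> z'" using J_inj[OF hL(2)] hL z'L by simp
    moreover have "h' \<noteq> z'" using vmD(3)[OF v' h'] by simp
    ultimately show "h' \<in> cH H z'" using h(1) by (auto simp: cH_def[OF v])
  qed
  have "is_minor (deletion (L\<lparr>carrier := carr z' (cH H z')\<rparr>) (cH H z') (cH H z' - H')) (mk z H)"
    by (rule minor_deletion[OF m[unfolded mk_def[of z']]]) auto
  then have "is_minor (mk z' (cH H z' - (cH H z' - H'))) (mk z H)" unfolding K_del[OF vc] .
  moreover have "cH H z' - (cH H z' - H') = H'" using sub by auto
  ultimately show ?thesis by simp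
qed

lemma vm_top: "vm \<bottom> G" and mk_top: "mk \<bottom> G = (L, G)" and gn_top: "gn G F {} = J ` G"
proof -
  have c: "cl F {g} = J g" if g: "g \<in> G" for g
  proof (rule cl_J)
    show "g \<in> carrier L" using GL[OF g] by simp
    show "g \<sqsubseteq> y \<longleftrightarrow> {g} \<subseteq> J y" if "y \<in> carrier L" for y using g by (simp add: J_def)
  qed
  show gt: "gn G F {} = J ` G" using c by (force simp: gn_def)
  show v: "vm \<bottom> G" unfolding vm_def J_bot gt using bot GL by auto
  have "carr \<bottom> G = carrier L"
  proof
    show "carr \<bottom> G \<subseteq> carrier L" by (rule carr_sub[OF v])
    show "carrier L \<subseteq> carr \<bottom> G"
    proof
      fix x assume x: "x \<in> carrier L"
      then obtain X where X: "X \<subseteq> G" "x = \<Squnion> X"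
        using generator_enriched_irr[OF fl] by (auto simp: generator_enriched_def)
      have XL: "X \<subseteq> carrier L" using X GL by auto
      have "\<bottom> \<squnion> (\<Squnion> X) = x"
        by (rule eqL) (use zsup_iff[OF bot(1) XL] sup_iff[OF XL] zsup_in[OF bot(1) XL] bot(2) X(2) x in auto)
      then show "x \<in> carr \<bottom> G" unfolding carr_def using X(1) by blast
    qed
  qed
  then show "mk \<bottom> G = (L, G)" by (simp add: mk_def)
qed

lemma tp_cell: "M.tp = cell \<bottom> G" by (simp add: M.tp_def cell_def J_bot gn_top)

lemma cells_vm:
  assumes "x \<in> cells G F" "x \<noteq> None"
  shows "\<exists>z H. vm z H \<and> x = cell z H"
  using assms(1)
proof (cases rule: cells_cases)
  case (Some y D)
  then obtain z where z: "z \<in> carrier L" "y = J z" by blast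
  have DF: "D \<subseteq> J ` carrier L" using M.gn_D[OF _ Some(2)] Some(3) by blast
  then obtain H where "H \<subseteq> carrier L" "D = J ` H" by (rule subset_imageE)
  then show ?thesis using Some z by (auto simp: vm_def cell_def)
qed (use assms in simp)

text \<open>Every \<open>z\<close> is the join of the join-irreducibles below it, so contracting
  these reaches it.\<close>

lemma cell_le_tp: "vm z H ==> mle F (cell z H) M.tp"
proof -
  assume v: "vm z H"
  note zL = vmD(1)[OF v]
  have "sp F {} (J ` G) (J z)" unfolding sp_def
  proof (intro conjI ballI impI subsetI)
    fix A g assume A: "A \<in> F" "\<forall>h\<in>J ` G. h \<subseteq> J z \<longrightarrow> h \<subseteq> A" and g: "g \<in> J z"
    have gG: "g \<in> G" "g \<sqsubseteq> z" using g by (auto simp: J_def)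
    have gL: "g \<in> carrier L" using GL[OF gG(1)] by simp
    have "J g \<subseteq> J z" using J_le[OF gL zL] gG by simp
    then have "J g \<subseteq> A" using A(2) gG(1) by blast
    moreover have "g \<in> J g" using gG(1) le_refl[OF gL] by (simp add: J_def)
    ultimately show "g \<in> A" by blast
  qed simp
  moreover have "\<exists>h\<in>J ` G. k = cl F (h \<union> J z)" if k: "k \<in> J ` H" for k
  proof -
    have "k \<in> gn G F (J z)" using v k by (auto simp: vm_def)
    then obtain g where g: "g \<in> G" "k = cl F (insert g (J z))" by (auto simp: gn_def)
    have gL: "g \<in> carrier L" using GL[OF g(1)] by simp
    have "k = cl F (J g \<union> J z)" unfolding g(2) cl_ins[OF g(1) zL] cl_join[OF gL zL] ..
    then show ?thesis using g(1) by blast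
  qed
  ultimately show ?thesis by (simp add: M.tp_def cell_def gn_top)
qed

text \<open>The minimum of a minor is recovered as the bottom of its lattice, which for
  \<open>mk z H\<close> is z by \<open>K_bot\<close>.\<close>

definition \<iota> :: "('a gorder \<times> 'a set) option => 'a cell" where
  "\<iota> x = (case x of None => None | Some M => cell \<bottom>\<^bsub>fst M\<^esub> (snd M))"

lemma \<iota>_mk: "vm z H ==> \<iota> (Some (mk z H)) = cell z H"
  by (simp add: \<iota>_def mk_def K_bot)

lemma cell_inj: "vm z H ==> vm z' H' ==> cell z H = cell z' H' ==> z = z' \<and> H = H'"
proof -
  assume v: "vm z H" "vm z' H'" and e: "cell z H = cell z' H'"
  have "inj_on J (carrier L)" using J_inj by (auto simp: inj_on_def)
  then have "H = H'" using e inj_on_image_eq_iff[of J "carrier L" H H'] vmD(2)[OF v(1)] vmD(2)[OF v(2)]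
    by (simp add: cell_def)
  then show ?thesis using e J_inj[OF vmD(1)[OF v(1)] vmD(1)[OF v(2)]] by (simp add: cell_def)
qed

lemma minors: "is_minor M (L, G) \<longleftrightarrow> (\<exists>z H. vm z H \<and> M = mk z H)"
proof
  assume "is_minor M (L, G)"
  then show "\<exists>z H. vm z H \<and> M = mk z H" using minor_mle[OF _ mk_top[symmetric] vm_top] by blast
next
  assume "\<exists>z H. vm z H \<and> M = mk z H"
  then obtain z H where v: "vm z H" "M = mk z H" by blast
  show "is_minor M (L, G)" unfolding v(2) mk_top[symmetric]
    by (rule mle_minor[OF vm_top v(1)]) (use cell_le_tp[OF v(1)] tp_cell in simp)
qed

lemma minor_iff:
  assumes v: "vm z H" "vm z' H'"
  shows "is_minor (mk z' H') (mk z H) \<longleftrightarrow> mle F (cell z' H') (cell z H)"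
proof
  assume "is_minor (mk z' H') (mk z H)"
  then obtain z1 H1 where 1: "mk z' H' = mk z1 H1" "vm z1 H1" "mle F (cell z1 H1) (cell z H)"
    using minor_mle[OF _ HOL.refl v(1)] by blast
  have "cell z' H' = cell z1 H1" using \<iota>_mk[OF v(2)] \<iota>_mk[OF 1(2)] 1(1) by simp
  then show "mle F (cell z' H') (cell z H)" using 1(3) by simp
qed (rule mle_minor[OF v])

theorem ab_index_minor_poset: "ab_index (minor_poset L G) = Psi G F"
proof (rule M.cells_iso)
  have car: "carrier (minor_poset L G) = insert None (Some ` {M. \<exists>z H. vm z H \<and> M = mk z H})"
    using minors by (simp add: minor_poset_def)
  show "bij_betw \<iota> (carrier (minor_poset L G)) (cells G F)" unfolding car
  proof (rule bij_betw_imageI)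
    show "inj_on \<iota> (insert None (Some ` {M. \<exists>z H. vm z H \<and> M = mk z H}))"
    proof (rule inj_onI)
      fix x y assume x: "x \<in> insert None (Some ` {M. \<exists>z H. vm z H \<and> M = mk z H})"
        and y: "y \<in> insert None (Some ` {M. \<exists>z H. vm z H \<and> M = mk z H})" and e: "\<iota> x = \<iota> y"
      consider "x = None" | z H where "vm z H" "x = Some (mk z H)" using x by blast
      then show "x = y"
      proof cases
        case 1
        then have "\<iota> y = None" using e by (simp add: \<iota>_def)
        then show ?thesis using 1 by (cases y) (auto simp: \<iota>_def cell_def)
      next
        case (2 z H)
        then have i: "\<iota> y = cell z H" using e \<iota>_mk by simp
        then have "y \<noteq> None" by (cases y) (auto simp: \<iota>_def cell_def)
        then obtain z' H' where z': "vm z' H'" "y = Some (mk z' H')" using y by blast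
        then have "cell z' H' = cell z H" using i \<iota>_mk by simp
        then show ?thesis using cell_inj[OF z'(1) 2(1)] z' 2 by simp
      qed
    qed
    show "\<iota> ` insert None (Some ` {M. \<exists>z H. vm z H \<and> M = mk z H}) = cells G F"
    proof
      show "\<iota> ` insert None (Some ` {M. \<exists>z H. vm z H \<and> M = mk z H}) \<subseteq> cells G F"
      proof
        fix c assume "c \<in> \<iota> ` insert None (Some ` {M. \<exists>z H. vm z H \<and> M = mk z H})"
        then consider "c = \<iota> None" | z H where "vm z H" "c = \<iota> (Some (mk z H))" by blast
        then show "c \<in> cells G F"
        proof cases
          case 1
          then show ?thesis by (simp add: \<iota>_def)
        next
          case (2 z H)
          then show ?thesis using \<iota>_mk cell_cells by simp
        qed
      qed
      show "cells G F \<subseteq> \<iota> ` insert None (Some ` {M. \<exists>z H. vm z H \<and> M = mk z H})"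
      proof
        fix c assume c: "c \<in> cells G F"
        show "c \<in> \<iota> ` insert None (Some ` {M. \<exists>z H. vm z H \<and> M = mk z H})"
        proof (cases "c = None")
          case True
          then have "c = \<iota> None" by (simp add: \<iota>_def)
          then show ?thesis by blast
        next
          case False
          then obtain z H where z: "vm z H" "c = cell z H" using cells_vm[OF c] by blast
          then have "c = \<iota> (Some (mk z H))" using \<iota>_mk by simp
          then show ?thesis using z(1) by blast
        qed
      qed
    qed
  qed
  show "x \<sqsubseteq>\<^bsub>minor_poset L G\<^esub> y \<longleftrightarrow> mle F (\<iota> x) (\<iota> y)"
    if x: "x \<in> carrier (minor_poset L G)" and y: "y \<in> carrier (minor_poset L G)" for x y
  proof -
    consider "x = None" | z H where "vm z H" "x = Some (mk z H)" using x unfolding car by blast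
    then show ?thesis
    proof cases
      case 1
      then show ?thesis by (simp add: minor_poset_def \<iota>_def)
    next
      case (2 z H)
      consider "y = None" | z' H' where "vm z' H'" "y = Some (mk z' H')" using y unfolding car by blast
      then show ?thesis
      proof cases
        case 1
        have "\<iota> x \<noteq> None" using 2 \<iota>_mk by (simp add: cell_def)
        then show ?thesis using 1 2 by (simp add: minor_poset_def \<iota>_def)
      next
        case h: (2 z' H')
        then show ?thesis using 2 minor_iff[OF h(1) 2(1)] \<iota>_mk[OF h(1)] \<iota>_mk[OF 2(1)] by (simp add: minor_poset_def)
      qed
    qed
  qed
  show "mle F x M.tp" if "x \<in> cells G F" for x
    using cells_vm[OF that] cell_le_tp by (cases "x = None") auto
qed

end

section \<open>Join extremal lattices\<close>

lemma chain_bound: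
  assumes "finite (carrier L)"
  shows "finite {card C - 1 | C. order_chain L C \<and> C \<noteq> {}}"
proof (rule finite_subset)
  show "{card C - 1 | C. order_chain L C \<and> C \<noteq> {}} \<subseteq> (\<lambda>C. card C - 1) ` Pow (carrier L)"
    by (auto simp: order_chain_def)
qed (use assms in simp)

context flat begin

lemma ex_chain:
  "\<exists>C. order_chain L C \<and> card C = Suc (poset_length L)"
proof -
  let ?M = "{card C - 1 | C. order_chain L C \<and> C \<noteq> {}}"
  have "order_chain L {\<bottom>}" using bot by (simp add: order_chain_def)
  then have "?M \<noteq> {}" by blast
  then have "poset_length L \<in> ?M" unfolding poset_length_def by (rule Max_in[OF chain_bound[OF finL]])
  then obtain C where C: "order_chain L C" "C \<noteq> {}" "poset_length L = card C - 1" by blast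
  have "finite C" using C(1) finL finite_subset by (auto simp: order_chain_def)
  then have "0 < card C" using C(2) by (simp add: card_gt_0_iff)
  then show ?thesis using C by (intro exI[of _ C]) simp
qed

text \<open>The sets \<open>J x\<close> along the chain are nested and distinct. Their sizes are
  card (irr L) + 1 distinct numbers from 0 to card (irr L), so every size occurs exactly
  once.\<close>

lemma chain_flag:
  assumes C: "order_chain L C" "card C = Suc (card (irr L))"
  shows "\<exists>A. flag (irr L) A (card (irr L)) \<and> A ` {..card (irr L)} = J ` C"
proof -
  let ?n = "card (irr L)"
  have CL: "C \<subseteq> carrier L" and tot: "\<And>x y. x \<in> C ==> y \<in> C ==> x \<sqsubseteq> y \<or> y \<sqsubseteq> x" using C(1) by (auto simp: order_chain_def)
  have fG: "finite (irr L)" by (rule M.finG)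
  have JG: "J x \<subseteq> irr L" for x by (auto simp: J_def)
  have fJ: "finite (J x)" for x using JG fG finite_subset by blast
  have cmp: "D \<subseteq> E \<or> E \<subseteq> D" if DE: "D \<in> J ` C" "E \<in> J ` C" for D E
  proof -
    obtain x y where x: "x \<in> C" "y \<in> C" "D = J x" "E = J y" using DE by blast
    have c: "x \<in> carrier L" "y \<in> carrier L" using x CL by auto
    show ?thesis unfolding x(3,4) J_le[OF c] J_le[OF c(2,1)] by (rule tot[OF x(1,2)])
  qed
  have fD: "finite D" if "D \<in> J ` C" for D using that fJ by blast
  have inj: "inj_on card (J ` C)"
  proof (rule inj_onI)
    fix D E assume h: "D \<in> J ` C" "E \<in> J ` C" "card D = card E"
    show "D = E" using cmp[OF h(1,2)]
    proof
      assume "D \<subseteq> E"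
      then show ?thesis by (rule card_subset_eq[OF fD[OF h(2)] _ h(3)])
    next
      assume "E \<subseteq> D"
      then show ?thesis using card_subset_eq[OF fD[OF h(1)] _ h(3)[symmetric]] by simp
    qed
  qed
  have "inj_on J C"
  proof (rule inj_onI)
    fix x y assume "x \<in> C" "y \<in> C" "J x = J y"
    then show "x = y" using J_inj[of x y] CL by auto
  qed
  then have "card (J ` C) = Suc ?n" using card_image C(2) by metis
  then have cc: "card (card ` J ` C) = Suc ?n" using card_image[OF inj] by simp
  have "card ` J ` C \<subseteq> {..?n}" using card_mono[OF fG JG] by auto
  then have im: "card ` J ` C = {..?n}" by (rule card_subset_eq[OF finite_atMost]) (simp add: cc)
  define A where "A = inv_into (J ` C) card"
  have A: "A i \<in> J ` C" "card (A i) = i" if "i \<le> ?n" for i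
    using that inv_into_into[of i card "J ` C"] f_inv_into_f[of i card "J ` C"] im by (simp_all add: A_def)
  have AD: "A (card D) = D" if "D \<in> J ` C" for D unfolding A_def by (rule inv_into_f_f[OF inj that])
  have "A ` {..?n} = J ` C"
  proof
    show "A ` {..?n} \<subseteq> J ` C" using A(1) by auto
    show "J ` C \<subseteq> A ` {..?n}"
    proof
      fix D assume D: "D \<in> J ` C"
      then have "card D \<in> {..?n}" using im by blast
      then show "D \<in> A ` {..?n}" using AD[OF D] by (metis imageI)
    qed
  qed
  moreover have "flag (irr L) A ?n"
  proof
    show "finite (irr L)" by (rule fG)
    show "A 0 = {}" using A(2)[of 0] fD[OF A(1)[of 0]] by simp
    have "A ?n \<subseteq> irr L" using A(1)[of ?n] JG by auto
    then show "A ?n = irr L" using card_subset_eq[OF fG] A(2)[of ?n] by simp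
    fix i j :: nat assume ij: "i < j" "j \<le> ?n"
    have "\<not> A j \<subseteq> A i" using card_mono[OF fD[OF A(1)[of i]], of "A j"] A(2)[of i] A(2)[of j] ij by auto
    then show "A i \<subset> A j" using cmp[OF A(1)[of i] A(1)[of j]] ij by auto
  qed (rule A(2))
  ultimately show ?thesis by blast
qed

end

lemma cd_index_eqI: "cd_to_ab p = ab_index P ==> cd_index P = p"
  unfolding cd_index_def by (rule the_equality) (auto intro: cd_to_ab_inj)

text \<open>The descent from the cube serves to establish \<open>good\<close> for the family of
  \<open>L\<close>; the descent from there to the flag yields the nonnegative difference.\<close>

theorem flag_le_minor_poset:
  assumes je: "join_extremal L" and n: "poset_length L = n"
  shows "coeff_le (cd_index (boolean_algebra_poset (n + 1))) (cd_index (minor_poset L (irr L)))"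
proof -
  interpret flat L using je by unfold_locales (simp add: join_extremal_def)
  have nG: "card (irr L) = n" using je n by (simp add: join_extremal_def)
  obtain C where C: "order_chain L C" "card C = Suc (card (irr L))" using ex_chain n nG by auto
  obtain A where A: "flag (irr L) A n" "A ` {..n} = J ` C" using chain_flag[OF C] nG by auto
  interpret Fl: flag "irr L" A n by (rule A(1))
  interpret Cu: cube "irr L" by unfold_locales (rule M.finG)
  have sub: "A ` {..n} \<subseteq> J ` carrier L" unfolding A(2) using C(1) by (intro image_mono) (simp add: order_chain_def)
  have "simple (irr L) (J ` carrier L)" by (rule simple_mono[OF Fl.fam fam sub Fl.simple_flag])
  moreover have "J ` carrier L \<subseteq> Pow (irr L)" by (auto simp: J_def)
  ultimately have gF: "M.good" using descend[OF Cu.fam fam _ _ Cu.cube_good] by blast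
  obtain p where p: "Fl.good" "nonneg_poly p" "cd_to_ab p = Psi (irr L) (J ` carrier L) - Psi (irr L) (A ` {..n})"
    using descend[OF fam Fl.fam sub Fl.simple_flag gF] by blast
  obtain q where q: "cd_to_ab q = Psi (irr L) (A ` {..n})"
    using Fl.good_psi[OF p(1), of None Fl.tp] Fl.tp_cells by (auto simp: Psi_def Fl.tp_def)
  have 1: "cd_index (boolean_algebra_poset (n + 1)) = q"
    by (rule cd_index_eqI) (use q Fl.Psi_flag in simp)
  have 2: "cd_index (minor_poset L (irr L)) = q + p"
    by (rule cd_index_eqI) (simp add: cd_to_ab_add q p(3) ab_index_minor_poset)
  show ?thesis unfolding 1 2 using p(2) by (simp add: coeff_le_def lookup_add nonneg_poly_def)
qed

text \<open>The witness for attainment: all of its elements together form the flag, so its minor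
  poset is Boolean.\<close>

definition nat_chain :: "nat => nat gorder" where
  "nat_chain n = \<lparr>carrier = {..n}, eq = (=), le = (\<le>)\<rparr>"

lemma finite_lattice_nat_chain: "finite_lattice (nat_chain n)"
proof -
  interpret partial_order "nat_chain n" by unfold_locales (auto simp: nat_chain_def)
  interpret total_order "nat_chain n" by unfold_locales (auto simp: nat_chain_def)
  have "lattice (nat_chain n)" by unfold_locales
  then show ?thesis by (auto simp: finite_lattice_def nat_chain_def)
qed

lemma irr_nat_chain: "irr (nat_chain n) = {1..n}"
proof -
  interpret flat "nat_chain n" by unfold_locales (rule finite_lattice_nat_chain)
  have le: "x \<sqsubseteq>\<^bsub>nat_chain n\<^esub> y \<longleftrightarrow> x \<le> y" for x y by (simp add: nat_chain_def)
  have car: "carrier (nat_chain n) = {..n}" by (simp add: nat_chain_def)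
  have b: "\<bottom>\<^bsub>nat_chain n\<^esub> = 0" using bot(2)[of 0] by (simp add: le car)
  have j: "x \<squnion>\<^bsub>nat_chain n\<^esub> y = x \<or> x \<squnion>\<^bsub>nat_chain n\<^esub> y = y" if xy: "x \<in> {..n}" "y \<in> {..n}" for x y
  proof -
    have c: "x \<in> carrier (nat_chain n)" "y \<in> carrier (nat_chain n)" using xy car by auto
    have "x \<squnion>\<^bsub>nat_chain n\<^esub> y \<le> max x y" using join_iff[OF c, of "max x y"] xy by (simp add: le car max_def)
    moreover have "x \<le> x \<squnion>\<^bsub>nat_chain n\<^esub> y" "y \<le> x \<squnion>\<^bsub>nat_chain n\<^esub> y"
      using join_left[OF c] join_right[OF c] by (simp_all add: le)
    ultimately show ?thesis by (auto simp: max_def split: if_splits)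
  qed
  show ?thesis unfolding irr_def b car using j by (auto simp: Suc_le_eq) metis
qed

lemma length_nat_chain: "poset_length (nat_chain n) = n"
  unfolding poset_length_def
proof (rule Max_eqI)
  let ?M = "{card C - 1 | C. order_chain (nat_chain n) C \<and> C \<noteq> {}}"
  show "finite ?M" by (rule chain_bound) (simp add: nat_chain_def)
  show "y \<le> n" if y: "y \<in> ?M" for y
  proof -
    obtain C where C: "y = card C - 1" "C \<subseteq> {..n}" using y by (auto simp: order_chain_def nat_chain_def)
    have "card C \<le> Suc n" using card_mono[OF _ C(2)] by simp
    then show ?thesis using C(1) by simp
  qed
  have "order_chain (nat_chain n) {..n}" by (auto simp: order_chain_def nat_chain_def)
  then show "n \<in> ?M" by (intro CollectI exI[of _ "{..n}"]) auto
qed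

lemma join_extremal_nat_chain: "join_extremal (nat_chain n)"
  by (simp add: join_extremal_def finite_lattice_nat_chain irr_nat_chain length_nat_chain)

lemma ab_index_nat_chain:
  "ab_index (minor_poset (nat_chain n) (irr (nat_chain n))) = ab_index (boolean_algebra_poset (n + 1))"
proof -
  interpret flat "nat_chain n" by unfold_locales (rule finite_lattice_nat_chain)
  have nG: "card (irr (nat_chain n)) = n" by (simp add: irr_nat_chain)
  have C: "order_chain (nat_chain n) (carrier (nat_chain n))" by (auto simp: order_chain_def nat_chain_def)
  have c: "card (carrier (nat_chain n)) = Suc (card (irr (nat_chain n)))" unfolding nG by (simp add: nat_chain_def)
  obtain A where A: "flag (irr (nat_chain n)) A n" "A ` {..n} = J ` carrier (nat_chain n)"
    using chain_flag[OF C c] unfolding nG by blast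
  interpret Fl: flag "irr (nat_chain n)" A n by (rule A(1))
  show ?thesis unfolding ab_index_minor_poset using Fl.Psi_flag unfolding A(2) .
qed

theorem corollary6p7:
  fixes n :: nat
  shows "(\<exists>L :: nat gorder.
            generator_enriched L (irr L) \<and> join_extremal L \<and> poset_length L = n \<and>
            cd_index (minor_poset L (irr L)) = cd_index (boolean_algebra_poset (n + 1))) \<and>
         (\<forall>L :: 'a gorder.
            join_extremal L \<and> poset_length L = n \<longrightarrow>
            coeff_le (cd_index (boolean_algebra_poset (n + 1)))
                     (cd_index (minor_poset L (irr L))))"
proof (intro conjI allI impI)
  have "cd_index (minor_poset (nat_chain n) (irr (nat_chain n))) = cd_index (boolean_algebra_poset (n + 1))"
    by (simp only: cd_index_def ab_index_nat_chain)
  then show "\<exists>L :: nat gorder.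
            generator_enriched L (irr L) \<and> join_extremal L \<and> poset_length L = n \<and>
            cd_index (minor_poset L (irr L)) = cd_index (boolean_algebra_poset (n + 1))"
    using generator_enriched_irr[OF finite_lattice_nat_chain] join_extremal_nat_chain length_nat_chain by blast
  fix L :: "'a gorder" assume "join_extremal L \<and> poset_length L = n"
  then show "coeff_le (cd_index (boolean_algebra_poset (n + 1))) (cd_index (minor_poset L (irr L)))"
    using flag_le_minor_poset by blast
qed

end
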